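(* Let $X$ be a spectrally negative Lévy process (not the negative of a subordinator). (i) For $-\infty<a\leq b\leq c$, $p,q\geq0$ and $x\leq c$, $$ \mathbb E_x\left[\mathrm e^{-p\tau_c^+ - q\int_0^{\tau_c^+}\mathbf 1_{(a,b)}(X_s)\,\mathrm ds};\,\tau_c^+<\infty\right] = \frac{\mathcal H^{(p,q)}(x-a) - q\int_b^x W^{(p)}(x-y)\mathcal H^{(p,q)}(y-a)\,\mathrm dy}{\mathcal H^{(p,q)}(c-a) - q\int_b^c W^{(p)}(c-y)\mathcal H^{(p,q)}(y-a)\,\mathrm dy}. $$ (ii) For $b\leq c$, $p,q\geq0$ and $x\leq c$, $$ \mathbb E_x\left[\mathrm e^{-p\tau_c^+ - q\int_0^{\tau_c^+}\mathbf 1_{(-\infty,b)}(X_s)\,\mathrm ds};\,\tau_c^+<\infty\right] = \frac{\mathcal H^{(p+q,-q)}(x-b)}{\mathcal H^{(p+q,-q)}(c-b)}. $$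
   Context: $X=(X_t)_{t\geq0}$ is a spectrally negative Lévy process: a process with stationary independent increments and no positive jumps; the case where $X$ is the negative of a subordinator (non-increasing paths) is excluded. $\mathbb P_x$ is the law of $X$ with $X_0=x$, $\mathbb E_x$ the expectation, and $\mathbb E_x[Y;A]:=\mathbb E_x[Y\mathbf 1_A]$. The Laplace exponent is defined by $\mathbb E_0[\mathrm e^{\lambda X_t}]=\mathrm e^{t\psi(\lambda)}$, $\lambda,t\geq0$, and $\Phi(q)=\sup\{\lambda\geq0:\psi(\lambda)=q\}$ for $q\geq0$. First passage time: $\tau_c^+=\inf\{t>0:X_t>c\}$, with $\inf\emptyset=\infty$. Scale functions: for $q\geq0$, $W^{(q)}$ is the unique function that is continuous on $[0,\infty)$ with $\int_0^\infty \mathrm e^{-\lambda y}W^{(q)}(y)\,\mathrm dy = \frac1{\psi(\lambda)-q}$ for $\lambda>\Phi(q)$, extended by $W^{(q)}(x)=0$ for $x<0$. For $p\geq0$ and $q\in\mathbb R$ with $p+q\geq0$, $$\mathcal H^{(p,q)}(x)=\mathrm e^{\Phi(p)x}\left(1+q\int_0^x \mathrm e^{-\Phi(p)y}W^{(p+q)}(y)\,\mathrm dy\right),\quad x\in\mathbb R,$$ so that $\mathcal H^{(p,q)}(x)=\mathrm e^{\Phi(p)x}$ for $x\leq0$. Since $W^{(p)}$ vanishes on $(-\infty,0)$, integrals of the form $\int_b^x W^{(p)}(x-y)(\cdots)\,\mathrm dy$ are $0$ when $x\leq b$. *)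

theory Defs
  imports "HOL-Probability.Probability"
begin

(* Levy processes started at 0. The time index is real and only times t >= 0 are
   constrained. Cadlag paths are required for every sample point, as on Skorokhod space,
   so that first passage times are measurable without completing M. *)
locale levy_process = prob_space M for M :: "'a measure" +
  fixes X :: "real \<Rightarrow> 'a \<Rightarrow> real"
  assumes measurable_X: "0 \<le> t \<Longrightarrow> X t \<in> borel_measurable M"
    and start_0: "AE \<omega> in M. X 0 \<omega> = 0"
    and indep_increments:
      "\<lbrakk>0 \<le> u 0; mono u\<rbrakk> \<Longrightarrow>
        indep_vars (\<lambda>_. borel) (\<lambda>i \<omega>. X (u (Suc i)) \<omega> - X (u i) \<omega>) {..<n :: nat}"
    and stationary_increments:
      "\<lbrakk>0 \<le> s; 0 \<le> h\<rbrakk> \<Longrightarrow>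
        distr M borel (\<lambda>\<omega>. X (s + h) \<omega> - X s \<omega>) = distr M borel (\<lambda>\<omega>. X h \<omega> - X 0 \<omega>)"
    and right_continuous_paths:
      "\<lbrakk>\<omega> \<in> space M; 0 \<le> t\<rbrakk> \<Longrightarrow> continuous (at_right t) (\<lambda>s. X s \<omega>)"
    and left_limits:
      "\<lbrakk>\<omega> \<in> space M; 0 < t\<rbrakk> \<Longrightarrow> \<exists>l. ((\<lambda>s. X s \<omega>) \<longlongrightarrow> l) (at_left t)"

locale spectrally_negative_levy_process = levy_process +
  assumes no_positive_jumps:
      "AE \<omega> in M. \<forall>t>0. \<forall>l. ((\<lambda>s. X s \<omega>) \<longlongrightarrow> l) (at_left t) \<longrightarrow> X t \<omega> \<le> l"
    and not_negative_subordinator: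
      "\<not> (AE \<omega> in M. antimono_on {0..} (\<lambda>t. X t \<omega>))"

(* The expectation under the law of the process started at x: since M carries the process
   started at 0, this is the expectation of the path functional F along x + X. *)
definition expectation_from ::
    "'a measure \<Rightarrow> (real \<Rightarrow> 'a \<Rightarrow> real) \<Rightarrow> real \<Rightarrow> ((real \<Rightarrow> real) \<Rightarrow> real) \<Rightarrow> real" where
  "expectation_from M X x F = (\<integral>\<omega>. F (\<lambda>t. x + X t \<omega>) \<partial>M)"

definition laplace_exponent :: "'a measure \<Rightarrow> (real \<Rightarrow> 'a \<Rightarrow> real) \<Rightarrow> real \<Rightarrow> real" where
  "laplace_exponent M X \<theta> =
    (THE r. \<forall>t\<ge>0. expectation_from M X 0 (\<lambda>w. exp (\<theta> * w t)) = exp (t * r))"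

definition right_inverse :: "'a measure \<Rightarrow> (real \<Rightarrow> 'a \<Rightarrow> real) \<Rightarrow> real \<Rightarrow> real" where
  "right_inverse M X q = Sup {\<theta>. 0 \<le> \<theta> \<and> laplace_exponent M X \<theta> = q}"

definition is_scale_function ::
    "'a measure \<Rightarrow> (real \<Rightarrow> 'a \<Rightarrow> real) \<Rightarrow> real \<Rightarrow> (real \<Rightarrow> real) \<Rightarrow> bool" where
  "is_scale_function M X q W \<longleftrightarrow>
    (\<forall>x<0. W x = 0) \<and> continuous_on {0..} W \<and>
    (\<forall>\<theta>>right_inverse M X q.
      set_integrable lborel {0..} (\<lambda>y. exp (- \<theta> * y) * W y) \<and>
      (LBINT y:{0..}. exp (- \<theta> * y) * W y) = 1 / (laplace_exponent M X \<theta> - q))"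

definition scale_function ::
    "'a measure \<Rightarrow> (real \<Rightarrow> 'a \<Rightarrow> real) \<Rightarrow> real \<Rightarrow> real \<Rightarrow> real" where
  "scale_function M X q = (THE W. is_scale_function M X q W)"

(* LBINT y=u..v is the oriented integral; for x < 0 it vanishes here because the scale
   function is 0 on the negative half-line. *)
definition scale_H ::
    "'a measure \<Rightarrow> (real \<Rightarrow> 'a \<Rightarrow> real) \<Rightarrow> real \<Rightarrow> real \<Rightarrow> real \<Rightarrow> real" where
  "scale_H M X p q x =
    exp (right_inverse M X p * x) *
    (1 + q * (LBINT y=ereal 0..ereal x.
                exp (- right_inverse M X p * y) * scale_function M X (p + q) y))"

definition first_passage :: "real \<Rightarrow> (real \<Rightarrow> real) \<Rightarrow> ereal" where
  "first_passage c w = Inf (ereal ` {t. 0 < t \<and> c < w t})"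

definition occupation_time :: "real set \<Rightarrow> real \<Rightarrow> (real \<Rightarrow> real) \<Rightarrow> real" where
  "occupation_time A T w = (LBINT s:{0..T}. indicator A (w s))"

(* real_of_ereal sends infinity to 0, but that case is cut off by the of_bool factor. *)
definition discounted_passage ::
    "real \<Rightarrow> real \<Rightarrow> real set \<Rightarrow> real \<Rightarrow> (real \<Rightarrow> real) \<Rightarrow> real" where
  "discounted_passage p q A c w =
    exp (- p * real_of_ereal (first_passage c w)
         - q * occupation_time A (real_of_ereal (first_passage c w)) w)
    * of_bool (first_passage c w < \<infinity>)"

end

theory Submission
  imports Defs
begin

text \<open>
  Let \<open>u x\<close> be the expectation in question. The discount rate has the form \<open>P + Q * indicator B\<close> with
  \<open>B\<close> bounded from below: \<open>P = p\<close>, \<open>Q = q\<close>, \<open>B = {a<..<b}\<close> in (i), and \<open>P = p + q\<close>, \<open>Q = - q\<close>,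
  \<open>B = {b..}\<close> in (ii). The Feynman--Kac formula expresses \<open>u\<close> through the Laplace transform
  \<open>exp (- \<Phi> P * (c - x))\<close> of the passage time and the \<open>P\<close>-potential measure of the process killed at
  first passage, whose density is \<open>exp (- \<Phi> P * (c - x)) * W (c - y) - W (x - y)\<close> with \<open>W\<close> the
  \<open>P\<close>-scale function. Hence \<open>u\<close> is a multiple of the solution of a Volterra equation with kernel \<open>W\<close>, and
  \<open>H\<close> solves that equation because both sides have the same Laplace transform.
  
  The scale function is itself obtained from the potential measure. Tilted by \<open>exp (\<Phi> P * y)\<close>, the
  potentials at different levels differ by a shift, so their mass on the positive half-line is a convex
  function of the level, and its derivative is the tilted scale function. The process is approximated
  along time grids throughout, so only independence of increments and the absence of positive jumps
  (continuous upward passage) are used.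
\<close>

section \<open>Independence of increments along time grids\<close>

text \<open>The rate is written as \<open>P + Q * indicator B\<close> with \<open>B\<close> bounded
  below for two reasons: the potential can give infinite mass to sets that reach down to minus
  infinity, and the Volterra equation needs a lower end from which uniqueness propagates. The
  half-line in (ii) is therefore replaced by its complement, at the price of a negative
  \<open>Q\<close>.

  \<open>scale_function\<close> is a definite description, so it says nothing until a function with
  the required transform has been built that is continuous on the closed half-line. The candidate is
  the derivative of a convex function, which is monotone but could jump. Right continuity comes with
  the construction; left continuity is the real obstacle, and it is settled by a second moment
  estimate for occupation times.

  The factor that the Volterra equation leaves open is found at \<open>x = c\<close>. The transform
  of the passage time of level 0 is 1, so the process exceeds its starting point immediately and the
  expectation at \<open>c\<close> is 1. This also shows that the denominators do not vanish.\<close>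

context levy_process
begin

abbreviation seq_space :: "(nat \<Rightarrow> real) measure" where
  "seq_space \<equiv> PiM UNIV (\<lambda>_. borel)"

lemma increments_measurable [measurable]:
  "0 \<le> s \<Longrightarrow> X s \<in> borel_measurable M"
  by (rule measurable_X)

text \<open>By independence the law of the increment vector is a product, and by stationarity its
  factors do not depend on \<open>s\<close>; the displayed sequence is the image of that vector
  under partial sums. Writing \<open>min j m\<close> freezes the sequence after index
  \<open>m\<close>, so that finitely many increments live in the fixed space
  \<open>seq_space\<close>. \<open>X 0\<close> is subtracted because it vanishes only almost
  surely.\<close>

lemma distr_increment_seq:
  fixes v :: "nat \<Rightarrow> real"
  assumes s: "0 \<le> s" and v: "v 0 = 0" "mono v"
  shows "distr M seq_space (\<lambda>\<omega> j. X (s + v (min j m)) \<omega> - X s \<omega>) =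
         distr M seq_space (\<lambda>\<omega> j. X (v (min j m)) \<omega> - X 0 \<omega>)"
proof (cases "m = 0")
  case True
  then show ?thesis using v by simp
next
  case False
  then have ne: "{..<m} \<noteq> {}" by auto
  have v0: "0 \<le> v j" for j using v by (metis monoD zero_le)
  have vS: "v j \<le> v (Suc j)" for j using v by (simp add: monoD)
  have key: "distr M (PiM {..<m} (\<lambda>_. borel)) (\<lambda>\<omega>. \<lambda>i\<in>{..<m}. X (t + v (Suc i)) \<omega> - X (t + v i) \<omega>)
    = PiM {..<m} (\<lambda>i. distr M borel (\<lambda>\<omega>. X (v (Suc i) - v i) \<omega> - X 0 \<omega>))" if t: "0 \<le> t" for t
  proof -
    have "indep_vars (\<lambda>_. borel) (\<lambda>i \<omega>. X (t + v (Suc i)) \<omega> - X (t + v i) \<omega>) {..<m}"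
      using indep_increments[of "\<lambda>i. t + v i" m] v t by (simp add: mono_def)
    then have "distr M (PiM {..<m} (\<lambda>_. borel)) (\<lambda>\<omega>. \<lambda>i\<in>{..<m}. X (t + v (Suc i)) \<omega> - X (t + v i) \<omega>)
      = PiM {..<m} (\<lambda>i. distr M borel (\<lambda>\<omega>. X (t + v (Suc i)) \<omega> - X (t + v i) \<omega>))"
      by (subst (asm) indep_vars_iff_distr_eq_PiM[OF ne]) (use t v0 in auto)
    also have "\<dots> = PiM {..<m} (\<lambda>i. distr M borel (\<lambda>\<omega>. X (v (Suc i) - v i) \<omega> - X 0 \<omega>))"
    proof (intro PiM_cong refl)
      fix i
      show "distr M borel (\<lambda>\<omega>. X (t + v (Suc i)) \<omega> - X (t + v i) \<omega>) =
        distr M borel (\<lambda>\<omega>. X (v (Suc i) - v i) \<omega> - X 0 \<omega>)"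
        using stationary_increments[of "t + v i" "v (Suc i) - v i"] t v0[of i] vS[of i] by simp
    qed
    finally show ?thesis .
  qed
  have sums: "distr M seq_space (\<lambda>\<omega> j. X (t + v (min j m)) \<omega> - X t \<omega>) =
    distr (distr M (PiM {..<m} (\<lambda>_. borel)) (\<lambda>\<omega>. \<lambda>i\<in>{..<m}. X (t + v (Suc i)) \<omega> - X (t + v i) \<omega>))
      seq_space (\<lambda>p j. \<Sum>i<min j m. p i)" if t: "0 \<le> t" for t
  proof (subst distr_distr)
    show "(\<lambda>p j. \<Sum>i<min j m. p i) \<in> PiM {..<m} (\<lambda>_. borel) \<rightarrow>\<^sub>M (seq_space :: (nat \<Rightarrow> real) measure)"
      by (rule measurable_PiM_single') (auto intro!: borel_measurable_sum measurable_component_singleton)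
    show "(\<lambda>\<omega>. \<lambda>i\<in>{..<m}. X (t + v (Suc i)) \<omega> - X (t + v i) \<omega>) \<in> M \<rightarrow>\<^sub>M PiM {..<m} (\<lambda>_. borel)"
      using t v0 by (intro measurable_restrict) auto
    have "(\<Sum>i<min j m. (\<lambda>i\<in>{..<m}. X (t + v (Suc i)) \<omega> - X (t + v i) \<omega>) i) = X (t + v (min j m)) \<omega> - X t \<omega>" for j \<omega>
    proof -
      have "(\<Sum>i<min j m. (\<lambda>i\<in>{..<m}. X (t + v (Suc i)) \<omega> - X (t + v i) \<omega>) i) = (\<Sum>i<min j m. X (t + v (Suc i)) \<omega> - X (t + v i) \<omega>)"
        by (intro sum.cong) auto
      also have "\<dots> = X (t + v (min j m)) \<omega> - X (t + v 0) \<omega>"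
        by (rule sum_lessThan_telescope)
      finally show ?thesis using v by simp
    qed
    then show "distr M seq_space (\<lambda>\<omega> j. X (t + v (min j m)) \<omega> - X t \<omega>) =
      distr M seq_space ((\<lambda>p j. \<Sum>i<min j m. p i) \<circ> (\<lambda>\<omega>. \<lambda>i\<in>{..<m}. X (t + v (Suc i)) \<omega> - X (t + v i) \<omega>))"
      by (simp add: o_def)
  qed
  show ?thesis using sums[OF s] sums[of 0] key[OF s] key[of 0] by simp
qed

text \<open>Both blocks of increments belong to one grid, hence to one independent family, so the
  joint law is a product. The law of the second block is that of a fresh copy started at time 0 by
  \<open>distr_increment_seq\<close>, and Tonelli's theorem turns the product into an iterated
  integral over two copies of \<open>M\<close>.\<close>

lemma grid_markov:
  fixes u v :: "nat \<Rightarrow> real" and \<Psi> :: "(nat \<Rightarrow> real) \<times> (nat \<Rightarrow> real) \<Rightarrow> ennreal"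
  assumes u: "u 0 = 0" "mono u" and v: "v 0 = 0" "mono v"
    and \<Psi> [measurable]: "\<Psi> \<in> borel_measurable (seq_space \<Otimes>\<^sub>M seq_space)"
  shows "(\<integral>\<^sup>+\<omega>. \<Psi> (\<lambda>j. X (u (min j k)) \<omega> - X 0 \<omega>, \<lambda>j. X (u k + v (min j m)) \<omega> - X (u k) \<omega>) \<partial>M) =
    (\<integral>\<^sup>+\<omega>. \<integral>\<^sup>+\<omega>'. \<Psi> (\<lambda>j. X (u (min j k)) \<omega> - X 0 \<omega>, \<lambda>j. X (v (min j m)) \<omega>' - X 0 \<omega>') \<partial>M \<partial>M)"
proof -
  have u0: "0 \<le> u j" for j using u by (metis monoD zero_le)
  have v0: "0 \<le> v j" for j using v by (metis monoD zero_le)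
  define w where "w i = (if i \<le> k then u i else u k + v (i - k))" for i
  have wmono: "mono w"
  proof (rule incseq_SucI)
    fix n
    consider "Suc n \<le> k" | "n = k" | "k < n" by linarith
    then show "w n \<le> w (Suc n)"
      by cases (use u v v0 in \<open>auto simp: w_def monoD Suc_diff_le\<close>)
  qed
  have wu: "w i = u i" if "i \<le> k" for i using that by (simp add: w_def)
  have wv: "w (k + i) = u k + v i" for i using v by (cases i) (auto simp: w_def)
  define D where "D i \<omega> = X (w (Suc i)) \<omega> - X (w i) \<omega>" for i \<omega>
  define past where "past = (\<lambda>\<omega> j. X (u (min j k)) \<omega> - X 0 \<omega>)"
  define fut where "fut = (\<lambda>\<omega> j. X (u k + v (min j m)) \<omega> - X (u k) \<omega>)"
  define fut0 where "fut0 = (\<lambda>\<omega> j. X (v (min j m)) \<omega> - X 0 \<omega>)"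
  have [measurable]: "past \<in> M \<rightarrow>\<^sub>M seq_space" "fut \<in> M \<rightarrow>\<^sub>M seq_space" "fut0 \<in> M \<rightarrow>\<^sub>M seq_space"
    unfolding past_def fut_def fut0_def
    by (rule measurable_PiM_single'; use u0 v0 in auto)+
  have "indep_vars (\<lambda>_. borel) D {..<k + m}"
    unfolding D_def using indep_increments[of w "k + m"] wmono u by (simp add: w_def)
  then have "indep_var (PiM {..<k} (\<lambda>_. borel)) (\<lambda>\<omega>. restrict (\<lambda>i. D i \<omega>) {..<k})
      (PiM {k..<k + m} (\<lambda>_. borel)) (\<lambda>\<omega>. restrict (\<lambda>i. D i \<omega>) {k..<k + m})"
    by (rule indep_var_restrict) auto
  then have "indep_var seq_space ((\<lambda>p j. \<Sum>i<min j k. p i) \<circ> (\<lambda>\<omega>. restrict (\<lambda>i. D i \<omega>) {..<k}))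
      seq_space ((\<lambda>p j. \<Sum>i<min j m. p (k + i)) \<circ> (\<lambda>\<omega>. restrict (\<lambda>i. D i \<omega>) {k..<k + m}))"
    by (rule indep_var_compose; intro measurable_PiM_single')
      (auto intro!: borel_measurable_sum measurable_component_singleton)
  also have "(\<lambda>p j. \<Sum>i<min j k. p i) \<circ> (\<lambda>\<omega>. restrict (\<lambda>i. D i \<omega>) {..<k}) = past"
  proof (intro ext)
    fix \<omega> j
    have "(\<Sum>i<min j k. restrict (\<lambda>i. D i \<omega>) {..<k} i) = (\<Sum>i<min j k. X (w (Suc i)) \<omega> - X (w i) \<omega>)"
      by (intro sum.cong) (auto simp: D_def)
    also have "\<dots> = X (w (min j k)) \<omega> - X (w 0) \<omega>"
      by (rule sum_lessThan_telescope)
    finally show "((\<lambda>p j. \<Sum>i<min j k. p i) \<circ> (\<lambda>\<omega>. restrict (\<lambda>i. D i \<omega>) {..<k})) \<omega> j = past \<omega> j"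
      using u by (simp add: past_def wu)
  qed
  also have "(\<lambda>p j. \<Sum>i<min j m. p (k + i)) \<circ> (\<lambda>\<omega>. restrict (\<lambda>i. D i \<omega>) {k..<k + m}) = fut"
  proof (intro ext)
    fix \<omega> j
    have "(\<Sum>i<min j m. restrict (\<lambda>i. D i \<omega>) {k..<k+m} (k + i)) = (\<Sum>i<min j m. X (w (k + Suc i)) \<omega> - X (w (k + i)) \<omega>)"
      by (intro sum.cong) (auto simp: D_def)
    also have "\<dots> = X (w (k + min j m)) \<omega> - X (w (k + 0)) \<omega>"
      by (rule sum_lessThan_telescope)
    finally show "((\<lambda>p j. \<Sum>i<min j m. p (k + i)) \<circ> (\<lambda>\<omega>. restrict (\<lambda>i. D i \<omega>) {k..<k + m})) \<omega> j = fut \<omega> j"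
      using v by (simp add: fut_def wv wu[of k])
  qed
  finally have ind: "distr M seq_space past \<Otimes>\<^sub>M distr M seq_space fut = distr M (seq_space \<Otimes>\<^sub>M seq_space) (\<lambda>x. (past x, fut x))"
    by (simp add: indep_var_distribution_eq)
  have feq: "distr M seq_space fut = distr M seq_space fut0"
    unfolding fut_def fut0_def using distr_increment_seq[OF u0 v] by simp
  interpret F: prob_space "distr M seq_space fut0" by (rule prob_space_distr) simp
  have "(\<integral>\<^sup>+\<omega>. \<Psi> (past \<omega>, fut \<omega>) \<partial>M) = (\<integral>\<^sup>+z. \<Psi> z \<partial>distr M (seq_space \<Otimes>\<^sub>M seq_space) (\<lambda>x. (past x, fut x)))"
    by (subst nn_integral_distr) auto
  also have "\<dots> = (\<integral>\<^sup>+z. \<Psi> z \<partial>(distr M seq_space past \<Otimes>\<^sub>M distr M seq_space fut0))"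
    by (simp add: ind[symmetric] feq)
  also have "\<dots> = (\<integral>\<^sup>+a. \<integral>\<^sup>+b. \<Psi> (a, b) \<partial>distr M seq_space fut0 \<partial>distr M seq_space past)"
    by (subst F.nn_integral_fst[symmetric]) auto
  also have "\<dots> = (\<integral>\<^sup>+\<omega>. \<integral>\<^sup>+b. \<Psi> (past \<omega>, b) \<partial>distr M seq_space fut0 \<partial>M)"
    by (subst nn_integral_distr) (auto)
  also have "\<dots> = (\<integral>\<^sup>+\<omega>. \<integral>\<^sup>+\<omega>'. \<Psi> (past \<omega>, fut0 \<omega>') \<partial>M \<partial>M)"
    by (intro nn_integral_cong, subst nn_integral_distr) (auto simp: space_PiM)
  finally show ?thesis unfolding past_def fut_def fut0_def .
qed

end

section \<open>First passage of right-continuous paths\<close>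

definition right_cont :: "(real \<Rightarrow> real) \<Rightarrow> bool" where
  "right_cont w \<longleftrightarrow> (\<forall>t\<ge>0. continuous (at_right t) w)"

definition alive :: "real \<Rightarrow> real \<Rightarrow> (real \<Rightarrow> real) \<Rightarrow> bool" where
  "alive c t w \<longleftrightarrow> (\<forall>r. 0 < r \<and> r \<le> t \<longrightarrow> w r \<le> c)"

definition passes :: "real \<Rightarrow> (real \<Rightarrow> real) \<Rightarrow> bool" where
  "passes c w \<longleftrightarrow> (\<exists>t>0. c < w t)"

text \<open>A real number in place of the extended \<open>first_passage\<close>. The infimum of the
  empty set carries no information, so every use is guarded by \<open>passes\<close>.\<close>

definition fpt :: "real \<Rightarrow> (real \<Rightarrow> real) \<Rightarrow> real" where
  "fpt c w = Inf {t. 0 < t \<and> c < w t}"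

text \<open>Rounding goes up because right continuity controls a path only at times slightly later
  than \<open>t\<close>.\<close>

definition grid_up :: "real \<Rightarrow> real \<Rightarrow> real" where
  "grid_up h t = of_int \<lceil>t / h\<rceil> * h"

lemma grid_up_bounds:
  assumes "0 < h"
  shows "t \<le> grid_up h t" "grid_up h t < t + h"
proof -
  have 1: "t / h \<le> of_int \<lceil>t / h\<rceil>" and 2: "of_int \<lceil>t / h\<rceil> < t / h + 1" by linarith+
  show "t \<le> grid_up h t"
    using 1 assms by (simp add: grid_up_def pos_divide_le_eq del: le_of_int_ceiling)
  have "of_int \<lceil>t / h\<rceil> * h < (t / h + 1) * h" using 2 assms by (intro mult_strict_right_mono)
  then show "grid_up h t < t + h"
    using assms by (simp add: grid_up_def distrib_right)
qed

lemma grid_up_nat: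
  assumes "0 < h" "0 \<le> t"
  shows "grid_up h t = real (nat \<lceil>t / h\<rceil>) * h"
  using assms by (simp add: grid_up_def)

lemma grid_up_eq:
  assumes "0 < h" "real K * h < s" "s \<le> real (Suc K) * h"
  shows "grid_up h s = real (Suc K) * h"
proof -
  have "\<lceil>s / h\<rceil> = int (Suc K)"
    using assms by (intro ceiling_unique) (auto simp: field_simps)
  then show ?thesis by (simp add: grid_up_def)
qed

lemma tendsto_one_over_Suc: "(\<lambda>n. 1 / real (Suc n)) \<longlonglongrightarrow> 0"
  using LIMSEQ_inverse_real_of_nat by (simp add: inverse_eq_divide del: of_nat_Suc)

lemma right_contD_seq:
  assumes "right_cont w" "0 \<le> t" "\<And>n. t \<le> s n" "s \<longlonglongrightarrow> t"
  shows "(\<lambda>n. w (s n)) \<longlonglongrightarrow> w t"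
proof -
  have "continuous (at t within {t..}) w"
    using assms(1,2) by (simp add: right_cont_def at_within_Ici_at_right)
  then show ?thesis
    using assms(3,4) by (auto simp: continuous_within_sequentially o_def)
qed

lemma grid_up_tendsto:
  assumes "\<And>n. 0 < h n" "h \<longlonglongrightarrow> 0"
  shows "(\<lambda>n. grid_up (h n) t) \<longlonglongrightarrow> t"
proof (rule tendsto_sandwich)
  show "\<forall>\<^sub>F n in sequentially. t \<le> grid_up (h n) t" "\<forall>\<^sub>F n in sequentially. grid_up (h n) t \<le> t + h n"
    using grid_up_bounds[OF assms(1)] by (auto intro!: always_eventually less_imp_le)
  show "(\<lambda>n. t + h n) \<longlonglongrightarrow> t" using tendsto_add[OF tendsto_const assms(2), of t] by simp
qed auto

lemma right_cont_grid_tendsto: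
  assumes "right_cont w" "0 \<le> t" "\<And>n. 0 < h n" "h \<longlonglongrightarrow> 0"
  shows "(\<lambda>n. w (grid_up (h n) t)) \<longlonglongrightarrow> w t"
  using grid_up_bounds[OF assms(3)] grid_up_tendsto[OF assms(3,4)]
  by (intro right_contD_seq[OF assms(1,2)])

lemma right_cont_shift: "right_cont w \<Longrightarrow> 0 \<le> s \<Longrightarrow> right_cont (\<lambda>r. a + w (s + r))"
  unfolding right_cont_def
proof safe
  fix t :: real assume w: "\<forall>t\<ge>0. continuous (at_right t) w" and st: "0 \<le> s" "0 \<le> t"
  then have "continuous (at_right (s + t)) w" by simp
  then have "(w \<longlongrightarrow> w (s + t)) (at_right (s + t))" by (simp add: continuous_within)
  moreover have "filterlim (\<lambda>r. s + r) (at_right (s + t)) (at_right t)"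
    unfolding filterlim_at by (auto simp: eventually_at_filter intro!: tendsto_intros)
  ultimately have "((\<lambda>r. w (s + r)) \<longlongrightarrow> w (s + t)) (at_right t)"
    by (rule filterlim_compose)
  then show "continuous (at_right t) (\<lambda>r. a + w (s + r))"
    by (simp add: continuous_within tendsto_add)
qed

text \<open>The path read at rounded times takes countably many values on intervals, hence is
  measurable, and converges pointwise by right continuity. The truncation \<open>max 0 t\<close> is
  there because nothing is known about paths at negative times.\<close>

lemma right_cont_measurable:
  assumes "right_cont w"
  shows "(\<lambda>t. w (max 0 t)) \<in> borel_measurable borel"
proof (rule borel_measurable_LIMSEQ_real)
  fix t :: real
  show "(\<lambda>n. w (grid_up (1 / Suc n) (max 0 t))) \<longlonglongrightarrow> w (max 0 t)"
    by (rule right_cont_grid_tendsto[OF assms _ _ tendsto_one_over_Suc]) auto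
next
  fix n
  have "(\<lambda>t::real. w (of_int (\<lceil>max 0 t / (1 / Suc n)\<rceil>) * (1 / Suc n))) \<in> borel_measurable borel"
    by (rule measurable_compose_countable[where f = "\<lambda>i (t::real). w (of_int i * (1 / Suc n))" and g = "\<lambda>t. \<lceil>max 0 t / (1 / Suc n)\<rceil>"]) measurable
  then show "(\<lambda>t. w (grid_up (1 / Suc n) (max 0 t))) \<in> borel_measurable borel"
    by (simp add: grid_up_def)
qed

lemma fpt_nonneg: "passes c w \<Longrightarrow> 0 \<le> fpt c w"
  unfolding fpt_def passes_def by (intro cInf_greatest) auto

lemma fpt_le: "0 < t \<Longrightarrow> c < w t \<Longrightarrow> fpt c w \<le> t"
  unfolding fpt_def by (intro cInf_lower bdd_belowI[of _ 0]) auto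

lemma alive_before_fpt: "t < fpt c w \<Longrightarrow> alive c t w"
  unfolding alive_def using fpt_le[of _ c w] by force

lemma alive_imp_le_fpt:
  assumes "passes c w" "alive c t w"
  shows "t \<le> fpt c w"
  unfolding fpt_def
proof (rule cInf_greatest)
  show "{t. 0 < t \<and> c < w t} \<noteq> {}" using assms(1) by (auto simp: passes_def)
next
  fix r assume "r \<in> {t. 0 < t \<and> c < w t}"
  then show "t \<le> r" using assms(2) by (auto simp: alive_def intro: leI)
qed

lemma not_passes_iff_alive: "\<not> passes c w \<longleftrightarrow> (\<forall>t. alive c t w)"
  unfolding passes_def alive_def by (meson not_le order_refl)

lemma not_alive_imp_passes: "\<not> alive c t w \<Longrightarrow> passes c w"
  using not_passes_iff_alive by blast

lemma alive_mono: "alive c t w \<Longrightarrow> s \<le> t \<Longrightarrow> c \<le> d \<Longrightarrow> alive d s w"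
  unfolding alive_def by force

lemma fpt_approx:
  assumes "passes c w" "0 < e"
  obtains t where "fpt c w \<le> t" "t < fpt c w + e" "0 < t" "c < w t"
proof -
  have "{t. 0 < t \<and> c < w t} \<noteq> {}" using assms(1) by (auto simp: passes_def)
  then obtain t where "t \<in> {t. 0 < t \<and> c < w t}" "t < fpt c w + e"
    using assms(2) cInf_lessD[of "{t. 0 < t \<and> c < w t}" "fpt c w + e"] by (auto simp: fpt_def)
  then show ?thesis using fpt_le[of t c w] by (intro that[of t]) auto
qed

lemma first_passage_fpt:
  shows "first_passage c w < \<infinity> \<longleftrightarrow> passes c w"
    and "passes c w \<Longrightarrow> real_of_ereal (first_passage c w) = fpt c w"
proof -
  show 1: "first_passage c w < \<infinity> \<longleftrightarrow> passes c w"
    unfolding first_passage_def passes_def Inf_less_iff by auto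
  assume p: "passes c w"
  have "first_passage c w = ereal (fpt c w)"
    unfolding first_passage_def fpt_def
    using p by (subst ereal_Inf') (auto simp: passes_def intro!: bdd_belowI[of _ 0])
  then show "real_of_ereal (first_passage c w) = fpt c w" by simp
qed

lemma fpt_value_ge:
  assumes w: "right_cont w" and p: "passes c w"
  shows "c \<le> w (fpt c w)"
proof -
  have "\<exists>t. fpt c w \<le> t \<and> t < fpt c w + 1 / Suc n \<and> c < w t" for n
    using fpt_approx[OF p, of "1 / Suc n"] by (metis of_nat_0_less_iff zero_less_Suc zero_less_divide_1_iff)
  then obtain s where s: "\<And>n. fpt c w \<le> s n" "\<And>n. s n < fpt c w + 1 / Suc n" "\<And>n. c < w (s n)" by metis
  have "s \<longlonglongrightarrow> fpt c w"
  proof (rule tendsto_sandwich[where f = "\<lambda>_. fpt c w" and h = "\<lambda>n. fpt c w + 1 / Suc n"])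
    show "(\<lambda>n. fpt c w + 1 / Suc n) \<longlonglongrightarrow> fpt c w"
      using tendsto_add[OF tendsto_const tendsto_one_over_Suc, of "fpt c w"] by simp
  qed (use s less_imp_le[OF s(2)] in \<open>auto intro!: always_eventually\<close>)
  then have "(\<lambda>n. w (s n)) \<longlonglongrightarrow> w (fpt c w)"
    using s by (intro right_contD_seq[OF w fpt_nonneg[OF p]])
  then show ?thesis using s(3) by (intro LIMSEQ_le_const) (auto intro: less_imp_le)
qed

text \<open>Continuous upward passage. Before the passage time the path stays at or below
  \<open>c\<close>, so its left limit there is at most \<open>c\<close>, and an upward jump is
  excluded; right continuity gives the other inequality. At passage time 0 the starting value takes
  the role of the left limit.\<close>

lemma fpt_value_eq:
  assumes w: "right_cont w" and p: "passes c w" and c: "w 0 \<le> c"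
    and l: "\<And>t. 0 < t \<Longrightarrow> \<exists>l. (w \<longlongrightarrow> l) (at_left t) \<and> w t \<le> l"
  shows "w (fpt c w) = c"
proof (cases "fpt c w = 0")
  case True
  then show ?thesis using fpt_value_ge[OF w p] c by simp
next
  case False
  then have pos: "0 < fpt c w" using fpt_nonneg[OF p] by simp
  then obtain l where l: "(w \<longlongrightarrow> l) (at_left (fpt c w))" "w (fpt c w) \<le> l" using l by blast
  have "eventually (\<lambda>t. 0 < t \<and> t < fpt c w) (at_left (fpt c w))"
    using pos eventually_at_left by fastforce
  then have "eventually (\<lambda>t. w t \<le> c) (at_left (fpt c w))"
    by eventually_elim (use alive_before_fpt[of _ c w] in \<open>auto simp: alive_def\<close>)
  then have "l \<le> c" using tendsto_upperbound[OF l(1)] by auto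
  then show ?thesis using l(2) fpt_value_ge[OF w p] by simp
qed

text \<open>The exceedance of \<open>c\<close> is strict, so by right continuity it persists at a
  grid point shortly after any time at which the path is above \<open>c\<close>. First exceedances
  on the grid therefore approach the passage time, and always from the right. All claims hold only
  eventually, since a coarse grid may miss a short excursion above \<open>c\<close>.\<close>

lemma grid_passage:
  assumes w: "right_cont w" and p: "passes c w" and h: "\<And>n. 0 < h n" "h \<longlonglongrightarrow> 0"
  defines "T \<equiv> \<lambda>n. LEAST j. 0 < j \<and> c < w (real j * h n)"
  shows "\<forall>\<^sub>F n in sequentially. 0 < T n \<and> c < w (real (T n) * h n)"
    and "(\<lambda>n. real (T n) * h n) \<longlonglongrightarrow> fpt c w"
    and "\<forall>\<^sub>F n in sequentially. fpt c w \<le> real (T n) * h n"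
    and "(\<lambda>n. w (real (T n) * h n)) \<longlonglongrightarrow> w (fpt c w)"
proof -
  have near: "\<forall>\<^sub>F n in sequentially. \<exists>j>0. c < w (real j * h n) \<and> real j * h n < fpt c w + e" if e: "0 < e" for e
  proof -
    from fpt_approx[OF p e] obtain t where t: "fpt c w \<le> t" "t < fpt c w + e" "0 < t" "c < w t" .
    have "(\<lambda>n. w (grid_up (h n) t)) \<longlonglongrightarrow> w t" using w t h by (intro right_cont_grid_tendsto) auto
    then have "\<forall>\<^sub>F n in sequentially. c < w (grid_up (h n) t)" using t(4) order_tendstoD(1) by blast
    moreover have "\<forall>\<^sub>F n in sequentially. grid_up (h n) t < fpt c w + e"
      using order_tendstoD(2)[OF grid_up_tendsto[of h t, OF h]] t(2) by blast
    ultimately show ?thesis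
    proof eventually_elim
      case (elim n)
      have "0 < grid_up (h n) t" using grid_up_bounds[OF h(1)] t(3) less_le_trans by blast
      then have "0 < nat \<lceil>t / h n\<rceil>" using grid_up_nat[OF h(1), of t n] t(3) h(1)[of n]
        by (simp add: zero_less_mult_iff)
      then show ?case using elim grid_up_nat[OF h(1), of t n] t(3) by (intro exI[of _ "nat \<lceil>t / h n\<rceil>"]) auto
    qed
  qed
  have T: "0 < T n \<and> c < w (real (T n) * h n) \<and> T n \<le> j" if "0 < j" "c < w (real j * h n)" for j n
    unfolding T_def using LeastI[of "\<lambda>j. 0 < j \<and> c < w (real j * h n)" j] Least_le[of "\<lambda>j. 0 < j \<and> c < w (real j * h n)" j] that
    by auto
  show 1: "\<forall>\<^sub>F n in sequentially. 0 < T n \<and> c < w (real (T n) * h n)"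
    using near[of 1, simplified] by eventually_elim (use T in blast)
  show 2: "\<forall>\<^sub>F n in sequentially. fpt c w \<le> real (T n) * h n"
    using 1 by eventually_elim (use h in \<open>auto intro!: fpt_le\<close>)
  show 3: "(\<lambda>n. real (T n) * h n) \<longlonglongrightarrow> fpt c w"
  proof (rule order_tendstoI)
    fix a assume "a < fpt c w"
    then show "\<forall>\<^sub>F n in sequentially. a < real (T n) * h n" using 2 by (auto elim: eventually_mono)
  next
    fix a assume a: "fpt c w < a"
    show "\<forall>\<^sub>F n in sequentially. real (T n) * h n < a"
      using near[of "a - fpt c w", simplified, OF a]
    proof eventually_elim
      case (elim n)
      then obtain j where j: "j > 0" "c < w (real j * h n)" "real j * h n < a" by auto
      have "real (T n) * h n \<le> real j * h n" using T[OF j(1,2)] h(1)[of n] by (intro mult_right_mono) auto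
      then show ?case using j by simp
    qed
  qed
  \<comment> \<open>Agrees eventually with the grid times, but lies to the right of the passage time
    for every index, as the sequential form of right continuity demands.\<close>
  define s where "s n = max (fpt c w) (real (T n) * h n)" for n
  have "(\<lambda>n. w (s n)) \<longlonglongrightarrow> w (fpt c w)"
  proof (rule right_contD_seq[OF w fpt_nonneg[OF p]])
    show "s \<longlonglongrightarrow> fpt c w" unfolding s_def using tendsto_max[OF tendsto_const 3, of "fpt c w"] by simp
  qed (simp add: s_def)
  moreover have "\<forall>\<^sub>F n in sequentially. w (s n) = w (real (T n) * h n)"
    using 2 by eventually_elim (simp add: s_def max_def)
  ultimately show "(\<lambda>n. w (real (T n) * h n)) \<longlonglongrightarrow> w (fpt c w)"
    by (rule Lim_transform_eventually)
qed

section \<open>Discounted passage functionals\<close>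

text \<open>At most one summand is nonzero, the one whose \<open>k\<close> is the first index above
  \<open>c\<close>. The sum form makes measurability and dependence on finitely many values
  evident.\<close>

definition grid_discount :: "(real \<Rightarrow> real) \<Rightarrow> real \<Rightarrow> real \<Rightarrow> nat \<Rightarrow> (nat \<Rightarrow> real) \<Rightarrow> real" where
  "grid_discount g c h m w = (\<Sum>k\<in>{1..m}.
     of_bool (c < w k \<and> (\<forall>j\<in>{1..<k}. w j \<le> c)) * exp (- (h * (\<Sum>j\<in>{1..k}. g (w j)))))"

definition path_discount :: "(real \<Rightarrow> real) \<Rightarrow> real \<Rightarrow> (real \<Rightarrow> real) \<Rightarrow> real" where
  "path_discount g c w = of_bool (passes c w) * exp (- (LBINT s:{0..fpt c w}. g (w s)))"

lemma integrable_indicator_interval [simp]: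
  fixes a b :: real
  shows
  "integrable lborel (indicat_real {a..b})" "integrable lborel (indicat_real {a<..b})"
  "integrable lborel (\<lambda>x. of_bool (a < x \<and> x \<le> b) :: real)"
proof -
  show "integrable lborel (indicat_real {a..b})"
    by (rule integrable_real_indicator) (auto simp: emeasure_lborel_Icc_eq)
  show 1: "integrable lborel (indicat_real {a<..b})"
    by (rule integrable_real_indicator; cases "a \<le> b") auto
  have "indicat_real {a<..b} = (\<lambda>x. of_bool (a < x \<and> x \<le> b))" by (auto simp: indicator_def fun_eq_iff)
  with 1 show "integrable lborel (\<lambda>x. of_bool (a < x \<and> x \<le> b) :: real)" by simp
qed

lemma integrable_bounded_interval:
  fixes f :: "real \<Rightarrow> real"
  assumes [measurable]: "f \<in> borel_measurable borel" and "A \<in> sets borel" "A \<subseteq> {a..b}"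
    and B: "\<And>x. x \<in> A \<Longrightarrow> \<bar>f x\<bar> \<le> B"
  shows "set_integrable lborel A f"
  unfolding set_integrable_def
proof (rule Bochner_Integration.integrable_bound)
  show "integrable lborel (\<lambda>x. indicator {a..b} x *\<^sub>R B)" by simp
  show "AE x in lborel. norm (indicat_real A x *\<^sub>R f x) \<le> norm (indicator {a..b} x *\<^sub>R B)"
    using B assms(3) by (intro AE_I2) (fastforce simp: indicator_def)
qed (use assms in measurable)

lemma set_lborel_integral_bound:
  fixes f :: "real \<Rightarrow> real"
  assumes "set_integrable lborel {a<..b} f" and "a \<le> b" and B: "\<And>x. x \<in> {a<..b} \<Longrightarrow> \<bar>f x\<bar> \<le> B"
  shows "\<bar>LBINT x:{a<..b}. f x\<bar> \<le> B * (b - a)"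
proof -
  have "\<bar>LBINT x:{a<..b}. f x\<bar> \<le> (LINT x|lborel. \<bar>indicator {a<..b} x *\<^sub>R f x\<bar>)"
    unfolding set_lebesgue_integral_def using integral_norm_bound[of lborel "\<lambda>x. indicator {a<..b} x *\<^sub>R f x"] by simp
  also have "\<dots> \<le> (LINT x|lborel. indicator {a<..b} x *\<^sub>R B)"
    using assms by (intro integral_mono integrable_abs) (auto simp: set_integrable_def indicator_def)
  also have "\<dots> = B * (b - a)" using assms by simp
  finally show ?thesis .
qed

lemma grid_sum_integral:
  fixes f :: "real \<Rightarrow> real"
  assumes h: "0 < h"
  shows "set_integrable lborel {0<..real K * h} (\<lambda>s. f (grid_up h s)) \<and>
    (LBINT s:{0<..real K * h}. f (grid_up h s)) = h * (\<Sum>j\<in>{1..K}. f (real j * h))"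
proof (induction K)
  case 0
  then show ?case by (simp add: set_integrable_def set_lebesgue_integral_def)
next
  case (Suc K)
  let ?I = "{real K * h<..real (Suc K) * h}"
  have un: "{0<..real (Suc K) * h} = {0<..real K * h} \<union> ?I"
  proof -
    have "0 \<le> real K * h" "real K * h \<le> real (Suc K) * h" using h by (auto simp: algebra_simps)
    then show ?thesis by auto
  qed
  have c: "f (grid_up h s) = f (real (Suc K) * h)" if "s \<in> ?I" for s
    using grid_up_eq[OF h] that by auto
  have "set_integrable lborel ?I (\<lambda>s. f (real (Suc K) * h))"
    by (simp add: set_integrable_def)
  then have 1: "set_integrable lborel ?I (\<lambda>s. f (grid_up h s))"
    using c set_integrable_cong[of lborel lborel ?I ?I "\<lambda>s. f (grid_up h s)" "\<lambda>_. f (real (Suc K) * h)"] by simp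
  have "(LBINT s:?I. f (grid_up h s)) = (LBINT s:?I. f (real (Suc K) * h))"
    using c by (intro set_lebesgue_integral_cong) auto
  also have "\<dots> = h * f (real (Suc K) * h)"
    using h by (simp add: set_lebesgue_integral_def algebra_simps)
  finally have 2: "(LBINT s:?I. f (grid_up h s)) = h * f (real (Suc K) * h)" .
  show ?case
  proof (intro conjI)
    show "set_integrable lborel {0<..real (Suc K) * h} (\<lambda>s. f (grid_up h s))"
      unfolding un using Suc 1 by (intro set_integrable_Un) auto
    have "(LBINT s:{0<..real (Suc K) * h}. f (grid_up h s)) =
      (LBINT s:{0<..real K * h}. f (grid_up h s)) + (LBINT s:?I. f (grid_up h s))"
      unfolding un using Suc 1 by (intro set_integral_Un) auto
    then show "(LBINT s:{0<..real (Suc K) * h}. f (grid_up h s)) = h * (\<Sum>j\<in>{1..Suc K}. f (real j * h))"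
      using Suc 2 by (simp add: algebra_simps)
  qed
qed

text \<open>The Riemann sum is exactly the integral of the step function
  \<open>g (w (grid_up h s))\<close>, which converges pointwise because \<open>w\<close> is
  right-continuous and \<open>g\<close> continuous; dominated convergence does the rest. Continuity
  of \<open>g\<close> is essential here, so indicator rates have to come later as limits.\<close>

lemma grid_integral_tendsto:
  fixes g :: "real \<Rightarrow> real"
  assumes w: "right_cont w" and g: "continuous_on UNIV g" "\<And>x. \<bar>g x\<bar> \<le> B"
    and h: "\<And>n. 0 < h n" "h \<longlonglongrightarrow> 0" and a: "0 \<le> a"
    and K: "(\<lambda>n. real (K n) * h n) \<longlonglongrightarrow> a" "\<forall>\<^sub>F n in sequentially. a \<le> real (K n) * h n"
  shows "(\<lambda>n. h n * (\<Sum>j\<in>{1..K n}. g (w (real j * h n)))) \<longlonglongrightarrow> (LBINT s:{0..a}. g (w s))"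
proof -
  have gm [measurable]: "g \<in> borel_measurable borel" using g(1) by (rule borel_measurable_continuous_onI)
  have wm [measurable]: "(\<lambda>s. w (max 0 s)) \<in> borel_measurable borel" by (rule right_cont_measurable[OF w])
  \<comment> \<open>Cutting at \<open>a + 1\<close> gives one integrable majorant for all
    \<open>n\<close>; the cut is inactive for large \<open>n\<close>.\<close>
  define b where "b n = min (real (K n) * h n) (a + 1)" for n
  have gb: "(\<lambda>s. g (w (grid_up (h n) (max 0 s)))) \<in> borel_measurable borel" for n
  proof -
    have "(\<lambda>s::real. w (max 0 (of_int \<lceil>max 0 s / h n\<rceil> * h n))) \<in> borel_measurable borel"
      by (rule measurable_compose_countable[where f = "\<lambda>i (t::real). w (max 0 (of_int i * h n))" and g = "\<lambda>s. \<lceil>max 0 s / h n\<rceil>"]) measurable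
    moreover have "max 0 (of_int \<lceil>max 0 s / h n\<rceil> * h n) = grid_up (h n) (max 0 s)" for s
      using grid_up_bounds(1)[OF h(1), of "max 0 s" n] unfolding grid_up_def by (smt (verit))
    ultimately have "(\<lambda>s. w (grid_up (h n) (max 0 s))) \<in> borel_measurable borel" by simp
    then show ?thesis by measurable
  qed
  have "(\<lambda>n. LINT s|lborel. indicator {0<..b n} s * g (w (grid_up (h n) (max 0 s)))) \<longlonglongrightarrow>
      (LINT s|lborel. indicator {0..a} s * g (w (max 0 s)))"
  proof (rule integral_dominated_convergence[where w = "\<lambda>s. indicator {0..a+1} s *\<^sub>R \<bar>B\<bar>"])
    show "integrable lborel (\<lambda>s. indicator {0..a+1} s *\<^sub>R \<bar>B\<bar>)" by simp
    show "AE s in lborel. norm (indicator {0<..b n} s * g (w (grid_up (h n) (max 0 s)))) \<le> indicator {0..a+1} s *\<^sub>R \<bar>B\<bar>" for n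
    proof (rule AE_I2)
      fix s
      have "\<bar>g (w (grid_up (h n) (max 0 s)))\<bar> \<le> \<bar>B\<bar>" by (rule order_trans[OF g(2)]) simp
      then show "norm (indicator {0<..b n} s * g (w (grid_up (h n) (max 0 s)))) \<le> indicator {0..a+1} s *\<^sub>R \<bar>B\<bar>"
        by (auto simp: indicator_def b_def)
    qed
    have bl: "b \<longlonglongrightarrow> a" unfolding b_def using tendsto_min[OF K(1) tendsto_const, of "a + 1"] by simp
    have be: "\<forall>\<^sub>F n in sequentially. a \<le> b n" using K(2) by (auto elim!: eventually_mono simp: b_def)
    show "AE s in lborel. (\<lambda>n. indicator {0<..b n} s * g (w (grid_up (h n) (max 0 s)))) \<longlonglongrightarrow> indicator {0..a} s * g (w (max 0 s))"
    proof -
      have "AE s in lborel. s \<noteq> 0 \<and> s \<noteq> (a::real)" using AE_lborel_singleton[of 0] AE_lborel_singleton[of a] by auto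
      then show ?thesis
      proof eventually_elim
        case (elim s)
        have "(\<lambda>n. w (grid_up (h n) (max 0 s))) \<longlonglongrightarrow> w (max 0 s)" by (rule right_cont_grid_tendsto[OF w _ h]) auto
        then have c: "(\<lambda>n. g (w (grid_up (h n) (max 0 s)))) \<longlonglongrightarrow> g (w (max 0 s))"
          by (rule continuous_on_tendsto_compose[OF g(1)]) auto
        have "\<forall>\<^sub>F n in sequentially. indicator {0<..b n} s = (indicator {0..a} s :: real)"
        proof (cases "s < a")
          case True
          show ?thesis using be by eventually_elim (use True elim in \<open>auto simp: indicator_def\<close>)
        next
          case False
          then have "\<forall>\<^sub>F n in sequentially. b n < s" using elim order_tendstoD(2)[OF bl, of s] by auto
          then show ?thesis by eventually_elim (use False elim in \<open>auto simp: indicator_def\<close>)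
        qed
        then have "(\<lambda>n. indicator {0<..b n} s :: real) \<longlonglongrightarrow> indicator {0..a} s" by (rule tendsto_eventually)
        from tendsto_mult[OF this c] show ?case .
      qed
    qed
  qed (use gb in measurable)
  moreover have "(LINT s|lborel. indicator {0..a} s * g (w (max 0 s))) = (LBINT s:{0..a}. g (w s))"
    unfolding set_lebesgue_integral_def by (intro Bochner_Integration.integral_cong) (auto simp: indicator_def)
  moreover have "\<forall>\<^sub>F n in sequentially. (LINT s|lborel. indicator {0<..b n} s * g (w (grid_up (h n) (max 0 s)))) =
      h n * (\<Sum>j\<in>{1..K n}. g (w (real j * h n)))"
  proof -
    have "\<forall>\<^sub>F n in sequentially. real (K n) * h n < a + 1" using order_tendstoD(2)[OF K(1)] by simp
    then show ?thesis
    proof eventually_elim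
      case (elim n)
      then have "(LINT s|lborel. indicator {0<..b n} s * g (w (grid_up (h n) (max 0 s)))) =
        (LBINT s:{0<..real (K n) * h n}. g (w (grid_up (h n) s)))"
        unfolding set_lebesgue_integral_def by (intro Bochner_Integration.integral_cong) (auto simp: indicator_def b_def)
      then show ?case using grid_sum_integral[OF h(1)[of n], of "K n" "\<lambda>x. g (w x)"] by simp
    qed
  qed
  ultimately show ?thesis by (auto intro: Lim_transform_eventually)
qed

lemma grid_discount_first:
  assumes "0 < T" "T \<le> m" "c < w T" "\<And>j. 0 < j \<Longrightarrow> j < T \<Longrightarrow> w j \<le> c"
  shows "grid_discount g c h m w = exp (- (h * (\<Sum>j\<in>{1..T}. g (w j))))"
proof -
  have "(c < w k \<and> (\<forall>j\<in>{1..<k}. w j \<le> c)) = (k = T)" if "k \<in> {1..m}" for k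
    using assms that by (metis atLeastAtMost_iff atLeastLessThan_iff le_less_linear linorder_neqE_nat not_le zero_less_one less_le_trans One_nat_def Suc_leI)
  then have "grid_discount g c h m w = (\<Sum>k\<in>{1..m}. of_bool (k = T) * exp (- (h * (\<Sum>j\<in>{1..k}. g (w j)))))"
    unfolding grid_discount_def by (intro sum.cong) auto
  also have "\<dots> = (\<Sum>k\<in>{1..m}. if T = k then exp (- (h * (\<Sum>j\<in>{1..k}. g (w j)))) else 0)"
    by (intro sum.cong) auto
  also have "\<dots> = exp (- (h * (\<Sum>j\<in>{1..T}. g (w j))))" using assms by (subst sum.delta') auto
  finally show ?thesis .
qed

lemma grid_discount_none:
  assumes "\<And>j. 0 < j \<Longrightarrow> j \<le> m \<Longrightarrow> w j \<le> c"
  shows "grid_discount g c h m w = 0"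
  unfolding grid_discount_def
proof (intro sum.neutral ballI)
  fix k assume "k \<in> {1..m}"
  then have "w k \<le> c" using assms by simp
  then show "of_bool (c < w k \<and> (\<forall>j\<in>{1..<k}. w j \<le> c)) * exp (- (h * (\<Sum>j\<in>{1..k}. g (w j)))) = 0" by simp
qed

lemma grid_discount_bounds:
  assumes "\<And>x. 0 \<le> g x" "0 \<le> h"
  shows "0 \<le> grid_discount g c h m w" "grid_discount g c h m w \<le> 1"
proof -
  have "grid_discount g c h m w = 0 \<or> (\<exists>T. grid_discount g c h m w = exp (- (h * (\<Sum>j\<in>{1..T}. g (w j)))))"
  proof (cases "\<exists>j. 0 < j \<and> j \<le> m \<and> c < w j")
    case True
    define T where "T = (LEAST j. 0 < j \<and> j \<le> m \<and> c < w j)"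
    have 1: "0 < T \<and> T \<le> m \<and> c < w T" unfolding T_def by (rule LeastI_ex[OF True])
    have "w j \<le> c" if "0 < j" "j < T" for j
      using not_less_Least[of j "\<lambda>j. 0 < j \<and> j \<le> m \<and> c < w j"] that 1 unfolding T_def[symmetric] by force
    then show ?thesis using grid_discount_first[of T m c w] 1 by blast
  next
    case False
    then show ?thesis using grid_discount_none[of m w c] by force
  qed
  moreover have "0 \<le> h * (\<Sum>j\<in>{1..T}. g (w j))" for T
    using assms by (intro mult_nonneg_nonneg sum_nonneg) auto
  ultimately show "0 \<le> grid_discount g c h m w" "grid_discount g c h m w \<le> 1" by force+
qed

lemma path_discount_bounds:
  assumes "\<And>x. 0 \<le> g x"
  shows "0 \<le> path_discount g c w" "path_discount g c w \<le> 1"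
proof -
  have "0 \<le> (LBINT s:{0..fpt c w}. g (w s))"
    unfolding set_lebesgue_integral_def using assms by (intro integral_nonneg_AE) (auto simp: indicator_def)
  then show "0 \<le> path_discount g c w" "path_discount g c w \<le> 1" by (auto simp: path_discount_def)
qed

text \<open>With mesh \<open>1 / (n + 1)\<close>, taking \<open>(n + 1)^2\<close> points makes the
  time horizon \<open>n + 1\<close>, so the mesh vanishes while every finite passage time is
  eventually covered.\<close>

lemma grid_discount_tendsto:
  assumes w: "right_cont w" and g: "continuous_on UNIV g" "\<And>x. \<bar>g x\<bar> \<le> B"
  shows "(\<lambda>n. grid_discount g c (1 / real (Suc n)) (Suc n * Suc n) (\<lambda>j. w (real j * (1 / real (Suc n))))) \<longlonglongrightarrow> path_discount g c w"
proof (cases "passes c w")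
  case False
  have "grid_discount g c (1 / real (Suc n)) (Suc n * Suc n) (\<lambda>j. w (real j * (1 / real (Suc n)))) = 0" for n
  proof (rule grid_discount_none)
    fix j :: nat assume "0 < j"
    then have "0 < real j * (1 / real (Suc n))" by simp
    then show "w (real j * (1 / real (Suc n))) \<le> c" using False unfolding passes_def by (meson not_le)
  qed
  then show ?thesis using False by (simp add: path_discount_def)
next
  case True
  define h where "h n = 1 / real (Suc n)" for n
  have h: "\<And>n. 0 < h n" "h \<longlonglongrightarrow> 0" unfolding h_def using tendsto_one_over_Suc by auto
  define T where "T n = (LEAST j. 0 < j \<and> c < w (real j * h n))" for n
  note gp = grid_passage[OF w True h, folded T_def]
  have "(\<lambda>n. h n * (\<Sum>j\<in>{1..T n}. g (w (real j * h n)))) \<longlonglongrightarrow> (LBINT s:{0..fpt c w}. g (w s))"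
    by (rule grid_integral_tendsto[OF w g h fpt_nonneg[OF True] gp(2,3)])
  then have "(\<lambda>n. exp (- (h n * (\<Sum>j\<in>{1..T n}. g (w (real j * h n)))))) \<longlonglongrightarrow> path_discount g c w"
    using True by (auto simp: path_discount_def intro!: tendsto_intros)
  moreover have "\<forall>\<^sub>F n in sequentially. exp (- (h n * (\<Sum>j\<in>{1..T n}. g (w (real j * h n))))) =
    grid_discount g c (h n) (Suc n * Suc n) (\<lambda>j. w (real j * h n))"
  proof -
    have "\<forall>\<^sub>F n in sequentially. real (T n) * h n < fpt c w + 1" using order_tendstoD(2)[OF gp(2)] by simp
    moreover have "\<forall>\<^sub>F n in sequentially. fpt c w + 1 \<le> real n"
      using eventually_ge_at_top[of "nat \<lceil>fpt c w + 1\<rceil>"] by eventually_elim linarith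
    ultimately show ?thesis using gp(1)
    proof eventually_elim
      case (elim n)
      have "real (T n) * h n < real (Suc n)" using elim by simp
      then have "real (T n) < real (Suc n * Suc n)" unfolding h_def by (simp only: of_nat_mult) (simp add: field_simps del: of_nat_Suc)
      then have "T n \<le> Suc n * Suc n" by (simp only: of_nat_less_iff less_imp_le)
      then show ?case using elim
        by (subst grid_discount_first[of "T n"]) (auto simp: T_def dest: not_less_Least intro: leI)
    qed
  qed
  ultimately show ?thesis unfolding h_def by (rule Lim_transform_eventually)
qed

lemma path_discount_tendsto:
  fixes g :: "nat \<Rightarrow> real \<Rightarrow> real"
  assumes w: "right_cont w" and [measurable]: "\<And>n. g n \<in> borel_measurable borel"
    and b: "\<And>n x. \<bar>g n x\<bar> \<le> B" and lim: "\<And>x. (\<lambda>n. g n x) \<longlonglongrightarrow> g' x"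
  shows "(\<lambda>n. path_discount (g n) c w) \<longlonglongrightarrow> path_discount g' c w"
proof -
  have wm [measurable]: "(\<lambda>s. w (max 0 s)) \<in> borel_measurable borel" by (rule right_cont_measurable[OF w])
  have gm [measurable]: "g' \<in> borel_measurable borel" by (rule borel_measurable_LIMSEQ_real[OF lim]) simp
  have eq: "(LBINT s:{0..a}. f (w s)) = (LINT s|lborel. indicator {0..a} s *\<^sub>R f (w (max 0 s)))" for f :: "real \<Rightarrow> real" and a
    unfolding set_lebesgue_integral_def by (intro Bochner_Integration.integral_cong) (auto simp: indicator_def)
  have "(\<lambda>n. LBINT s:{0..fpt c w}. g n (w s)) \<longlonglongrightarrow> (LBINT s:{0..fpt c w}. g' (w s))"
    unfolding eq
  proof (rule integral_dominated_convergence[where w = "\<lambda>s. indicator {0..fpt c w} s *\<^sub>R \<bar>B\<bar>"])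
    show "AE s in lborel. norm (indicat_real {0..fpt c w} s *\<^sub>R g n (w (max 0 s))) \<le> indicator {0..fpt c w} s *\<^sub>R \<bar>B\<bar>" for n
      using order_trans[OF b abs_ge_self] by (auto simp: indicator_def)
  qed (auto intro!: tendsto_intros lim)
  then show ?thesis unfolding path_discount_def by (intro tendsto_intros)
qed

lemma exp_diff_bounds:
  fixes a b :: real
  assumes "\<bar>a\<bar> \<le> M" "\<bar>b\<bar> \<le> M"
  shows "\<bar>exp b - exp a\<bar> \<le> exp M * \<bar>b - a\<bar>" "\<bar>exp b - exp a - exp a * (b - a)\<bar> \<le> exp M * (b - a)\<^sup>2"
proof -
  have mvt: "\<exists>z. \<bar>z - a\<bar> \<le> \<bar>b - a\<bar> \<and> \<bar>z\<bar> \<le> M \<and> exp b - exp a = exp z * (b - a)" if "\<bar>a\<bar> \<le> M" "\<bar>b\<bar> \<le> M" for a b :: real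
  proof (cases a b rule: linorder_cases)
    case less
    then obtain z where "a < z" "z < b" "exp b - exp a = (b - a) * exp z" using MVT2[of a b exp exp] by (auto intro: DERIV_exp)
    then show ?thesis using that by (intro exI[of _ z]) (auto simp: algebra_simps)
  next
    case greater
    then obtain z where "b < z" "z < a" "exp a - exp b = (a - b) * exp z" using MVT2[of b a exp exp] by (auto intro: DERIV_exp)
    then show ?thesis using that by (intro exI[of _ z]) (auto simp: algebra_simps)
  qed (use that in auto)
  have 1: "\<bar>exp b - exp a\<bar> \<le> exp M * \<bar>b - a\<bar>" if "\<bar>a\<bar> \<le> M" "\<bar>b\<bar> \<le> M" for a b :: real
    using mvt[OF that] by (auto simp: abs_mult intro!: mult_right_mono)
  then show "\<bar>exp b - exp a\<bar> \<le> exp M * \<bar>b - a\<bar>" using assms by simp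
  obtain z where z: "\<bar>z - a\<bar> \<le> \<bar>b - a\<bar>" "\<bar>z\<bar> \<le> M" "exp b - exp a = exp z * (b - a)" using mvt[OF assms] by blast
  have "\<bar>exp b - exp a - exp a * (b - a)\<bar> = \<bar>exp z - exp a\<bar> * \<bar>b - a\<bar>" by (simp add: z(3) abs_mult[symmetric] algebra_simps)
  also have "\<dots> \<le> (exp M * \<bar>z - a\<bar>) * \<bar>b - a\<bar>" using 1[OF assms(1) z(2)] by (intro mult_right_mono) auto
  also have "\<dots> \<le> (exp M * \<bar>b - a\<bar>) * \<bar>b - a\<bar>" using z by (intro mult_right_mono mult_left_mono) auto
  finally show "\<bar>exp b - exp a - exp a * (b - a)\<bar> \<le> exp M * (b - a)\<^sup>2" by (simp add: power2_eq_square abs_mult[symmetric])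
qed

text \<open>Cutting the interval into \<open>n + 1\<close> pieces leaves a total variation of order
  \<open>1 / (n + 1)\<close>. This stands in for a vanishing derivative when \<open>D\<close> is
  built from integrals of functions that are merely measurable.\<close>

lemma quadratic_increment_const:
  fixes D :: "real \<Rightarrow> real"
  assumes "0 \<le> T" and D: "\<And>x y. 0 \<le> x \<Longrightarrow> x \<le> y \<Longrightarrow> y \<le> T \<Longrightarrow> \<bar>D y - D x\<bar> \<le> C * (y - x)\<^sup>2"
  shows "D T = D 0"
proof -
  have "\<bar>D T - D 0\<bar> \<le> C * T\<^sup>2 * (1 / real (Suc n))" for n
  proof -
    let ?s = "\<lambda>i. real i * (T / real (Suc n))"
    have "D T - D 0 = (\<Sum>i<Suc n. D (?s (Suc i)) - D (?s i))"
      by (subst sum_lessThan_telescope) simp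
    also have "\<bar>\<dots>\<bar> \<le> (\<Sum>i<Suc n. \<bar>D (?s (Suc i)) - D (?s i)\<bar>)" by (rule sum_abs)
    also have "\<dots> \<le> (\<Sum>i<Suc n. C * (T / real (Suc n))\<^sup>2)"
    proof (rule sum_mono)
      fix i assume i: "i \<in> {..<Suc n}"
      have "?s (Suc i) \<le> real (Suc n) * (T / real (Suc n))" using i assms by (intro mult_right_mono) auto
      also have "\<dots> = T" by simp
      finally have "?s (Suc i) \<le> T" .
      then have "\<bar>D (?s (Suc i)) - D (?s i)\<bar> \<le> C * (?s (Suc i) - ?s i)\<^sup>2"
        using assms(1) by (intro D mult_right_mono mult_nonneg_nonneg) auto
      also have "?s (Suc i) - ?s i = T / real (Suc n)" by (simp add: algebra_simps add_divide_distrib)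
      finally show "\<bar>D (?s (Suc i)) - D (?s i)\<bar> \<le> C * (T / real (Suc n))\<^sup>2" .
    qed
    also have "\<dots> = C * T\<^sup>2 * (1 / real (Suc n))" by (simp add: power2_eq_square del: of_nat_Suc)
    finally show ?thesis .
  qed
  moreover have "(\<lambda>n. C * T\<^sup>2 * (1 / real (Suc n))) \<longlonglongrightarrow> C * T\<^sup>2 * 0"
    by (intro tendsto_mult tendsto_const tendsto_one_over_Suc)
  ultimately have "\<bar>D T - D 0\<bar> \<le> C * T\<^sup>2 * 0" by (intro LIMSEQ_le_const) auto
  then show ?thesis by simp
qed

text \<open>The chain rule for \<open>exp G\<close>, where \<open>G\<close> is the running integral
  of \<open>g\<close>. Such a \<open>G\<close> is Lipschitz but need not be differentiable
  everywhere, so the two sides are compared through their increments: on a short interval each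
  equals \<open>exp (G x) * (G y - G x)\<close> up to a quadratic error.\<close>

lemma exp_integral_identity:
  fixes g :: "real \<Rightarrow> real"
  assumes [measurable]: "g \<in> borel_measurable borel" and B: "\<And>s. \<bar>g s\<bar> \<le> B" and t: "0 \<le> t"
  shows "(LBINT s:{0<..t}. g s * exp (LBINT r:{0<..s}. g r)) = exp (LBINT s:{0<..t}. g s) - 1"
    and "set_integrable lborel {0<..t} (\<lambda>s. g s * exp (LBINT r:{0<..s}. g r))"
proof -
  define G where "G s = (LBINT r:{0<..s}. g r)" for s
  have B0: "0 \<le> B" using B[of 0] by linarith
  have gi: "set_integrable lborel {x<..y} g" for x y
    by (rule integrable_bounded_interval[of _ _ x y B]) (use B in auto)
  have Gd: "G y - G x = (LBINT r:{x<..y}. g r)" if "0 \<le> x" "x \<le> y" for x y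
  proof -
    have "{0<..y} = {0<..x} \<union> {x<..y}" using that by auto
    then show ?thesis unfolding G_def using gi by (simp add: set_integral_Un)
  qed
  have Gl: "\<bar>G y - G x\<bar> \<le> B * (y - x)" if "0 \<le> x" "x \<le> y" for x y
    unfolding Gd[OF that] using that gi B by (intro set_lborel_integral_bound) auto
  have G0: "G 0 = 0" by (simp add: G_def set_lebesgue_integral_def)
  have Gb: "\<bar>G x\<bar> \<le> B * t" if "0 \<le> x" "x \<le> t" for x
    using Gl[of 0 x] that G0 B0 mult_left_mono[of x t B] by simp
  have "(\<lambda>s. G (max 0 s)) \<in> borel_measurable borel"
  proof (rule borel_measurable_continuous_onI, rule continuous_on_subset)
    have "(\<lambda>x. G (max 0 x)) = (\<lambda>x. G (max 0 x))" ..
    show "continuous_on UNIV (\<lambda>s. G (max 0 s))"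
    proof (rule lipschitz_on_continuous_on[where L = B], rule lipschitz_onI)
      fix x y :: real
      have "\<bar>G (max 0 y) - G (max 0 x)\<bar> \<le> B * (max 0 y - max 0 x)" if "x \<le> y" for x y
        using that by (intro Gl) auto
      moreover have "max 0 y - max 0 x \<le> y - x" if "x \<le> y" for x y :: real using that by auto
      ultimately have *: "\<bar>G (max 0 y) - G (max 0 x)\<bar> \<le> B * (y - x)" if "x \<le> y" for x y
        using that B0 by (meson mult_left_mono order_trans)
      show "dist (G (max 0 x)) (G (max 0 y)) \<le> B * dist x y"
        using *[of x y] *[of y x] by (cases "x \<le> y") (auto simp: dist_real_def abs_if split: if_splits)
    qed (rule B0)
  qed simp
  note [measurable] = this
  have integ: "set_integrable lborel {x<..y} (\<lambda>s. g s * exp (G s))" if "0 \<le> x" "y \<le> t" for x y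
  proof -
    have "set_integrable lborel {x<..y} (\<lambda>s. g s * exp (G (max 0 s)))"
    proof (rule integrable_bounded_interval[of _ _ x y "B * exp (B * t)"])
      fix s assume "s \<in> {x<..y}"
      then have "G (max 0 s) \<le> B * t" using Gb[of s] that by auto
      then show "\<bar>g s * exp (G (max 0 s))\<bar> \<le> B * exp (B * t)" using B[of s] B0 by (auto simp: abs_mult intro!: mult_mono)
    qed auto
    then show ?thesis
      by (rule set_integrable_cong[THEN iffD1, rotated -1]) (use that in auto)
  qed
  define D where "D x = exp (G x) - 1 - (LBINT s:{0<..x}. g s * exp (G s))" for x
  have "D t = D 0"
  proof (rule quadratic_increment_const[OF t])
    fix x y assume xy: "0 \<le> x" "x \<le> y" "y \<le> t"
    let ?M = "exp (B * t)"
    have "{0<..y} = {0<..x} \<union> {x<..y}" using xy by auto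
    then have 1: "(LBINT s:{0<..y}. g s * exp (G s)) = (LBINT s:{0<..x}. g s * exp (G s)) + (LBINT s:{x<..y}. g s * exp (G s))"
      using integ xy by (simp add: set_integral_Un)
    have "(LBINT s:{x<..y}. g s * exp (G s)) - exp (G x) * (G y - G x) = (LBINT s:{x<..y}. g s * exp (G s) - exp (G x) * g s)"
      unfolding Gd[OF xy(1,2)] using integ[of x y] xy gi by (subst set_integral_diff) auto
    also have "\<bar>\<dots>\<bar> \<le> B * (?M * (B * (y - x))) * (y - x)"
    proof (rule set_lborel_integral_bound)
      show "set_integrable lborel {x<..y} (\<lambda>s. g s * exp (G s) - exp (G x) * g s)"
        using integ[of x y] xy gi by (intro set_integral_diff) auto
      fix s assume s: "s \<in> {x<..y}"
      have "\<bar>exp (G s) - exp (G x)\<bar> \<le> ?M * \<bar>G s - G x\<bar>" using s xy by (intro exp_diff_bounds Gb) auto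
      also have "\<dots> \<le> ?M * (B * (s - x))" using s xy by (intro mult_left_mono Gl) auto
      also have "\<dots> \<le> ?M * (B * (y - x))" using s B0 by (intro mult_left_mono) auto
      finally have "\<bar>g s\<bar> * \<bar>exp (G s) - exp (G x)\<bar> \<le> B * (?M * (B * (y - x)))" using B[of s] B0 by (intro mult_mono) auto
      moreover have "g s * exp (G s) - exp (G x) * g s = g s * (exp (G s) - exp (G x))" by (simp add: algebra_simps)
      ultimately show "\<bar>g s * exp (G s) - exp (G x) * g s\<bar> \<le> B * (?M * (B * (y - x)))" by (simp add: abs_mult)
    qed (use xy in simp)
    finally have 2: "\<bar>(LBINT s:{x<..y}. g s * exp (G s)) - exp (G x) * (G y - G x)\<bar> \<le> B\<^sup>2 * ?M * (y - x)\<^sup>2"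
      by (simp add: power2_eq_square algebra_simps)
    have "\<bar>exp (G y) - exp (G x) - exp (G x) * (G y - G x)\<bar> \<le> ?M * (G y - G x)\<^sup>2"
      using xy by (intro exp_diff_bounds Gb) auto
    also have "\<dots> \<le> ?M * (B * (y - x))\<^sup>2"
      using Gl[OF xy(1,2)] by (intro mult_left_mono) (auto intro: abs_le_square_iff[THEN iffD1] order_trans[OF _ abs_ge_self])
    finally have 3: "\<bar>exp (G y) - exp (G x) - exp (G x) * (G y - G x)\<bar> \<le> B\<^sup>2 * ?M * (y - x)\<^sup>2"
      by (simp add: power2_eq_square algebra_simps)
    show "\<bar>D y - D x\<bar> \<le> (2 * (B\<^sup>2 * ?M)) * (y - x)\<^sup>2"
      using 1 2 3 unfolding D_def by (simp add: abs_le_iff)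
  qed
  then show "(LBINT s:{0<..t}. g s * exp (LBINT r:{0<..s}. g r)) = exp (LBINT s:{0<..t}. g s) - 1"
    by (simp add: D_def G0) (simp add: G_def set_lebesgue_integral_def)
  show "set_integrable lborel {0<..t} (\<lambda>s. g s * exp (LBINT r:{0<..s}. g r))"
    using integ[of 0 t] by (simp add: G_def)
qed

section \<open>Uniqueness for Laplace transforms and Volterra equations\<close>

text \<open>On the unit interval the exponential series can be integrated term by term, so the
  moments determine the characteristic function. The uniqueness theorem for characteristic functions
  speaks of probability measures, whence the normalisation and the separate case of total mass
  0.\<close>

lemma finite_measure_moment_unique:
  fixes F G :: "real measure"
  assumes F: "finite_measure F" "sets F = sets borel" "AE x in F. x \<in> {0..1}"
    and G: "finite_measure G" "sets G = sets borel" "AE x in G. x \<in> {0..1}"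
    and mom: "\<And>n. (LINT x|F. x ^ n) = (LINT x|G. x ^ n)"
  shows "F = G"
proof -
  have sp: "space F = UNIV" "space G = UNIV" using sets_eq_imp_space_eq[OF F(2)] sets_eq_imp_space_eq[OF G(2)] by simp_all
  have mG: "measure G UNIV = measure F UNIV" using mom[of 0] sp by simp
  have series: "(\<lambda>n. (\<i> * complex_of_real t) ^ n / fact n * complex_of_real (LINT x|H. x ^ n)) sums
      (LINT x|H. iexp (t * x))"
    if H: "finite_measure H" "sets H = sets borel" "AE x in H. x \<in> {0..1}" for H :: "real measure" and t
  proof -
    interpret H: finite_measure H by (rule H(1))
    have [measurable_cong]: "sets H = sets borel" by (rule H(2))
    let ?f = "\<lambda>n x. (\<i> * complex_of_real (t * x)) ^ n / fact n"
    have bd: "AE x in H. norm (?f n x) \<le> \<bar>t\<bar> ^ n / fact n" for n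
      using H(3)
    proof eventually_elim
      case (elim x)
      then have "\<bar>t * x\<bar> ^ n \<le> \<bar>t\<bar> ^ n" by (intro power_mono) (auto simp: abs_mult mult_left_le)
      then show ?case by (simp add: norm_divide norm_power norm_mult abs_mult divide_right_mono)
    qed
    have int: "integrable H (?f n)" for n
      by (rule H.integrable_const_bound[OF bd]) measurable
    have se: "summable (\<lambda>n. \<bar>t\<bar> ^ n / fact n)"
      using summable_exp[of "\<bar>t\<bar>"] by (simp add: divide_inverse mult.commute)
    have "(\<lambda>n. LINT x|H. ?f n x) sums (LINT x|H. (\<Sum>n. ?f n x))"
    proof (rule sums_integral[OF int])
      show "AE x in H. summable (\<lambda>n. norm (?f n x))"
      proof -
        have "AE x in H. \<forall>n. norm (?f n x) \<le> \<bar>t\<bar> ^ n / fact n"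
          using bd by (subst AE_all_countable) blast
        then show ?thesis
        proof eventually_elim
          case (elim x)
          show ?case by (rule summable_comparison_test'[OF se, of 0]) (use elim in simp)
        qed
      qed
      show "summable (\<lambda>n. LINT x|H. norm (?f n x))"
      proof (rule summable_comparison_test'[OF summable_mult[OF se, of "measure H (space H)"]])
        fix n
        have "(LINT x|H. norm (?f n x)) \<le> (LINT x|H. \<bar>t\<bar> ^ n / fact n)"
          using int bd by (intro integral_mono_AE integrable_norm) auto
        also have "\<dots> = measure H (space H) * (\<bar>t\<bar> ^ n / fact n)" by simp
        finally show "norm (LINT x|H. norm (?f n x)) \<le> measure H (space H) * (\<bar>t\<bar> ^ n / fact n)" by simp
      qed
    qed
    moreover have "(\<Sum>n. ?f n x) = iexp (t * x)" for x
      by (simp add: exp_def scaleR_conv_of_real divide_inverse mult.commute)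
    moreover have "(LINT x|H. ?f n x) = (\<i> * complex_of_real t) ^ n / fact n * complex_of_real (LINT x|H. x ^ n)" for n
    proof -
      have "(LINT x|H. ?f n x) = (LINT x|H. (\<i> * complex_of_real t) ^ n / fact n * complex_of_real (x ^ n))"
        by (intro Bochner_Integration.integral_cong refl) (simp add: power_mult_distrib)
      then show ?thesis by (simp del: of_real_power)
    qed
    ultimately show ?thesis by simp
  qed
  have ch: "(LINT x|F. iexp (t * x)) = (LINT x|G. iexp (t * x))" for t
    using series[OF F, of t] series[OF G, of t] mom by (auto dest: sums_unique2)
  interpret F: finite_measure F by (rule F(1))
  interpret G: finite_measure G by (rule G(1))
  show ?thesis
  proof (cases "measure F UNIV = 0")
    case True
    show ?thesis
    proof (rule measure_eqI)
      fix A assume "A \<in> sets F"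
      have "emeasure F UNIV = 0" "emeasure G UNIV = 0"
        using True mG F.emeasure_eq_measure[of UNIV] G.emeasure_eq_measure[of UNIV] by auto
      then show "emeasure F A = emeasure G A"
        using emeasure_mono[of A UNIV F] emeasure_mono[of A UNIV G] F(2) G(2) by auto
    qed (use F(2) G(2) in simp)
  next
    case False
    then have pos: "0 < measure F UNIV" using zero_less_measure_iff by blast
    let ?s = "\<lambda>H. scale_measure (1 / measure F UNIV) H"
    have rd: "real_distribution (?s H)" "\<And>t. char (?s H) t = (LINT x|H. iexp (t * x)) / measure F UNIV"
      if H: "finite_measure H" "sets H = sets borel" "measure H UNIV = measure F UNIV" for H :: "real measure"
    proof -
      interpret H: finite_measure H by (rule H(1))
      have spH: "space H = UNIV" using sets_eq_imp_space_eq[OF H(2)] by simp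
      have "prob_space (?s H)"
      proof
        have "emeasure (?s H) (space (?s H)) = ennreal (1 / measure F UNIV) * ennreal (measure F UNIV)"
          using H spH by (simp add: H.emeasure_eq_measure space_scale_measure)
        also have "\<dots> = 1" using pos by (simp add: ennreal_mult[symmetric])
        finally show "emeasure (?s H) (space (?s H)) = 1" .
      qed
      then show "real_distribution (?s H)"
        by (auto simp: real_distribution_def real_distribution_axioms_def H(2))
      fix t
      have "?s H = density H (\<lambda>_. ennreal (1 / measure F UNIV))"
      proof (rule measure_eqI)
        fix A assume "A \<in> sets (?s H)"
        then show "emeasure (?s H) A = emeasure (density H (\<lambda>_. ennreal (1 / measure F UNIV))) A"
          by (simp add: emeasure_density nn_integral_cmult)
      qed simp
      then show "char (?s H) t = (LINT x|H. iexp (t * x)) / measure F UNIV"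
        unfolding char_def using pos
        by (subst \<open>?s H = _\<close>, subst integral_density)
          (auto simp: H(2) measurable_cong_sets[OF H(2) refl] scaleR_conv_of_real divide_inverse mult.commute)
    qed
    have "?s F = ?s G"
    proof (rule Levy_uniqueness)
      show "real_distribution (?s F)" "real_distribution (?s G)" using rd(1) F G mG by auto
      show "char (?s F) = char (?s G)"
        by (rule ext) (simp only: rd(2)[OF F(1,2) refl] rd(2)[OF G(1,2) mG] ch)
    qed
    have "F = scale_measure (measure F UNIV) (?s F)"
      using pos by (simp add: scale_scale_measure ennreal_mult[symmetric])
    also have "\<dots> = scale_measure (measure F UNIV) (?s G)" by (simp add: \<open>?s F = ?s G\<close>)
    also have "\<dots> = G" using pos by (simp add: scale_scale_measure ennreal_mult[symmetric])
    finally show ?thesis .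
  qed
qed

text \<open>The measures may be infinite towards minus infinity. Tilting by
  \<open>exp (l * y)\<close> makes them finite, and the image under \<open>exp (y - c)\<close> lives
  on the unit interval, where its \<open>n\<close>-th moment is the transform at
  \<open>l + n\<close> up to a constant. Tilt and image can both be undone.\<close>

lemma laplace_transform_unique:
  fixes N1 N2 :: "real measure"
  assumes s: "sets N1 = sets borel" "sets N2 = sets borel"
    and c: "AE y in N1. y \<le> c" "AE y in N2. y \<le> c"
    and eq: "\<And>l. l > l0 \<Longrightarrow> (\<integral>\<^sup>+y. ennreal (exp (l * y)) \<partial>N1) = (\<integral>\<^sup>+y. ennreal (exp (l * y)) \<partial>N2)"
    and fin: "\<And>l. l > l0 \<Longrightarrow> (\<integral>\<^sup>+y. ennreal (exp (l * y)) \<partial>N1) < \<infinity>"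
  shows "N1 = N2"
proof -
  define l where "l = l0 + 1"
  define F where "F N = distr (density N (\<lambda>y. ennreal (exp (l * y)))) borel (\<lambda>y. exp (y - c))" for N :: "real measure"
  have Fp: "finite_measure (F N)" "sets (F N) = sets borel" "AE x in F N. x \<in> {0..1}"
      "\<And>n. (LINT x|F N. x ^ n) = enn2real (\<integral>\<^sup>+y. ennreal (exp ((l + real n) * y)) \<partial>N) * exp (- (real n * c))"
      "N = density (distr (F N) borel (\<lambda>x. ln x + c)) (\<lambda>y. ennreal (exp (- (l * y))))"
    if N: "sets N = sets borel" "AE y in N. y \<le> c" "\<And>l. l > l0 \<Longrightarrow> (\<integral>\<^sup>+y. ennreal (exp (l * y)) \<partial>N) < \<infinity>" for N
  proof -
    have [measurable_cong]: "sets N = sets borel" by (rule N(1))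
    have spN: "space N = UNIV" using sets_eq_imp_space_eq[OF N(1)] by simp
    show "finite_measure (F N)"
    proof
      have "emeasure (F N) (space (F N)) = (\<integral>\<^sup>+y. ennreal (exp (l * y)) \<partial>N)"
        unfolding F_def by (simp add: emeasure_distr emeasure_density spN)
      also have "\<dots> < \<infinity>" by (rule N(3)) (simp add: l_def)
      finally show "emeasure (F N) (space (F N)) \<noteq> \<infinity>" by simp
    qed
    show "sets (F N) = sets borel" by (simp add: F_def)
    show "AE x in F N. x \<in> {0..1}"
      unfolding F_def by (subst AE_distr_iff) (use N(2) in \<open>auto simp: AE_density elim!: eventually_mono\<close>)
    show "(LINT x|F N. x ^ n) = enn2real (\<integral>\<^sup>+y. ennreal (exp ((l + real n) * y)) \<partial>N) * exp (- (real n * c))" for n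
    proof -
      have "(LINT x|F N. x ^ n) = (LINT y|N. exp (l * y) * exp (y - c) ^ n)"
        unfolding F_def by (subst integral_distr) (auto simp: integral_density)
      also have "\<dots> = (LINT y|N. exp ((l + real n) * y) * exp (- (real n * c)))"
        by (intro Bochner_Integration.integral_cong refl) (simp add: exp_of_nat_mult[symmetric] exp_add[symmetric] algebra_simps)
      also have "\<dots> = (LINT y|N. exp ((l + real n) * y)) * exp (- (real n * c))" by simp
      also have "(LINT y|N. exp ((l + real n) * y)) = enn2real (\<integral>\<^sup>+y. ennreal (exp ((l + real n) * y)) \<partial>N)"
        by (rule integral_eq_nn_integral) auto
      finally show ?thesis .
    qed
    have "distr (F N) borel (\<lambda>x. ln x + c) = density N (\<lambda>y. ennreal (exp (l * y)))"
    proof -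
      have "distr (F N) borel (\<lambda>x. ln x + c) = distr (density N (\<lambda>y. ennreal (exp (l * y)))) borel (\<lambda>y. y)"
        unfolding F_def by (subst distr_distr) (auto simp: o_def)
      also have "\<dots> = density N (\<lambda>y. ennreal (exp (l * y)))" by (rule distr_id2) (simp add: N(1))
      finally show ?thesis .
    qed
    then show "N = density (distr (F N) borel (\<lambda>x. ln x + c)) (\<lambda>y. ennreal (exp (- (l * y))))"
      by (simp add: density_density_eq ennreal_mult[symmetric] exp_minus density_1)
  qed
  have fin2: "\<And>l. l > l0 \<Longrightarrow> (\<integral>\<^sup>+y. ennreal (exp (l * y)) \<partial>N2) < \<infinity>" using eq fin by simp
  have "F N1 = F N2"
  proof (rule finite_measure_moment_unique)
    fix n
    have "l + real n > l0" by (simp add: l_def)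
    then show "(LINT x|F N1. x ^ n) = (LINT x|F N2. x ^ n)"
      using Fp(4)[OF s(1) c(1) fin, of n] Fp(4)[OF s(2) c(2) fin2, of n] eq[of "l + real n"] by simp
  qed (use Fp[OF s(1) c(1) fin] Fp[OF s(2) c(2) fin2] in auto)
  then show ?thesis using Fp(5)[OF s(1) c(1) fin] Fp(5)[OF s(2) c(2) fin2] by simp
qed

lemma continuous_AE_zero:
  fixes h :: "real \<Rightarrow> real"
  assumes c: "continuous_on {a..} h" and z: "AE x in lborel. a \<le> x \<longrightarrow> h x = 0" and x: "a \<le> x"
  shows "h x = 0"
proof (rule ccontr)
  assume nz: "h x \<noteq> 0"
  have "\<forall>e>0. \<exists>d>0. \<forall>y\<in>{a..}. dist y x < d \<longrightarrow> dist (h y) (h x) < e"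
    using c x unfolding continuous_on_iff by auto
  then obtain d where d: "0 < d" "\<And>y. a \<le> y \<Longrightarrow> \<bar>y - x\<bar> < d \<Longrightarrow> \<bar>h y - h x\<bar> < \<bar>h x\<bar>"
    using nz by (metis atLeast_iff dist_real_def zero_less_abs_iff)
  have "AE y in lborel. y \<notin> {x<..<x + d}"
    using z
  proof eventually_elim
    case (elim y)
    show ?case
    proof
      assume y: "y \<in> {x<..<x + d}"
      then have "\<bar>h y - h x\<bar> < \<bar>h x\<bar>" using d(2)[of y] x by auto
      then show False using elim y x by auto
    qed
  qed
  then have "emeasure lborel {x<..<x+d} = 0"
    by (subst (asm) AE_iff_measurable[of "{x<..<x + d}"]) auto
  then show False using d by simp
qed

text \<open>The positive and the negative part of the difference are densities of two measures,
  reflected onto the negative half-line, with equal transforms. So the two parts coincide almost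
  everywhere, the difference vanishes almost everywhere, and by continuity everywhere.\<close>

lemma laplace_function_unique:
  fixes f g :: "real \<Rightarrow> real"
  assumes c: "continuous_on {0..} f" "continuous_on {0..} g"
    and i: "\<And>l. l > l0 \<Longrightarrow> set_integrable lborel {0..} (\<lambda>y. exp (- l * y) * f y)"
      "\<And>l. l > l0 \<Longrightarrow> set_integrable lborel {0..} (\<lambda>y. exp (- l * y) * g y)"
    and eq: "\<And>l. l > l0 \<Longrightarrow> (LBINT y:{0..}. exp (- l * y) * f y) = (LBINT y:{0..}. exp (- l * y) * g y)"
    and x: "0 \<le> x"
  shows "f x = g x"
proof -
  define h where "h y = indicator {0..} y * (f y - g y)" for y
  have hc: "continuous_on {0..} h"
    unfolding h_def using c by (intro continuous_intros) (auto simp: indicator_def intro: continuous_on_eq[OF continuous_on_const[of _ 1]])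
  have [measurable]: "h \<in> borel_measurable borel"
  proof -
    have "(\<lambda>y. if y \<in> {0..} then h y else 0) \<in> borel_measurable borel"
      by (rule borel_measurable_continuous_on_if) (use hc in auto)
    moreover have "(\<lambda>y. if y \<in> {0..} then h y else 0) = h" by (auto simp: h_def)
    ultimately show ?thesis by simp
  qed
  have hi: "integrable lborel (\<lambda>y. exp (- l * y) * h y)" and h0: "(LINT y|lborel. exp (- l * y) * h y) = 0" if "l > l0" for l
  proof -
    have e: "(\<lambda>y. exp (- l * y) * h y) = (\<lambda>y. indicator {0..} y *\<^sub>R (exp (- l * y) * f y) - indicator {0..} y *\<^sub>R (exp (- l * y) * g y))"
      by (auto simp: h_def algebra_simps)
    show "integrable lborel (\<lambda>y. exp (- l * y) * h y)" "(LINT y|lborel. exp (- l * y) * h y) = 0"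
      unfolding e using i[OF that] eq[OF that] by (auto simp: set_integrable_def set_lebesgue_integral_def)
  qed
  have uminus_measurable: "(uminus :: real \<Rightarrow> real) \<in> borel_measurable (density lborel f)" for f by simp
  \<comment> \<open>\<open>ennreal\<close> sends negative numbers to 0, so \<open>s = 1\<close> and
    \<open>s = - 1\<close> select the positive and the negative part.\<close>
  define N where "N s = distr (density lborel (\<lambda>y. ennreal (s * h y))) borel uminus" for s :: real
  have lt: "(\<integral>\<^sup>+y. ennreal (exp (l * y)) \<partial>N s) = (\<integral>\<^sup>+y. ennreal (max 0 (s * (exp (- l * y) * h y))) \<partial>lborel)" for s l
    unfolding N_def by (subst nn_integral_distr, simp, simp, subst nn_integral_density)
      (auto intro!: nn_integral_cong simp: ennreal_mult''[symmetric] mult_ac max_def ennreal_neg)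
  have "N 1 = N (-1)"
  proof (rule laplace_transform_unique)
    show "AE y in N 1. y \<le> 0" "AE y in N (-1). y \<le> 0"
      unfolding N_def by (subst AE_distr_iff[OF uminus_measurable], simp, subst AE_density, simp, auto simp: h_def indicator_def)+
    fix l assume l: "l > l0"
    let ?k = "\<lambda>y. exp (- l * y) * h y"
    have m: "integrable lborel (\<lambda>y. max 0 (1 * ?k y))" "integrable lborel (\<lambda>y. max 0 (- 1 * ?k y))"
      using hi[OF l] by (auto intro!: Bochner_Integration.integrable_max simp del: mult_minus_left mult_minus_right)
    have "(LINT y|lborel. max 0 (1 * ?k y)) - (LINT y|lborel. max 0 (- 1 * ?k y)) = (LINT y|lborel. max 0 (1 * ?k y) - max 0 (- 1 * ?k y))"
      using m by simp
    also have "\<dots> = (LINT y|lborel. ?k y)" by (intro Bochner_Integration.integral_cong) (auto simp: max_def)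
    finally have eq: "(LINT y|lborel. max 0 (1 * ?k y)) = (LINT y|lborel. max 0 (- 1 * ?k y))" using h0[OF l] by simp
    show "(\<integral>\<^sup>+y. ennreal (exp (l * y)) \<partial>N 1) = (\<integral>\<^sup>+y. ennreal (exp (l * y)) \<partial>N (- 1))"
      unfolding lt using m eq by (subst (1 2) nn_integral_eq_integral) auto
    show "(\<integral>\<^sup>+y. ennreal (exp (l * y)) \<partial>N 1) < \<infinity>"
      unfolding lt using m by (subst nn_integral_eq_integral) auto
  qed (auto simp: N_def)
  have un: "density lborel (\<lambda>y. ennreal (s * h y)) = distr (N s) borel uminus" for s
    unfolding N_def by (subst distr_distr) (auto simp: o_def intro!: distr_id2[symmetric])
  have "density lborel (\<lambda>y. ennreal (1 * h y)) = density lborel (\<lambda>y. ennreal (- 1 * h y))"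
    unfolding un by (simp add: \<open>N 1 = N (-1)\<close>)
  then have "AE y in lborel. ennreal (1 * h y) = ennreal (- 1 * h y)"
    by (subst (asm) sigma_finite_measure.density_unique_iff[OF lborel.sigma_finite_measure_axioms]) auto
  then have "AE y in lborel. 0 \<le> y \<longrightarrow> h y = 0"
    by eventually_elim (metis ennreal_neg ennreal_eq_0_iff linorder_le_cases mult_1 mult_minus_left neg_le_0_iff_le order_antisym)
  from continuous_AE_zero[OF hc this x] show ?thesis using x by (simp add: h_def)
qed

text \<open>With respect to the weight \<open>exp (2 * C * (x - a))\<close> the integral operator is
  a contraction with factor 1/2, since integrating the weight divides it by \<open>2 * C\<close>.
  Iterating the inequality gives the bounds \<open>M / 2 ^ n\<close>.\<close>

lemma volterra_zero:
  fixes D :: "real \<Rightarrow> real"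
  assumes C: "0 < C" and i: "set_integrable lborel {a..c} D"
    and bd: "\<And>x. a \<le> x \<Longrightarrow> x \<le> c \<Longrightarrow> \<bar>D x\<bar> \<le> M"
    and D: "\<And>x. a \<le> x \<Longrightarrow> x \<le> c \<Longrightarrow> \<bar>D x\<bar> \<le> C * (LBINT y:{a..x}. \<bar>D y\<bar>)"
    and x: "a \<le> x" "x \<le> c"
  shows "D x = 0"
proof -
  have M: "0 \<le> M" using bd[OF x] by linarith
  have *: "\<forall>x\<in>{a..c}. \<bar>D x\<bar> \<le> M / 2 ^ n * exp (2 * C * (x - a))" for n
  proof (induction n)
    case 0
    have "M * 1 \<le> M * exp (2 * C * (x - a))" if "a \<le> x" for x
      using that C M by (intro mult_left_mono) auto
    then show ?case using bd by fastforce
  next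
    case (Suc n)
    show ?case
    proof
      fix x assume x: "x \<in> {a..c}"
      let ?K = "M / 2 ^ n"
      have F: "has_bochner_integral lborel (\<lambda>y. indicator {a..x} y *\<^sub>R (?K * exp (2 * C * (y - a))))
          (?K / (2 * C) * exp (2 * C * (x - a)) - ?K / (2 * C) * exp (2 * C * (a - a)))"
        using C x by (intro has_bochner_integral_FTC_Icc[where F = "\<lambda>y. ?K / (2 * C) * exp (2 * C * (y - a))"])
          (auto intro!: derivative_eq_intros continuous_intros simp: has_real_derivative_iff_has_vector_derivative[symmetric])
      have "(LBINT y:{a..x}. \<bar>D y\<bar>) \<le> (LBINT y:{a..x}. ?K * exp (2 * C * (y - a)))"
      proof (rule set_integral_mono)
        show "set_integrable lborel {a..x} (\<lambda>y. \<bar>D y\<bar>)"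
          using x by (intro set_integrable_abs set_integrable_subset[OF i]) auto
        show "set_integrable lborel {a..x} (\<lambda>y. ?K * exp (2 * C * (y - a)))"
          using F by (auto simp: set_integrable_def has_bochner_integral_iff)
      qed (use Suc x in auto)
      also have "\<dots> = ?K / (2 * C) * exp (2 * C * (x - a)) - ?K / (2 * C)"
        unfolding set_lebesgue_integral_def has_bochner_integral_integral_eq[OF F] by simp
      also have "\<dots> \<le> ?K / (2 * C) * exp (2 * C * (x - a))" using M C by simp
      finally have "C * (LBINT y:{a..x}. \<bar>D y\<bar>) \<le> C * (?K / (2 * C) * exp (2 * C * (x - a)))"
        using C by (intro mult_left_mono) auto
      also have "\<dots> = M / 2 ^ Suc n * exp (2 * C * (x - a))" using C by simp
      finally show "\<bar>D x\<bar> \<le> M / 2 ^ Suc n * exp (2 * C * (x - a))" using D[of x] x by auto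
    qed
  qed
  have "(\<lambda>n. M / 2 ^ n * exp (2 * C * (x - a))) \<longlonglongrightarrow> 0 * exp (2 * C * (x - a))"
  proof (intro tendsto_mult tendsto_const)
    have "(\<lambda>n. M * (1 / 2) ^ n) \<longlonglongrightarrow> M * 0" by (intro tendsto_mult tendsto_const LIMSEQ_power_zero) auto
    then show "(\<lambda>n. M / 2 ^ n) \<longlonglongrightarrow> 0" by (simp add: power_divide)
  qed
  then have "\<bar>D x\<bar> \<le> 0 * exp (2 * C * (x - a))"
    by (rule LIMSEQ_le_const) (use * x in auto)
  then show ?thesis by simp
qed

section \<open>The Markov property at fixed times\<close>

lemma alive_grid_tendsto:
  assumes w: "right_cont w" and t: "0 < t"
  shows "(\<lambda>n. of_bool (\<forall>j\<in>{1..Suc n}. w (real j * (t / real (Suc n))) \<le> c) :: real) \<longlonglongrightarrow> of_bool (alive c t w)"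
proof (rule tendsto_eventually)
  show "\<forall>\<^sub>F n in sequentially. of_bool (\<forall>j\<in>{1..Suc n}. w (real j * (t / real (Suc n))) \<le> c) = (of_bool (alive c t w) :: real)"
  proof (cases "alive c t w")
    case True
    have "w (real j * (t / real (Suc n))) \<le> c" if "j \<in> {1..Suc n}" for n j
    proof -
      have "real j * (t / real (Suc n)) \<le> real (Suc n) * (t / real (Suc n))"
        using that t by (intro mult_right_mono) auto
      then have "real j * (t / real (Suc n)) \<le> t" by simp
      moreover have "0 < real j * (t / real (Suc n))" using that t by simp
      ultimately show ?thesis using True unfolding alive_def by blast
    qed
    then show ?thesis using True by (auto intro!: always_eventually)
  next
    case False
    then obtain r where r: "0 < r" "r \<le> t" "c < w r" unfolding alive_def by (auto simp: not_le)
    define h where "h n = t / real (Suc n)" for n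
    have h: "\<And>n. 0 < h n" "h \<longlonglongrightarrow> 0"
      unfolding h_def using t tendsto_mult[OF tendsto_const tendsto_one_over_Suc, of t] by auto
    have "\<forall>\<^sub>F n in sequentially. \<exists>j\<in>{1..Suc n}. c < w (real j * h n)"
    \<comment> \<open>The last grid point is \<open>t\<close> itself, so an exceedance exactly at
      \<open>t\<close> is seen by every grid. An earlier one persists to the right and is caught at
      a grid point before \<open>t\<close>.\<close>
    proof (cases "r = t")
      case True
      have "c < w (real (Suc n) * h n)" for n using True r(3) by (simp add: h_def)
      then have "\<exists>j\<in>{1..Suc n}. c < w (real j * h n)" for n by (intro bexI[of _ "Suc n"]) auto
      then show ?thesis by simp
    next
      case False
      then have rt: "r < t" using r by simp
      have "(\<lambda>n. w (grid_up (h n) r)) \<longlonglongrightarrow> w r" using right_cont_grid_tendsto[OF w _ h] r by simp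
      then have "\<forall>\<^sub>F n in sequentially. c < w (grid_up (h n) r)" using order_tendstoD(1) r(3) by blast
      moreover have "\<forall>\<^sub>F n in sequentially. grid_up (h n) r < t" using order_tendstoD(2)[OF grid_up_tendsto[of h r, OF h] rt] .
      ultimately show ?thesis
      proof eventually_elim
        case (elim n)
        let ?j = "nat \<lceil>r / h n\<rceil>"
        have g: "grid_up (h n) r = real ?j * h n" using grid_up_nat[OF h(1)] r by simp
        have "real ?j * h n < real (Suc n) * h n" using elim(2) g by (simp add: h_def)
        then have "?j \<le> Suc n" using h(1)[of n] by (simp only: mult_less_cancel_right_pos of_nat_less_iff less_imp_le)
        moreover have "0 < ?j" using r h(1)[of n] by simp
        ultimately have "?j \<in> {1..Suc n}" by (metis atLeastAtMost_iff One_nat_def Suc_leI)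
        then show ?case using elim(1) unfolding g by (rule bexI[rotated])
      qed
    qed
    then show ?thesis by eventually_elim (use False in \<open>auto simp: h_def not_le\<close>)
  qed
qed

text \<open>
  Limits of functions of finitely many grid values: for these the Markov property at a fixed time
  follows from the independence of increments alone.
\<close>

definition grid_functional :: "((real \<Rightarrow> real) \<Rightarrow> real) \<Rightarrow> bool" where
  "grid_functional F \<longleftrightarrow> (\<exists>(f :: nat \<Rightarrow> (nat \<Rightarrow> real) \<Rightarrow> real) h m.
     (\<forall>n. 0 \<le> h n \<and> f n \<in> borel_measurable (PiM UNIV (\<lambda>_. borel)) \<and>
        (\<forall>w. 0 \<le> f n w \<and> f n w \<le> 1) \<and> (\<forall>w w'. (\<forall>j\<le>m n. w j = w' j) \<longrightarrow> f n w = f n w')) \<and>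
     (\<forall>w. right_cont w \<longrightarrow> (\<lambda>n. f n (\<lambda>j. w (real j * h n))) \<longlonglongrightarrow> F w))"

text \<open>One further pointwise limit: Riemann sums along a grid converge for continuous rates,
  whereas the rates of the theorem are indicators and are reached only from continuous ones.\<close>

definition path_functional :: "((real \<Rightarrow> real) \<Rightarrow> real) \<Rightarrow> bool" where
  "path_functional F \<longleftrightarrow> (\<exists>Fk. (\<forall>k. grid_functional (Fk k)) \<and> (\<forall>w. right_cont w \<longrightarrow> (\<lambda>k::nat. Fk k w) \<longlonglongrightarrow> F w))"

lemma grid_functional_bounds: "grid_functional F \<Longrightarrow> right_cont w \<Longrightarrow> 0 \<le> F w \<and> F w \<le> 1"
  unfolding grid_functional_def by (metis LIMSEQ_le_const LIMSEQ_le_const2)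

lemma path_functional_bounds: "path_functional F \<Longrightarrow> right_cont w \<Longrightarrow> 0 \<le> F w \<and> F w \<le> 1"
  unfolding path_functional_def using grid_functional_bounds by (metis LIMSEQ_le_const LIMSEQ_le_const2)

lemma grid_functional_path_functional: "grid_functional F \<Longrightarrow> path_functional F"
  unfolding path_functional_def by (intro exI[of _ "\<lambda>_. F"]) auto

lemma grid_discount_measurable [measurable]:
  assumes [measurable]: "g \<in> borel_measurable borel"
  shows "grid_discount g c h m \<in> borel_measurable (PiM UNIV (\<lambda>_. borel))"
  unfolding grid_discount_def by measurable

lemma grid_functional_discount:
  assumes "continuous_on UNIV g" "\<And>x. 0 \<le> g x" "\<And>x. g x \<le> B"
  shows "grid_functional (path_discount g c)"
proof -
  have [measurable]: "g \<in> borel_measurable borel" using assms(1) by (rule borel_measurable_continuous_onI)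
  have "grid_discount g c h m w = grid_discount g c h m w'" if "\<forall>j\<le>m. w j = w' j" for h m w w'
    unfolding grid_discount_def using that by (intro sum.cong arg_cong2[of _ _ _ _ "(*)"] arg_cong[of _ _ of_bool] arg_cong[of _ _ exp] arg_cong[of _ _ uminus] refl) auto
  moreover have "(\<lambda>n. grid_discount g c (1 / real (Suc n)) (Suc n * Suc n) (\<lambda>j. w (real j * (1 / real (Suc n))))) \<longlonglongrightarrow> path_discount g c w"
    if "right_cont w" for w
    by (rule grid_discount_tendsto[OF that assms(1), of B]) (use assms in \<open>auto simp: abs_of_nonneg\<close>)
  moreover have "0 \<le> grid_discount g c (1 / real (Suc n)) m w \<and> grid_discount g c (1 / real (Suc n)) m w \<le> 1" for n m w
    using assms(2) by (auto intro!: grid_discount_bounds)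
  ultimately show ?thesis unfolding grid_functional_def
    by (intro exI[of _ "\<lambda>n. grid_discount g c (1 / real (Suc n)) (Suc n * Suc n)"] exI[of _ "\<lambda>n. 1 / real (Suc n)"] exI[of _ "\<lambda>n. Suc n * Suc n"] conjI allI impI)
      (blast | simp)+
qed

lemma path_functional_discount:
  fixes g :: "nat \<Rightarrow> real \<Rightarrow> real"
  assumes g: "\<And>n. continuous_on UNIV (g n)" "\<And>n x. 0 \<le> g n x" "\<And>n x. g n x \<le> B"
    and lim: "\<And>x. (\<lambda>n. g n x) \<longlonglongrightarrow> g' x"
  shows "path_functional (path_discount g' c)"
  unfolding path_functional_def
proof (intro exI conjI allI impI)
  fix n show "grid_functional (path_discount (g n) c)" using g by (rule grid_functional_discount)
next
  fix w assume "right_cont w"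
  then show "(\<lambda>n. path_discount (g n) c w) \<longlonglongrightarrow> path_discount g' c w"
    by (rule path_discount_tendsto[where B = B]) (use g lim in \<open>auto simp: abs_of_nonneg intro: borel_measurable_continuous_onI\<close>)
qed

text \<open>The mesh \<open>r / (n + 1)\<close> makes \<open>r\<close> a grid point for every
  \<open>n\<close>, so \<open>\<phi> (w r)\<close> is a grid value and \<open>\<phi>\<close> may be
  any bounded Borel function.\<close>

lemma path_functional_alive_at:
  assumes [measurable]: "\<phi> \<in> borel_measurable borel" and \<phi>: "\<And>x. 0 \<le> \<phi> x" "\<And>x. \<phi> x \<le> (1::real)" and r: "0 < r"
  shows "path_functional (\<lambda>w. of_bool (alive c r w) * \<phi> (w r))"
proof (rule grid_functional_path_functional)
  let ?f = "\<lambda>n w. of_bool (\<forall>j\<in>{1..Suc n}. w j \<le> c) * \<phi> (w (Suc n))"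
  show "grid_functional (\<lambda>w. of_bool (alive c r w) * \<phi> (w r))"
    unfolding grid_functional_def
  proof (intro exI[of _ ?f] exI[of _ "\<lambda>n. r / real (Suc n)"] exI[of _ "\<lambda>n. Suc n"] conjI allI impI)
    fix w assume w: "right_cont w"
    have "\<phi> (w (real (Suc n) * (r / real (Suc n)))) = \<phi> (w r)" for n by simp
    then show "(\<lambda>n. of_bool (\<forall>j\<in>{1..Suc n}. w (real j * (r / real (Suc n))) \<le> c) * \<phi> (w (real (Suc n) * (r / real (Suc n)))))
        \<longlonglongrightarrow> of_bool (alive c r w) * \<phi> (w r)"
      using tendsto_mult[OF alive_grid_tendsto[OF w r] tendsto_const] by presburger
  qed (use \<phi> r in \<open>auto simp: mult_le_one\<close>)
qed

section \<open>Joint measurability of path functionals and the Markov property\<close>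

context levy_process
begin

lemma right_cont_path:
  assumes "\<omega> \<in> space M" shows "right_cont (\<lambda>t. X t \<omega>)"
  using right_continuous_paths[OF assms] by (simp add: right_cont_def)

lemma right_cont_path_shift:
  assumes "\<omega> \<in> space M" "0 \<le> s" shows "right_cont (\<lambda>r. y + X (s + r) \<omega>)"
  using right_cont_shift[OF right_cont_path[OF assms(1)] assms(2)] .

lemma right_cont_path_start: "\<omega> \<in> space M \<Longrightarrow> right_cont (\<lambda>r. y + X r \<omega>)"
  using right_cont_path_shift[of \<omega> 0 y] by simp

text \<open>Rounding the random time up makes it countably valued, which reduces the claim to
  measurability of the single variables \<open>X t\<close>; right continuity passes to the
  limit.\<close>

lemma joint_measurable:
  assumes [measurable]: "T \<in> borel_measurable N" "\<zeta> \<in> N \<rightarrow>\<^sub>M M"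
  shows "(\<lambda>z. X (max 0 (T z)) (\<zeta> z)) \<in> borel_measurable N"
proof (rule borel_measurable_LIMSEQ_real)
  fix z assume "z \<in> space N"
  then have "\<zeta> z \<in> space M" using assms(2) by (meson measurable_space)
  then show "(\<lambda>n. X (grid_up (1 / Suc n) (max 0 (T z))) (\<zeta> z)) \<longlonglongrightarrow> X (max 0 (T z)) (\<zeta> z)"
    by (intro right_cont_grid_tendsto[OF right_cont_path _ _ tendsto_one_over_Suc]) auto
next
  fix n
  have "(\<lambda>z. X (max 0 (of_int (\<lceil>max 0 (T z) / (1 / Suc n)\<rceil>) * (1 / Suc n))) (\<zeta> z)) \<in> borel_measurable N"
    by (rule measurable_compose_countable[where f = "\<lambda>i z. X (max 0 (of_int i * (1 / Suc n))) (\<zeta> z)" and g = "\<lambda>z. \<lceil>max 0 (T z) / (1 / Suc n)\<rceil>"])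
      (auto intro!: measurable_compose[OF assms(2)])
  moreover have "max 0 (of_int (\<lceil>max 0 t / (1 / Suc n)\<rceil>) * (1 / Suc n)) = grid_up (1 / Suc n) (max 0 t)" for t
    using grid_up_bounds(1)[of "1 / Suc n" "max 0 t"] unfolding grid_up_def by (auto simp: max_def)
  ultimately show "(\<lambda>z. X (grid_up (1 / Suc n) (max 0 (T z))) (\<zeta> z)) \<in> borel_measurable N" by (simp only:)
qed

lemma grid_functional_measurable:
  assumes F: "grid_functional F"
    and [measurable]: "T \<in> borel_measurable N" "\<zeta> \<in> N \<rightarrow>\<^sub>M M" "y \<in> borel_measurable N"
  shows "(\<lambda>z. F (\<lambda>r. y z + X (max 0 (T z) + r) (\<zeta> z))) \<in> borel_measurable N"
proof -
  obtain f :: "nat \<Rightarrow> (nat \<Rightarrow> real) \<Rightarrow> real" and h where f: "\<And>n. 0 \<le> h n" "\<And>n. f n \<in> borel_measurable seq_space"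
      "\<And>w. right_cont w \<Longrightarrow> (\<lambda>n. f n (\<lambda>j. w (real j * h n))) \<longlonglongrightarrow> F w"
    using F unfolding grid_functional_def by blast
  show ?thesis
  proof (rule borel_measurable_LIMSEQ_real)
    fix z assume "z \<in> space N"
    then have "\<zeta> z \<in> space M" using assms(3) by (meson measurable_space)
    then show "(\<lambda>n. f n (\<lambda>j. y z + X (max 0 (T z) + real j * h n) (\<zeta> z))) \<longlonglongrightarrow> F (\<lambda>r. y z + X (max 0 (T z) + r) (\<zeta> z))"
      by (intro f(3) right_cont_path_shift) auto
  next
    fix n
    have "(\<lambda>z. (\<lambda>j. y z + X (max 0 (max 0 (T z) + real j * h n)) (\<zeta> z))) \<in> N \<rightarrow>\<^sub>M seq_space"
      by (rule measurable_PiM_single') (auto intro!: borel_measurable_add joint_measurable)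
    moreover have "max 0 (max 0 (T z) + real j * h n) = max 0 (T z) + real j * h n" for z j
      using f(1)[of n] by (simp add: max_def)
    ultimately show "(\<lambda>z. f n (\<lambda>j. y z + X (max 0 (T z) + real j * h n) (\<zeta> z))) \<in> borel_measurable N"
      using measurable_compose[OF _ f(2)] by simp
  qed
qed

lemma path_functional_measurable:
  assumes F: "path_functional F"
    and [measurable]: "T \<in> borel_measurable N" "\<zeta> \<in> N \<rightarrow>\<^sub>M M" "y \<in> borel_measurable N"
  shows "(\<lambda>z. F (\<lambda>r. y z + X (max 0 (T z) + r) (\<zeta> z))) \<in> borel_measurable N"
proof -
  obtain Fk :: "nat \<Rightarrow> (real \<Rightarrow> real) \<Rightarrow> real" where Fk: "\<And>k. grid_functional (Fk k)" "\<And>w. right_cont w \<Longrightarrow> (\<lambda>k. Fk k w) \<longlonglongrightarrow> F w"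
    using F unfolding path_functional_def by blast
  show ?thesis
  proof (rule borel_measurable_LIMSEQ_real)
    fix z assume "z \<in> space N"
    then have "\<zeta> z \<in> space M" using assms(3) by (meson measurable_space)
    then show "(\<lambda>k. Fk k (\<lambda>r. y z + X (max 0 (T z) + r) (\<zeta> z))) \<longlonglongrightarrow> F (\<lambda>r. y z + X (max 0 (T z) + r) (\<zeta> z))"
      by (intro Fk right_cont_path_shift) auto
  qed (intro grid_functional_measurable Fk; measurable)
qed

lemma path_functional_measurable0:
  assumes F: "path_functional F" and [measurable]: "\<zeta> \<in> N \<rightarrow>\<^sub>M M" "y \<in> borel_measurable N"
  shows "(\<lambda>z. F (\<lambda>r. y z + X r (\<zeta> z))) \<in> borel_measurable N"
  using path_functional_measurable[OF F, of "\<lambda>_. 0" N \<zeta> y] by simp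

lemma path_functional_integrable:
  assumes F: "path_functional F" shows "integrable M (\<lambda>\<omega>. F (\<lambda>r. y + X r \<omega>))"
  by (rule integrable_const_bound[of _ 1])
    (use path_functional_bounds[OF F right_cont_path_start] path_functional_measurable0[OF F, of "\<lambda>\<omega>. \<omega>" M "\<lambda>_. y"] in \<open>auto intro!: AE_I2 simp: abs_of_nonneg\<close>)

lemma expectation_functional_measurable:
  assumes F: "path_functional F"
  shows "(\<lambda>y. LINT \<omega>|M. F (\<lambda>r. y + X r \<omega>)) \<in> borel_measurable borel"
proof -
  have "(\<lambda>(y, \<omega>). F (\<lambda>r. y + X r \<omega>)) \<in> borel_measurable (borel \<Otimes>\<^sub>M M)"
    using path_functional_measurable0[OF F, of snd "borel \<Otimes>\<^sub>M M" fst] by (simp add: case_prod_beta')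
  then show ?thesis by (rule borel_measurable_lebesgue_integral)
qed

lemma alive_measurable:
  assumes [measurable]: "T \<in> borel_measurable N" "\<zeta> \<in> N \<rightarrow>\<^sub>M M" "y \<in> borel_measurable N"
  shows "(\<lambda>z. of_bool (alive c (T z) (\<lambda>r. y z + X r (\<zeta> z))) :: real) \<in> borel_measurable N"
proof -
  have a: "alive c t w" if "t \<le> 0" for t w using that by (auto simp: alive_def)
  have "(\<lambda>z. if T z \<le> 0 then 1 else of_bool (alive c (T z) (\<lambda>r. y z + X r (\<zeta> z))) :: real) \<in> borel_measurable N"
  proof (rule borel_measurable_LIMSEQ_real)
    fix z assume "z \<in> space N"
    then have "\<zeta> z \<in> space M" using assms(2) by (meson measurable_space)
    then show "(\<lambda>n. if T z \<le> 0 then 1 else of_bool (\<forall>j\<in>{1..Suc n}. y z + X (max 0 (real j * (T z / real (Suc n)))) (\<zeta> z) \<le> c) :: real)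
        \<longlonglongrightarrow> (if T z \<le> 0 then 1 else of_bool (alive c (T z) (\<lambda>r. y z + X r (\<zeta> z))))"
      using alive_grid_tendsto[OF right_cont_path_start[of "\<zeta> z" "y z"], of "T z" c]
      by (cases "T z \<le> 0") (auto simp: not_le max_def)
  next
    fix n
    have [measurable]: "(\<lambda>z. X (max 0 (real j * (T z / real (Suc n)))) (\<zeta> z)) \<in> borel_measurable N" for j
      by (rule joint_measurable) measurable
    show "(\<lambda>z. if T z \<le> 0 then 1 else of_bool (\<forall>j\<in>{1..Suc n}. y z + X (max 0 (real j * (T z / real (Suc n)))) (\<zeta> z) \<le> c) :: real) \<in> borel_measurable N"
      by measurable
  qed
  moreover have "(if t \<le> 0 then 1 else of_bool (alive c t w)) = (of_bool (alive c t w) :: real)" for t w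
    using a by auto
  ultimately show ?thesis by simp
qed

text \<open>The past is read with mesh \<open>s / (n + 1)\<close>, so that \<open>s\<close> is its
  last point, and the future with the mesh of the functional, of which only the first
  \<open>m n\<close> points matter. At this level the identity is \<open>grid_markov\<close>; both
  sides are bounded by 1 and converge along right-continuous paths.\<close>

lemma markov_grid_functional:
  assumes F: "grid_functional F" and s: "0 < s"
    and [measurable]: "\<phi> \<in> borel_measurable borel" and \<phi>: "\<And>x. 0 \<le> \<phi> x" "\<And>x. \<phi> x \<le> (1::real)"
  shows "(LINT \<omega>|M. of_bool (alive c s (\<lambda>r. x + X r \<omega>)) * \<phi> (x + X s \<omega>) * F (\<lambda>r. x + X (s + r) \<omega>)) =
    (LINT \<omega>|M. of_bool (alive c s (\<lambda>r. x + X r \<omega>)) * \<phi> (x + X s \<omega>) * (LINT \<omega>'|M. F (\<lambda>r. x + X s \<omega> + X r \<omega>')))"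
proof -
  obtain f :: "nat \<Rightarrow> (nat \<Rightarrow> real) \<Rightarrow> real" and h m where f: "\<And>n. 0 \<le> h n" "\<And>n. f n \<in> borel_measurable seq_space"
      "\<And>n w. 0 \<le> f n w" "\<And>n w. f n w \<le> 1" "\<And>n w w'. (\<forall>j\<le>m n. w j = w' j) \<Longrightarrow> f n w = f n w'"
      "\<And>w. right_cont w \<Longrightarrow> (\<lambda>n. f n (\<lambda>j. w (real j * h n))) \<longlonglongrightarrow> F w"
    using F unfolding grid_functional_def by blast
  note [measurable] = f(2)
  define al where "al n \<omega> = (of_bool (\<forall>j\<in>{1..Suc n}. x + X (real j * (s / real (Suc n))) \<omega> \<le> c) :: real)" for n \<omega>
  define u where "u n y = (LINT \<omega>'|M. f n (\<lambda>j. y + X (real j * h n) \<omega>'))" for n y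
  have Xm: "X (real j * h n) \<in> borel_measurable M" "X (s + real j * h n) \<in> borel_measurable M" "X (real j * (s / real (Suc n))) \<in> borel_measurable M" for j n
    using f(1)[of n] s by (auto intro!: measurable_X)
  have fm1 [measurable]: "(\<lambda>\<omega>. f n (\<lambda>j. x + X (s + real j * h n) \<omega>)) \<in> borel_measurable M" for n
    by (rule measurable_compose[OF _ f(2)], rule measurable_PiM_single') (use Xm in auto)
  have fm2 [measurable]: "(\<lambda>\<omega>. f n (\<lambda>j. y + X (real j * h n) \<omega>)) \<in> borel_measurable M" for n y
    by (rule measurable_compose[OF _ f(2)], rule measurable_PiM_single') (use Xm in auto)
  have um [measurable]: "u n \<in> borel_measurable borel" for n
  proof -
    have "(\<lambda>(y, \<omega>). f n (\<lambda>j. y + X (real j * h n) \<omega>)) \<in> borel_measurable (borel \<Otimes>\<^sub>M M)"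
      unfolding case_prod_beta'
      by (rule measurable_compose[OF _ f(2)], rule measurable_PiM_single') (auto intro!: borel_measurable_add measurable_compose[OF measurable_snd Xm(1)])
    then show ?thesis unfolding u_def by (rule borel_measurable_lebesgue_integral)
  qed
  have alm [measurable]: "al n \<in> borel_measurable M" for n
    unfolding al_def using Xm by measurable
  have ub: "0 \<le> u n y" "u n y \<le> 1" for n y
    unfolding u_def using f(3,4) by (auto intro!: integral_nonneg_AE integral_le_const integrable_const_bound[of _ 1] AE_I2 simp: abs_of_nonneg)
  have alb: "0 \<le> al n \<omega>" "al n \<omega> \<le> 1" for n \<omega> by (auto simp: al_def)
  have bd: "\<bar>al n \<omega> * \<phi> a * b\<bar> \<le> 1" if "0 \<le> b" "b \<le> 1" for n \<omega> a b
    using that alb[of n \<omega>] \<phi>[of a] by (simp add: abs_mult mult_le_one)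
  have Xs [measurable]: "X s \<in> borel_measurable M" using s by simp
  have step: "(LINT \<omega>|M. al n \<omega> * \<phi> (x + X s \<omega>) * f n (\<lambda>j. x + X (s + real j * h n) \<omega>)) =
    (LINT \<omega>|M. al n \<omega> * \<phi> (x + X s \<omega>) * u n (x + X s \<omega>))" for n
  proof -
    define \<Psi> where "\<Psi> = (\<lambda>(p, q). ennreal (of_bool (\<forall>j\<in>{1..Suc n}. x + p j \<le> c) * \<phi> (x + p (Suc n)) * f n (\<lambda>j. x + p (Suc n) + q j)))"
    have [measurable]: "\<Psi> \<in> borel_measurable (seq_space \<Otimes>\<^sub>M seq_space)"
    proof -
      have [measurable]: "(\<lambda>z. f n (\<lambda>j. x + fst z (Suc n) + snd z j)) \<in> borel_measurable (seq_space \<Otimes>\<^sub>M seq_space)"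
        by (rule measurable_compose[OF _ f(2)], rule measurable_PiM_single') auto
      show ?thesis unfolding \<Psi>_def case_prod_beta' by measurable
    qed
    let ?u = "\<lambda>j. real j * (s / real (Suc n))" and ?v = "\<lambda>j. real j * h n"
    have us: "?u (Suc n) = s" by simp
    have "(\<integral>\<^sup>+\<omega>. \<Psi> (\<lambda>j. X (?u (min j (Suc n))) \<omega> - X 0 \<omega>, \<lambda>j. X (?u (Suc n) + ?v (min j (m n))) \<omega> - X (?u (Suc n)) \<omega>) \<partial>M) =
      (\<integral>\<^sup>+\<omega>. \<integral>\<^sup>+\<omega>'. \<Psi> (\<lambda>j. X (?u (min j (Suc n))) \<omega> - X 0 \<omega>, \<lambda>j. X (?v (min j (m n))) \<omega>' - X 0 \<omega>') \<partial>M \<partial>M)"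
      using f(1)[of n] s by (intro grid_markov) (auto simp: mono_def intro!: divide_right_mono mult_right_mono)
    also have "(\<integral>\<^sup>+\<omega>. \<Psi> (\<lambda>j. X (?u (min j (Suc n))) \<omega> - X 0 \<omega>, \<lambda>j. X (?u (Suc n) + ?v (min j (m n))) \<omega> - X (?u (Suc n)) \<omega>) \<partial>M) =
      (\<integral>\<^sup>+\<omega>. ennreal (al n \<omega> * \<phi> (x + X s \<omega>) * f n (\<lambda>j. x + X (s + real j * h n) \<omega>)) \<partial>M)"
    proof (intro nn_integral_cong_AE)
      show "AE \<omega> in M. \<Psi> (\<lambda>j. X (?u (min j (Suc n))) \<omega> - X 0 \<omega>, \<lambda>j. X (?u (Suc n) + ?v (min j (m n))) \<omega> - X (?u (Suc n)) \<omega>) =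
        ennreal (al n \<omega> * \<phi> (x + X s \<omega>) * f n (\<lambda>j. x + X (s + real j * h n) \<omega>))"
        using start_0
      proof eventually_elim
        case (elim \<omega>)
        have "f n (\<lambda>j. x + X s \<omega> + (X (s + ?v (min j (m n))) \<omega> - X s \<omega>)) = f n (\<lambda>j. x + X (s + real j * h n) \<omega>)"
          by (rule f(5)) auto
        moreover have "(\<forall>j\<in>{1..Suc n}. x + (X (?u (min j (Suc n))) \<omega> - X 0 \<omega>) \<le> c) = (\<forall>j\<in>{1..Suc n}. x + X (?u j) \<omega> \<le> c)"
          using elim by (intro ball_cong refl) (auto simp: min_def)
        ultimately show ?case using elim us by (simp add: \<Psi>_def al_def)
      qed
    qed
    also have "(\<integral>\<^sup>+\<omega>. \<integral>\<^sup>+\<omega>'. \<Psi> (\<lambda>j. X (?u (min j (Suc n))) \<omega> - X 0 \<omega>, \<lambda>j. X (?v (min j (m n))) \<omega>' - X 0 \<omega>') \<partial>M \<partial>M) =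
      (\<integral>\<^sup>+\<omega>. ennreal (al n \<omega> * \<phi> (x + X s \<omega>) * u n (x + X s \<omega>)) \<partial>M)"
    proof (intro nn_integral_cong_AE)
      show "AE \<omega> in M. (\<integral>\<^sup>+\<omega>'. \<Psi> (\<lambda>j. X (?u (min j (Suc n))) \<omega> - X 0 \<omega>, \<lambda>j. X (?v (min j (m n))) \<omega>' - X 0 \<omega>') \<partial>M) =
        ennreal (al n \<omega> * \<phi> (x + X s \<omega>) * u n (x + X s \<omega>))"
        using start_0
      proof eventually_elim
        case (elim \<omega>)
        have al_eq: "(\<forall>j\<in>{1..Suc n}. x + (X (?u (min j (Suc n))) \<omega> - X 0 \<omega>) \<le> c) = (\<forall>j\<in>{1..Suc n}. x + X (?u j) \<omega> \<le> c)"
          using elim by (intro ball_cong refl) (auto simp: min_def)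
        have "(\<integral>\<^sup>+\<omega>'. \<Psi> (\<lambda>j. X (?u (min j (Suc n))) \<omega> - X 0 \<omega>, \<lambda>j. X (?v (min j (m n))) \<omega>' - X 0 \<omega>') \<partial>M) =
          (\<integral>\<^sup>+\<omega>'. ennreal (al n \<omega> * \<phi> (x + X s \<omega>)) * ennreal (f n (\<lambda>j. x + X s \<omega> + X (real j * h n) \<omega>')) \<partial>M)"
        proof (intro nn_integral_cong_AE)
          show "AE \<omega>' in M. \<Psi> (\<lambda>j. X (?u (min j (Suc n))) \<omega> - X 0 \<omega>, \<lambda>j. X (?v (min j (m n))) \<omega>' - X 0 \<omega>') =
            ennreal (al n \<omega> * \<phi> (x + X s \<omega>)) * ennreal (f n (\<lambda>j. x + X s \<omega> + X (real j * h n) \<omega>'))"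
            using start_0
          proof eventually_elim
            case (elim \<omega>')
            have "f n (\<lambda>j. x + X s \<omega> + (X (?v (min j (m n))) \<omega>' - X 0 \<omega>')) = f n (\<lambda>j. x + X s \<omega> + X (real j * h n) \<omega>')"
              using elim by (intro f(5)) auto
            then show ?case using \<open>X 0 \<omega> = 0\<close> al_eq us \<phi> f(3) by (simp add: \<Psi>_def al_def ennreal_mult)
          qed
        qed
        also have "\<dots> = ennreal (al n \<omega> * \<phi> (x + X s \<omega>)) * (\<integral>\<^sup>+\<omega>'. ennreal (f n (\<lambda>j. x + X s \<omega> + X (real j * h n) \<omega>')) \<partial>M)"
          by (rule nn_integral_cmult) measurable
        also have "(\<integral>\<^sup>+\<omega>'. ennreal (f n (\<lambda>j. x + X s \<omega> + X (real j * h n) \<omega>')) \<partial>M) = ennreal (u n (x + X s \<omega>))"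
          unfolding u_def using f(3,4) by (intro nn_integral_eq_integral integrable_const_bound[of _ 1]) (auto simp: abs_of_nonneg)
        finally show ?case using alb[of n \<omega>] \<phi>[of "x + X s \<omega>"] ub by (simp add: ennreal_mult'')
      qed
    qed
    finally have eq: "(\<integral>\<^sup>+\<omega>. ennreal (al n \<omega> * \<phi> (x + X s \<omega>) * f n (\<lambda>j. x + X (s + real j * h n) \<omega>)) \<partial>M) =
      (\<integral>\<^sup>+\<omega>. ennreal (al n \<omega> * \<phi> (x + X s \<omega>) * u n (x + X s \<omega>)) \<partial>M)" .
    show ?thesis
      by (subst (1 2) integral_eq_nn_integral) (use eq alb \<phi> f(3) ub in \<open>auto intro!: mult_nonneg_nonneg\<close>)
  qed
  have sp: "AE \<omega> in M. \<omega> \<in> space M" by simp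
  have L1: "(\<lambda>n. LINT \<omega>|M. al n \<omega> * \<phi> (x + X s \<omega>) * f n (\<lambda>j. x + X (s + real j * h n) \<omega>)) \<longlonglongrightarrow>
    (LINT \<omega>|M. of_bool (alive c s (\<lambda>r. x + X r \<omega>)) * \<phi> (x + X s \<omega>) * F (\<lambda>r. x + X (s + r) \<omega>))"
  proof (rule integral_dominated_convergence[where w = "\<lambda>_. 1"])
    show "(\<lambda>\<omega>. of_bool (alive c s (\<lambda>r. x + X r \<omega>)) * \<phi> (x + X s \<omega>) * F (\<lambda>r. x + X (s + r) \<omega>)) \<in> borel_measurable M"
      using alive_measurable[of "\<lambda>_. s" M "\<lambda>\<omega>. \<omega>" "\<lambda>_. x" c] grid_functional_measurable[OF F, of "\<lambda>_. s" M "\<lambda>\<omega>. \<omega>" "\<lambda>_. x"] s by auto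
    show "AE \<omega> in M. (\<lambda>n. al n \<omega> * \<phi> (x + X s \<omega>) * f n (\<lambda>j. x + X (s + real j * h n) \<omega>)) \<longlonglongrightarrow>
      of_bool (alive c s (\<lambda>r. x + X r \<omega>)) * \<phi> (x + X s \<omega>) * F (\<lambda>r. x + X (s + r) \<omega>)"
      using sp
    proof eventually_elim
      case (elim \<omega>)
      show ?case unfolding al_def
        using alive_grid_tendsto[OF right_cont_path_start[OF elim] s, of x c] f(6)[OF right_cont_path_shift[OF elim, of s x]] s
        by (intro tendsto_mult tendsto_const) auto
    qed
  qed (use bd f(3,4) in auto)
  have L2: "(\<lambda>n. LINT \<omega>|M. al n \<omega> * \<phi> (x + X s \<omega>) * u n (x + X s \<omega>)) \<longlonglongrightarrow>
    (LINT \<omega>|M. of_bool (alive c s (\<lambda>r. x + X r \<omega>)) * \<phi> (x + X s \<omega>) * (LINT \<omega>'|M. F (\<lambda>r. x + X s \<omega> + X r \<omega>')))"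
  proof (rule integral_dominated_convergence[where w = "\<lambda>_. 1"])
    show "(\<lambda>\<omega>. of_bool (alive c s (\<lambda>r. x + X r \<omega>)) * \<phi> (x + X s \<omega>) * (LINT \<omega>'|M. F (\<lambda>r. x + X s \<omega> + X r \<omega>'))) \<in> borel_measurable M"
      using alive_measurable[of "\<lambda>_. s" M "\<lambda>\<omega>. \<omega>" "\<lambda>_. x" c] expectation_functional_measurable[OF grid_functional_path_functional[OF F]] by measurable
    show "AE \<omega> in M. (\<lambda>n. al n \<omega> * \<phi> (x + X s \<omega>) * u n (x + X s \<omega>)) \<longlonglongrightarrow>
      of_bool (alive c s (\<lambda>r. x + X r \<omega>)) * \<phi> (x + X s \<omega>) * (LINT \<omega>'|M. F (\<lambda>r. x + X s \<omega> + X r \<omega>'))"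
      using sp
    proof eventually_elim
      case (elim \<omega>)
      have "(\<lambda>n. u n y) \<longlonglongrightarrow> (LINT \<omega>'|M. F (\<lambda>r. y + X r \<omega>'))" for y
        unfolding u_def
      proof (rule integral_dominated_convergence[where w = "\<lambda>_. 1"])
        show "(\<lambda>\<omega>'. F (\<lambda>r. y + X r \<omega>')) \<in> borel_measurable M"
          using grid_functional_measurable[OF F, of "\<lambda>_. 0" M "\<lambda>\<omega>. \<omega>" "\<lambda>_. y"] by simp
        show "AE \<omega> in M. (\<lambda>n. f n (\<lambda>j. y + X (real j * h n) \<omega>)) \<longlonglongrightarrow> F (\<lambda>r. y + X r \<omega>)"
          using sp by eventually_elim (use f(6)[OF right_cont_path_start] in simp)
      qed (use f(3,4) in \<open>auto simp: abs_of_nonneg\<close>)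
      then show ?case unfolding al_def
        using alive_grid_tendsto[OF right_cont_path_start[OF elim] s, of x c]
        by (intro tendsto_mult tendsto_const) auto
    qed
  qed (use bd ub in auto)
  show ?thesis using LIMSEQ_unique[OF L1[unfolded step] L2] .
qed

lemma markov_property:
  assumes F: "path_functional F" and s: "0 < s"
    and [measurable]: "\<phi> \<in> borel_measurable borel" and \<phi>: "\<And>x. 0 \<le> \<phi> x" "\<And>x. \<phi> x \<le> (1::real)"
  shows "(LINT \<omega>|M. of_bool (alive c s (\<lambda>r. x + X r \<omega>)) * \<phi> (x + X s \<omega>) * F (\<lambda>r. x + X (s + r) \<omega>)) =
    (LINT \<omega>|M. of_bool (alive c s (\<lambda>r. x + X r \<omega>)) * \<phi> (x + X s \<omega>) * (LINT \<omega>'|M. F (\<lambda>r. x + X s \<omega> + X r \<omega>')))"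
proof -
  obtain Fk :: "nat \<Rightarrow> (real \<Rightarrow> real) \<Rightarrow> real" where Fk: "\<And>k. grid_functional (Fk k)" "\<And>w. right_cont w \<Longrightarrow> (\<lambda>k. Fk k w) \<longlonglongrightarrow> F w"
    using F unfolding path_functional_def by blast
  have sp: "AE \<omega> in M. \<omega> \<in> space M" by simp
  have Xs [measurable]: "X s \<in> borel_measurable M" using s by simp
  have [measurable]: "(\<lambda>\<omega>. of_bool (alive c s (\<lambda>r. x + X r \<omega>)) :: real) \<in> borel_measurable M"
    using alive_measurable[of "\<lambda>_. s" M "\<lambda>\<omega>. \<omega>" "\<lambda>_. x" c] by simp
  have bd: "\<bar>of_bool P * \<phi> a * b\<bar> \<le> 1" if "0 \<le> b" "b \<le> 1" for P a b
    using that \<phi>[of a] by (auto simp: abs_mult mult_le_one)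
  have lim: "(\<lambda>k. LINT \<omega>'|M. Fk k (\<lambda>r. y + X r \<omega>')) \<longlonglongrightarrow> (LINT \<omega>'|M. F (\<lambda>r. y + X r \<omega>'))" for y
  proof (rule integral_dominated_convergence[where w = "\<lambda>_. 1"])
    show "(\<lambda>\<omega>. F (\<lambda>r. y + X r \<omega>)) \<in> borel_measurable M" "(\<lambda>\<omega>. Fk k (\<lambda>r. y + X r \<omega>)) \<in> borel_measurable M" for k
      using path_functional_measurable0[OF F, of "\<lambda>\<omega>. \<omega>" M "\<lambda>_. y"] path_functional_measurable0[OF grid_functional_path_functional[OF Fk(1)], of "\<lambda>\<omega>. \<omega>" M "\<lambda>_. y"] by auto
    show "AE \<omega> in M. (\<lambda>k. Fk k (\<lambda>r. y + X r \<omega>)) \<longlonglongrightarrow> F (\<lambda>r. y + X r \<omega>)"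
      using sp by eventually_elim (intro Fk right_cont_path_start)
    show "AE \<omega> in M. norm (Fk k (\<lambda>r. y + X r \<omega>)) \<le> 1" for k
      using sp by eventually_elim (use grid_functional_bounds[OF Fk(1) right_cont_path_start] in \<open>auto simp: abs_of_nonneg\<close>)
  qed auto
  have ub: "0 \<le> (LINT \<omega>'|M. Fk k (\<lambda>r. y + X r \<omega>')) \<and> (LINT \<omega>'|M. Fk k (\<lambda>r. y + X r \<omega>')) \<le> 1" for k y
  proof
    show "0 \<le> (LINT \<omega>'|M. Fk k (\<lambda>r. y + X r \<omega>'))"
      using grid_functional_bounds[OF Fk(1) right_cont_path_start] by (intro integral_nonneg_AE AE_I2) auto
    show "(LINT \<omega>'|M. Fk k (\<lambda>r. y + X r \<omega>')) \<le> 1"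
      using grid_functional_bounds[OF Fk(1) right_cont_path_start] path_functional_integrable[OF grid_functional_path_functional[OF Fk(1)]]
      by (intro integral_le_const AE_I2) auto
  qed
  have L1: "(\<lambda>k. LINT \<omega>|M. of_bool (alive c s (\<lambda>r. x + X r \<omega>)) * \<phi> (x + X s \<omega>) * Fk k (\<lambda>r. x + X (s + r) \<omega>)) \<longlonglongrightarrow>
    (LINT \<omega>|M. of_bool (alive c s (\<lambda>r. x + X r \<omega>)) * \<phi> (x + X s \<omega>) * F (\<lambda>r. x + X (s + r) \<omega>))"
  proof (rule integral_dominated_convergence[where w = "\<lambda>_. 1"])
    have [measurable]: "(\<lambda>\<omega>. F (\<lambda>r. x + X (s + r) \<omega>)) \<in> borel_measurable M" "(\<lambda>\<omega>. Fk k (\<lambda>r. x + X (s + r) \<omega>)) \<in> borel_measurable M" for k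
      using path_functional_measurable[OF F, of "\<lambda>_. s" M "\<lambda>\<omega>. \<omega>" "\<lambda>_. x"] grid_functional_measurable[OF Fk(1), of "\<lambda>_. s" M "\<lambda>\<omega>. \<omega>" "\<lambda>_. x"] s by auto
    show "(\<lambda>\<omega>. of_bool (alive c s (\<lambda>r. x + X r \<omega>)) * \<phi> (x + X s \<omega>) * F (\<lambda>r. x + X (s + r) \<omega>)) \<in> borel_measurable M"
      "(\<lambda>\<omega>. of_bool (alive c s (\<lambda>r. x + X r \<omega>)) * \<phi> (x + X s \<omega>) * Fk k (\<lambda>r. x + X (s + r) \<omega>)) \<in> borel_measurable M" for k
      by measurable
    show "AE \<omega> in M. (\<lambda>k. of_bool (alive c s (\<lambda>r. x + X r \<omega>)) * \<phi> (x + X s \<omega>) * Fk k (\<lambda>r. x + X (s + r) \<omega>)) \<longlonglongrightarrow>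
      of_bool (alive c s (\<lambda>r. x + X r \<omega>)) * \<phi> (x + X s \<omega>) * F (\<lambda>r. x + X (s + r) \<omega>)"
      using sp by eventually_elim (use s in \<open>intro tendsto_mult tendsto_const Fk right_cont_path_shift; simp\<close>)
    show "AE \<omega> in M. norm (of_bool (alive c s (\<lambda>r. x + X r \<omega>)) * \<phi> (x + X s \<omega>) * Fk k (\<lambda>r. x + X (s + r) \<omega>)) \<le> 1" for k
      using sp by eventually_elim (use s bd grid_functional_bounds[OF Fk(1) right_cont_path_shift] in auto)
  qed auto
  have L2: "(\<lambda>k. LINT \<omega>|M. of_bool (alive c s (\<lambda>r. x + X r \<omega>)) * \<phi> (x + X s \<omega>) * (LINT \<omega>'|M. Fk k (\<lambda>r. x + X s \<omega> + X r \<omega>'))) \<longlonglongrightarrow>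
    (LINT \<omega>|M. of_bool (alive c s (\<lambda>r. x + X r \<omega>)) * \<phi> (x + X s \<omega>) * (LINT \<omega>'|M. F (\<lambda>r. x + X s \<omega> + X r \<omega>')))"
  proof (rule integral_dominated_convergence[where w = "\<lambda>_. 1"])
    note [measurable] = expectation_functional_measurable[OF F] expectation_functional_measurable[OF grid_functional_path_functional[OF Fk(1)]]
    show "(\<lambda>\<omega>. of_bool (alive c s (\<lambda>r. x + X r \<omega>)) * \<phi> (x + X s \<omega>) * (LINT \<omega>'|M. F (\<lambda>r. x + X s \<omega> + X r \<omega>'))) \<in> borel_measurable M"
      "(\<lambda>\<omega>. of_bool (alive c s (\<lambda>r. x + X r \<omega>)) * \<phi> (x + X s \<omega>) * (LINT \<omega>'|M. Fk k (\<lambda>r. x + X s \<omega> + X r \<omega>'))) \<in> borel_measurable M" for k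
      by measurable
  qed (use lim bd ub in \<open>auto intro!: tendsto_intros\<close>)
  show ?thesis using LIMSEQ_unique[OF L1[unfolded markov_grid_functional[OF Fk(1) s assms(3) \<phi>]] L2] .
qed

end

section \<open>Exponential moments and the Laplace exponent\<close>

lemma sum_of_bool_first:
  fixes P :: "nat \<Rightarrow> bool"
  shows "(\<Sum>k\<in>{1..N}. of_bool (P k \<and> (\<forall>j\<in>{1..<k}. \<not> P j)) :: real) = of_bool (\<exists>k\<in>{1..N}. P k)"
proof (cases "\<exists>k\<in>{1..N}. P k")
  case True
  define T where "T = (LEAST k. k \<in> {1..N} \<and> P k)"
  have T: "T \<in> {1..N} \<and> P T" unfolding T_def by (rule LeastI_ex) (use True in blast)
  have l: "\<not> P j" if "1 \<le> j" "j < T" for j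
    using not_less_Least[of j "\<lambda>k. k \<in> {1..N} \<and> P k"] that T unfolding T_def[symmetric] by auto
  have "(P k \<and> (\<forall>j\<in>{1..<k}. \<not> P j)) = (T = k)" if "k \<in> {1..N}" for k
  proof
    assume a: "P k \<and> (\<forall>j\<in>{1..<k}. \<not> P j)"
    show "T = k"
    proof (cases T k rule: linorder_cases)
      case less then show ?thesis using a T by auto
    next
      case greater then show ?thesis using a l[of k] that by auto
    qed
  qed (use T l in auto)
  then have "(\<Sum>k\<in>{1..N}. of_bool (P k \<and> (\<forall>j\<in>{1..<k}. \<not> P j)) :: real) = (\<Sum>k\<in>{1..N}. if T = k then 1 else 0)"
    by (intro sum.cong refl) (simp only: of_bool_def)
  also have "\<dots> = 1" using T by (subst sum.delta') auto
  finally show ?thesis using True by simp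
next
  case False
  then show ?thesis by (auto intro!: sum.neutral)
qed

text \<open>Additivity fixes the values at multiples of \<open>1 / (n + 1)\<close>. The distance
  from \<open>t\<close> down to the nearest such multiple tends to 0, and there continuity at 0 from
  the right applies.\<close>

lemma additive_right_continuous_linear:
  fixes g :: "real \<Rightarrow> real"
  assumes add: "\<And>s t. 0 \<le> s \<Longrightarrow> 0 \<le> t \<Longrightarrow> g (s + t) = g s + g t"
    and lim: "\<And>s. (\<And>n. 0 \<le> s n) \<Longrightarrow> s \<longlonglongrightarrow> 0 \<Longrightarrow> (\<lambda>n::nat. g (s n)) \<longlonglongrightarrow> 0"
    and t: "0 \<le> t"
  shows "g t = t * g 1"
proof -
  have g0: "g 0 = 0" using add[of 0 0] by simp
  have mult: "g (real k * s) = real k * g s" if "0 \<le> s" for k s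
    using that by (induction k) (auto simp: g0 distrib_right add)
  have frac: "g (1 / real (Suc n)) = g 1 / real (Suc n)" for n
    using mult[of "1 / real (Suc n)" "Suc n"] by (simp add: field_simps del: of_nat_Suc)
  define k where "k n = nat \<lfloor>t * real (Suc n)\<rfloor>" for n
  define r where "r n = t - real (k n) * (1 / real (Suc n))" for n
  have kr: "real (k n) \<le> t * real (Suc n)" "t * real (Suc n) < real (k n) + 1" for n
    unfolding k_def using t by (auto simp: of_nat_nat)
  have r: "0 \<le> r n" "r n \<le> 1 / real (Suc n)" for n
  proof -
    have "real (k n) / real (Suc n) \<le> t" "t < (real (k n) + 1) / real (Suc n)"
      using kr[of n] by (auto simp: pos_divide_le_eq pos_less_divide_eq simp del: of_nat_Suc)
    then show "0 \<le> r n" "r n \<le> 1 / real (Suc n)" by (auto simp: r_def add_divide_distrib)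
  qed
  have rl: "r \<longlonglongrightarrow> 0"
    by (rule tendsto_sandwich[where f = "\<lambda>_. 0" and h = "\<lambda>n. 1 / real (Suc n)"]) (use r tendsto_one_over_Suc in auto)
  have eq: "g t = (t - r n) * g 1 + g (r n)" for n
  proof -
    have "g t = g (real (k n) * (1 / real (Suc n)) + r n)" by (simp add: r_def)
    also have "\<dots> = g (real (k n) * (1 / real (Suc n))) + g (r n)" using r by (intro add) auto
    also have "g (real (k n) * (1 / real (Suc n))) = real (k n) * g (1 / real (Suc n))" by (rule mult) simp
    also have "real (k n) * g (1 / real (Suc n)) = (t - r n) * g 1" unfolding frac r_def by simp
    finally show ?thesis .
  qed
  have "(\<lambda>n. (t - r n) * g 1 + g (r n)) \<longlonglongrightarrow> (t - 0) * g 1 + 0"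
    by (intro tendsto_intros rl lim r)
  then have "(\<lambda>n. g t) \<longlonglongrightarrow> t * g 1" unfolding eq[symmetric] by simp
  then show ?thesis by (rule LIMSEQ_const_iff[THEN iffD1])
qed

context levy_process
begin

lemma grid_indep_nn:
  fixes u v :: "nat \<Rightarrow> real" and f g :: "(nat \<Rightarrow> real) \<Rightarrow> ennreal"
  assumes u: "u 0 = 0" "mono u" and v: "v 0 = 0" "mono v"
    and [measurable]: "f \<in> borel_measurable seq_space" "g \<in> borel_measurable seq_space"
  shows "(\<integral>\<^sup>+\<omega>. f (\<lambda>j. X (u (min j k)) \<omega> - X 0 \<omega>) * g (\<lambda>j. X (u k + v (min j m)) \<omega> - X (u k) \<omega>) \<partial>M) =
    (\<integral>\<^sup>+\<omega>. f (\<lambda>j. X (u (min j k)) \<omega> - X 0 \<omega>) \<partial>M) * (\<integral>\<^sup>+\<omega>. g (\<lambda>j. X (v (min j m)) \<omega> - X 0 \<omega>) \<partial>M)"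
proof -
  have u0: "0 \<le> u j" for j using u by (metis monoD zero_le)
  have v0: "0 \<le> v j" for j using v by (metis monoD zero_le)
  have [measurable]: "(\<lambda>\<omega>. f (\<lambda>j. X (u (min j k)) \<omega> - X 0 \<omega>)) \<in> borel_measurable M"
    by (rule measurable_compose[OF _ assms(5)], rule measurable_PiM_single') (auto simp: u0)
  have [measurable]: "(\<lambda>\<omega>. g (\<lambda>j. X (v (min j m)) \<omega> - X 0 \<omega>)) \<in> borel_measurable M"
    by (rule measurable_compose[OF _ assms(6)], rule measurable_PiM_single') (auto simp: v0)
  have "(\<integral>\<^sup>+\<omega>. f (\<lambda>j. X (u (min j k)) \<omega> - X 0 \<omega>) * g (\<lambda>j. X (u k + v (min j m)) \<omega> - X (u k) \<omega>) \<partial>M) =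
    (\<integral>\<^sup>+\<omega>. \<integral>\<^sup>+\<omega>'. f (\<lambda>j. X (u (min j k)) \<omega> - X 0 \<omega>) * g (\<lambda>j. X (v (min j m)) \<omega>' - X 0 \<omega>') \<partial>M \<partial>M)"
    using grid_markov[OF u v, of "\<lambda>(p, q). f p * g q" k m] by simp
  also have "\<dots> = (\<integral>\<^sup>+\<omega>. f (\<lambda>j. X (u (min j k)) \<omega> - X 0 \<omega>) \<partial>M) * (\<integral>\<^sup>+\<omega>. g (\<lambda>j. X (v (min j m)) \<omega> - X 0 \<omega>) \<partial>M)"
    by (simp add: nn_integral_cmult nn_integral_multc)
  finally show ?thesis .
qed

lemma grid_indep:
  fixes u v :: "nat \<Rightarrow> real" and f g :: "(nat \<Rightarrow> real) \<Rightarrow> real"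
  assumes u: "u 0 = 0" "mono u" and v: "v 0 = 0" "mono v"
    and [measurable]: "f \<in> borel_measurable seq_space" "g \<in> borel_measurable seq_space"
    and pos: "\<And>w. 0 \<le> f w" "\<And>w. 0 \<le> g w"
  shows "(LINT \<omega>|M. f (\<lambda>j. X (u (min j k)) \<omega> - X 0 \<omega>) * g (\<lambda>j. X (u k + v (min j m)) \<omega> - X (u k) \<omega>)) =
    (LINT \<omega>|M. f (\<lambda>j. X (u (min j k)) \<omega> - X 0 \<omega>)) * (LINT \<omega>|M. g (\<lambda>j. X (v (min j m)) \<omega> - X 0 \<omega>))"
proof -
  have u0: "0 \<le> u j" for j using u by (metis monoD zero_le)
  have v0: "0 \<le> v j" for j using v by (metis monoD zero_le)
  have [measurable]: "(\<lambda>\<omega>. f (\<lambda>j. X (u (min j k)) \<omega> - X 0 \<omega>)) \<in> borel_measurable M"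
    by (rule measurable_compose[OF _ assms(5)], rule measurable_PiM_single') (auto simp: u0)
  have [measurable]: "(\<lambda>\<omega>. g (\<lambda>j. X (v (min j m)) \<omega> - X 0 \<omega>)) \<in> borel_measurable M"
    by (rule measurable_compose[OF _ assms(6)], rule measurable_PiM_single') (auto simp: v0)
  have [measurable]: "(\<lambda>\<omega>. g (\<lambda>j. X (u k + v (min j m)) \<omega> - X (u k) \<omega>)) \<in> borel_measurable M"
    by (rule measurable_compose[OF _ assms(6)], rule measurable_PiM_single') (auto simp: u0 v0)
  show ?thesis
    using grid_indep_nn[OF u v, of "\<lambda>w. ennreal (f w)" "\<lambda>w. ennreal (g w)" k m]
    by (simp add: integral_eq_nn_integral pos enn2real_mult[symmetric] ennreal_mult[symmetric])
qed

lemma alive_pred [measurable]: "Measurable.pred M (\<lambda>\<omega>. alive c t (\<lambda>r. y + X r \<omega>))"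
proof -
  have "(\<lambda>\<omega>. of_bool (alive c t (\<lambda>r. y + X r \<omega>)) :: real) \<in> borel_measurable M"
    by (rule alive_measurable) auto
  then have "Measurable.pred M (\<lambda>\<omega>. of_bool (alive c t (\<lambda>r. y + X r \<omega>)) = (1 :: real))" by measurable
  then show ?thesis by simp
qed

lemma alive_pred0 [measurable]: "Measurable.pred M (\<lambda>\<omega>. alive c t (\<lambda>r. X r \<omega>))"
  using alive_pred[of c t 0] by simp

section \<open>Crossing probabilities over short times\<close>

definition crossing_prob :: "real \<Rightarrow> real \<Rightarrow> real" where
  "crossing_prob c t = (LINT \<omega>|M. of_bool (\<not> alive c t (\<lambda>r. X r \<omega>)))"

lemma crossing_prob_bounds: "0 \<le> crossing_prob c t" "crossing_prob c t \<le> 1"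
  unfolding crossing_prob_def
  by (auto intro!: integral_nonneg_AE integral_le_const integrable_const_bound[of _ 1])

text \<open>A path that starts at 0 < \<open>c\<close> has a strictly positive passage time of
  \<open>c\<close>, because its value at that time is at least \<open>c\<close>. So for almost every
  path the crossing event disappears once \<open>t\<close> is small.\<close>

lemma crossing_prob_small:
  assumes e: "0 < e" and c: "0 < c"
  shows "\<exists>t>0. crossing_prob c t < e"
proof -
  have "(\<lambda>n. crossing_prob c (1 / real (Suc n))) \<longlonglongrightarrow> (LINT \<omega>|M. 0)"
    unfolding crossing_prob_def
  proof (rule integral_dominated_convergence[where w = "\<lambda>_. 1"])
    have "AE \<omega> in M. \<omega> \<in> space M" by simp
    with start_0 show "AE \<omega> in M. (\<lambda>n. of_bool (\<not> alive c (1 / real (Suc n)) (\<lambda>r. X r \<omega>)) :: real) \<longlonglongrightarrow> 0"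
    proof eventually_elim
      case (elim \<omega>)
      let ?w = "\<lambda>r. X r \<omega>"
      have "\<forall>\<^sub>F n in sequentially. alive c (1 / real (Suc n)) ?w"
      proof (cases "passes c ?w")
        case True
        have "fpt c ?w \<noteq> 0" using fpt_value_ge[OF right_cont_path[OF elim(2)] True] elim(1) c by auto
        then have "0 < fpt c ?w" using fpt_nonneg[OF True] by simp
        then have "\<forall>\<^sub>F n in sequentially. 1 / real (Suc n) < fpt c ?w"
          using order_tendstoD(2)[OF tendsto_one_over_Suc] by blast
        then show ?thesis by eventually_elim (rule alive_before_fpt)
      next
        case False
        then show ?thesis by (simp add: not_passes_iff_alive)
      qed
      then show ?case by (intro tendsto_eventually) (auto elim: eventually_mono)
    qed
  qed auto
  then have "\<forall>\<^sub>F n in sequentially. crossing_prob c (1 / real (Suc n)) < e"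
    using order_tendstoD(2) e by force
  then obtain n where "crossing_prob c (1 / real (Suc n)) < e" by (auto simp: eventually_sequentially)
  then show ?thesis by (intro exI[of _ "1 / real (Suc n)"]) auto
qed

end

context spectrally_negative_levy_process
begin

text \<open>A single null set serves all levels \<open>c\<close> at once, because the absence of
  upward jumps is a property of the whole path.\<close>

lemma AE_fpt_value:
  "AE \<omega> in M. \<omega> \<in> space M \<and> X 0 \<omega> = 0 \<and> (\<forall>c\<ge>0. passes c (\<lambda>t. X t \<omega>) \<longrightarrow> X (fpt c (\<lambda>t. X t \<omega>)) \<omega> = c)"
proof -
  have "AE \<omega> in M. \<omega> \<in> space M" by simp
  with start_0 no_positive_jumps show ?thesis
  proof eventually_elim
    case (elim \<omega>)
    have "X (fpt c (\<lambda>t. X t \<omega>)) \<omega> = c" if "0 \<le> c" "passes c (\<lambda>t. X t \<omega>)" for c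
    proof (rule fpt_value_eq[OF right_cont_path[OF elim(3)] that(2)])
      show "X 0 \<omega> \<le> c" using elim(1) that by simp
      fix t :: real assume "0 < t"
      then show "\<exists>l. ((\<lambda>t. X t \<omega>) \<longlongrightarrow> l) (at_left t) \<and> X t \<omega> \<le> l"
        using left_limits[OF elim(3)] elim(2) by blast
    qed
    then show ?case using elim by blast
  qed
qed

text \<open>At the first grid point above \<open>a\<close> the path value tends to the value at the
  passage time of \<open>a\<close>, which is \<open>a\<close> itself; an overshoot of more than 1 is
  eventually impossible along almost every path.\<close>

lemma overshoot_vanishes:
  assumes t: "0 < t" and a: "0 \<le> a"
  shows "(\<lambda>n. LINT \<omega>|M. of_bool (\<exists>k\<in>{1..Suc n}. a < X (real k * (t / real (Suc n))) \<omega> \<and>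
      (\<forall>j\<in>{1..<k}. X (real j * (t / real (Suc n))) \<omega> \<le> a) \<and> a + 1 < X (real k * (t / real (Suc n))) \<omega>) :: real) \<longlonglongrightarrow> 0"
proof -
  define h where "h n = t / real (Suc n)" for n
  have h: "\<And>n. 0 < h n" "h \<longlonglongrightarrow> 0"
    unfolding h_def using t tendsto_mult[OF tendsto_const tendsto_one_over_Suc, of t] by auto
  have [measurable]: "X (real k * h n) \<in> borel_measurable M" for k n using h(1)[of n] by (intro measurable_X) auto
  define R where "R n \<omega> \<longleftrightarrow> (\<exists>k\<in>{1..Suc n}. a < X (real k * h n) \<omega> \<and>
      (\<forall>j\<in>{1..<k}. X (real j * h n) \<omega> \<le> a) \<and> a + 1 < X (real k * h n) \<omega>)" for n \<omega>
  have [measurable]: "Measurable.pred M (R n)" for n unfolding R_def by measurable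
  have "(\<lambda>n. LINT \<omega>|M. of_bool (R n \<omega>) :: real) \<longlonglongrightarrow> (LINT \<omega>|M. 0)"
  proof (rule integral_dominated_convergence[where w = "\<lambda>_. 1"])
    show "AE \<omega> in M. (\<lambda>n. of_bool (R n \<omega>) :: real) \<longlonglongrightarrow> 0"
      using AE_fpt_value
    proof eventually_elim
      case (elim \<omega>)
      let ?w = "\<lambda>r. X r \<omega>"
      have w: "right_cont ?w" using elim by (intro right_cont_path) auto
      have "\<forall>\<^sub>F n in sequentially. \<not> R n \<omega>"
      proof (cases "passes a ?w")
        case True
        define T where "T n = (LEAST j. 0 < j \<and> a < ?w (real j * h n))" for n
        note gp = grid_passage[OF w True h, folded T_def]
        have "X (fpt a ?w) \<omega> = a" using elim True a by blast
        then have "\<forall>\<^sub>F n in sequentially. X (real (T n) * h n) \<omega> < a + 1"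
          using order_tendstoD(2)[OF gp(4), of "a + 1"] by simp
        then show ?thesis using gp(1)
        proof eventually_elim
          case (elim n)
          show ?case
          proof
            assume "R n \<omega>"
            then obtain k where k: "k \<in> {1..Suc n}" "a < X (real k * h n) \<omega>"
              "\<forall>j\<in>{1..<k}. X (real j * h n) \<omega> \<le> a" "a + 1 < X (real k * h n) \<omega>" unfolding R_def by auto
            have "T n \<le> k" unfolding T_def using k by (intro Least_le) auto
            moreover have "k \<le> T n"
            proof (rule ccontr)
              assume "\<not> k \<le> T n"
              then have "X (real (T n) * h n) \<omega> \<le> a" using k(3) elim(2) by auto
              then show False using elim(2) by simp
            qed
            ultimately show False using elim(1) k(4) by simp
          qed
        qed
      next
        case False
        then have "?w r \<le> a" if "0 < r" for r using that False unfolding passes_def by (meson not_le)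
        then have "X (real k * h n) \<omega> \<le> a" if "k \<in> {1..Suc n}" for k n using that h(1)[of n] by auto
        then show ?thesis unfolding R_def by (intro always_eventually allI) (meson not_le)
      qed
      then show ?case by (intro tendsto_eventually) (auto elim: eventually_mono)
    qed
  qed auto
  then show ?thesis unfolding R_def h_def by simp
qed

text \<open>
  The loss of one unit of height absorbs the overshoot of the grid approximations, which vanishes
  only in the limit of the mesh.
\<close>

lemma crossing_prob_submult:
  assumes t: "0 < t" and a: "0 \<le> a" and b: "0 \<le> b"
  shows "crossing_prob (a + 1 + b) t \<le> crossing_prob a t * crossing_prob b t"
proof -
  define h where "h n = t / real (Suc n)" for n
  have h0: "0 < h n" for n unfolding h_def using t by simp
  have Xm [measurable]: "X (real k * h n) \<in> borel_measurable M" "X (real i * h n + real k * h n) \<in> borel_measurable M" for i k n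
    using h0[of n] by (auto intro!: measurable_X)
  define e where "e c n = (LINT \<omega>|M. of_bool (\<exists>k\<in>{1..Suc n}. c < X (real k * h n) \<omega>) :: real)" for c n
  define R where "R n = (LINT \<omega>|M. of_bool (\<exists>k\<in>{1..Suc n}. a < X (real k * h n) \<omega> \<and>
      (\<forall>j\<in>{1..<k}. X (real j * h n) \<omega> \<le> a) \<and> a + 1 < X (real k * h n) \<omega>) :: real)" for n
  have sp: "AE \<omega> in M. \<omega> \<in> space M" by simp
  have el: "(\<lambda>n. e c n) \<longlonglongrightarrow> crossing_prob c t" for c
    unfolding e_def crossing_prob_def
  proof (rule integral_dominated_convergence[where w = "\<lambda>_. 1"])
    show "AE \<omega> in M. (\<lambda>n. of_bool (\<exists>k\<in>{1..Suc n}. c < X (real k * h n) \<omega>) :: real) \<longlonglongrightarrow> of_bool (\<not> alive c t (\<lambda>r. X r \<omega>))"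
      using sp
    proof eventually_elim
      case (elim \<omega>)
      have "(\<lambda>n. 1 - of_bool (\<forall>j\<in>{1..Suc n}. X (real j * h n) \<omega> \<le> c) :: real) \<longlonglongrightarrow> 1 - of_bool (alive c t (\<lambda>r. X r \<omega>))"
        unfolding h_def by (intro tendsto_diff tendsto_const alive_grid_tendsto[OF right_cont_path[OF elim] t])
      moreover have "(1 - of_bool (\<forall>j\<in>{1..Suc n}. X (real j * h n) \<omega> \<le> c) :: real) = of_bool (\<exists>k\<in>{1..Suc n}. c < X (real k * h n) \<omega>)" for n
        by (auto simp: not_le)
      moreover have "(1 - of_bool (alive c t (\<lambda>r. X r \<omega>)) :: real) = of_bool (\<not> alive c t (\<lambda>r. X r \<omega>))" by simp
      ultimately show ?case by simp
    qed
  qed auto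
  have "e (a + 1 + b) n \<le> e a n * e b n + R n" for n
  proof -
    define F where "F k \<omega> \<longleftrightarrow> a < X (real k * h n) \<omega> \<and> (\<forall>j\<in>{1..<k}. X (real j * h n) \<omega> \<le> a)" for k \<omega>
    \<comment> \<open>The window after \<open>k\<close> has full length \<open>Suc n\<close> instead
      of the remaining number of steps. This only enlarges the event, and its probability becomes
      \<open>e b n\<close> for every \<open>k\<close>.\<close>
    define G where "G k \<omega> \<longleftrightarrow> (\<exists>j\<in>{1..Suc n}. b < X (real k * h n + real j * h n) \<omega> - X (real k * h n) \<omega>)" for k \<omega>
    define Q where "Q \<omega> \<longleftrightarrow> (\<exists>k\<in>{1..Suc n}. a < X (real k * h n) \<omega> \<and>
      (\<forall>j\<in>{1..<k}. X (real j * h n) \<omega> \<le> a) \<and> a + 1 < X (real k * h n) \<omega>)" for \<omega>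
    have [measurable]: "Measurable.pred M (F k)" "Measurable.pred M (G k)" "Measurable.pred M Q" for k
      unfolding F_def G_def Q_def by measurable
    have int: "integrable M (\<lambda>\<omega>. of_bool (P \<omega>) :: real)" if [measurable]: "Measurable.pred M P" for P
      by (rule integrable_const_bound[of _ 1]) auto
    have int2: "integrable M (\<lambda>\<omega>. of_bool (F k \<omega>) * of_bool (G k \<omega>) :: real)" for k
      by (rule integrable_const_bound[of _ 1]) auto
    have ind: "(LINT \<omega>|M. of_bool (F k \<omega>) * of_bool (G k \<omega>)) = (LINT \<omega>|M. of_bool (F k \<omega>)) * e b n" for k
    proof -
      let ?u = "\<lambda>j. real j * h n"
      let ?f = "\<lambda>p. of_bool (a < p k \<and> (\<forall>j\<in>{1..<k}. p j \<le> a)) :: real"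
      let ?g = "\<lambda>q. of_bool (\<exists>j\<in>{1..Suc n}. b < q j) :: real"
      have "(LINT \<omega>|M. ?f (\<lambda>j. X (?u (min j k)) \<omega> - X 0 \<omega>) * ?g (\<lambda>j. X (?u k + ?u (min j (Suc n))) \<omega> - X (?u k) \<omega>)) =
        (LINT \<omega>|M. ?f (\<lambda>j. X (?u (min j k)) \<omega> - X 0 \<omega>)) * (LINT \<omega>|M. ?g (\<lambda>j. X (?u (min j (Suc n))) \<omega> - X 0 \<omega>))"
        by (rule grid_indep) (use h0[of n] in \<open>auto simp: mono_def intro!: mult_right_mono\<close>)
      moreover have "(LINT \<omega>|M. ?f (\<lambda>j. X (?u (min j k)) \<omega> - X 0 \<omega>) * ?g (\<lambda>j. X (?u k + ?u (min j (Suc n))) \<omega> - X (?u k) \<omega>)) =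
        (LINT \<omega>|M. of_bool (F k \<omega>) * of_bool (G k \<omega>))"
        by (rule integral_cong_AE) (use start_0 in \<open>auto elim!: eventually_mono simp: F_def G_def simp del: of_bool_conj\<close>)
      moreover have "(LINT \<omega>|M. ?f (\<lambda>j. X (?u (min j k)) \<omega> - X 0 \<omega>)) = (LINT \<omega>|M. of_bool (F k \<omega>))"
        by (rule integral_cong_AE) (use start_0 in \<open>auto elim!: eventually_mono simp: F_def G_def simp del: of_bool_conj\<close>)
      moreover have "(LINT \<omega>|M. ?g (\<lambda>j. X (?u (min j (Suc n))) \<omega> - X 0 \<omega>)) = e b n"
        unfolding e_def by (rule integral_cong_AE) (use start_0 in \<open>auto elim!: eventually_mono\<close>)
      ultimately show ?thesis by simp
    qed
    have "e (a + 1 + b) n \<le> (LINT \<omega>|M. (\<Sum>k\<in>{1..Suc n}. of_bool (F k \<omega>) * of_bool (G k \<omega>)) +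
        of_bool (Q \<omega>))"
      unfolding e_def
    proof (rule integral_mono)
      fix \<omega>
      have nn: "0 \<le> (\<Sum>k\<in>{1..Suc n}. of_bool (F k \<omega>) * of_bool (G k \<omega>) :: real)" by (intro sum_nonneg) auto
      show "of_bool (\<exists>k\<in>{1..Suc n}. a + 1 + b < X (real k * h n) \<omega>) \<le> (\<Sum>k\<in>{1..Suc n}. of_bool (F k \<omega>) * of_bool (G k \<omega>)) + (of_bool (Q \<omega>) :: real)"
      proof (cases "(\<exists>k\<in>{1..Suc n}. a + 1 + b < X (real k * h n) \<omega>) \<and> \<not> Q \<omega>")
        case True
        then obtain i where i: "i \<in> {1..Suc n}" "a + 1 + b < X (real i * h n) \<omega>" and nR: "\<not> Q \<omega>" by blast
        define T where "T = (LEAST j. 1 \<le> j \<and> a < X (real j * h n) \<omega>)"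
        have T: "1 \<le> T" "a < X (real T * h n) \<omega>" "T \<le> i"
          using LeastI[of "\<lambda>j. 1 \<le> j \<and> a < X (real j * h n) \<omega>" i] Least_le[of "\<lambda>j. 1 \<le> j \<and> a < X (real j * h n) \<omega>" i] i b
          unfolding T_def by auto
        have Tl: "X (real j * h n) \<omega> \<le> a" if "1 \<le> j" "j < T" for j
          using not_less_Least[of j "\<lambda>j. 1 \<le> j \<and> a < X (real j * h n) \<omega>"] that unfolding T_def[symmetric] by (auto simp: not_less)
        have Tv: "X (real T * h n) \<omega> \<le> a + 1" using nR T Tl i unfolding Q_def by (meson atLeastAtMost_iff atLeastLessThan_iff not_le order_trans)
        have "T \<noteq> i" using Tv i(2) b by auto
        then have "T < i" using T(3) by simp
        have "real T * h n + real (i - T) * h n = real i * h n" using \<open>T < i\<close> by (simp add: of_nat_diff algebra_simps)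
        then have "G T \<omega>" using i Tv T(1) \<open>T < i\<close> unfolding G_def by (intro bexI[of _ "i - T"]) auto
        moreover have "F T \<omega>" using T Tl by (auto simp: F_def)
        ultimately have "of_bool (F T \<omega>) * of_bool (G T \<omega>) = (1 :: real)" by simp
        moreover have "of_bool (F T \<omega>) * of_bool (G T \<omega>) \<le> (\<Sum>k\<in>{1..Suc n}. of_bool (F k \<omega>) * of_bool (G k \<omega>) :: real)"
          using T i by (intro member_le_sum) auto
        ultimately have "1 \<le> (\<Sum>k\<in>{1..Suc n}. of_bool (F k \<omega>) * of_bool (G k \<omega>) :: real)" by linarith
        moreover have "of_bool (\<exists>k\<in>{1..Suc n}. a + 1 + b < X (real k * h n) \<omega>) \<le> (1 :: real)" by (simp only: of_bool_def split: if_split) simp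
        moreover have "0 \<le> (of_bool (Q \<omega>) :: real)" by (simp only: of_bool_def split: if_split) simp
        ultimately show ?thesis by linarith
      next
        case False
        then have "of_bool (\<exists>k\<in>{1..Suc n}. a + 1 + b < X (real k * h n) \<omega>) \<le> (of_bool (Q \<omega>) :: real)"
          by (simp only: of_bool_def split: if_split) argo
        then show ?thesis using nn by linarith
      qed
    qed (intro Bochner_Integration.integrable_add Bochner_Integration.integrable_sum int int2; measurable)+
    also have "\<dots> = (\<Sum>k\<in>{1..Suc n}. LINT \<omega>|M. of_bool (F k \<omega>) * of_bool (G k \<omega>)) + R n"
      unfolding R_def Q_def[symmetric]
      by (subst Bochner_Integration.integral_add, (intro Bochner_Integration.integrable_sum int int2; measurable)+,
          subst Bochner_Integration.integral_sum, intro int2, simp)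
    also have "(\<Sum>k\<in>{1..Suc n}. LINT \<omega>|M. of_bool (F k \<omega>) * of_bool (G k \<omega>)) = (\<Sum>k\<in>{1..Suc n}. LINT \<omega>|M. of_bool (F k \<omega>)) * e b n"
      by (simp only: ind sum_distrib_right)
    also have "(\<Sum>k\<in>{1..Suc n}. LINT \<omega>|M. of_bool (F k \<omega>)) = (LINT \<omega>|M. (\<Sum>k\<in>{1..Suc n}. of_bool (F k \<omega>)) :: real)"
    proof (rule Bochner_Integration.integral_sum[symmetric])
      fix k show "integrable M (\<lambda>\<omega>. of_bool (F k \<omega>) :: real)" by (rule int) measurable
    qed
    also have "\<dots> = e a n"
      unfolding e_def
    proof (intro Bochner_Integration.integral_cong refl)
      fix \<omega>
      show "(\<Sum>k\<in>{1..Suc n}. of_bool (F k \<omega>)) = (of_bool (\<exists>k\<in>{1..Suc n}. a < X (real k * h n) \<omega>) :: real)"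
        using sum_of_bool_first[of "\<lambda>k. a < X (real k * h n) \<omega>" "Suc n"] by (simp only: not_less F_def)
    qed
    finally show ?thesis .
  qed
  moreover have "R \<longlonglongrightarrow> 0" unfolding R_def h_def by (rule overshoot_vanishes[OF t a])
  then have "(\<lambda>n. e a n * e b n + R n) \<longlonglongrightarrow> crossing_prob a t * crossing_prob b t + 0"
    by (intro tendsto_intros el)
  ultimately show ?thesis
    using LIMSEQ_le[OF el, of "\<lambda>n. e a n * e b n + R n" "crossing_prob a t * crossing_prob b t + 0" "a + 1 + b"] by auto
qed


lemma crossing_prob_power:
  assumes "0 < t"
  shows "crossing_prob (2 * real m + 1) t \<le> crossing_prob 1 t ^ Suc m"
proof (induction m)
  case (Suc m)
  have "crossing_prob (2 * real (Suc m) + 1) t = crossing_prob ((2 * real m + 1) + 1 + 1) t" by (simp add: algebra_simps)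
  also have "\<dots> \<le> crossing_prob (2 * real m + 1) t * crossing_prob 1 t"
    by (rule crossing_prob_submult[OF assms]) auto
  also have "\<dots> \<le> crossing_prob 1 t ^ Suc m * crossing_prob 1 t"
    by (intro mult_right_mono Suc crossing_prob_bounds)
  finally show ?case by (simp add: mult.commute)
qed simp

text \<open>Crossing probabilities decay geometrically in the level, with a ratio that can be made
  as small as desired by shrinking \<open>t0\<close>. The band of heights from
  \<open>2 * m + 1\<close> to \<open>2 * m + 3\<close> costs at most
  \<open>exp (\<theta> * (2 * m + 3))\<close> and is reached with probability at most the
  \<open>m\<close>-th power of \<open>exp (- 2 * \<theta>) / 2\<close>; the product is
  \<open>exp (3 * \<theta>) / 2 ^ m\<close>, which is summable. The bound is uniform in time because
  it will also justify continuity of the moments at time 0.\<close>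

lemma exp_path_dominated:
  assumes \<theta>: "0 \<le> \<theta>"
  obtains t0 Z where "0 < t0" "Z \<in> borel_measurable M" "(\<integral>\<^sup>+\<omega>. Z \<omega> \<partial>M) < \<infinity>"
    "AE \<omega> in M. \<forall>s\<in>{0..t0}. ennreal (exp (\<theta> * X s \<omega>)) \<le> Z \<omega>"
proof -
  obtain t0 where t0: "0 < t0" "crossing_prob 1 t0 < exp (- 2 * \<theta>) / 2"
    using crossing_prob_small[of "exp (- 2 * \<theta>) / 2" 1] by auto
  \<comment> \<open>\<open>Y m\<close> takes care of heights in the band above
    \<open>2 * m + 1\<close>, and the constant \<open>exp \<theta>\<close> in \<open>Z\<close> of
    heights up to 1.\<close>
  define Y where "Y m \<omega> = ennreal (exp (\<theta> * (2 * real m + 3)) * of_bool (\<not> alive (2 * real m + 1) t0 (\<lambda>r. X r \<omega>)))" for m :: nat and \<omega>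
  define Z where "Z \<omega> = ennreal (exp \<theta>) + (\<Sum>m. Y m \<omega>)" for \<omega>
  have [measurable]: "Y m \<in> borel_measurable M" for m unfolding Y_def by measurable
  have [measurable]: "Z \<in> borel_measurable M" unfolding Z_def by measurable
  have Yint: "(\<integral>\<^sup>+\<omega>. Y m \<omega> \<partial>M) \<le> ennreal (exp (3 * \<theta>) * (1 / 2) ^ m)" for m
  proof -
    have "(\<integral>\<^sup>+\<omega>. Y m \<omega> \<partial>M) = ennreal (LINT \<omega>|M. exp (\<theta> * (2 * real m + 3)) * of_bool (\<not> alive (2 * real m + 1) t0 (\<lambda>r. X r \<omega>)))"
      unfolding Y_def by (intro nn_integral_eq_integral integrable_const_bound[of _ "exp (\<theta> * (2 * real m + 3))"]) auto
    also have "\<dots> = ennreal (exp (\<theta> * (2 * real m + 3)) * crossing_prob (2 * real m + 1) t0)" by (simp add: crossing_prob_def)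
    also have "\<dots> \<le> ennreal (exp (3 * \<theta>) * (1 / 2) ^ m)"
    proof (rule ennreal_leI)
      have "exp (\<theta> * (2 * real m + 3)) * crossing_prob (2 * real m + 1) t0 \<le> exp (\<theta> * (2 * real m + 3)) * crossing_prob 1 t0 ^ Suc m"
        using crossing_prob_power[OF t0(1), of m] by (intro mult_left_mono) auto
      also have "\<dots> \<le> exp (\<theta> * (2 * real m + 3)) * (crossing_prob 1 t0 ^ m * 1)"
        using crossing_prob_bounds[of 1 t0] by (simp only: power_Suc mult.commute[of "crossing_prob 1 t0"]) (intro mult_left_mono; simp)
      also have "\<dots> \<le> exp (\<theta> * (2 * real m + 3)) * ((exp (- 2 * \<theta>) / 2) ^ m * 1)"
        using t0 crossing_prob_bounds[of 1 t0] by (intro mult_left_mono mult_right_mono power_mono) auto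
      also have "\<dots> = exp (3 * \<theta>) * (1 / 2) ^ m"
        by (simp add: power_divide exp_of_nat_mult[symmetric] exp_add[symmetric] algebra_simps flip: exp_add)
      finally show "exp (\<theta> * (2 * real m + 3)) * crossing_prob (2 * real m + 1) t0 \<le> exp (3 * \<theta>) * (1 / 2) ^ m" .
    qed
    finally show ?thesis .
  qed
  have "(\<integral>\<^sup>+\<omega>. Z \<omega> \<partial>M) = ennreal (exp \<theta>) + (\<Sum>m. \<integral>\<^sup>+\<omega>. Y m \<omega> \<partial>M)"
    unfolding Z_def by (simp add: nn_integral_add nn_integral_suminf emeasure_space_1)
  also have "\<dots> \<le> ennreal (exp \<theta>) + (\<Sum>m. ennreal (exp (3 * \<theta>) * (1 / 2) ^ m))"
    by (intro add_left_mono suminf_le Yint summableI)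
  also have "(\<Sum>m. ennreal (exp (3 * \<theta>) * (1 / 2) ^ m)) = ennreal (exp (3 * \<theta>) * 2)"
    using sums_mult[OF geometric_sums[of "1/2 :: real"], of "exp (3 * \<theta>)"] by (intro suminf_ennreal_eq) auto
  also have "ennreal (exp \<theta>) + ennreal (exp (3 * \<theta>) * 2) < \<infinity>" by simp
  finally have fin: "(\<integral>\<^sup>+\<omega>. Z \<omega> \<partial>M) < \<infinity>" .
  have dom: "AE \<omega> in M. \<forall>s\<in>{0..t0}. ennreal (exp (\<theta> * X s \<omega>)) \<le> Z \<omega>"
    using start_0
  proof eventually_elim
    case (elim \<omega>)
    show ?case
    proof
      fix s assume s: "s \<in> {0..t0}"
      show "ennreal (exp (\<theta> * X s \<omega>)) \<le> Z \<omega>"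
      proof (cases "X s \<omega> \<le> 1")
        case True
        then have "\<theta> * X s \<omega> \<le> \<theta> * 1" using \<theta> by (intro mult_left_mono)
        then have "ennreal (exp (\<theta> * X s \<omega>)) \<le> ennreal (exp \<theta>)" by (intro ennreal_leI) simp
        then show ?thesis unfolding Z_def by (rule order_trans) simp
      next
        case False
        define m where "m = nat (\<lceil>(X s \<omega> - 1) / 2\<rceil> - 1)"
        have "0 < \<lceil>(X s \<omega> - 1) / 2\<rceil>" using False by simp
        then have "real m = of_int \<lceil>(X s \<omega> - 1) / 2\<rceil> - 1" by (simp add: m_def)
        then have m: "2 * real m + 1 < X s \<omega>" "X s \<omega> \<le> 2 * real m + 3"
          using ceiling_correct[of "(X s \<omega> - 1) / 2"] by (auto simp del: le_of_int_ceiling)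
        have "s \<noteq> 0" using False elim by auto
        have "\<not> alive (2 * real m + 1) t0 (\<lambda>r. X r \<omega>)"
        proof
          assume "alive (2 * real m + 1) t0 (\<lambda>r. X r \<omega>)"
          then have "X s \<omega> \<le> 2 * real m + 1" using s \<open>s \<noteq> 0\<close> by (simp add: alive_def)
          then show False using m by simp
        qed
        moreover have "exp (\<theta> * X s \<omega>) \<le> exp (\<theta> * (2 * real m + 3))" using m \<theta> by (simp add: mult_left_mono)
        ultimately have "ennreal (exp (\<theta> * X s \<omega>)) \<le> Y m \<omega>" unfolding Y_def by (intro ennreal_leI) simp
        also have "Y m \<omega> \<le> (\<Sum>m. Y m \<omega>)" using sum_le_suminf[OF summableI, of "{m}" "\<lambda>m. Y m \<omega>"] by simp
        finally show ?thesis unfolding Z_def by (rule add_increasing[OF zero_le])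
      qed
    qed
  qed
  show ?thesis by (rule that[OF t0(1) _ fin dom]) simp
qed

lemma exp_moment_semigroup:
  assumes "0 \<le> s" "0 \<le> t"
  shows "(\<integral>\<^sup>+\<omega>. ennreal (exp (\<theta> * X (s + t) \<omega>)) \<partial>M) = (\<integral>\<^sup>+\<omega>. ennreal (exp (\<theta> * X s \<omega>)) \<partial>M) * (\<integral>\<^sup>+\<omega>. ennreal (exp (\<theta> * X t \<omega>)) \<partial>M)"
proof -
  have c0: "(\<integral>\<^sup>+\<omega>. ennreal (exp (\<theta> * (X r \<omega> - X 0 \<omega>))) \<partial>M) = (\<integral>\<^sup>+\<omega>. ennreal (exp (\<theta> * X r \<omega>)) \<partial>M)" for r
    by (rule nn_integral_cong_AE) (use start_0 in \<open>auto elim!: eventually_mono\<close>)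
  have "(\<integral>\<^sup>+\<omega>. ennreal (exp (\<theta> * (X s \<omega> - X 0 \<omega>))) * ennreal (exp (\<theta> * (X (s + t) \<omega> - X s \<omega>))) \<partial>M) =
    (\<integral>\<^sup>+\<omega>. ennreal (exp (\<theta> * (X s \<omega> - X 0 \<omega>))) \<partial>M) * (\<integral>\<^sup>+\<omega>. ennreal (exp (\<theta> * (X t \<omega> - X 0 \<omega>))) \<partial>M)"
    using grid_indep_nn[of "\<lambda>j. real j * s" "\<lambda>j. real j * t" "\<lambda>p. ennreal (exp (\<theta> * p 1))" "\<lambda>p. ennreal (exp (\<theta> * p 1))" 1 1] assms
    by (simp add: mono_def mult_right_mono)
  also have "(\<lambda>\<omega>. ennreal (exp (\<theta> * (X s \<omega> - X 0 \<omega>))) * ennreal (exp (\<theta> * (X (s + t) \<omega> - X s \<omega>)))) = (\<lambda>\<omega>. ennreal (exp (\<theta> * (X (s + t) \<omega> - X 0 \<omega>))))"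
    by (simp add: ennreal_mult[symmetric] exp_add[symmetric] algebra_simps flip: exp_add)
  finally show ?thesis unfolding c0 .
qed

text \<open>The domination covers times up to \<open>t0\<close> only; a longer time is cut into
  equal pieces of length at most \<open>t0\<close>, over which the moments multiply.\<close>

lemma exp_moment_finite:
  assumes \<theta>: "0 \<le> \<theta>" and t: "0 \<le> t"
  shows "(\<integral>\<^sup>+\<omega>. ennreal (exp (\<theta> * X t \<omega>)) \<partial>M) < \<infinity>"
proof -
  obtain t0 Z where Z: "0 < t0" "Z \<in> borel_measurable M" "(\<integral>\<^sup>+\<omega>. Z \<omega> \<partial>M) < \<infinity>"
    "AE \<omega> in M. \<forall>s\<in>{0..t0}. ennreal (exp (\<theta> * X s \<omega>)) \<le> Z \<omega>" using exp_path_dominated[OF \<theta>] .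
  have small: "(\<integral>\<^sup>+\<omega>. ennreal (exp (\<theta> * X s \<omega>)) \<partial>M) < \<infinity>" if "s \<in> {0..t0}" for s
  proof -
    have "(\<integral>\<^sup>+\<omega>. ennreal (exp (\<theta> * X s \<omega>)) \<partial>M) \<le> (\<integral>\<^sup>+\<omega>. Z \<omega> \<partial>M)"
      by (rule nn_integral_mono_AE) (use Z(4) that in \<open>auto elim!: eventually_mono\<close>)
    then show ?thesis using Z(3) by simp
  qed
  have pw: "(\<integral>\<^sup>+\<omega>. ennreal (exp (\<theta> * X (real n * s) \<omega>)) \<partial>M) = (\<integral>\<^sup>+\<omega>. ennreal (exp (\<theta> * X s \<omega>)) \<partial>M) ^ n" if "0 \<le> s" for n s
  proof (induction n)
    case 0
    have "(\<integral>\<^sup>+\<omega>. ennreal (exp (\<theta> * X 0 \<omega>)) \<partial>M) = (\<integral>\<^sup>+\<omega>. 1 \<partial>M)"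
      by (rule nn_integral_cong_AE) (use start_0 in \<open>auto elim!: eventually_mono\<close>)
    then show ?case by (simp add: emeasure_space_1)
  next
    case (Suc n)
    have "real (Suc n) * s = s + real n * s" by (simp add: algebra_simps)
    then show ?case using exp_moment_semigroup[of s "real n * s" \<theta>] that Suc by simp
  qed
  define n where "n = Suc (nat \<lceil>t / t0\<rceil>)"
  have "t / t0 \<le> real n" unfolding n_def by linarith
  then have "t / real n \<le> t0" using Z(1) by (simp add: n_def field_simps)
  then have "(\<integral>\<^sup>+\<omega>. ennreal (exp (\<theta> * X (t / real n) \<omega>)) \<partial>M) < \<infinity>" using t by (intro small) auto
  then have "(\<integral>\<^sup>+\<omega>. ennreal (exp (\<theta> * X (t / real n) \<omega>)) \<partial>M) ^ n < \<infinity>" by (simp add: power_less_top_ennreal)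
  moreover have "real n * (t / real n) = t" by (simp add: n_def del: of_nat_Suc)
  ultimately show ?thesis using pw[of "t / real n" n] t by simp
qed

lemma exp_moment_integrable:
  assumes "0 \<le> \<theta>" "0 \<le> t"
  shows "integrable M (\<lambda>\<omega>. exp (\<theta> * X t \<omega>))"
  using exp_moment_finite[OF assms] assms by (intro integrableI_nonneg) auto

abbreviation \<psi> :: "real \<Rightarrow> real" where "\<psi> \<equiv> laplace_exponent M X"

text \<open>The logarithm of the moment is additive in time, and tends to 0 at time 0 by domination
  over the initial stretch of the path, so it is linear. The factor is then the only number that
  fits the description defining \<open>\<psi>\<close>.\<close>

lemma exp_moment:
  assumes \<theta>: "0 \<le> \<theta>" and t: "0 \<le> t"
  shows "(LINT \<omega>|M. exp (\<theta> * X t \<omega>)) = exp (t * \<psi> \<theta>)"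
proof -
  define F where "F t = (LINT \<omega>|M. exp (\<theta> * X t \<omega>))" for t
  have nn: "(\<integral>\<^sup>+\<omega>. ennreal (exp (\<theta> * X t \<omega>)) \<partial>M) = ennreal (F t)" if "0 \<le> t" for t
    unfolding F_def using that by (intro nn_integral_eq_integral exp_moment_integrable \<theta>) auto
  have F0: "0 \<le> F t" for t unfolding F_def by (intro integral_nonneg_AE) auto
  have Fpos: "0 < F t" if t: "0 \<le> t" for t
  proof (rule ccontr)
    assume "\<not> 0 < F t"
    then have "F t = 0" using F0[of t] by simp
    then have "AE \<omega> in M. exp (\<theta> * X t \<omega>) = 0"
      unfolding F_def using exp_moment_integrable[OF \<theta> t] by (subst (asm) integral_nonneg_eq_0_iff_AE) auto
    then show False by simp
  qed
  have Fadd: "F (s + t) = F s * F t" if "0 \<le> s" "0 \<le> t" for s t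
    using exp_moment_semigroup[OF that, of \<theta>] that F0 by (simp add: nn ennreal_mult[symmetric])
  obtain t0 Z where Z: "0 < t0" "Z \<in> borel_measurable M" "(\<integral>\<^sup>+\<omega>. Z \<omega> \<partial>M) < \<infinity>"
    "AE \<omega> in M. \<forall>s\<in>{0..t0}. ennreal (exp (\<theta> * X s \<omega>)) \<le> Z \<omega>" using exp_path_dominated[OF \<theta>] .
  have Zfin: "AE \<omega> in M. Z \<omega> \<noteq> \<infinity>" using Z(2,3) by (intro nn_integral_PInf_AE) auto
  have lim: "(\<lambda>n. ln (F (s n))) \<longlonglongrightarrow> 0" if s: "\<And>n. 0 \<le> s n" "s \<longlonglongrightarrow> 0" for s :: "nat \<Rightarrow> real"
  proof -
    have "(\<lambda>n. LINT \<omega>|M. exp (\<theta> * X (min (s n) t0) \<omega>)) \<longlonglongrightarrow> (LINT \<omega>|M. 1)"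
    proof (rule integral_dominated_convergence[where w = "\<lambda>\<omega>. enn2real (Z \<omega>)"])
      show "integrable M (\<lambda>\<omega>. enn2real (Z \<omega>))"
      proof (rule integrableI_nonneg)
        have "(\<integral>\<^sup>+\<omega>. ennreal (enn2real (Z \<omega>)) \<partial>M) = (\<integral>\<^sup>+\<omega>. Z \<omega> \<partial>M)"
          by (rule nn_integral_cong_AE) (use Zfin in \<open>auto elim!: eventually_mono simp: less_top\<close>)
        then show "(\<integral>\<^sup>+\<omega>. ennreal (enn2real (Z \<omega>)) \<partial>M) < \<infinity>" using Z(3) by simp
      qed (use Z in auto)
      show "AE \<omega> in M. norm (exp (\<theta> * X (min (s n) t0) \<omega>)) \<le> enn2real (Z \<omega>)" for n
        using Z(4) Zfin
      proof eventually_elim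
        case (elim \<omega>)
        have "ennreal (exp (\<theta> * X (min (s n) t0) \<omega>)) \<le> Z \<omega>" using elim(1) s(1)[of n] Z(1) by auto
        then have "enn2real (ennreal (exp (\<theta> * X (min (s n) t0) \<omega>))) \<le> enn2real (Z \<omega>)"
          using elim(2) by (intro enn2real_mono) (auto simp: less_top)
        then show ?case by simp
      qed
      have "AE \<omega> in M. \<omega> \<in> space M" by simp
      with start_0 show "AE \<omega> in M. (\<lambda>n. exp (\<theta> * X (min (s n) t0) \<omega>)) \<longlonglongrightarrow> 1"
      proof eventually_elim
        case (elim \<omega>)
        have "(\<lambda>n. min (s n) t0) \<longlonglongrightarrow> min 0 t0" by (intro tendsto_min s tendsto_const)
        then have "(\<lambda>n. X (min (s n) t0) \<omega>) \<longlonglongrightarrow> X 0 \<omega>"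
          using s(1) Z(1) by (intro right_contD_seq[OF right_cont_path[OF elim(2)]]) auto
        then have "(\<lambda>n. exp (\<theta> * X (min (s n) t0) \<omega>)) \<longlonglongrightarrow> exp (\<theta> * X 0 \<omega>)" by (intro tendsto_intros)
        then show ?case using elim by simp
      qed
      have [measurable]: "X (min (s n) t0) \<in> borel_measurable M" for n
        using s(1)[of n] Z(1) by (intro measurable_X) simp
      show "(\<lambda>\<omega>. exp (\<theta> * X (min (s n) t0) \<omega>)) \<in> borel_measurable M" for n by measurable
    qed simp
    moreover have "\<forall>\<^sub>F n in sequentially. (LINT \<omega>|M. exp (\<theta> * X (min (s n) t0) \<omega>)) = F (s n)"
      using order_tendstoD(2)[OF s(2) Z(1)] by eventually_elim (simp add: F_def)
    ultimately have "(\<lambda>n. F (s n)) \<longlonglongrightarrow> 1" using Lim_transform_eventually by (fastforce simp: prob_space)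
    then have "(\<lambda>n. ln (F (s n))) \<longlonglongrightarrow> ln 1" by (intro tendsto_ln) auto
    then show ?thesis by simp
  qed
  have "ln (F t) = t * ln (F 1)" if "0 \<le> t" for t
  proof (rule additive_right_continuous_linear[OF _ lim that])
    show "ln (F (s + t)) = ln (F s) + ln (F t)" if "0 \<le> s" "0 \<le> t" for s t
      using Fadd[OF that] Fpos[OF that(1)] Fpos[OF that(2)] by (simp add: ln_mult)
  qed
  then have Fexp: "F t = exp (t * ln (F 1))" if "0 \<le> t" for t using that Fpos[OF that] by (metis exp_ln)
  have "\<psi> \<theta> = ln (F 1)"
    unfolding laplace_exponent_def expectation_from_def
  proof (rule the_equality)
    show "\<forall>t\<ge>0. (LINT \<omega>|M. exp (\<theta> * (0 + X t \<omega>))) = exp (t * ln (F 1))"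
    proof (intro allI impI)
      fix t :: real assume "0 \<le> t"
      then show "(LINT \<omega>|M. exp (\<theta> * (0 + X t \<omega>))) = exp (t * ln (F 1))"
        using Fexp[of t] by (simp only: F_def add_0_left)
    qed
    fix r assume "\<forall>t\<ge>0. (LINT \<omega>|M. exp (\<theta> * (0 + X t \<omega>))) = exp (t * r)"
    then have "F 1 = exp r" by (auto simp: F_def dest: spec[of _ 1])
    then show "r = ln (F 1)" by simp
  qed
  then show ?thesis using Fexp[OF t] by (simp only: F_def)
qed

lemma laplace_exponent_zero: "\<psi> 0 = 0"
  using exp_moment[of 0 1] by (simp add: prob_space)

lemma laplace_exponent_continuous: "continuous_on {0..} \<psi>"
proof -
  have "continuous_on {0..} (\<lambda>\<theta>. exp (\<psi> \<theta>))"
    unfolding continuous_on_sequentially o_def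
  proof (intro allI ballI impI; elim conjE)
    fix x :: "nat \<Rightarrow> real" and a assume a: "a \<in> {0..}" and x: "\<forall>n. x n \<in> {0..}" "x \<longlonglongrightarrow> a"
    obtain K where K: "\<And>n. x n \<le> K" using convergent_imp_Bseq[of x] x(2) unfolding convergent_def Bseq_def
      by (metis abs_le_D1 real_norm_def)
    have K0: "0 \<le> K" using K[of 0] x(1) by (meson atLeast_iff order_trans)
    have "(\<lambda>n. LINT \<omega>|M. exp (x n * X 1 \<omega>)) \<longlonglongrightarrow> (LINT \<omega>|M. exp (a * X 1 \<omega>))"
    proof (rule integral_dominated_convergence[where w = "\<lambda>\<omega>. 1 + exp (K * X 1 \<omega>)"])
      show "integrable M (\<lambda>\<omega>. 1 + exp (K * X 1 \<omega>))" using exp_moment_integrable[of K 1] K0 by simp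
      show "AE \<omega> in M. norm (exp (x n * X 1 \<omega>)) \<le> 1 + exp (K * X 1 \<omega>)" for n
      proof (rule AE_I2)
        fix \<omega>
        show "norm (exp (x n * X 1 \<omega>)) \<le> 1 + exp (K * X 1 \<omega>)"
        proof (cases "0 \<le> X 1 \<omega>")
          case True
          then have "exp (x n * X 1 \<omega>) \<le> exp (K * X 1 \<omega>)" using K[of n] by (simp add: mult_right_mono)
          then show ?thesis by (simp del: exp_le_cancel_iff)
        next
          case False
          then have "exp (x n * X 1 \<omega>) \<le> 1" using x(1) by (simp add: mult_nonneg_nonpos)
          then show ?thesis by (simp add: add_increasing2)
        qed
      qed
      show "AE \<omega> in M. (\<lambda>n. exp (x n * X 1 \<omega>)) \<longlonglongrightarrow> exp (a * X 1 \<omega>)" by (intro AE_I2 tendsto_intros x)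
    qed auto
    then show "(\<lambda>n. exp (\<psi> (x n))) \<longlonglongrightarrow> exp (\<psi> a)" using exp_moment[of _ 1] a x(1) by simp
  qed
  then have "continuous_on {0..} (\<lambda>\<theta>. ln (exp (\<psi> \<theta>)))" by (rule continuous_on_ln) auto
  then show ?thesis by simp
qed

text \<open>If every \<open>X t\<close> were nonpositive almost surely, then so would be every
  increment, by stationarity. Off one null set the path would decrease along all the countably many
  grids, and by right continuity everywhere, which is the excluded case.\<close>

lemma positive_somewhere: "\<exists>t>0. \<not> (AE \<omega> in M. X t \<omega> \<le> 0)"
proof (rule ccontr)
  assume "\<not> ?thesis"
  then have neg: "AE \<omega> in M. X t \<omega> \<le> 0" if "0 < t" for t using that by blast
  have inc: "AE \<omega> in M. X (s + h) \<omega> \<le> X s \<omega>" if "0 \<le> s" "0 \<le> h" for s h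
  proof (cases "h = 0")
    case False
    then have h: "0 < h" using that by simp
    have "AE \<omega> in M. X h \<omega> - X 0 \<omega> \<le> 0" using neg[OF h] start_0 by eventually_elim simp
    then have "AE z in distr M borel (\<lambda>\<omega>. X h \<omega> - X 0 \<omega>). z \<le> 0" using that by (subst AE_distr_iff) auto
    then have "AE z in distr M borel (\<lambda>\<omega>. X (s + h) \<omega> - X s \<omega>). z \<le> 0" by (simp only: stationary_increments[OF that])
    then show ?thesis using that by (subst (asm) AE_distr_iff) (auto elim!: eventually_mono)
  qed simp
  have "AE \<omega> in M. \<forall>n i k::nat. X (real i * (1 / real (Suc n)) + real k * (1 / real (Suc n))) \<omega> \<le> X (real i * (1 / real (Suc n))) \<omega>"
    by (intro AE_all_countable[THEN iffD2] allI inc) auto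
  moreover have "AE \<omega> in M. \<omega> \<in> space M" by simp
  ultimately have "AE \<omega> in M. antimono_on {0..} (\<lambda>t. X t \<omega>)"
  proof eventually_elim
    case (elim \<omega>)
    show ?case
    proof (rule monotone_onI)
      fix s t :: real assume st: "s \<in> {0..}" "t \<in> {0..}" "s \<le> t"
      have l: "(\<lambda>n. X (grid_up (1 / Suc n) t) \<omega>) \<longlonglongrightarrow> X t \<omega>" if "0 \<le> t" for t
        by (rule right_cont_grid_tendsto[OF right_cont_path[OF elim(2)] that _ tendsto_one_over_Suc]) simp
      have "X (grid_up (1 / Suc n) t) \<omega> \<le> X (grid_up (1 / Suc n) s) \<omega>" for n
      proof -
        define i where "i = nat \<lceil>s / (1 / Suc n)\<rceil>"
        define j where "j = nat \<lceil>t / (1 / Suc n)\<rceil>"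
        have "i \<le> j" unfolding i_def j_def using st by (intro nat_mono ceiling_mono divide_right_mono) auto
        then have "real i * (1 / real (Suc n)) + real (j - i) * (1 / real (Suc n)) = real j * (1 / real (Suc n))"
          by (simp add: of_nat_diff algebra_simps diff_divide_distrib)
        moreover have "grid_up (1 / Suc n) s = real i * (1 / real (Suc n))" "grid_up (1 / Suc n) t = real j * (1 / real (Suc n))"
          unfolding i_def j_def by (rule grid_up_nat; use st in simp)+
        ultimately show ?thesis using elim(1)[rule_format, of i n "j - i"] by (simp only:)
      qed
      then show "X t \<omega> \<le> X s \<omega>" using l[of s] l[of t] st by (intro LIMSEQ_le) auto
    qed
  qed
  then show False using not_negative_subordinator by simp
qed

text \<open>Some \<open>X t\<close> exceeds a fixed \<open>e > 0\<close> with positive probability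
  \<open>P\<close>. Keeping only this event in the exponential moment bounds \<open>\<psi>\<close>
  below by an affine function with slope \<open>e / t\<close>.\<close>

lemma laplace_exponent_at_top: "filterlim \<psi> at_top at_top"
proof -
  obtain t where t: "0 < t" "\<not> (AE \<omega> in M. X t \<omega> \<le> 0)" using positive_somewhere by blast
  have [measurable]: "X t \<in> borel_measurable M" using t by simp
  have "\<exists>n. \<not> (AE \<omega> in M. X t \<omega> \<le> 1 / real (Suc n))"
  proof (rule ccontr)
    assume "\<nexists>n. \<not> (AE \<omega> in M. X t \<omega> \<le> 1 / real (Suc n))"
    then have "AE \<omega> in M. \<forall>n. X t \<omega> \<le> 1 / real (Suc n)" by (subst AE_all_countable) blast
    then have "AE \<omega> in M. X t \<omega> \<le> 0"
      by eventually_elim (rule LIMSEQ_le_const[OF tendsto_one_over_Suc], blast)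
    then show False using t by simp
  qed
  then obtain e where e: "0 < e" "\<not> (AE \<omega> in M. X t \<omega> \<le> e)" by (metis of_nat_0_less_iff zero_less_Suc zero_less_divide_1_iff)
  define P where "P = (LINT \<omega>|M. of_bool (e < X t \<omega>) :: real)"
  have Pi: "integrable M (\<lambda>\<omega>. of_bool (e < X t \<omega>) :: real)" by (rule integrable_const_bound[of _ 1]) auto
  have "P \<noteq> 0"
  proof
    assume "P = 0"
    then have "AE \<omega> in M. (of_bool (e < X t \<omega>) :: real) = 0"
      unfolding P_def using Pi by (subst (asm) integral_nonneg_eq_0_iff_AE) auto
    then show False using e(2) by (auto simp: not_less)
  qed
  moreover have "0 \<le> P" unfolding P_def by (intro integral_nonneg_AE) auto
  ultimately have P: "0 < P" by simp
  have bd: "\<theta> * e / t + ln P / t \<le> \<psi> \<theta>" if "0 \<le> \<theta>" for \<theta>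
  proof -
    have "exp (\<theta> * e) * P = (LINT \<omega>|M. exp (\<theta> * e) * of_bool (e < X t \<omega>))" by (simp add: P_def)
    also have "\<dots> \<le> (LINT \<omega>|M. exp (\<theta> * X t \<omega>))"
      using Pi exp_moment_integrable[OF that, of t] t that by (intro integral_mono) (auto intro!: mult_left_mono)
    also have "\<dots> = exp (t * \<psi> \<theta>)" using that t by (simp add: exp_moment)
    finally have "ln (exp (\<theta> * e) * P) \<le> t * \<psi> \<theta>" using P by (simp add: ln_le_cancel_iff[symmetric])
    then have "\<theta> * e + ln P \<le> t * \<psi> \<theta>" using P by (simp add: ln_mult)
    then show ?thesis using t by (simp add: field_simps)
  qed
  show ?thesis
    unfolding filterlim_at_top
  proof
    fix K
    show "\<forall>\<^sub>F \<theta> in at_top. K \<le> \<psi> \<theta>"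
      using eventually_ge_at_top[of "max 0 ((K - ln P / t) * t / e)"]
    proof eventually_elim
      case (elim \<theta>)
      then have "(K - ln P / t) * t \<le> \<theta> * e" using e by (simp add: pos_divide_le_eq)
      then have "K - ln P / t \<le> \<theta> * e / t" using t by (simp add: pos_le_divide_eq)
      then show ?case using bd[of \<theta>] elim by linarith
    qed
  qed
qed

end

section \<open>The Laplace transform of the first passage time\<close>

lemma sum_first_index:
  fixes a :: "nat \<Rightarrow> real"
  assumes "1 \<le> T" "T \<le> N" "P T" "\<And>j. 1 \<le> j \<Longrightarrow> j < T \<Longrightarrow> \<not> P j"
  shows "(\<Sum>k\<in>{1..N}. of_bool (P k \<and> (\<forall>j\<in>{1..<k}. \<not> P j)) * a k) = a T"
proof -
  have "(P k \<and> (\<forall>j\<in>{1..<k}. \<not> P j)) = (T = k)" if "k \<in> {1..N}" for k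
  proof
    assume b: "P k \<and> (\<forall>j\<in>{1..<k}. \<not> P j)"
    show "T = k"
    proof (cases T k rule: linorder_cases)
      case less then show ?thesis using b assms by auto
    next
      case greater then show ?thesis using b assms(4)[of k] that by auto
    qed
  qed (use assms in auto)
  then have "(\<Sum>k\<in>{1..N}. of_bool (P k \<and> (\<forall>j\<in>{1..<k}. \<not> P j)) * a k) = (\<Sum>k\<in>{1..N}. of_bool (T = k) * a k)"
    by (intro sum.cong refl) (simp only: of_bool_def)
  also have "\<dots> = (\<Sum>k\<in>{1..N}. if T = k then a k else 0)" by (intro sum.cong refl) simp
  also have "\<dots> = a T" using assms by (subst sum.delta') auto
  finally show ?thesis .
qed

lemma first_index_cases:
  fixes P :: "nat \<Rightarrow> bool"
  obtains (none) "\<And>k. k \<in> {1..N} \<Longrightarrow> \<not> P k"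
  | (some) T where "1 \<le> T" "T \<le> N" "P T" "\<And>j. 1 \<le> j \<Longrightarrow> j < T \<Longrightarrow> \<not> P j"
proof (cases "\<exists>k\<in>{1..N}. P k")
  case True
  define T where "T = (LEAST k. k \<in> {1..N} \<and> P k)"
  have T: "T \<in> {1..N} \<and> P T" unfolding T_def by (rule LeastI_ex) (use True in blast)
  have "\<not> P j" if "1 \<le> j" "j < T" for j
    using not_less_Least[of j "\<lambda>k. k \<in> {1..N} \<and> P k"] that T unfolding T_def[symmetric] by auto
  then show ?thesis using T by (intro some[of T]) auto
next
  case False
  then show ?thesis by (intro none) auto
qed

text \<open>Truncation at \<open>K\<close> costs at most \<open>Z^2 / K\<close>, hence at most
  \<open>C / K\<close> in expectation, uniformly in \<open>n\<close>; the truncated variables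
  converge by domination. This is uniform integrability from a bound in the square mean.\<close>

lemma (in prob_space) bounded_second_moment_convergence:
  fixes Z :: "nat \<Rightarrow> 'a \<Rightarrow> real"
  assumes i: "\<And>n. integrable M (Z n)" "\<And>n. integrable M (\<lambda>\<omega>. (Z n \<omega>)\<^sup>2)"
    and pos: "\<And>n \<omega>. 0 \<le> Z n \<omega>" and C: "\<And>n. (LINT \<omega>|M. (Z n \<omega>)\<^sup>2) \<le> C"
    and lim: "AE \<omega> in M. (\<lambda>n. Z n \<omega>) \<longlonglongrightarrow> Z' \<omega>" and [measurable]: "Z' \<in> borel_measurable M"
    and B: "\<And>\<omega>. Z' \<omega> \<le> B"
  shows "(\<lambda>n. LINT \<omega>|M. Z n \<omega>) \<longlonglongrightarrow> (LINT \<omega>|M. Z' \<omega>)"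
proof (rule LIMSEQ_I)
  fix e :: real assume e: "0 < e"
  note [measurable] = borel_measurable_integrable[OF i(1)]
  define K where "K = max (max B 1) (4 * C / e)"
  have K: "0 < K" "B \<le> K" "4 * C / e \<le> K" by (auto simp: K_def)
  have "4 * C \<le> K * e" using K(3) e by (simp add: pos_divide_le_eq)
  then have CK: "C / K \<le> e / 4" using K(1) by (simp add: pos_divide_le_eq mult.commute)
  have mi: "integrable M (\<lambda>\<omega>. min (Z n \<omega>) K)" for n
    by (rule integrable_const_bound[of _ K]) (use pos K in \<open>auto simp: abs_of_nonneg\<close>)
  have "(\<lambda>n. LINT \<omega>|M. min (Z n \<omega>) K) \<longlonglongrightarrow> (LINT \<omega>|M. Z' \<omega>)"
  proof (rule integral_dominated_convergence[where w = "\<lambda>_. K"])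
    show "AE \<omega> in M. (\<lambda>n. min (Z n \<omega>) K) \<longlonglongrightarrow> Z' \<omega>"
      using lim
    proof eventually_elim
      case (elim \<omega>)
      have "(\<lambda>n. min (Z n \<omega>) K) \<longlonglongrightarrow> min (Z' \<omega>) K" by (intro tendsto_min elim tendsto_const)
      then show ?case using B[of \<omega>] K by (simp add: min_absorb1)
    qed
  qed (use pos K in \<open>auto simp: abs_of_nonneg\<close>)
  then obtain n0 where n0: "\<And>n. n0 \<le> n \<Longrightarrow> \<bar>(LINT \<omega>|M. min (Z n \<omega>) K) - (LINT \<omega>|M. Z' \<omega>)\<bar> < e / 2"
    using LIMSEQ_D[of _ _ "e / 2"] e by (metis half_gt_zero real_norm_def)
  have diff: "\<bar>(LINT \<omega>|M. Z n \<omega>) - (LINT \<omega>|M. min (Z n \<omega>) K)\<bar> \<le> e / 4" for n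
  proof -
    have "(LINT \<omega>|M. Z n \<omega>) - (LINT \<omega>|M. min (Z n \<omega>) K) = (LINT \<omega>|M. Z n \<omega> - min (Z n \<omega>) K)"
      using i mi by simp
    also have "\<dots> \<le> (LINT \<omega>|M. (Z n \<omega>)\<^sup>2 / K)"
    proof (rule integral_mono)
      fix \<omega>
      show "Z n \<omega> - min (Z n \<omega>) K \<le> (Z n \<omega>)\<^sup>2 / K"
      proof (cases "Z n \<omega> \<le> K")
        case False
        then have "Z n \<omega> * K \<le> Z n \<omega> * Z n \<omega>" using pos by (intro mult_left_mono) auto
        then have "Z n \<omega> \<le> (Z n \<omega>)\<^sup>2 / K" using K by (simp add: pos_le_divide_eq power2_eq_square)
        then show ?thesis using K False by simp
      qed (use K in auto)
    qed (use i mi in auto)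
    also have "\<dots> \<le> C / K" using C[of n] K by (simp add: divide_right_mono)
    finally have "(LINT \<omega>|M. Z n \<omega>) - (LINT \<omega>|M. min (Z n \<omega>) K) \<le> e / 4" using CK by linarith
    moreover have "(LINT \<omega>|M. min (Z n \<omega>) K) \<le> (LINT \<omega>|M. Z n \<omega>)" using i mi by (intro integral_mono) auto
    ultimately show ?thesis by simp
  qed
  show "\<exists>n0. \<forall>n\<ge>n0. norm ((LINT \<omega>|M. Z n \<omega>) - (LINT \<omega>|M. Z' \<omega>)) < e"
  proof (intro exI allI impI)
    fix n assume "n0 \<le> n"
    then show "norm ((LINT \<omega>|M. Z n \<omega>) - (LINT \<omega>|M. Z' \<omega>)) < e"
      using n0[of n] diff[of n] e unfolding real_norm_def by linarith
  qed
qed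

lemma path_discount_const: "path_discount (\<lambda>_. q) c w = of_bool (passes c w) * exp (- (q * fpt c w))"
  using fpt_nonneg[of c w] by (cases "passes c w") (auto simp: path_discount_def set_lebesgue_integral_def)

lemma grid_functional_discount_const: "0 \<le> q \<Longrightarrow> grid_functional (path_discount (\<lambda>_. q) c)"
  by (rule grid_functional_discount[of _ q]) auto

context spectrally_negative_levy_process
begin

definition passage_discount :: "real \<Rightarrow> real \<Rightarrow> 'a \<Rightarrow> real" where
  "passage_discount q c \<omega> = path_discount (\<lambda>_. q) c (\<lambda>r. X r \<omega>)"

lemma passage_discount_eq: "passage_discount q c \<omega> = of_bool (passes c (\<lambda>r. X r \<omega>)) * exp (- (q * fpt c (\<lambda>r. X r \<omega>)))"
  by (simp add: passage_discount_def path_discount_const)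

lemma passage_discount_measurable: "0 \<le> q \<Longrightarrow> passage_discount q c \<in> borel_measurable M"
  unfolding passage_discount_def
  using path_functional_measurable0[OF grid_functional_path_functional[OF grid_functional_discount_const], of q "\<lambda>\<omega>. \<omega>" M "\<lambda>_. 0" c] by simp

lemma passage_discount_bounds: "0 \<le> q \<Longrightarrow> 0 \<le> passage_discount q c \<omega>" "0 \<le> q \<Longrightarrow> passage_discount q c \<omega> \<le> 1"
  using path_discount_bounds[of "\<lambda>_. q"] by (auto simp: passage_discount_def)

lemma passage_discount_integrable: "0 \<le> q \<Longrightarrow> integrable M (passage_discount q c)"
  by (rule integrable_const_bound[of _ 1]) (use passage_discount_bounds passage_discount_measurable in \<open>auto simp: abs_of_nonneg\<close>)

lemma exp_martingale_integrable:
  assumes "0 \<le> l" "0 \<le> t"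
  shows "integrable M (\<lambda>\<omega>. exp (l * X t \<omega> - t * \<psi> l))" "(LINT \<omega>|M. exp (l * X t \<omega> - t * \<psi> l)) = 1"
proof -
  have e: "exp (l * X t \<omega> - t * \<psi> l) = exp (l * X t \<omega>) * exp (- (t * \<psi> l))" for \<omega> by (simp add: exp_add[symmetric] flip: exp_add)
  show "integrable M (\<lambda>\<omega>. exp (l * X t \<omega> - t * \<psi> l))" unfolding e by (rule integrable_mult_left) (rule exp_moment_integrable[OF assms])
  show "(LINT \<omega>|M. exp (l * X t \<omega> - t * \<psi> l)) = 1"
    unfolding e integral_mult_left_zero exp_moment[OF assms] by (simp add: exp_minus)
qed

text \<open>The event that \<open>k\<close> is the first index above \<open>c\<close> is decided by
  the increments up to \<open>k\<close>, while the exponential martingale factor from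
  \<open>k\<close> to \<open>N\<close> is independent of them and has mean 1.\<close>

lemma grid_stopping:
  assumes l: "0 \<le> l" and h: "0 < h" and k: "1 \<le> k" "k \<le> N"
  shows "(LINT \<omega>|M. of_bool (c < X (real k * h) \<omega> \<and> (\<forall>j\<in>{1..<k}. \<not> c < X (real j * h) \<omega>)) * exp (l * X (real N * h) \<omega> - (real N * h) * \<psi> l)) =
    (LINT \<omega>|M. of_bool (c < X (real k * h) \<omega> \<and> (\<forall>j\<in>{1..<k}. \<not> c < X (real j * h) \<omega>)) * exp (l * X (real k * h) \<omega> - (real k * h) * \<psi> l))"
proof -
  let ?u = "\<lambda>j. real j * h"
  let ?f = "\<lambda>p. of_bool (c < p k \<and> (\<forall>j\<in>{1..<k}. \<not> c < p j)) * exp (l * p k - (real k * h) * \<psi> l) :: real"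
  let ?g = "\<lambda>q. exp (l * q (N - k) - (real (N - k) * h) * \<psi> l) :: real"
  have N: "?u k + ?u (N - k) = real N * h" using k by (simp add: of_nat_diff algebra_simps)
  have [measurable]: "X (real j * h) \<in> borel_measurable M" for j using h by (intro measurable_X) auto
  have "(LINT \<omega>|M. ?f (\<lambda>j. X (?u (min j k)) \<omega> - X 0 \<omega>) * ?g (\<lambda>j. X (?u k + ?u (min j (N - k))) \<omega> - X (?u k) \<omega>)) =
    (LINT \<omega>|M. ?f (\<lambda>j. X (?u (min j k)) \<omega> - X 0 \<omega>)) * (LINT \<omega>|M. ?g (\<lambda>j. X (?u (min j (N - k))) \<omega> - X 0 \<omega>))"
    by (rule grid_indep) (use h in \<open>auto simp: mono_def intro!: mult_right_mono\<close>)
  moreover have "(LINT \<omega>|M. ?g (\<lambda>j. X (?u (min j (N - k))) \<omega> - X 0 \<omega>)) = (LINT \<omega>|M. exp (l * X (real (N - k) * h) \<omega> - (real (N - k) * h) * \<psi> l))"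
    by (rule integral_cong_AE) (use start_0 in \<open>auto elim!: eventually_mono\<close>)
  moreover have "\<dots> = 1" using exp_martingale_integrable(2)[OF l, of "real (N - k) * h"] h by simp
  moreover have "(LINT \<omega>|M. ?f (\<lambda>j. X (?u (min j k)) \<omega> - X 0 \<omega>)) =
    (LINT \<omega>|M. of_bool (c < X (real k * h) \<omega> \<and> (\<forall>j\<in>{1..<k}. \<not> c < X (real j * h) \<omega>)) * exp (l * X (real k * h) \<omega> - (real k * h) * \<psi> l))"
    by (rule integral_cong_AE) (use start_0 in \<open>auto elim!: eventually_mono simp del: of_bool_conj\<close>)
  moreover have "(LINT \<omega>|M. ?f (\<lambda>j. X (?u (min j k)) \<omega> - X 0 \<omega>) * ?g (\<lambda>j. X (?u k + ?u (min j (N - k))) \<omega> - X (?u k) \<omega>)) =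
    (LINT \<omega>|M. of_bool (c < X (real k * h) \<omega> \<and> (\<forall>j\<in>{1..<k}. \<not> c < X (real j * h) \<omega>)) * exp (l * X (real N * h) \<omega> - (real N * h) * \<psi> l))"
  proof (rule integral_cong_AE)
    have [measurable]: "X (?u k + ?u j) \<in> borel_measurable M" for j using h by (intro measurable_X) auto
    show "(\<lambda>\<omega>. ?f (\<lambda>j. X (?u (min j k)) \<omega> - X 0 \<omega>) * ?g (\<lambda>j. X (?u k + ?u (min j (N - k))) \<omega> - X (?u k) \<omega>)) \<in> borel_measurable M"
      "(\<lambda>\<omega>. of_bool (c < X (real k * h) \<omega> \<and> (\<forall>j\<in>{1..<k}. \<not> c < X (real j * h) \<omega>)) * exp (l * X (real N * h) \<omega> - (real N * h) * \<psi> l)) \<in> borel_measurable M"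
      by measurable
    show "AE \<omega> in M. ?f (\<lambda>j. X (?u (min j k)) \<omega> - X 0 \<omega>) * ?g (\<lambda>j. X (?u k + ?u (min j (N - k))) \<omega> - X (?u k) \<omega>) =
      of_bool (c < X (real k * h) \<omega> \<and> (\<forall>j\<in>{1..<k}. \<not> c < X (real j * h) \<omega>)) * exp (l * X (real N * h) \<omega> - (real N * h) * \<psi> l)"
      using start_0
    proof eventually_elim
      case (elim \<omega>)
      have b: "(c < X (?u (min k k)) \<omega> - X 0 \<omega> \<and> (\<forall>j\<in>{1..<k}. \<not> c < X (?u (min j k)) \<omega> - X 0 \<omega>)) =
        (c < X (real k * h) \<omega> \<and> (\<forall>j\<in>{1..<k}. \<not> c < X (real j * h) \<omega>))"
        using elim by (intro conj_cong ball_cong refl) (auto simp: min_def)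
      have "(l * X (real k * h) \<omega> - (real k * h) * \<psi> l) + (l * (X (real N * h) \<omega> - X (real k * h) \<omega>) - (real (N - k) * h) * \<psi> l)
        = l * X (real N * h) \<omega> - (real N * h) * \<psi> l" using k by (simp add: of_nat_diff algebra_simps)
      then have "exp (l * X (real k * h) \<omega> - (real k * h) * \<psi> l) * exp (l * (X (real N * h) \<omega> - X (real k * h) \<omega>) - (real (N - k) * h) * \<psi> l)
        = exp (l * X (real N * h) \<omega> - (real N * h) * \<psi> l)" by (simp only: exp_add[symmetric])
      then show ?case unfolding b using elim by (simp only: N min.idem mult.assoc diff_zero)
    qed
  qed
  ultimately show ?thesis by simp
qed

text \<open>
  Optional stopping at the first grid point above the level; in the limit of the mesh the
  \<open>L\<^sup>2\<close> bound needed for uniform integrability comes from the exponent \<open>2 * l\<close>.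
\<close>

lemma stopped_exponential:
  assumes l: "0 \<le> l" "0 \<le> \<psi> l" and c: "0 \<le> c" and t: "0 < t"
  shows "(LINT \<omega>|M. of_bool (\<not> alive c t (\<lambda>r. X r \<omega>)) * exp (l * X t \<omega> - t * \<psi> l)) =
    exp (l * c) * (LINT \<omega>|M. of_bool (\<not> alive c t (\<lambda>r. X r \<omega>)) * passage_discount (\<psi> l) c \<omega>)"
proof -
  define h where "h n = t / real (Suc n)" for n
  have h: "\<And>n. 0 < h n" "h \<longlonglongrightarrow> 0"
    unfolding h_def using t tendsto_mult[OF tendsto_const tendsto_one_over_Suc, of t] by auto
  have Nh: "real (Suc n) * h n = t" for n by (simp add: h_def)
  have Nh_le: "real k * h n \<le> t" if "k \<le> Suc n" for k n
  proof -
    have "real k * h n \<le> real (Suc n) * h n" using that h(1)[of n] by (intro mult_right_mono) auto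
    then show ?thesis by (simp only: Nh)
  qed
  have [measurable]: "X (real k * h n) \<in> borel_measurable M" "X t \<in> borel_measurable M" for k n
    using h(1)[of n] t by (auto intro!: measurable_X)
  note [measurable] = passage_discount_measurable[OF l(2)]
  define F where "F n k \<omega> \<longleftrightarrow> c < X (real k * h n) \<omega> \<and> (\<forall>j\<in>{1..<k}. \<not> c < X (real j * h n) \<omega>)" for n k \<omega>
  have [measurable]: "Measurable.pred M (F n k)" for n k unfolding F_def by measurable
  define m where "m l n k \<omega> = exp (l * X (real k * h n) \<omega> - (real k * h n) * \<psi> l)" for l n k \<omega>
  have [measurable]: "m l n k \<in> borel_measurable M" for l n k unfolding m_def by measurable
  define Z where "Z l n \<omega> = (\<Sum>k\<in>{1..Suc n}. of_bool (F n k \<omega>) * m l n k \<omega>)" for l n \<omega>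
  have mi: "integrable M (m l n k)" if "0 \<le> l" for l n k
    unfolding m_def using that h(1)[of n] by (intro exp_martingale_integrable) auto
  have Fmi: "integrable M (\<lambda>\<omega>. of_bool (F n k \<omega>) * m l n k' \<omega>)" if "0 \<le> l" for l n k k'
    by (rule Bochner_Integration.integrable_bound[OF mi[OF that, of n k']]) (auto simp: m_def)
  have Zi: "integrable M (Z l n)" if "0 \<le> l" for l n
    unfolding Z_def by (intro Bochner_Integration.integrable_sum) (rule Fmi[OF that])
  have EZ: "(LINT \<omega>|M. Z l n \<omega>) = (LINT \<omega>|M. of_bool (\<exists>k\<in>{1..Suc n}. c < X (real k * h n) \<omega>) * m l n (Suc n) \<omega>)" if "0 \<le> l" for l n
  proof -
    have "(LINT \<omega>|M. Z l n \<omega>) = (\<Sum>k\<in>{1..Suc n}. LINT \<omega>|M. of_bool (F n k \<omega>) * m l n k \<omega>)"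
      unfolding Z_def by (rule Bochner_Integration.integral_sum) (rule Fmi[OF that])
    also have "\<dots> = (\<Sum>k\<in>{1..Suc n}. LINT \<omega>|M. of_bool (F n k \<omega>) * m l n (Suc n) \<omega>)"
    proof (rule sum.cong[OF refl])
      fix k assume "k \<in> {1..Suc n}"
      then show "(LINT \<omega>|M. of_bool (F n k \<omega>) * m l n k \<omega>) = (LINT \<omega>|M. of_bool (F n k \<omega>) * m l n (Suc n) \<omega>)"
        unfolding F_def m_def by (intro grid_stopping[OF that h(1), symmetric]) auto
    qed
    also have "\<dots> = (LINT \<omega>|M. (\<Sum>k\<in>{1..Suc n}. of_bool (F n k \<omega>) * m l n (Suc n) \<omega>))"
      by (rule Bochner_Integration.integral_sum[symmetric]) (rule Fmi[OF that])
    also have "\<dots> = (LINT \<omega>|M. of_bool (\<exists>k\<in>{1..Suc n}. c < X (real k * h n) \<omega>) * m l n (Suc n) \<omega>)"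
    proof (intro Bochner_Integration.integral_cong refl)
      fix \<omega>
      show "(\<Sum>k\<in>{1..Suc n}. of_bool (F n k \<omega>) * m l n (Suc n) \<omega>) = of_bool (\<exists>k\<in>{1..Suc n}. c < X (real k * h n) \<omega>) * m l n (Suc n) \<omega>"
        using sum_of_bool_first[of "\<lambda>k. c < X (real k * h n) \<omega>" "Suc n"] by (simp only: F_def sum_distrib_right[symmetric])
    qed
    finally show ?thesis .
  qed
  \<comment> \<open>The square of the martingale for \<open>l\<close>, stopped at time
    \<open>s\<close>, is the one for \<open>2 * l\<close> times
    \<open>exp ((\<psi> (2 * l) - 2 * \<psi> l) * s)\<close>; for \<open>s\<close> between 0 and
    \<open>t\<close> the last factor is at most \<open>C\<close>.\<close>
  define C where "C = exp (\<bar>\<psi> (2 * l) - 2 * \<psi> l\<bar> * t)"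
  have Zsq: "(Z l n \<omega>)\<^sup>2 \<le> C * Z (2 * l) n \<omega>" for n \<omega>
  proof (cases rule: first_index_cases[of "Suc n" "\<lambda>k. c < X (real k * h n) \<omega>"])
    case none
    then have "Z l n \<omega> = 0" for l unfolding Z_def F_def by (intro sum.neutral) auto
    then show ?thesis by simp
  next
    case (some T)
    have Z: "Z l n \<omega> = m l n T \<omega>" for l
      unfolding Z_def F_def by (rule sum_first_index[OF some(1,2)]) (use some in auto)
    have Tt: "real T * h n \<le> t" "0 \<le> real T * h n" using Nh_le[OF some(2)] h(1)[of n] by auto
    have "(m l n T \<omega>)\<^sup>2 = exp ((\<psi> (2 * l) - 2 * \<psi> l) * (real T * h n)) * m (2 * l) n T \<omega>"
      unfolding m_def by (simp add: exp_double[symmetric] exp_add[symmetric] algebra_simps flip: exp_add)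
    also have "\<dots> \<le> C * m (2 * l) n T \<omega>"
    proof (rule mult_right_mono)
      have "(\<psi> (2 * l) - 2 * \<psi> l) * (real T * h n) \<le> \<bar>\<psi> (2 * l) - 2 * \<psi> l\<bar> * t"
        using Tt by (intro mult_mono) auto
      then show "exp ((\<psi> (2 * l) - 2 * \<psi> l) * (real T * h n)) \<le> C" by (simp add: C_def)
    qed (simp add: m_def)
    finally show ?thesis by (simp add: Z)
  qed
  have Zsqi: "integrable M (\<lambda>\<omega>. (Z l n \<omega>)\<^sup>2)" for n
  proof (rule Bochner_Integration.integrable_bound[where f = "\<lambda>\<omega>. C * Z (2 * l) n \<omega>"])
    show "integrable M (\<lambda>\<omega>. C * Z (2 * l) n \<omega>)" using Zi[of "2 * l" n] l by simp
    show "AE \<omega> in M. norm ((Z l n \<omega>)\<^sup>2) \<le> norm (C * Z (2 * l) n \<omega>)" using order_trans[OF Zsq abs_ge_self] by auto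
  qed (use Zi[OF l(1)] in measurable)
  have Zsqb: "(LINT \<omega>|M. (Z l n \<omega>)\<^sup>2) \<le> C" for n
  proof -
    have l2: "0 \<le> 2 * l" using l by simp
    have "(LINT \<omega>|M. (Z l n \<omega>)\<^sup>2) \<le> (LINT \<omega>|M. C * Z (2 * l) n \<omega>)"
      using Zsqi Zi[OF l2] Zsq by (intro integral_mono) auto
    also have "\<dots> = C * (LINT \<omega>|M. of_bool (\<exists>k\<in>{1..Suc n}. c < X (real k * h n) \<omega>) * m (2 * l) n (Suc n) \<omega>)"
      by (simp add: EZ[OF l2])
    also have "\<dots> \<le> C * (LINT \<omega>|M. m (2 * l) n (Suc n) \<omega>)"
    proof (intro mult_left_mono integral_mono mi l2)
      show "integrable M (\<lambda>\<omega>. of_bool (\<exists>k\<in>{1..Suc n}. c < X (real k * h n) \<omega>) * m (2 * l) n (Suc n) \<omega>)"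
      proof (rule Bochner_Integration.integrable_bound[OF mi[OF l2, of n "Suc n"]])
        have [simp]: "0 \<le> h n" using h(1)[of n] by simp
        show "(\<lambda>\<omega>. of_bool (\<exists>k\<in>{1..Suc n}. c < X (real k * h n) \<omega>) * m (2 * l) n (Suc n) \<omega>) \<in> borel_measurable M"
          by measurable
      qed (auto simp: m_def)
    qed (auto simp: m_def C_def)
    also have "\<dots> = C" unfolding m_def Nh using exp_martingale_integrable(2)[OF l2, of t] t by simp
    finally show ?thesis .
  qed
  have AEg: "AE \<omega> in M. (\<lambda>n. of_bool (\<exists>k\<in>{1..Suc n}. c < X (real k * h n) \<omega>) :: real) \<longlonglongrightarrow> of_bool (\<not> alive c t (\<lambda>r. X r \<omega>))"
  proof -
    have "AE \<omega> in M. \<omega> \<in> space M" by simp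
    then show ?thesis
    proof eventually_elim
      case (elim \<omega>)
      have "(\<lambda>n. 1 - of_bool (\<forall>j\<in>{1..Suc n}. X (real j * h n) \<omega> \<le> c) :: real) \<longlonglongrightarrow> 1 - of_bool (alive c t (\<lambda>r. X r \<omega>))"
        unfolding h_def by (intro tendsto_diff tendsto_const alive_grid_tendsto[OF right_cont_path[OF elim] t])
      moreover have "(1 - of_bool (\<forall>j\<in>{1..Suc n}. X (real j * h n) \<omega> \<le> c) :: real) = of_bool (\<exists>k\<in>{1..Suc n}. c < X (real k * h n) \<omega>)" for n
        by (auto simp: not_le)
      moreover have "(1 - of_bool (alive c t (\<lambda>r. X r \<omega>)) :: real) = of_bool (\<not> alive c t (\<lambda>r. X r \<omega>))" by simp
      ultimately show ?case by simp
    qed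
  qed
  have L1: "(\<lambda>n. LINT \<omega>|M. Z l n \<omega>) \<longlonglongrightarrow> (LINT \<omega>|M. of_bool (\<not> alive c t (\<lambda>r. X r \<omega>)) * exp (l * X t \<omega> - t * \<psi> l))"
    unfolding EZ[OF l(1)] m_def Nh
  proof (rule integral_dominated_convergence[where w = "\<lambda>\<omega>. exp (l * X t \<omega> - t * \<psi> l)"])
    show "integrable M (\<lambda>\<omega>. exp (l * X t \<omega> - t * \<psi> l))" using l t by (intro exp_martingale_integrable) auto
    show "AE \<omega> in M. (\<lambda>n. of_bool (\<exists>k\<in>{1..Suc n}. c < X (real k * h n) \<omega>) * exp (l * X t \<omega> - t * \<psi> l))
      \<longlonglongrightarrow> of_bool (\<not> alive c t (\<lambda>r. X r \<omega>)) * exp (l * X t \<omega> - t * \<psi> l)"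
      using AEg by eventually_elim (intro tendsto_mult tendsto_const)
  qed auto
  have L2: "(\<lambda>n. LINT \<omega>|M. Z l n \<omega>) \<longlonglongrightarrow> (LINT \<omega>|M. exp (l * c) * (of_bool (\<not> alive c t (\<lambda>r. X r \<omega>)) * passage_discount (\<psi> l) c \<omega>))"
  proof (rule bounded_second_moment_convergence[where C = C and B = "exp (l * c)"])
    show "0 \<le> Z l n \<omega>" for n \<omega> unfolding Z_def by (intro sum_nonneg) (auto simp: m_def)
    show "exp (l * c) * (of_bool (\<not> alive c t (\<lambda>r. X r \<omega>)) * passage_discount (\<psi> l) c \<omega>) \<le> exp (l * c)" for \<omega>
      using passage_discount_bounds[OF l(2), of c \<omega>] by auto
    show "AE \<omega> in M. (\<lambda>n. Z l n \<omega>) \<longlonglongrightarrow> exp (l * c) * (of_bool (\<not> alive c t (\<lambda>r. X r \<omega>)) * passage_discount (\<psi> l) c \<omega>)"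
      using AEg AE_fpt_value
    proof eventually_elim
      case (elim \<omega>)
      let ?w = "\<lambda>r. X r \<omega>"
      have w: "right_cont ?w" using elim by (intro right_cont_path) auto
      show ?case
      proof (cases "alive c t ?w")
        case True
        have "\<not> c < X (real k * h n) \<omega>" if k: "k \<in> {1..Suc n}" for n k
        proof -
          have "real k * h n \<le> t" "0 < real k * h n" using k h(1)[of n] Nh_le[of k n] by auto
          then show ?thesis using True unfolding alive_def by (meson not_le)
        qed
        then have "Z l n \<omega> = 0" for n unfolding Z_def F_def by (intro sum.neutral) auto
        then show ?thesis using True by simp
      next
        case False
        then have p: "passes c ?w" by (rule not_alive_imp_passes)
        define T where "T n = (LEAST j. 0 < j \<and> c < ?w (real j * h n))" for n
        note gp = grid_passage[OF w p h, folded T_def]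
        have "(\<lambda>n. exp (l * X (real (T n) * h n) \<omega> - (real (T n) * h n) * \<psi> l)) \<longlonglongrightarrow> exp (l * X (fpt c ?w) \<omega> - fpt c ?w * \<psi> l)"
          by (intro tendsto_intros gp)
        also have "exp (l * X (fpt c ?w) \<omega> - fpt c ?w * \<psi> l) = exp (l * c) * (of_bool (\<not> alive c t ?w) * passage_discount (\<psi> l) c \<omega>)"
          using elim(2) c p False by (simp add: passage_discount_eq exp_diff exp_minus field_simps)
        finally have lim: "(\<lambda>n. exp (l * X (real (T n) * h n) \<omega> - (real (T n) * h n) * \<psi> l)) \<longlonglongrightarrow> exp (l * c) * (of_bool (\<not> alive c t ?w) * passage_discount (\<psi> l) c \<omega>)" .
        have "\<forall>\<^sub>F n in sequentially. 1 / 2 < (of_bool (\<exists>k\<in>{1..Suc n}. c < X (real k * h n) \<omega>) :: real)"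
          using order_tendstoD(1)[OF elim(1), of "1/2"] False by simp
        then have "\<forall>\<^sub>F n in sequentially. exp (l * X (real (T n) * h n) \<omega> - (real (T n) * h n) * \<psi> l) = Z l n \<omega>"
          using gp(1)
        proof eventually_elim
          case (elim n)
          have "\<exists>k\<in>{1..Suc n}. c < X (real k * h n) \<omega>"
          proof (rule ccontr)
            assume "\<not> ?thesis"
            then show False using elim(1) by (simp only: of_bool_def if_False)
          qed
          then obtain k where k: "k \<in> {1..Suc n}" "c < X (real k * h n) \<omega>" by blast
          have "T n \<le> k" unfolding T_def using k by (intro Least_le) auto
          then have "Z l n \<omega> = m l n (T n) \<omega>"
            unfolding Z_def F_def using elim(2) k
            by (intro sum_first_index) (auto simp: T_def dest: not_less_Least)
          then show ?case by (simp add: m_def)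
        qed
        with lim show ?thesis by (rule Lim_transform_eventually)
      qed
    qed
  qed (use Zi[OF l(1)] Zsqi Zsqb in auto)
  from LIMSEQ_unique[OF L1 L2] show ?thesis by simp
qed

section \<open>Roots of the Laplace exponent and the transform of the passage time\<close>

abbreviation \<Phi> :: "real \<Rightarrow> real" where "\<Phi> \<equiv> right_inverse M X"

text \<open>As \<open>t\<close> grows in \<open>stopped_exponential\<close>, the contribution of
  paths that have not passed yet is at most \<open>exp (l * c - t * \<psi> l)\<close>, since these
  are below \<open>c\<close>; it vanishes because \<open>\<psi> l\<close> is strictly
  positive.\<close>

lemma passage_laplace_root:
  assumes l: "0 \<le> l" "0 < \<psi> l" and c: "0 \<le> c"
  shows "(LINT \<omega>|M. passage_discount (\<psi> l) c \<omega>) = exp (- (l * c))"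
proof -
  have pl: "0 \<le> \<psi> l" using l by simp
  note [measurable] = passage_discount_measurable[OF pl]
  have L1: "(\<lambda>n. LINT \<omega>|M. of_bool (\<not> alive c (real (Suc n)) (\<lambda>r. X r \<omega>)) * passage_discount (\<psi> l) c \<omega>) \<longlonglongrightarrow> (LINT \<omega>|M. passage_discount (\<psi> l) c \<omega>)"
  proof (rule integral_dominated_convergence[where w = "\<lambda>_. 1"])
    show "AE \<omega> in M. (\<lambda>n. of_bool (\<not> alive c (real (Suc n)) (\<lambda>r. X r \<omega>)) * passage_discount (\<psi> l) c \<omega>) \<longlonglongrightarrow> passage_discount (\<psi> l) c \<omega>"
    proof (rule AE_I2)
      fix \<omega>
      let ?w = "\<lambda>r. X r \<omega>"
      show "(\<lambda>n. of_bool (\<not> alive c (real (Suc n)) ?w) * passage_discount (\<psi> l) c \<omega>) \<longlonglongrightarrow> passage_discount (\<psi> l) c \<omega>"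
      proof (cases "passes c ?w")
        case True
        have "\<forall>\<^sub>F n in sequentially. fpt c ?w < real (Suc n)"
          using eventually_ge_at_top[of "nat \<lceil>fpt c ?w\<rceil>"] by eventually_elim linarith
        then have "\<forall>\<^sub>F n in sequentially. of_bool (\<not> alive c (real (Suc n)) ?w) * passage_discount (\<psi> l) c \<omega> = passage_discount (\<psi> l) c \<omega>"
          by eventually_elim (use alive_imp_le_fpt[OF True] in fastforce)
        then show ?thesis by (rule tendsto_eventually)
      next
        case False
        then show ?thesis by (simp add: passage_discount_eq)
      qed
    qed
  qed (use passage_discount_bounds[OF pl] in auto)
  have one: "1 - exp (l * c) * (LINT \<omega>|M. of_bool (\<not> alive c t (\<lambda>r. X r \<omega>)) * passage_discount (\<psi> l) c \<omega>) \<in> {0..exp (l * c - t * \<psi> l)}" if t: "0 < t" for t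
  proof -
    have [measurable]: "X t \<in> borel_measurable M" using t by simp
    have ei: "integrable M (\<lambda>\<omega>. exp (l * X t \<omega> - t * \<psi> l))" "(LINT \<omega>|M. exp (l * X t \<omega> - t * \<psi> l)) = 1"
      using exp_martingale_integrable[OF l(1), of t] t by auto
    have i: "integrable M (\<lambda>\<omega>. of_bool (P \<omega>) * exp (l * X t \<omega> - t * \<psi> l))" if [measurable]: "Measurable.pred M P" for P
      by (rule Bochner_Integration.integrable_bound[OF ei(1)]) auto
    have "1 = (LINT \<omega>|M. of_bool (\<not> alive c t (\<lambda>r. X r \<omega>)) * exp (l * X t \<omega> - t * \<psi> l) + of_bool (alive c t (\<lambda>r. X r \<omega>)) * exp (l * X t \<omega> - t * \<psi> l))"
      unfolding ei(2)[symmetric] by (intro Bochner_Integration.integral_cong) auto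
    also have "\<dots> = (LINT \<omega>|M. of_bool (\<not> alive c t (\<lambda>r. X r \<omega>)) * exp (l * X t \<omega> - t * \<psi> l)) + (LINT \<omega>|M. of_bool (alive c t (\<lambda>r. X r \<omega>)) * exp (l * X t \<omega> - t * \<psi> l))"
      by (rule Bochner_Integration.integral_add) (rule i; measurable)+
    finally have "1 - exp (l * c) * (LINT \<omega>|M. of_bool (\<not> alive c t (\<lambda>r. X r \<omega>)) * passage_discount (\<psi> l) c \<omega>) =
      (LINT \<omega>|M. of_bool (alive c t (\<lambda>r. X r \<omega>)) * exp (l * X t \<omega> - t * \<psi> l))"
      using stopped_exponential[OF l(1) pl c t] by simp
    moreover have "0 \<le> (LINT \<omega>|M. of_bool (alive c t (\<lambda>r. X r \<omega>)) * exp (l * X t \<omega> - t * \<psi> l))"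
      by (intro integral_nonneg_AE) auto
    moreover have "(LINT \<omega>|M. of_bool (alive c t (\<lambda>r. X r \<omega>)) * exp (l * X t \<omega> - t * \<psi> l)) \<le> exp (l * c - t * \<psi> l)"
    proof (rule integral_le_const)
      show "integrable M (\<lambda>\<omega>. of_bool (alive c t (\<lambda>r. X r \<omega>)) * exp (l * X t \<omega> - t * \<psi> l))" by (rule i) measurable
      show "AE \<omega> in M. of_bool (alive c t (\<lambda>r. X r \<omega>)) * exp (l * X t \<omega> - t * \<psi> l) \<le> exp (l * c - t * \<psi> l)"
        using t l by (intro AE_I2) (auto simp: alive_def intro!: mult_left_mono)
    qed
    ultimately show ?thesis by simp
  qed
  have "(\<lambda>n. exp (l * c - real (Suc n) * \<psi> l)) \<longlonglongrightarrow> 0"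
  proof (rule filterlim_compose[OF exp_at_bot], rule filterlim_at_bot[THEN iffD2], intro allI)
    fix K
    show "\<forall>\<^sub>F n in sequentially. l * c - real (Suc n) * \<psi> l \<le> K"
      using eventually_ge_at_top[of "nat \<lceil>(l * c - K) / \<psi> l\<rceil>"]
    proof eventually_elim
      case (elim n)
      then have "(l * c - K) / \<psi> l \<le> real (Suc n)" by linarith
      then show ?case using l by (simp add: pos_divide_le_eq algebra_simps)
    qed
  qed
  then have "(\<lambda>n. 1 - exp (l * c) * (LINT \<omega>|M. of_bool (\<not> alive c (real (Suc n)) (\<lambda>r. X r \<omega>)) * passage_discount (\<psi> l) c \<omega>)) \<longlonglongrightarrow> 0"
    by (rule tendsto_sandwich[rotated -1, where f = "\<lambda>_. 0"]) (use one in auto)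
  moreover have "(\<lambda>n. 1 - exp (l * c) * (LINT \<omega>|M. of_bool (\<not> alive c (real (Suc n)) (\<lambda>r. X r \<omega>)) * passage_discount (\<psi> l) c \<omega>)) \<longlonglongrightarrow> 1 - exp (l * c) * (LINT \<omega>|M. passage_discount (\<psi> l) c \<omega>)"
    by (intro tendsto_intros L1)
  ultimately have "1 - exp (l * c) * (LINT \<omega>|M. passage_discount (\<psi> l) c \<omega>) = 0" by (rule LIMSEQ_unique[rotated])
  then show ?thesis by (simp add: exp_minus field_simps)
qed


lemma laplace_root_exists:
  assumes "0 \<le> a" "\<psi> a \<le> q"
  shows "\<exists>l\<ge>a. \<psi> l = q"
proof -
  have "\<forall>\<^sub>F l in at_top. q \<le> \<psi> l" using laplace_exponent_at_top by (simp add: filterlim_at_top)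
  moreover have "\<forall>\<^sub>F l in at_top. a \<le> l" by (rule eventually_ge_at_top)
  ultimately have "\<forall>\<^sub>F l in at_top. q \<le> \<psi> l \<and> a \<le> l" by (rule eventually_conj)
  then obtain b where b: "q \<le> \<psi> b" "a \<le> b" using eventually_happens trivial_limit_at_top_linorder by blast
  have "continuous_on {a..b} \<psi>" using laplace_exponent_continuous by (rule continuous_on_subset) (use assms in auto)
  from IVT'[OF assms(2) b(1,2) this] show ?thesis by blast
qed

text \<open>The supremum is attained because \<open>\<psi>\<close> is continuous and the set of
  roots is bounded. Beyond it \<open>\<psi>\<close> cannot be at most \<open>q\<close>: as
  \<open>\<psi>\<close> tends to infinity, the intermediate value theorem would yield a larger
  root.\<close>

lemma right_inverse_root:
  assumes q: "0 \<le> q"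
  shows "0 \<le> \<Phi> q" "\<psi> (\<Phi> q) = q" "\<And>l. \<Phi> q < l \<Longrightarrow> q < \<psi> l"
proof -
  let ?S = "{l. 0 \<le> l \<and> \<psi> l = q}"
  have ne: "?S \<noteq> {}" using laplace_root_exists[of 0 q] q laplace_exponent_zero by auto
  have bdd: "bdd_above ?S"
  proof -
    have "\<forall>\<^sub>F l in at_top. q + 1 \<le> \<psi> l" using laplace_exponent_at_top by (simp add: filterlim_at_top)
    then obtain b where "\<And>l. b \<le> l \<Longrightarrow> q + 1 \<le> \<psi> l" by (auto simp: eventually_at_top_linorder)
    note b = this
    have "l \<le> b" if "l \<in> ?S" for l
    proof (rule ccontr)
      assume "\<not> l \<le> b"
      then show False using b[of l] that by simp
    qed
    then show ?thesis by (intro bdd_aboveI[of _ b])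
  qed
  have "closed ({0..} \<inter> \<psi> -` {q})"
    by (rule continuous_closed_preimage[OF laplace_exponent_continuous]) auto
  moreover have "{0..} \<inter> \<psi> -` {q} = ?S" by auto
  ultimately have "Sup ?S \<in> ?S" using closed_contains_Sup[OF ne bdd] by simp
  then show 1: "0 \<le> \<Phi> q" "\<psi> (\<Phi> q) = q" by (auto simp: right_inverse_def)
  fix l assume l: "\<Phi> q < l"
  show "q < \<psi> l"
  proof (rule ccontr)
    assume "\<not> q < \<psi> l"
    then obtain l' where l': "l \<le> l'" "\<psi> l' = q" using laplace_root_exists[of l q] l 1 by auto
    then have "l' \<le> \<Phi> q" unfolding right_inverse_def using l 1 by (intro cSup_upper bdd) auto
    then show False using l l' by simp
  qed
qed

lemma right_inverse_mono:
  assumes "0 \<le> p" "p < q" shows "\<Phi> p < \<Phi> q"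
proof (rule ccontr)
  assume "\<not> \<Phi> p < \<Phi> q"
  then have "\<Phi> p = \<Phi> q \<or> \<Phi> q < \<Phi> p" by auto
  then have "q \<le> \<psi> (\<Phi> p)" using right_inverse_root(2,3)[of q] assms by (metis less_imp_le order_refl order_trans)
  then show False using right_inverse_root(2)[of p] assms by simp
qed

text \<open>The values decrease to a limit at which \<open>\<psi>\<close> vanishes by continuity. It
  is at least \<open>\<Phi> 0\<close>, and \<open>\<Phi> 0\<close> is the largest root. This is what
  carries the passage transform over to the rate 0, where \<open>\<psi> l\<close> is no longer
  strictly positive.\<close>

lemma right_inverse_tendsto_zero: "(\<lambda>n. \<Phi> (1 / real (Suc n))) \<longlonglongrightarrow> \<Phi> 0"
proof -
  have dec: "decseq (\<lambda>n. \<Phi> (1 / real (Suc n)))"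
  proof (rule decseq_SucI)
    fix n show "\<Phi> (1 / real (Suc (Suc n))) \<le> \<Phi> (1 / real (Suc n))"
      by (intro less_imp_le right_inverse_mono) (auto simp: field_simps)
  qed
  have lb: "\<Phi> 0 \<le> \<Phi> (1 / real (Suc n))" for n by (rule less_imp_le[OF right_inverse_mono]) auto
  obtain L where L: "(\<lambda>n. \<Phi> (1 / real (Suc n))) \<longlonglongrightarrow> L" using decseq_convergent[OF dec, of "\<Phi> 0"] lb by (metis (no_types, lifting))
  have LL: "\<Phi> 0 \<le> L" using L lb by (intro LIMSEQ_le_const) auto
  have L0: "0 \<le> L" using LL right_inverse_root(1)[of 0] by simp
  have "(\<lambda>n. \<psi> (\<Phi> (1 / real (Suc n)))) \<longlonglongrightarrow> \<psi> L"
    by (rule continuous_on_tendsto_compose[OF laplace_exponent_continuous L]) (use L0 right_inverse_root(1) in auto)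
  moreover have "\<psi> (\<Phi> (1 / real (Suc n))) = 1 / real (Suc n)" for n by (rule right_inverse_root) simp
  ultimately have "(\<lambda>n. 1 / real (Suc n)) \<longlonglongrightarrow> \<psi> L" by (simp only:)
  then have "\<psi> L = 0" using tendsto_one_over_Suc by (rule LIMSEQ_unique)
  then have "\<not> \<Phi> 0 < L" using right_inverse_root(3)[of 0 L] by auto
  then show ?thesis using L LL by simp
qed

lemma passage_laplace:
  assumes q: "0 \<le> q" and c: "0 \<le> c"
  shows "(LINT \<omega>|M. passage_discount q c \<omega>) = exp (- (\<Phi> q * c))"
proof (cases "q = 0")
  case False
  then show ?thesis using passage_laplace_root[of "\<Phi> q" c] right_inverse_root[OF q] q c by simp
next
  case True
  have lim: "(\<lambda>n. LINT \<omega>|M. passage_discount (1 / real (Suc n)) c \<omega>) \<longlonglongrightarrow> (LINT \<omega>|M. passage_discount 0 c \<omega>)"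
  proof (rule integral_dominated_convergence[where w = "\<lambda>_. 1"])
    show "AE \<omega> in M. (\<lambda>n. passage_discount (1 / real (Suc n)) c \<omega>) \<longlonglongrightarrow> passage_discount 0 c \<omega>"
      unfolding passage_discount_eq by (intro AE_I2 tendsto_intros tendsto_one_over_Suc)
  qed (use passage_discount_bounds passage_discount_measurable in \<open>auto simp: abs_of_nonneg\<close>)
  have eq: "(LINT \<omega>|M. passage_discount (1 / real (Suc n)) c \<omega>) = exp (- (\<Phi> (1 / real (Suc n)) * c))" for n
    using passage_laplace_root[of "\<Phi> (1 / real (Suc n))" c] right_inverse_root[of "1 / real (Suc n)"] c by simp
  have "(\<lambda>n. exp (- (\<Phi> (1 / real (Suc n)) * c))) \<longlonglongrightarrow> exp (- (\<Phi> 0 * c))"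
    by (intro tendsto_intros right_inverse_tendsto_zero)
  with lim[unfolded eq] show ?thesis unfolding True by (rule LIMSEQ_unique)
qed

text \<open>Level 0 and rate 1 in \<open>passage_laplace\<close> give mean 1 to a variable bounded
  by 1, so the discount is 1 almost surely and the passage time is 0. In other words, 0 is regular
  for the open upper half-line.\<close>

lemma AE_regular: "AE \<omega> in M. passes 0 (\<lambda>r. X r \<omega>) \<and> fpt 0 (\<lambda>r. X r \<omega>) = 0"
proof -
  have i: "integrable M (\<lambda>\<omega>. 1 - passage_discount 1 0 \<omega>)" using passage_discount_integrable[of 1 0] by simp
  have "(LINT \<omega>|M. 1 - passage_discount 1 0 \<omega>) = 0"
    using passage_laplace[of 1 0] passage_discount_integrable[of 1 0] by (simp add: prob_space)
  then have "AE \<omega> in M. 1 - passage_discount 1 0 \<omega> = 0"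
    using i passage_discount_bounds[of 1 0] by (subst (asm) integral_nonneg_eq_0_iff_AE) auto
  then show ?thesis
    by eventually_elim (auto simp: passage_discount_eq of_bool_def split: if_splits)
qed

section \<open>Potential measures and their Laplace transforms\<close>

definition potential :: "real \<Rightarrow> real \<Rightarrow> real measure" where
  "potential p c = distr (density (lborel \<Otimes>\<^sub>M M) (\<lambda>(t, \<omega>). ennreal (of_bool (0 < t \<and> alive c t (\<lambda>r. X r \<omega>)) * exp (- p * t))))
     borel (\<lambda>(t, \<omega>). X (max 0 t) \<omega>)"

lemma sets_potential [simp, measurable_cong]: "sets (potential p c) = sets borel" "space (potential p c) = UNIV"
  by (simp_all add: potential_def)

lemma joint_path_measurable [measurable]: "(\<lambda>z. X (max 0 (fst z)) (snd z)) \<in> borel_measurable (borel \<Otimes>\<^sub>M M)"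
  by (rule joint_measurable) measurable

lemma joint_alive_measurable [measurable]:
  "(\<lambda>z. of_bool (alive c (fst z) (\<lambda>r. y + X r (snd z))) :: real) \<in> borel_measurable (lborel \<Otimes>\<^sub>M M)"
  by (rule alive_measurable) measurable

lemma joint_alive_measurable0 [measurable]:
  "(\<lambda>z. of_bool (0 < fst z \<and> alive c (fst z) (\<lambda>r. X r (snd z))) :: real) \<in> borel_measurable (lborel \<Otimes>\<^sub>M M)"
proof -
  have [measurable]: "(\<lambda>z. of_bool (alive c (fst z) (\<lambda>r. X r (snd z))) :: real) \<in> borel_measurable (lborel \<Otimes>\<^sub>M M)"
    using joint_alive_measurable[of c 0] by simp
  have "(\<lambda>z. of_bool (0 < fst z) * of_bool (alive c (fst z) (\<lambda>r. X r (snd z))) :: real) \<in> borel_measurable (lborel \<Otimes>\<^sub>M M)"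
    by measurable
  then show ?thesis by (simp add: of_bool_conj)
qed

text \<open>The order with \<open>t\<close> outside meets the Markov property at a fixed time; the
  order with the path outside meets pathwise integrals over time. Nonnegative integrals are used
  because the potential can be infinite.\<close>

lemma nn_integral_potential:
  assumes [measurable]: "f \<in> borel_measurable borel"
  shows "(\<integral>\<^sup>+y. f y \<partial>potential p c) = (\<integral>\<^sup>+t. \<integral>\<^sup>+\<omega>. ennreal (of_bool (0 < t \<and> alive c t (\<lambda>r. X r \<omega>)) * exp (- p * t)) * f (X (max 0 t) \<omega>) \<partial>M \<partial>lborel)"
    and "(\<integral>\<^sup>+y. f y \<partial>potential p c) = (\<integral>\<^sup>+\<omega>. \<integral>\<^sup>+t. ennreal (of_bool (0 < t \<and> alive c t (\<lambda>r. X r \<omega>)) * exp (- p * t)) * f (X (max 0 t) \<omega>) \<partial>lborel \<partial>M)"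
proof -
  interpret P: pair_sigma_finite lborel M ..
  let ?g = "\<lambda>z. ennreal (of_bool (0 < fst z \<and> alive c (fst z) (\<lambda>r. X r (snd z))) * exp (- p * fst z)) * f (X (max 0 (fst z)) (snd z))"
  have [measurable]: "?g \<in> borel_measurable (lborel \<Otimes>\<^sub>M M)" by measurable
  have 0: "(\<integral>\<^sup>+y. f y \<partial>potential p c) = (\<integral>\<^sup>+z. ?g z \<partial>(lborel \<Otimes>\<^sub>M M))"
    unfolding potential_def case_prod_beta' by (subst nn_integral_distr, measurable, subst nn_integral_density, measurable)
  show "(\<integral>\<^sup>+y. f y \<partial>potential p c) = (\<integral>\<^sup>+t. \<integral>\<^sup>+\<omega>. ennreal (of_bool (0 < t \<and> alive c t (\<lambda>r. X r \<omega>)) * exp (- p * t)) * f (X (max 0 t) \<omega>) \<partial>M \<partial>lborel)"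
    unfolding 0 by (subst nn_integral_fst[symmetric]) auto
  show "(\<integral>\<^sup>+y. f y \<partial>potential p c) = (\<integral>\<^sup>+\<omega>. \<integral>\<^sup>+t. ennreal (of_bool (0 < t \<and> alive c t (\<lambda>r. X r \<omega>)) * exp (- p * t)) * f (X (max 0 t) \<omega>) \<partial>lborel \<partial>M)"
    unfolding 0 by (subst P.nn_integral_snd[symmetric]) auto
qed

lemma alive_time_integral:
  assumes p: "passes c w" and a: "a \<noteq> 0"
  shows "(\<integral>\<^sup>+t. ennreal (of_bool (0 < t \<and> alive c t w) * exp (a * t)) \<partial>lborel) = ennreal ((exp (a * fpt c w) - 1) / a)"
proof -
  have "(\<integral>\<^sup>+t. ennreal (of_bool (0 < t \<and> alive c t w) * exp (a * t)) \<partial>lborel) = (\<integral>\<^sup>+t. ennreal (exp (a * t)) * indicator {0..fpt c w} t \<partial>lborel)"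
  proof (rule nn_integral_cong_AE)
    have "AE t in lborel. t \<noteq> 0 \<and> t \<noteq> fpt c w" using AE_lborel_singleton[of 0] AE_lborel_singleton[of "fpt c w"] by auto
    then show "AE t in lborel. ennreal (of_bool (0 < t \<and> alive c t w) * exp (a * t)) = ennreal (exp (a * t)) * indicator {0..fpt c w} t"
    proof eventually_elim
      case (elim t)
      have "(0 < t \<and> alive c t w) = (t \<in> {0..fpt c w})"
        using elim alive_before_fpt[of t c w] alive_imp_le_fpt[OF p, of t] by auto
      then show ?case by (auto simp: indicator_def of_bool_def)
    qed
  qed
  also have "\<dots> = ennreal (exp (a * fpt c w) / a - exp (a * 0) / a)"
    by (rule nn_integral_FTC_Icc) (use a fpt_nonneg[OF p] in \<open>auto intro!: derivative_eq_intros\<close>)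
  finally show ?thesis by (simp add: diff_divide_distrib)
qed

text \<open>For fixed \<open>t\<close>, \<open>stopped_exponential\<close> and the full passage
  transform show that on paths still below \<open>c\<close> the martingale may be replaced by its
  value at the future passage time. Afterwards only time is left in the integral: up to the passage
  time \<open>s\<close>, the function \<open>exp ((\<psi> l - p) * t)\<close> integrates to a
  difference quotient, and what remains is \<open>exp (l * c)\<close> times the difference of the
  discounts at the rates \<open>p\<close> and \<open>\<psi> l\<close>, divided by
  \<open>\<psi> l - p\<close>.\<close>

lemma potential_laplace:
  assumes p: "0 \<le> p" and c: "0 \<le> c" and l: "\<Phi> p < l"
  shows "(\<integral>\<^sup>+y. ennreal (exp (l * y)) \<partial>potential p c) = ennreal ((exp ((l - \<Phi> p) * c) - 1) / (\<psi> l - p))"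
proof -
  interpret P: pair_sigma_finite lborel M ..
  have l0: "0 \<le> l" using right_inverse_root(1)[OF p] l by simp
  have pl: "p < \<psi> l" using right_inverse_root(3)[OF p l] .
  then have l1: "0 < \<psi> l" "0 \<le> \<psi> l" using p by auto
  note [measurable] = passage_discount_measurable[OF l1(2)] passage_discount_measurable[OF p]
  let ?a = "\<psi> l - p"
  have a: "0 < ?a" using pl by simp
  have E: "(LINT \<omega>|M. passage_discount (\<psi> l) c \<omega>) = exp (- (l * c))" using passage_laplace_root[OF l0 l1(1) c] .
  \<comment> \<open>The exchange at fixed \<open>t\<close>, written with nonnegative integrals so
    that the order of integration can be changed next.\<close>
  have step: "(\<integral>\<^sup>+\<omega>. ennreal (of_bool (0 < t \<and> alive c t (\<lambda>r. X r \<omega>)) * exp (- p * t)) * ennreal (exp (l * X (max 0 t) \<omega>)) \<partial>M) =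
     (\<integral>\<^sup>+\<omega>. ennreal (exp (l * c) * passage_discount (\<psi> l) c \<omega>) * ennreal (of_bool (0 < t \<and> alive c t (\<lambda>r. X r \<omega>)) * exp (?a * t)) \<partial>M)" for t
  proof (cases "0 < t")
    case True
    have [measurable]: "X t \<in> borel_measurable M" using True by simp
    have ei: "integrable M (\<lambda>\<omega>. exp (l * X t \<omega> - t * \<psi> l))" "(LINT \<omega>|M. exp (l * X t \<omega> - t * \<psi> l)) = 1"
      using exp_martingale_integrable[OF l0, of t] True by auto
    have i: "integrable M (\<lambda>\<omega>. of_bool (P \<omega>) * exp (l * X t \<omega> - t * \<psi> l))" if [measurable]: "Measurable.pred M P" for P
      by (rule Bochner_Integration.integrable_bound[OF ei(1)]) auto
    have j: "integrable M (\<lambda>\<omega>. of_bool (P \<omega>) * passage_discount (\<psi> l) c \<omega>)" if [measurable]: "Measurable.pred M P" for P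
      by (rule integrable_const_bound[of _ 1]) (use passage_discount_bounds[OF l1(2)] in auto)
    let ?A = "\<lambda>\<omega>. alive c t (\<lambda>r. X r \<omega>)"
    have s1: "(LINT \<omega>|M. of_bool (?A \<omega>) * exp (l * X t \<omega> - t * \<psi> l)) + (LINT \<omega>|M. of_bool (\<not> ?A \<omega>) * exp (l * X t \<omega> - t * \<psi> l)) = 1"
    proof -
      have "(LINT \<omega>|M. of_bool (?A \<omega>) * exp (l * X t \<omega> - t * \<psi> l)) + (LINT \<omega>|M. of_bool (\<not> ?A \<omega>) * exp (l * X t \<omega> - t * \<psi> l)) =
        (LINT \<omega>|M. of_bool (?A \<omega>) * exp (l * X t \<omega> - t * \<psi> l) + of_bool (\<not> ?A \<omega>) * exp (l * X t \<omega> - t * \<psi> l))"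
        by (rule Bochner_Integration.integral_add[symmetric]) (rule i; measurable)+
      also have "\<dots> = 1" unfolding ei(2)[symmetric] by (intro Bochner_Integration.integral_cong) auto
      finally show ?thesis .
    qed
    have s2: "(LINT \<omega>|M. of_bool (?A \<omega>) * passage_discount (\<psi> l) c \<omega>) + (LINT \<omega>|M. of_bool (\<not> ?A \<omega>) * passage_discount (\<psi> l) c \<omega>) = exp (- (l * c))"
    proof -
      have "(LINT \<omega>|M. of_bool (?A \<omega>) * passage_discount (\<psi> l) c \<omega>) + (LINT \<omega>|M. of_bool (\<not> ?A \<omega>) * passage_discount (\<psi> l) c \<omega>) =
        (LINT \<omega>|M. of_bool (?A \<omega>) * passage_discount (\<psi> l) c \<omega> + of_bool (\<not> ?A \<omega>) * passage_discount (\<psi> l) c \<omega>)"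
        by (rule Bochner_Integration.integral_add[symmetric]) (rule j; measurable)+
      also have "\<dots> = exp (- (l * c))" unfolding E[symmetric] by (intro Bochner_Integration.integral_cong) auto
      finally show ?thesis .
    qed
    have "exp (l * c) * exp (- (l * c)) = 1" by (simp add: exp_minus)
    then have key: "(LINT \<omega>|M. of_bool (?A \<omega>) * exp (l * X t \<omega> - t * \<psi> l)) = exp (l * c) * (LINT \<omega>|M. of_bool (?A \<omega>) * passage_discount (\<psi> l) c \<omega>)"
      using s1 arg_cong[OF s2, of "\<lambda>z. exp (l * c) * z"] stopped_exponential[OF l0 l1(2) c True] by (simp add: distrib_left)
    have "(\<integral>\<^sup>+\<omega>. ennreal (of_bool (0 < t \<and> ?A \<omega>) * exp (- p * t)) * ennreal (exp (l * X (max 0 t) \<omega>)) \<partial>M) =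
      (\<integral>\<^sup>+\<omega>. ennreal (exp (?a * t) * (of_bool (?A \<omega>) * exp (l * X t \<omega> - t * \<psi> l))) \<partial>M)"
    proof (intro nn_integral_cong)
      fix \<omega>
      have "exp (- p * t) * exp (l * X t \<omega>) = exp (?a * t) * exp (l * X t \<omega> - t * \<psi> l)"
        unfolding exp_add[symmetric] by (simp add: algebra_simps)
      then show "ennreal (of_bool (0 < t \<and> ?A \<omega>) * exp (- p * t)) * ennreal (exp (l * X (max 0 t) \<omega>)) = ennreal (exp (?a * t) * (of_bool (?A \<omega>) * exp (l * X t \<omega> - t * \<psi> l)))"
        using True by (cases "?A \<omega>") (simp_all add: ennreal_mult[symmetric])
    qed
    also have "\<dots> = ennreal (LINT \<omega>|M. exp (?a * t) * (of_bool (?A \<omega>) * exp (l * X t \<omega> - t * \<psi> l)))"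
      by (rule nn_integral_eq_integral) (auto intro!: integrable_mult_right i)
    also have "(LINT \<omega>|M. exp (?a * t) * (of_bool (?A \<omega>) * exp (l * X t \<omega> - t * \<psi> l))) = (LINT \<omega>|M. exp (?a * t) * exp (l * c) * (of_bool (?A \<omega>) * passage_discount (\<psi> l) c \<omega>))"
      unfolding integral_mult_right_zero key by simp
    also have "ennreal \<dots> = (\<integral>\<^sup>+\<omega>. ennreal (exp (?a * t) * exp (l * c) * (of_bool (?A \<omega>) * passage_discount (\<psi> l) c \<omega>)) \<partial>M)"
      by (rule nn_integral_eq_integral[symmetric]) (use passage_discount_bounds[OF l1(2)] in \<open>auto intro!: integrable_mult_right j mult_nonneg_nonneg\<close>)
    also have "\<dots> = (\<integral>\<^sup>+\<omega>. ennreal (exp (l * c) * passage_discount (\<psi> l) c \<omega>) * ennreal (of_bool (0 < t \<and> ?A \<omega>) * exp (?a * t)) \<partial>M)"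
      using True passage_discount_bounds[OF l1(2)] by (intro nn_integral_cong) (auto simp: ennreal_mult[symmetric] mult_ac)
    finally show ?thesis .
  qed simp
  have "(\<integral>\<^sup>+y. ennreal (exp (l * y)) \<partial>potential p c) =
    (\<integral>\<^sup>+t. \<integral>\<^sup>+\<omega>. ennreal (exp (l * c) * passage_discount (\<psi> l) c \<omega>) * ennreal (of_bool (0 < t \<and> alive c t (\<lambda>r. X r \<omega>)) * exp (?a * t)) \<partial>M \<partial>lborel)"
    by (subst nn_integral_potential(1), measurable, simp only: step)
  also have "\<dots> = (\<integral>\<^sup>+\<omega>. \<integral>\<^sup>+t. ennreal (exp (l * c) * passage_discount (\<psi> l) c \<omega>) * ennreal (of_bool (0 < t \<and> alive c t (\<lambda>r. X r \<omega>)) * exp (?a * t)) \<partial>lborel \<partial>M)"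
    by (rule P.Fubini'[symmetric]) (unfold case_prod_beta', measurable)
  also have "\<dots> = (\<integral>\<^sup>+\<omega>. ennreal (exp (l * c) / ?a * (passage_discount p c \<omega> - passage_discount (\<psi> l) c \<omega>)) \<partial>M)"
  proof (intro nn_integral_cong)
    fix \<omega> assume \<omega>: "\<omega> \<in> space M"
    let ?w = "\<lambda>r. X r \<omega>"
    have m: "(\<lambda>t. ennreal (of_bool (0 < t \<and> alive c t ?w) * exp (?a * t))) \<in> borel_measurable lborel"
    proof -
      have "(\<lambda>t. of_bool (alive c t (\<lambda>r. 0 + X r \<omega>)) :: real) \<in> borel_measurable lborel"
        by (rule alive_measurable) (use \<omega> in measurable)
      then have [measurable]: "(\<lambda>t. of_bool (alive c t ?w) :: real) \<in> borel_measurable lborel" by simp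
      have "(\<lambda>t. ennreal (of_bool (0 < t) * of_bool (alive c t ?w) * exp (?a * t))) \<in> borel_measurable lborel" by measurable
      then show ?thesis by (simp add: of_bool_conj)
    qed
    have "(\<integral>\<^sup>+t. ennreal (exp (l * c) * passage_discount (\<psi> l) c \<omega>) * ennreal (of_bool (0 < t \<and> alive c t ?w) * exp (?a * t)) \<partial>lborel) =
      ennreal (exp (l * c) * passage_discount (\<psi> l) c \<omega>) * (\<integral>\<^sup>+t. ennreal (of_bool (0 < t \<and> alive c t ?w) * exp (?a * t)) \<partial>lborel)"
      using m by (rule nn_integral_cmult)
    also have "\<dots> = ennreal (exp (l * c) / ?a * (passage_discount p c \<omega> - passage_discount (\<psi> l) c \<omega>))"
    proof (cases "passes c ?w")
      case True
      let ?t = "fpt c ?w"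
      have e: "exp (- (\<psi> l * ?t)) * exp (?a * ?t) = exp (- (p * ?t))" unfolding exp_add[symmetric] by (simp add: algebra_simps)
      have "(exp (l * c) * exp (- (\<psi> l * ?t))) * ((exp (?a * ?t) - 1) / ?a) = exp (l * c) / ?a * (exp (- (\<psi> l * ?t)) * exp (?a * ?t) - exp (- (\<psi> l * ?t)))"
        using a by (simp add: field_simps)
      also have "\<dots> = exp (l * c) / ?a * (exp (- (p * ?t)) - exp (- (\<psi> l * ?t)))" by (simp only: e)
      finally have fin: "(exp (l * c) * exp (- (\<psi> l * ?t))) * ((exp (?a * ?t) - 1) / ?a) = exp (l * c) / ?a * (exp (- (p * ?t)) - exp (- (\<psi> l * ?t)))" .
      have pd: "passage_discount q c \<omega> = exp (- (q * ?t))" for q using True by (simp add: passage_discount_eq)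
      have "ennreal (exp (l * c) * exp (- (\<psi> l * ?t))) * ennreal ((exp (?a * ?t) - 1) / ?a) =
        ennreal ((exp (l * c) * exp (- (\<psi> l * ?t))) * ((exp (?a * ?t) - 1) / ?a))"
        by (rule ennreal_mult[symmetric]) (use a fpt_nonneg[OF True] in auto)
      then show ?thesis
        unfolding alive_time_integral[OF True less_imp_neq[OF a, symmetric]] pd by (simp only: fin)
    qed (simp add: passage_discount_eq)
    finally show "(\<integral>\<^sup>+t. ennreal (exp (l * c) * passage_discount (\<psi> l) c \<omega>) * ennreal (of_bool (0 < t \<and> alive c t ?w) * exp (?a * t)) \<partial>lborel) =
      ennreal (exp (l * c) / ?a * (passage_discount p c \<omega> - passage_discount (\<psi> l) c \<omega>))" .
  qed
  also have "\<dots> = ennreal (LINT \<omega>|M. exp (l * c) / ?a * (passage_discount p c \<omega> - passage_discount (\<psi> l) c \<omega>))"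
  proof (rule nn_integral_eq_integral)
    show "integrable M (\<lambda>\<omega>. exp (l * c) / ?a * (passage_discount p c \<omega> - passage_discount (\<psi> l) c \<omega>))"
      using passage_discount_integrable[OF p, of c] passage_discount_integrable[OF l1(2), of c] by simp
    have "passage_discount (\<psi> l) c \<omega> \<le> passage_discount p c \<omega>" for \<omega>
      using pl fpt_nonneg[of c "\<lambda>r. X r \<omega>"] by (auto simp: passage_discount_eq of_bool_def intro!: mult_right_mono)
    then show "AE \<omega> in M. 0 \<le> exp (l * c) / ?a * (passage_discount p c \<omega> - passage_discount (\<psi> l) c \<omega>)"
      using a by (intro AE_I2 mult_nonneg_nonneg) auto
  qed
  also have "(LINT \<omega>|M. exp (l * c) / ?a * (passage_discount p c \<omega> - passage_discount (\<psi> l) c \<omega>)) = exp (l * c) / ?a * (exp (- (\<Phi> p * c)) - exp (- (l * c)))"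
    using passage_discount_integrable[OF p, of c] passage_discount_integrable[OF l1(2), of c] passage_laplace[OF p c] E by simp
  also have "\<dots> = (exp ((l - \<Phi> p) * c) - 1) / ?a"
    using a by (simp add: field_simps exp_diff exp_minus left_diff_distrib)
  finally show ?thesis .
qed

end

section \<open>Potential measures of the process killed at first passage\<close>

context spectrally_negative_levy_process
begin

text \<open>
  The difference of the potentials at the levels \<open>c + d\<close> and \<open>c\<close>, as a measure of its own
  because both may be infinite.
\<close>

definition excess :: "real \<Rightarrow> real \<Rightarrow> real \<Rightarrow> real measure" where
  "excess p c d = distr (density (lborel \<Otimes>\<^sub>M M)
     (\<lambda>(t, \<omega>). ennreal (of_bool (0 < t \<and> alive (c + d) t (\<lambda>r. X r \<omega>) \<and> \<not> alive c t (\<lambda>r. X r \<omega>)) * exp (- p * t))))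
     borel (\<lambda>(t, \<omega>). X (max 0 t) \<omega>)"

lemma sets_excess [simp, measurable_cong]: "sets (excess p c d) = sets borel" "space (excess p c d) = UNIV"
  by (simp_all add: excess_def)

lemma excess_density_measurable [measurable]:
  "(\<lambda>z. of_bool (0 < fst z \<and> alive (c + d) (fst z) (\<lambda>r. X r (snd z)) \<and> \<not> alive c (fst z) (\<lambda>r. X r (snd z))) :: real) \<in> borel_measurable (lborel \<Otimes>\<^sub>M M)"
proof -
  have [measurable]: "(\<lambda>z. of_bool (alive c (fst z) (\<lambda>r. X r (snd z))) :: real) \<in> borel_measurable (lborel \<Otimes>\<^sub>M M)" for c
    using joint_alive_measurable[of c 0] by simp
  have "(\<lambda>z. of_bool (0 < fst z) * (of_bool (alive (c + d) (fst z) (\<lambda>r. X r (snd z))) * (1 - of_bool (alive c (fst z) (\<lambda>r. X r (snd z))))) :: real) \<in> borel_measurable (lborel \<Otimes>\<^sub>M M)"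
    by measurable
  then show ?thesis by (simp add: of_bool_conj of_bool_not_iff)
qed

lemma nn_integral_excess:
  assumes [measurable]: "f \<in> borel_measurable borel" and d: "0 \<le> d"
  shows "(\<integral>\<^sup>+y. f y \<partial>potential p (c + d)) = (\<integral>\<^sup>+y. f y \<partial>potential p c) + (\<integral>\<^sup>+y. f y \<partial>excess p c d)"
proof -
  let ?a = "\<lambda>c z. of_bool (0 < fst z \<and> alive c (fst z) (\<lambda>r. X r (snd z))) :: real"
  let ?b = "\<lambda>z. of_bool (0 < fst z \<and> alive (c + d) (fst z) (\<lambda>r. X r (snd z)) \<and> \<not> alive c (fst z) (\<lambda>r. X r (snd z))) :: real"
  let ?f = "\<lambda>z. f (X (max 0 (fst z)) (snd z))"
  have p: "(\<integral>\<^sup>+y. f y \<partial>potential p c) = (\<integral>\<^sup>+z. ennreal (?a c z * exp (- p * fst z)) * ?f z \<partial>(lborel \<Otimes>\<^sub>M M))" for c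
    unfolding potential_def case_prod_beta' by (subst nn_integral_distr, measurable, subst nn_integral_density, measurable)
  have e: "(\<integral>\<^sup>+y. f y \<partial>excess p c d) = (\<integral>\<^sup>+z. ennreal (?b z * exp (- p * fst z)) * ?f z \<partial>(lborel \<Otimes>\<^sub>M M))"
    unfolding excess_def case_prod_beta' by (subst nn_integral_distr, measurable, subst nn_integral_density, measurable)
  have split: "?a (c + d) z = ?a c z + ?b z" for z
    using alive_mono[of c "fst z" "\<lambda>r. X r (snd z)" "fst z" "c + d"] d by auto
  have "ennreal (?a (c + d) z * exp (- p * fst z)) * ?f z = ennreal (?a c z * exp (- p * fst z)) * ?f z + ennreal (?b z * exp (- p * fst z)) * ?f z" for z
  proof -
    have "ennreal (?a (c + d) z * exp (- p * fst z)) = ennreal (?a c z * exp (- p * fst z) + ?b z * exp (- p * fst z))"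
      by (simp only: split distrib_right)
    also have "\<dots> = ennreal (?a c z * exp (- p * fst z)) + ennreal (?b z * exp (- p * fst z))"
      by (rule ennreal_plus) auto
    finally show ?thesis by (simp only: distrib_right)
  qed
  then show ?thesis unfolding p e by (simp add: nn_integral_add)
qed

lemma AE_potential_le: "AE y in potential p c. y \<le> c"
proof -
  have alive_at: "w t \<le> c" if "alive c t w" "0 < t" for t w using that by (simp add: alive_def)
  have "(\<integral>\<^sup>+y. indicator {c<..} y \<partial>potential p c) = 0"
    by (subst nn_integral_potential(1), measurable)
      (auto intro!: nn_integral_zero' AE_I2 dest: alive_at simp: indicator_def nn_integral_0_iff_AE not_less)
  then have "emeasure (potential p c) {c<..} = 0" by simp
  then show ?thesis by (intro AE_I[of _ _ "{c<..}"]) auto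
qed

lemma AE_excess_le: assumes "0 \<le> d" shows "AE y in excess p c d. y \<le> c + d"
proof -
  have "emeasure (potential p (c + d)) {c + d<..} = 0"
    using AE_potential_le[where p = p and c = "c + d"] by (subst (asm) AE_iff_measurable[of "{c + d<..}"]) auto
  then have "emeasure (excess p c d) {c + d<..} = 0"
    using nn_integral_excess[of "indicator {c + d<..}" d p c] assms by simp
  then show ?thesis by (intro AE_I[of _ _ "{c + d<..}"]) auto
qed

text \<open>
  The two sides have the same Laplace transform, so no strong Markov property at the passage time
  is needed.
\<close>

lemma potential_shift:
  assumes p: "0 \<le> p" and c: "0 \<le> c" and d: "0 \<le> d" and [measurable]: "f \<in> borel_measurable borel"
  shows "(\<integral>\<^sup>+y. ennreal (exp (\<Phi> p * y)) * f y \<partial>potential p (c + d)) =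
    (\<integral>\<^sup>+y. ennreal (exp (\<Phi> p * y)) * f y \<partial>potential p c) + (\<integral>\<^sup>+y. ennreal (exp (\<Phi> p * y)) * f (y + c) \<partial>potential p d)"
proof -
  let ?e = "\<lambda>y. ennreal (exp (\<Phi> p * y))"
  define E1 where "E1 = density (excess p c d) ?e"
  define E2 where "E2 = distr (density (potential p d) ?e) borel (\<lambda>y. y + c)"
  have tilt: "(\<integral>\<^sup>+y. ?e y * ennreal (exp (l * y)) \<partial>potential p c) = ennreal ((exp (l * c) - 1) / (\<psi> (l + \<Phi> p) - p))" if "0 < l" "0 \<le> c" for l c
  proof -
    have "(\<integral>\<^sup>+y. ?e y * ennreal (exp (l * y)) \<partial>potential p c) = (\<integral>\<^sup>+y. ennreal (exp ((l + \<Phi> p) * y)) \<partial>potential p c)"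
      by (intro nn_integral_cong) (simp add: ennreal_mult[symmetric] exp_add[symmetric] distrib_right add.commute)
    then show ?thesis using potential_laplace[OF p that(2), of "l + \<Phi> p"] that by simp
  qed
  have x: "0 < \<psi> (l + \<Phi> p) - p" if "0 < l" for l using right_inverse_root(3)[OF p, of "l + \<Phi> p"] that by simp
  have L1: "(\<integral>\<^sup>+y. ennreal (exp (l * y)) \<partial>E1) = ennreal (exp (l * c) * ((exp (l * d) - 1) / (\<psi> (l + \<Phi> p) - p)))" if l: "0 < l" for l
  proof -
    have "(\<integral>\<^sup>+y. ennreal (exp (l * y)) \<partial>E1) = (\<integral>\<^sup>+y. ?e y * ennreal (exp (l * y)) \<partial>excess p c d)"
      unfolding E1_def by (subst nn_integral_density) auto
    moreover have "ennreal ((exp (l * (c + d)) - 1) / (\<psi> (l + \<Phi> p) - p)) = ennreal ((exp (l * c) - 1) / (\<psi> (l + \<Phi> p) - p)) + (\<integral>\<^sup>+y. ?e y * ennreal (exp (l * y)) \<partial>excess p c d)"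
      using nn_integral_excess[of "\<lambda>y. ?e y * ennreal (exp (l * y))" d p c] tilt[OF l, of c] tilt[OF l, of "c + d"] c d by simp
    moreover have "ennreal ((exp (l * (c + d)) - 1) / (\<psi> (l + \<Phi> p) - p)) = ennreal ((exp (l * c) - 1) / (\<psi> (l + \<Phi> p) - p)) + ennreal (exp (l * c) * ((exp (l * d) - 1) / (\<psi> (l + \<Phi> p) - p)))"
    proof -
      have "(exp (l * (c + d)) - 1) / (\<psi> (l + \<Phi> p) - p) = (exp (l * c) - 1) / (\<psi> (l + \<Phi> p) - p) + exp (l * c) * ((exp (l * d) - 1) / (\<psi> (l + \<Phi> p) - p))"
        by (simp add: distrib_left exp_add right_diff_distrib diff_divide_distrib)
      moreover have "0 \<le> (exp (l * c) - 1) / (\<psi> (l + \<Phi> p) - p)" "0 \<le> exp (l * c) * ((exp (l * d) - 1) / (\<psi> (l + \<Phi> p) - p))"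
        using x[OF l] l c d by auto
      ultimately show ?thesis by (simp only: ennreal_plus)
    qed
    ultimately show ?thesis by (simp add: ennreal_add_left_cancel)
  qed
  have L2: "(\<integral>\<^sup>+y. ennreal (exp (l * y)) \<partial>E2) = ennreal (exp (l * c) * ((exp (l * d) - 1) / (\<psi> (l + \<Phi> p) - p)))" if l: "0 < l" for l
  proof -
    have "(\<integral>\<^sup>+y. ennreal (exp (l * y)) \<partial>E2) = (\<integral>\<^sup>+y. ennreal (exp (l * c)) * (?e y * ennreal (exp (l * y))) \<partial>potential p d)"
      unfolding E2_def
      by (subst nn_integral_distr, simp, simp, subst nn_integral_density)
        (auto intro!: nn_integral_cong simp: ennreal_mult[symmetric] exp_add[symmetric] algebra_simps)
    also have "\<dots> = ennreal (exp (l * c)) * ennreal ((exp (l * d) - 1) / (\<psi> (l + \<Phi> p) - p))"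
      by (subst nn_integral_cmult) (simp_all add: tilt[OF l d])
    also have "\<dots> = ennreal (exp (l * c) * ((exp (l * d) - 1) / (\<psi> (l + \<Phi> p) - p)))"
      by (rule ennreal_mult[symmetric]) (use x[OF l] l d in auto)
    finally show ?thesis .
  qed
  have "E1 = E2"
  proof (rule laplace_transform_unique[where c = "c + d" and ?l0.0 = 0])
    show "AE y in E1. y \<le> c + d" unfolding E1_def using AE_excess_le[OF d, where p = p and c = c] by (subst AE_density) auto
    have "AE y in potential p d. y + c \<le> c + d" using AE_potential_le by eventually_elim simp
    then show "AE y in E2. y \<le> c + d" unfolding E2_def by (subst AE_distr_iff) (auto simp: AE_density)
  qed (use L1 L2 in \<open>auto simp: E1_def E2_def\<close>)
  then have "(\<integral>\<^sup>+y. f y \<partial>E1) = (\<integral>\<^sup>+y. f y \<partial>E2)" by simp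
  moreover have "(\<integral>\<^sup>+y. f y \<partial>E1) = (\<integral>\<^sup>+y. ?e y * f y \<partial>excess p c d)"
    unfolding E1_def by (subst nn_integral_density) auto
  moreover have "(\<integral>\<^sup>+y. f y \<partial>E2) = (\<integral>\<^sup>+y. ?e y * f (y + c) \<partial>potential p d)"
    unfolding E2_def by (subst nn_integral_distr, simp, simp, subst nn_integral_density) auto
  ultimately show ?thesis using nn_integral_excess[of "\<lambda>y. ?e y * f y" d p c] d by simp
qed

section \<open>Tilted tail masses and their convexity in the level\<close>

definition pot_tail :: "real \<Rightarrow> real \<Rightarrow> real \<Rightarrow> real" where
  "pot_tail p c z = enn2real (\<integral>\<^sup>+y. ennreal (exp (\<Phi> p * y)) * indicator {z<..} y \<partial>potential p c)"

text \<open>The value 0 at negative levels matches the scale function, which vanishes there;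
  \<open>pot_tail_eq\<close> then holds with one formula for every \<open>z\<close>.\<close>

definition pot_mass :: "real \<Rightarrow> real \<Rightarrow> real" where
  "pot_mass p c = (if c \<le> 0 then 0 else pot_tail p c 0)"

text \<open>Above \<open>z\<close> the tilt is at most \<open>exp (- z)\<close> times
  \<open>exp ((\<Phi> p + 1) * y)\<close>, and at the exponent \<open>\<Phi> p + 1\<close> the
  Laplace transform is known to be finite.\<close>

lemma pot_tail_finite:
  assumes "0 \<le> p" "0 \<le> c"
  shows "(\<integral>\<^sup>+y. ennreal (exp (\<Phi> p * y)) * indicator {z<..} y \<partial>potential p c) < \<infinity>"
proof -
  have "(\<integral>\<^sup>+y. ennreal (exp (\<Phi> p * y)) * indicator {z<..} y \<partial>potential p c) \<le>
    (\<integral>\<^sup>+y. ennreal (exp (- z)) * ennreal (exp ((\<Phi> p + 1) * y)) \<partial>potential p c)"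
  proof (intro nn_integral_mono)
    fix y
    have "exp (\<Phi> p * y) \<le> exp (- z + (\<Phi> p + 1) * y)" if "z < y" using that by (simp add: algebra_simps)
    then show "ennreal (exp (\<Phi> p * y)) * indicator {z<..} y \<le> ennreal (exp (- z)) * ennreal (exp ((\<Phi> p + 1) * y))"
      by (auto simp: indicator_def ennreal_mult[symmetric] exp_add[symmetric] intro!: ennreal_leI)
  qed
  also have "\<dots> = ennreal (exp (- z)) * ennreal ((exp ((\<Phi> p + 1 - \<Phi> p) * c) - 1) / (\<psi> (\<Phi> p + 1) - p))"
    by (subst nn_integral_cmult) (simp_all add: potential_laplace[OF assms])
  also have "\<dots> < \<infinity>" by (simp add: ennreal_mult[symmetric] ennreal_mult_less_top)
  finally show ?thesis .
qed

lemma pot_tail_ennreal: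
  assumes "0 \<le> p" "0 \<le> c"
  shows "ennreal (pot_tail p c z) = (\<integral>\<^sup>+y. ennreal (exp (\<Phi> p * y)) * indicator {z<..} y \<partial>potential p c)"
  unfolding pot_tail_def using pot_tail_finite[OF assms, of z] by (simp add: less_top)

lemma pot_tail_nonneg [simp]: "0 \<le> pot_tail p c z" by (simp add: pot_tail_def)

lemma pot_tail_antimono:
  assumes "0 \<le> p" "0 \<le> c" "z \<le> z'" shows "pot_tail p c z' \<le> pot_tail p c z"
proof -
  have "ennreal (pot_tail p c z') \<le> ennreal (pot_tail p c z)"
    unfolding pot_tail_ennreal[OF assms(1,2)] using assms(3) by (intro nn_integral_mono mult_left_mono) (auto simp: indicator_def)
  then show ?thesis by (simp add: ennreal_le_iff)
qed

lemma pot_tail_above: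
  assumes "c \<le> z" shows "pot_tail p c z = 0"
proof -
  have "(\<integral>\<^sup>+y. ennreal (exp (\<Phi> p * y)) * indicator {z<..} y \<partial>potential p c) = (\<integral>\<^sup>+y. 0 \<partial>potential p c)"
    by (rule nn_integral_cong_AE) (use AE_potential_le[where p = p and c = c] assms in \<open>auto elim!: eventually_mono simp: indicator_def\<close>)
  then show ?thesis by (simp add: pot_tail_def)
qed

lemma pot_tail_shift:
  assumes "0 \<le> p" "0 \<le> c" "0 \<le> d"
  shows "pot_tail p (c + d) z = pot_tail p c z + pot_tail p d (z - c)"
proof -
  have "ennreal (pot_tail p (c + d) z) = ennreal (pot_tail p c z) + (\<integral>\<^sup>+y. ennreal (exp (\<Phi> p * y)) * indicator {z<..} (y + c) \<partial>potential p d)"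
    using pot_tail_ennreal[OF assms(1), of "c + d" z] pot_tail_ennreal[OF assms(1,2), of z] potential_shift[OF assms, of "indicator {z<..}"] assms by simp
  also have "(\<integral>\<^sup>+y. ennreal (exp (\<Phi> p * y)) * indicator {z<..} (y + c) \<partial>potential p d) = ennreal (pot_tail p d (z - c))"
    unfolding pot_tail_ennreal[OF assms(1,3)] by (intro nn_integral_cong) (auto simp: indicator_def)
  finally show ?thesis by (simp add: ennreal_plus[symmetric] del: ennreal_plus)
qed

lemma pot_mass_eq: "0 \<le> c \<Longrightarrow> pot_mass p c = pot_tail p c 0"
  using pot_tail_above[of 0 0 p] by (auto simp: pot_mass_def)

text \<open>For \<open>z\<close> between 0 and \<open>c\<close> the level is reached in two stages,
  \<open>z\<close> and \<open>c - z\<close>, the first of which puts no mass above \<open>z\<close>.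
  For negative \<open>z\<close> the level \<open>c - z\<close> is split the other way round, into
  \<open>- z\<close> and \<open>c\<close>.\<close>

lemma pot_tail_eq:
  assumes p: "0 \<le> p" and c: "0 \<le> c"
  shows "pot_tail p c z = pot_mass p (c - z) - pot_mass p (- z)"
proof -
  consider "c \<le> z" | "0 \<le> z" "z < c" | "z < 0" by linarith
  then show ?thesis
  proof cases
    case 1
    then show ?thesis using c by (simp add: pot_tail_above pot_mass_def)
  next
    case 2
    then show ?thesis using pot_tail_shift[OF p, of z "c - z" z] by (simp add: pot_tail_above pot_mass_eq pot_mass_def)
  next
    case 3
    then show ?thesis using pot_tail_shift[OF p, of "- z" c 0] c by (simp add: pot_mass_eq)
  qed
qed

text \<open>The increment over a step \<open>d\<close> at \<open>x\<close> is the tail above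
  \<open>- x\<close> of the potential at level \<open>d\<close>, which grows with \<open>x\<close>.
  This is the convexity of \<open>pot_mass\<close>.\<close>

lemma pot_mass_increment_mono:
  assumes p: "0 \<le> p" and d: "0 \<le> d" and x: "x \<le> y"
  shows "0 \<le> pot_mass p (x + d) - pot_mass p x" "pot_mass p (x + d) - pot_mass p x \<le> pot_mass p (y + d) - pot_mass p y"
  using pot_tail_eq[OF p d, of "- x"] pot_tail_eq[OF p d, of "- y"] pot_tail_antimono[OF p d, of "- y" "- x"] x pot_tail_nonneg[of p d "- x"]
  by (simp_all add: add.commute)

lemma pot_mass_mono: "0 \<le> p \<Longrightarrow> x \<le> y \<Longrightarrow> pot_mass p x \<le> pot_mass p y"
  using pot_mass_increment_mono(1)[of p "y - x" x x] by simp

text \<open>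
  By \<open>potential_shift\<close> the function \<open>pot_mass p\<close> is convex; its right derivative will turn out to be
  \<open>exp (- (\<Phi> p * x)) * W x\<close> for the scale function \<open>W\<close>.
\<close>

definition slope :: "real \<Rightarrow> nat \<Rightarrow> real \<Rightarrow> real" where
  "slope p n x = 2 ^ n * (pot_mass p (x + 1 / 2 ^ n) - pot_mass p x)"

definition tilted_scale :: "real \<Rightarrow> real \<Rightarrow> real" where
  "tilted_scale p x = lim (\<lambda>n. slope p n x)"

text \<open>Dyadic steps are chosen because halving compares one increment with two equal halves, of
  which the left one is the smaller by convexity; the quotients decrease in
  \<open>n\<close>.\<close>

lemma slope_props:
  assumes p: "0 \<le> p"
  shows "0 \<le> slope p n x" "slope p (Suc n) x \<le> slope p n x" "x \<le> y \<Longrightarrow> slope p n x \<le> slope p n y"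
proof -
  show "0 \<le> slope p n x" unfolding slope_def using pot_mass_increment_mono(1)[OF p, of "1 / 2 ^ n" x x] by simp
  show "x \<le> y \<Longrightarrow> slope p n x \<le> slope p n y" unfolding slope_def using pot_mass_increment_mono(2)[OF p, of "1 / 2 ^ n" x y] by simp
  let ?e = "1 / 2 ^ Suc n :: real"
  have e: "1 / 2 ^ n = ?e + ?e" by simp
  have "pot_mass p (x + ?e) - pot_mass p x \<le> pot_mass p (x + ?e + ?e) - pot_mass p (x + ?e)"
    by (rule pot_mass_increment_mono(2)[OF p]) auto
  then have "2 * (pot_mass p (x + ?e) - pot_mass p x) \<le> pot_mass p (x + 1 / 2 ^ n) - pot_mass p x" unfolding e by (simp add: add.assoc)
  then have "2 ^ n * (2 * (pot_mass p (x + ?e) - pot_mass p x)) \<le> 2 ^ n * (pot_mass p (x + 1 / 2 ^ n) - pot_mass p x)"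
    by (intro mult_left_mono) auto
  then show "slope p (Suc n) x \<le> slope p n x" unfolding slope_def by (simp add: mult_ac)
qed

lemma slope_tendsto:
  assumes p: "0 \<le> p"
  shows "(\<lambda>n. slope p n x) \<longlonglongrightarrow> tilted_scale p x" "tilted_scale p x \<le> slope p n x" "0 \<le> tilted_scale p x"
proof -
  have d: "decseq (\<lambda>n. slope p n x)" by (rule decseq_SucI) (rule slope_props[OF p])
  have "convergent (\<lambda>n. slope p n x)"
    using decseq_convergent[OF d, of 0] slope_props(1)[OF p] by (metis convergent_def)
  then show l: "(\<lambda>n. slope p n x) \<longlonglongrightarrow> tilted_scale p x" unfolding tilted_scale_def by (simp add: convergent_LIMSEQ_iff)
  show "tilted_scale p x \<le> slope p n x" by (rule decseq_ge[OF d l])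
  show "0 \<le> tilted_scale p x" by (rule LIMSEQ_le_const[OF l]) (use slope_props(1)[OF p] in auto)
qed

lemma tilted_scale_mono: "0 \<le> p \<Longrightarrow> x \<le> y \<Longrightarrow> tilted_scale p x \<le> tilted_scale p y"
  using slope_tendsto(1) slope_props(3) by (meson LIMSEQ_le)

lemma tilted_scale_neg: "x < 0 \<Longrightarrow> tilted_scale p x = 0"
proof -
  assume x: "x < 0"
  have "(\<lambda>n. (1 / 2) ^ n) \<longlonglongrightarrow> (0::real)" by (rule LIMSEQ_power_zero) simp
  then have "\<forall>\<^sub>F n in sequentially. (1 / 2) ^ n < - x" using x order_tendstoD(2) by fastforce
  then have "\<forall>\<^sub>F n in sequentially. slope p n x = 0"
    by eventually_elim (use x in \<open>simp add: slope_def pot_mass_def power_divide\<close>)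
  then show ?thesis unfolding tilted_scale_def by (intro limI tendsto_eventually)
qed

text \<open>Among the dyadic increments that make up the interval, each is at least the one at
  \<open>x\<close> and at most the one starting at \<open>x + d\<close>. Adding them up and refining
  the mesh bounds the total by the length times the right derivative at either end.\<close>

lemma pot_mass_bounds:
  assumes p: "0 \<le> p" and d: "0 \<le> d"
  shows "d * tilted_scale p x \<le> pot_mass p (x + d) - pot_mass p x" "pot_mass p (x + d) - pot_mass p x \<le> d * tilted_scale p (x + d)"
proof -
  define k where "k = pot_mass p"
  define e where "e n = 1 / (2::real) ^ n" for n :: nat
  define m where "m n = nat \<lfloor>d / e n\<rfloor>" for n
  have e: "0 < e n" for n by (simp add: e_def)
  have el: "e \<longlonglongrightarrow> 0" unfolding e_def using LIMSEQ_power_zero[of "1/2 :: real"] by (simp add: power_divide)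
  have m: "real (m n) * e n \<le> d" "d < (real (m n) + 1) * e n" for n
  proof -
    have "real (m n) \<le> d / e n" "d / e n < real (m n) + 1" unfolding m_def using d e[of n] by (auto simp: of_nat_nat)
    then show "real (m n) * e n \<le> d" "d < (real (m n) + 1) * e n" using e[of n] by (auto simp: pos_le_divide_eq pos_divide_less_eq)
  qed
  have ml: "(\<lambda>n. real (m n) * e n) \<longlonglongrightarrow> d"
  proof (rule tendsto_sandwich[where f = "\<lambda>n. d - e n" and h = "\<lambda>_. d"])
    show "(\<lambda>n. d - e n) \<longlonglongrightarrow> d" using tendsto_diff[OF tendsto_const el, of d] by simp
    show "\<forall>\<^sub>F n in sequentially. d - e n \<le> real (m n) * e n"
    proof (rule always_eventually, rule allI)
      fix n show "d - e n \<le> real (m n) * e n" using m(2)[of n] by (simp add: distrib_right)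
    qed
  qed (use m in auto)
  have sl: "slope p n x = (k (x + e n) - k x) / e n" for n x by (simp add: slope_def k_def e_def)
  have tele: "k (x + real j * e n) - k x = (\<Sum>i<j. k (x + real i * e n + e n) - k (x + real i * e n))" for j n
  proof (induction j)
    case (Suc j)
    have "x + real (Suc j) * e n = x + real j * e n + e n" by (simp add: algebra_simps)
    then show ?case using Suc by (simp add: add.assoc)
  qed simp
  have lo: "real (m n) * e n * slope p n x \<le> k (x + d) - k x" for n
  proof -
    have "real (m n) * (k (x + e n) - k x) = (\<Sum>i<m n. k (x + e n) - k x)" by simp
    also have "\<dots> \<le> (\<Sum>i<m n. k (x + real i * e n + e n) - k (x + real i * e n))"
      unfolding k_def using e[of n] by (intro sum_mono pot_mass_increment_mono(2)[OF p]) auto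
    also have "\<dots> = k (x + real (m n) * e n) - k x" by (rule tele[symmetric])
    also have "\<dots> \<le> k (x + d) - k x" unfolding k_def using pot_mass_mono[OF p, of "x + real (m n) * e n" "x + d"] m(1)[of n] by simp
    finally show ?thesis using e[of n] by (simp add: sl)
  qed
  have hi: "k (x + d) - k x \<le> (real (m n) * e n + e n) * slope p n (x + d)" for n
  proof -
    have "k (x + d) - k x \<le> k (x + real (Suc (m n)) * e n) - k x"
      unfolding k_def using pot_mass_mono[OF p, of "x + d" "x + real (Suc (m n)) * e n"] m(2)[of n] by (simp add: add.commute)
    also have "\<dots> = (\<Sum>i<Suc (m n). k (x + real i * e n + e n) - k (x + real i * e n))" by (rule tele)
    also have "\<dots> \<le> (\<Sum>i<Suc (m n). k (x + d + e n) - k (x + d))"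
    proof (rule sum_mono)
      fix i assume "i \<in> {..<Suc (m n)}"
      then have "real i * e n \<le> real (m n) * e n" using e[of n] by (intro mult_right_mono) auto
      then have "real i * e n \<le> d" using m(1)[of n] by linarith
      then show "k (x + real i * e n + e n) - k (x + real i * e n) \<le> k (x + d + e n) - k (x + d)"
        unfolding k_def using e[of n] by (intro pot_mass_increment_mono(2)[OF p]) auto
    qed
    also have "\<dots> = (real (m n) + 1) * (k (x + d + e n) - k (x + d))" by simp
    also have "\<dots> = (real (m n) * e n + e n) * slope p n (x + d)" using e[of n] by (simp add: sl field_simps)
    finally show ?thesis .
  qed
  have "(\<lambda>n. real (m n) * e n * slope p n x) \<longlonglongrightarrow> d * tilted_scale p x"
    by (intro tendsto_mult ml slope_tendsto[OF p])
  then show "d * tilted_scale p x \<le> pot_mass p (x + d) - pot_mass p x" using lo unfolding k_def by (intro LIMSEQ_le_const2) auto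
  have "(\<lambda>n. (real (m n) * e n + e n) * slope p n (x + d)) \<longlonglongrightarrow> (d + 0) * tilted_scale p (x + d)"
    by (intro tendsto_intros ml el slope_tendsto[OF p])
  then show "pot_mass p (x + d) - pot_mass p x \<le> d * tilted_scale p (x + d)" using hi unfolding k_def by (intro LIMSEQ_le_const) auto
qed

lemma pot_mass_continuous: assumes p: "0 \<le> p" shows "continuous_on UNIV (pot_mass p)"
proof -
  have "isCont (pot_mass p) x" for x
  proof -
    have b: "\<bar>pot_mass p y - pot_mass p x\<bar> \<le> \<bar>y - x\<bar> * tilted_scale p (x + 1)" if "\<bar>y - x\<bar> < 1" for y
    proof (cases "x \<le> y")
      case True
      have "(y - x) * tilted_scale p y \<le> (y - x) * tilted_scale p (x + 1)"
        using that True by (intro mult_left_mono tilted_scale_mono[OF p]) auto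
      then show ?thesis using pot_mass_bounds(2)[OF p, of "y - x" x] pot_mass_mono[OF p True] True by simp
    next
      case False
      have "(x - y) * tilted_scale p x \<le> (x - y) * tilted_scale p (x + 1)"
        using False by (intro mult_left_mono tilted_scale_mono[OF p]) auto
      have "pot_mass p (y + (x - y)) - pot_mass p y \<le> (x - y) * tilted_scale p (y + (x - y))"
        by (rule pot_mass_bounds(2)[OF p]) (use False in simp)
      then have "pot_mass p x - pot_mass p y \<le> (x - y) * tilted_scale p x" by simp
      also note \<open>\<dots> \<le> (x - y) * tilted_scale p (x + 1)\<close>
      finally have "pot_mass p x - pot_mass p y \<le> (x - y) * tilted_scale p (x + 1)" .
      moreover have "\<bar>pot_mass p y - pot_mass p x\<bar> = pot_mass p x - pot_mass p y" "\<bar>y - x\<bar> = x - y"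
        using pot_mass_mono[OF p, of y x] False by auto
      ultimately show ?thesis by (simp only:)
    qed
    have "((\<lambda>y. \<bar>y - x\<bar> * tilted_scale p (x + 1)) \<longlongrightarrow> \<bar>x - x\<bar> * tilted_scale p (x + 1)) (at x)" by (intro tendsto_intros)
    then have z: "((\<lambda>y. \<bar>y - x\<bar> * tilted_scale p (x + 1)) \<longlongrightarrow> 0) (at x)" by simp
    have "\<forall>\<^sub>F y in at x. norm (pot_mass p y - pot_mass p x) \<le> \<bar>y - x\<bar> * tilted_scale p (x + 1)"
      using eventually_at_in_open[of "ball x 1" x] by (auto simp: dist_real_def abs_minus_commute elim!: eventually_mono intro!: b)
    then have "((\<lambda>y. pot_mass p y - pot_mass p x) \<longlongrightarrow> 0) (at x)" by (rule Lim_null_comparison) (rule z)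
    then show ?thesis by (simp add: isCont_def LIM_zero_iff)
  qed
  then show ?thesis by (simp add: continuous_at_imp_continuous_on)
qed

end

section \<open>Continuity of the scale function\<close>

text \<open>The diagonal is a null set, the two halves of the plane contribute equally by symmetry,
  and on one of them the later time is written as \<open>s + r\<close>.\<close>

lemma nn_integral_square_ordered:
  fixes f :: "real \<Rightarrow> ennreal"
  assumes [measurable]: "f \<in> borel_measurable borel"
  shows "(\<integral>\<^sup>+s. f s \<partial>lborel) * (\<integral>\<^sup>+s. f s \<partial>lborel) =
    2 * (\<integral>\<^sup>+s. \<integral>\<^sup>+r. f s * (f (s + r) * indicator {0<..} r) \<partial>lborel \<partial>lborel)"
proof -
  have "(\<integral>\<^sup>+s. f s \<partial>lborel) * (\<integral>\<^sup>+t. f t \<partial>lborel) = (\<integral>\<^sup>+s. \<integral>\<^sup>+t. f s * f t \<partial>lborel \<partial>lborel)"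
    by (simp add: nn_integral_cmult nn_integral_multc)
  also have "\<dots> = (\<integral>\<^sup>+s. \<integral>\<^sup>+t. f s * f t * indicator {s<..} t + f s * f t * indicator {t<..} s \<partial>lborel \<partial>lborel)"
  proof (rule nn_integral_cong)
    fix s :: real
    show "(\<integral>\<^sup>+t. f s * f t \<partial>lborel) = (\<integral>\<^sup>+t. f s * f t * indicator {s<..} t + f s * f t * indicator {t<..} s \<partial>lborel)"
      by (rule nn_integral_cong_AE) (use AE_lborel_singleton[of s] in \<open>auto elim!: eventually_mono simp: indicator_def\<close>)
  qed
  also have "\<dots> = (\<integral>\<^sup>+s. \<integral>\<^sup>+t. f s * f t * indicator {s<..} t \<partial>lborel \<partial>lborel) + (\<integral>\<^sup>+s. \<integral>\<^sup>+t. f s * f t * indicator {t<..} s \<partial>lborel \<partial>lborel)"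
  proof -
    have [measurable]: "(\<lambda>x. f (fst x) * f (snd x) * indicator {fst x<..} (snd x)) \<in> borel_measurable (lborel \<Otimes>\<^sub>M lborel)"
      "(\<lambda>x. f (fst x) * f (snd x) * indicator {snd x<..} (fst x)) \<in> borel_measurable (lborel \<Otimes>\<^sub>M lborel)"
      unfolding indicator_def greaterThan_iff by measurable
    have "(\<integral>\<^sup>+t. f s * f t * indicator {s<..} t + f s * f t * indicator {t<..} s \<partial>lborel) =
      (\<integral>\<^sup>+t. f s * f t * indicator {s<..} t \<partial>lborel) + (\<integral>\<^sup>+t. f s * f t * indicator {t<..} s \<partial>lborel)" for s
      by (rule nn_integral_add) (auto simp: indicator_def)
    then show ?thesis
      by (simp only:) (rule nn_integral_add; use lborel.borel_measurable_nn_integral_fst[of "\<lambda>x. f (fst x) * f (snd x) * indicator {fst x<..} (snd x)"]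
          lborel.borel_measurable_nn_integral_fst[of "\<lambda>x. f (fst x) * f (snd x) * indicator {snd x<..} (fst x)"] in simp)
  qed
  also have "(\<integral>\<^sup>+s. \<integral>\<^sup>+t. f s * f t * indicator {t<..} s \<partial>lborel \<partial>lborel) = (\<integral>\<^sup>+t. \<integral>\<^sup>+s. f s * f t * indicator {t<..} s \<partial>lborel \<partial>lborel)"
    by (rule lborel_pair.Fubini'[symmetric]) (unfold case_prod_beta' indicator_def greaterThan_iff, measurable)
  also have "(\<integral>\<^sup>+t. \<integral>\<^sup>+s. f s * f t * indicator {t<..} s \<partial>lborel \<partial>lborel) = (\<integral>\<^sup>+s. \<integral>\<^sup>+t. f s * f t * indicator {s<..} t \<partial>lborel \<partial>lborel)"
    by (simp add: mult.commute)
  also have "(\<integral>\<^sup>+s. \<integral>\<^sup>+t. f s * f t * indicator {s<..} t \<partial>lborel \<partial>lborel) = (\<integral>\<^sup>+s. \<integral>\<^sup>+r. f s * (f (s + r) * indicator {0<..} r) \<partial>lborel \<partial>lborel)"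
  proof (rule nn_integral_cong)
    fix s :: real
    have "(\<integral>\<^sup>+t. f s * f t * indicator {s<..} t \<partial>lborel) = (\<integral>\<^sup>+r. f s * f (s + 1 * r) * indicator {s<..} (s + 1 * r) \<partial>lborel)"
      by (subst nn_integral_real_affine[where c = 1 and t = s]) (auto simp: indicator_def)
    then show "(\<integral>\<^sup>+t. f s * f t * indicator {s<..} t \<partial>lborel) = (\<integral>\<^sup>+r. f s * (f (s + r) * indicator {0<..} r) \<partial>lborel)"
      by (simp add: mult.assoc) (auto intro!: nn_integral_cong simp: indicator_def)
  qed
  finally show ?thesis by (simp add: mult_2)
qed

text \<open>The inequality is \<open>(r - 2 * b)^2 / (4 * b) >= 0\<close>. The constant
  \<open>b\<close> is paid only where \<open>A\<close> is positive, which is how the probability of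
  hitting a set enters.\<close>

lemma ennreal_am_gm:
  assumes b: "0 < b"
  shows "(A :: ennreal) \<le> ennreal (1 / (4 * b)) * (A * A) + ennreal b * indicator {0<..} A"
proof (cases A)
  case (real r)
  show ?thesis
  proof (cases "r = 0")
    case False
    then have r: "0 < r" using real by simp
    have "0 \<le> (r - 2 * b)\<^sup>2 / (4 * b)" using b by simp
    also have "(r - 2 * b)\<^sup>2 / (4 * b) = 1 / (4 * b) * (r * r) + b - r" using b by (simp add: power2_eq_square field_simps)
    finally have "r \<le> 1 / (4 * b) * (r * r) + b" by simp
    then have "ennreal r \<le> ennreal (1 / (4 * b) * (r * r) + b)" by (rule ennreal_leI)
    also have "\<dots> = ennreal (1 / (4 * b)) * (A * A) + ennreal b * indicator {0<..} A"
    proof -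
      have "ennreal (u * (r * r) + b) = ennreal u * (ennreal r * ennreal r) + ennreal b" if "0 \<le> u" for u
        using that r b by (simp add: ennreal_mult ennreal_plus)
      from this[of "1 / (4 * b)"] show ?thesis using b r real by (simp add: indicator_def del: times_divide_eq_left)
    qed
    finally show ?thesis using real by simp
  qed (use real in simp)
next
  case top
  then show ?thesis using b by (simp add: ennreal_mult_top)
qed

context spectrally_negative_levy_process
begin

section \<open>Second moments of discounted occupation times\<close>

definition occupation :: "real \<Rightarrow> real \<Rightarrow> real set \<Rightarrow> 'a \<Rightarrow> ennreal" where
  "occupation p d I \<omega> = (\<integral>\<^sup>+t. ennreal (of_bool (0 < t \<and> alive d t (\<lambda>r. X r \<omega>)) * exp (- p * t)) * indicator I (X (max 0 t) \<omega>) \<partial>lborel)"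

lemma occupation_measurable [measurable]:
  assumes [measurable]: "I \<in> sets borel"
  shows "occupation p d I \<in> borel_measurable M"
proof -
  interpret P: pair_sigma_finite lborel M ..
  have m: "(\<lambda>z. ennreal (of_bool (0 < fst z \<and> alive d (fst z) (\<lambda>r. X r (snd z))) * exp (- p * fst z)) * indicator I (X (max 0 (fst z)) (snd z))) \<in> borel_measurable (lborel \<Otimes>\<^sub>M M)"
    by measurable
  have "(\<lambda>z. ennreal (of_bool (0 < snd z \<and> alive d (snd z) (\<lambda>r. X r (fst z))) * exp (- p * snd z)) * indicator I (X (max 0 (snd z)) (fst z))) \<in> borel_measurable (M \<Otimes>\<^sub>M lborel)"
    using measurable_compose[OF measurable_pair_swap' m] by (simp add: case_prod_beta')
  then show ?thesis unfolding occupation_def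
    using lborel.borel_measurable_nn_integral_fst[of "\<lambda>z. ennreal (of_bool (0 < snd z \<and> alive d (snd z) (\<lambda>r. X r (fst z))) * exp (- p * snd z)) * indicator I (X (max 0 (snd z)) (fst z))" M] by simp
qed

lemma nn_integral_occupation:
  assumes [measurable]: "I \<in> sets borel"
  shows "(\<integral>\<^sup>+\<omega>. occupation p d I \<omega> \<partial>M) = emeasure (potential p d) I"
  unfolding occupation_def using nn_integral_potential(2)[of "indicator I" p d] by simp

lemma alive_shift_iff:
  assumes "0 < s" "0 < r"
  shows "alive d (s + r) w \<longleftrightarrow> alive d s w \<and> alive d r (\<lambda>u. w (s + u))"
proof
  assume "alive d (s + r) w"
  then show "alive d s w \<and> alive d r (\<lambda>u. w (s + u))" using assms by (auto simp: alive_def)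
next
  assume a: "alive d s w \<and> alive d r (\<lambda>u. w (s + u))"
  show "alive d (s + r) w" unfolding alive_def
  proof (intro allI impI)
    fix u assume u: "0 < u \<and> u \<le> s + r"
    show "w u \<le> d"
    proof (cases "u \<le> s")
      case False
      then have "w (s + (u - s)) \<le> d" using a u unfolding alive_def by (metis add_diff_cancel_left' add_le_cancel_left diff_gt_0_iff_gt le_add_diff_inverse less_eq_real_def not_le add.commute diff_add_cancel)
      then show ?thesis by simp
    qed (use a u in \<open>auto simp: alive_def\<close>)
  qed
qed

text \<open>In the ordered square the Markov property at the earlier time \<open>s\<close> sees a
  process restarted at some \<open>y\<close> in \<open>I\<close>. Its remaining occupation has as
  mean a potential of the translated set at level \<open>d - y\<close>, hence at most
  \<open>B\<close>; the factor 2 counts the two orders.\<close>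

lemma occupation_second_moment:
  assumes I [measurable]: "I \<in> sets borel"
    and B: "\<And>y. y \<in> I \<Longrightarrow> emeasure (potential p (d - y)) {x. y + x \<in> I} \<le> B" and p: "0 \<le> p"
  shows "(\<integral>\<^sup>+\<omega>. occupation p d I \<omega> * occupation p d I \<omega> \<partial>M) \<le> 2 * (B * (\<integral>\<^sup>+\<omega>. occupation p d I \<omega> \<partial>M))"
proof -
  interpret P: pair_sigma_finite lborel M ..
  define f where "f \<omega> t = ennreal (of_bool (0 < t \<and> alive d t (\<lambda>r. X r \<omega>)) * exp (- p * t)) * indicator I (X (max 0 t) \<omega>)" for \<omega> t
  have fj [measurable]: "(\<lambda>z. f (\<zeta> z) (T z)) \<in> borel_measurable N"
    if [measurable]: "\<zeta> \<in> N \<rightarrow>\<^sub>M M" "T \<in> borel_measurable N" for \<zeta> T and N :: "'z measure"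
  proof -
    have [measurable]: "(\<lambda>z. X (max 0 (T z)) (\<zeta> z)) \<in> borel_measurable N" by (rule joint_measurable) measurable
    have [measurable]: "(\<lambda>z. of_bool (alive d (T z) (\<lambda>r. 0 + X r (\<zeta> z))) :: real) \<in> borel_measurable N" by (rule alive_measurable) measurable
    have "(\<lambda>z. ennreal (of_bool (0 < T z) * of_bool (alive d (T z) (\<lambda>r. 0 + X r (\<zeta> z))) * exp (- p * T z)) * indicator I (X (max 0 (T z)) (\<zeta> z))) \<in> borel_measurable N"
      by measurable
    then show ?thesis unfolding f_def by (simp add: of_bool_conj)
  qed
  have occ: "occupation p d I \<omega> = (\<integral>\<^sup>+t. f \<omega> t \<partial>lborel)" for \<omega> by (simp add: occupation_def f_def)
  define g where "g y r \<omega>' = ennreal (of_bool (0 < r \<and> alive (d - y) r (\<lambda>u. X u \<omega>')) * exp (- p * r)) * indicator {x. y + x \<in> I} (X (max 0 r) \<omega>')" for y r \<omega>'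
  have gj [measurable]: "(\<lambda>z. g (y z) (T z) (\<zeta> z)) \<in> borel_measurable N"
    if [measurable]: "\<zeta> \<in> N \<rightarrow>\<^sub>M M" "T \<in> borel_measurable N" "y \<in> borel_measurable N" for \<zeta> T y and N :: "'z measure"
  proof -
    have [measurable]: "(\<lambda>z. X (max 0 (T z)) (\<zeta> z)) \<in> borel_measurable N" by (rule joint_measurable) measurable
    have [measurable]: "(\<lambda>z. of_bool (alive d (T z) (\<lambda>r. y z + X r (\<zeta> z))) :: real) \<in> borel_measurable N" by (rule alive_measurable) measurable
    have "(\<lambda>z. ennreal (of_bool (0 < T z) * of_bool (alive d (T z) (\<lambda>r. y z + X r (\<zeta> z))) * exp (- p * T z)) * indicator I (y z + X (max 0 (T z)) (\<zeta> z))) \<in> borel_measurable N"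
      by measurable
    moreover have "alive d t (\<lambda>r. a + w r) = alive (d - a) t w" for t a w by (auto simp: alive_def algebra_simps)
    ultimately show ?thesis unfolding g_def by (simp add: of_bool_conj indicator_def)
  qed
  have gB: "(\<integral>\<^sup>+r. \<integral>\<^sup>+\<omega>'. g y r \<omega>' \<partial>M \<partial>lborel) \<le> B" if "y \<in> I" for y
  proof -
    have "{x. y + x \<in> I} \<in> sets borel" by measurable
    then have "(\<integral>\<^sup>+r. \<integral>\<^sup>+\<omega>'. g y r \<omega>' \<partial>M \<partial>lborel) = emeasure (potential p (d - y)) {x. y + x \<in> I}"
      unfolding g_def using nn_integral_potential(1)[of "indicator {x. y + x \<in> I}" p "d - y"] by simp
    then show ?thesis using B[OF that] by simp
  qed
  have inner: "(\<integral>\<^sup>+\<omega>. f \<omega> s * (f \<omega> (s + r) * indicator {0<..} r) \<partial>M) \<le> (\<integral>\<^sup>+\<omega>. f \<omega> s * (\<integral>\<^sup>+\<omega>'. g (X (max 0 s) \<omega>) r \<omega>' \<partial>M) \<partial>M)" for s r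
  proof (cases "0 < s \<and> 0 < r")
    case False
    then have "(\<integral>\<^sup>+\<omega>. f \<omega> s * (f \<omega> (s + r) * indicator {0<..} r) \<partial>M) = (\<integral>\<^sup>+\<omega>. 0 \<partial>M)"
      by (intro nn_integral_cong) (auto simp: f_def)
    then show ?thesis by simp
  next
    case True
    then have s: "0 < s" and r: "0 < r" by auto
    have [measurable]: "X s \<in> borel_measurable M" using s by simp
    define F where "F = (\<lambda>w. of_bool (alive d r w) * indicator I (w r) :: real)"
    have F: "path_functional F" unfolding F_def by (rule path_functional_alive_at) (use r in auto)
    define u where "u y = (LINT \<omega>'|M. F (\<lambda>r. y + X r \<omega>'))" for y
    have mk: "(LINT \<omega>|M. of_bool (alive d s (\<lambda>r. 0 + X r \<omega>)) * indicator I (0 + X s \<omega>) * F (\<lambda>r. 0 + X (s + r) \<omega>)) =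
      (LINT \<omega>|M. of_bool (alive d s (\<lambda>r. 0 + X r \<omega>)) * indicator I (0 + X s \<omega>) * u (0 + X s \<omega>))"
      unfolding u_def by (rule markov_property[OF F s]) auto
    have Fb: "0 \<le> F w" "F w \<le> 1" for w unfolding F_def by (auto simp: indicator_def)
    have Fi: "integrable M (\<lambda>\<omega>'. F (\<lambda>r. y + X r \<omega>'))" for y by (rule path_functional_integrable[OF F])
    have ub: "0 \<le> u y" "u y \<le> 1" for y
      unfolding u_def using Fi Fb by (auto intro!: integral_nonneg_AE integral_le_const)
    have [measurable]: "u \<in> borel_measurable borel" unfolding u_def by (rule expectation_functional_measurable[OF F])
    have [measurable]: "(\<lambda>\<omega>. F (\<lambda>r. X (s + r) \<omega>)) \<in> borel_measurable M"
      using path_functional_measurable[OF F, of "\<lambda>_. s" M "\<lambda>\<omega>. \<omega>" "\<lambda>_. 0"] s by simp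
    let ?a = "\<lambda>\<omega>. of_bool (alive d s (\<lambda>r. X r \<omega>)) * indicator I (X s \<omega>) :: real"
    have i1: "integrable M (\<lambda>\<omega>. ?a \<omega> * F (\<lambda>r. X (s + r) \<omega>))" and i2: "integrable M (\<lambda>\<omega>. ?a \<omega> * u (X s \<omega>))"
      by (rule integrable_const_bound[of _ 1]; use Fb ub in \<open>auto simp: indicator_def abs_of_nonneg\<close>)+
    have "(\<integral>\<^sup>+\<omega>. f \<omega> s * (f \<omega> (s + r) * indicator {0<..} r) \<partial>M) = (\<integral>\<^sup>+\<omega>. ennreal (exp (- p * s) * exp (- p * (s + r)) * (?a \<omega> * F (\<lambda>r. X (s + r) \<omega>))) \<partial>M)"
    proof (intro nn_integral_cong)
      fix \<omega>
      show "f \<omega> s * (f \<omega> (s + r) * indicator {0<..} r) = ennreal (exp (- p * s) * exp (- p * (s + r)) * (?a \<omega> * F (\<lambda>r. X (s + r) \<omega>)))"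
        using s r alive_shift_iff[OF s r, of d "\<lambda>r. X r \<omega>"]
        by (auto simp: f_def F_def indicator_def ennreal_mult[symmetric])
    qed
    also have "\<dots> = ennreal (LINT \<omega>|M. exp (- p * s) * exp (- p * (s + r)) * (?a \<omega> * F (\<lambda>r. X (s + r) \<omega>)))"
      by (rule nn_integral_eq_integral) (use i1 Fb in \<open>auto intro!: integrable_mult_right mult_nonneg_nonneg\<close>)
    also have "(LINT \<omega>|M. exp (- p * s) * exp (- p * (s + r)) * (?a \<omega> * F (\<lambda>r. X (s + r) \<omega>))) = (LINT \<omega>|M. exp (- p * s) * exp (- p * (s + r)) * (?a \<omega> * u (X s \<omega>)))"
      unfolding integral_mult_right_zero using mk by simp
    also have "ennreal \<dots> = (\<integral>\<^sup>+\<omega>. ennreal (exp (- p * s) * exp (- p * (s + r)) * (?a \<omega> * u (X s \<omega>))) \<partial>M)"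
      by (rule nn_integral_eq_integral[symmetric]) (use i2 ub in \<open>auto intro!: integrable_mult_right mult_nonneg_nonneg\<close>)
    also have "\<dots> \<le> (\<integral>\<^sup>+\<omega>. f \<omega> s * (\<integral>\<^sup>+\<omega>'. g (X (max 0 s) \<omega>) r \<omega>' \<partial>M) \<partial>M)"
    proof (intro nn_integral_mono)
      fix \<omega>
      let ?y = "X s \<omega>"
      have al: "alive d r (\<lambda>r. ?y + w r) = alive (d - ?y) r w" for w by (auto simp: alive_def algebra_simps)
      have "(\<integral>\<^sup>+\<omega>'. g ?y r \<omega>' \<partial>M) = (\<integral>\<^sup>+\<omega>'. ennreal (exp (- p * r) * F (\<lambda>r. ?y + X r \<omega>')) \<partial>M)"
        using r by (intro nn_integral_cong) (auto simp: g_def F_def al indicator_def)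
      also have "\<dots> = ennreal (exp (- p * r) * u ?y)"
        unfolding u_def integral_mult_right_zero[symmetric]
        by (rule nn_integral_eq_integral) (use Fi Fb in \<open>auto intro!: integrable_mult_right\<close>)
      finally have gy: "(\<integral>\<^sup>+\<omega>'. g ?y r \<omega>' \<partial>M) = ennreal (exp (- p * r) * u ?y)" .
      \<comment> \<open>The later time carries the discount \<open>exp (- p * (s + r))\<close>;
        dropping the part \<open>exp (- p * s)\<close> leaves the discount of the restarted
        process.\<close>
      have "exp (- p * (s + r)) \<le> exp (- p * r)" using p s by (simp add: mult_left_mono)
      then have "exp (- p * s) * exp (- p * (s + r)) * (?a \<omega> * u ?y) \<le> exp (- p * s) * exp (- p * r) * (?a \<omega> * u ?y)"
        using ub by (intro mult_right_mono mult_left_mono) auto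
      then have "ennreal (exp (- p * s) * exp (- p * (s + r)) * (?a \<omega> * u ?y)) \<le> ennreal (exp (- p * s) * exp (- p * r) * (?a \<omega> * u ?y))"
        by (rule ennreal_leI)
      also have "\<dots> = f \<omega> s * (\<integral>\<^sup>+\<omega>'. g (X (max 0 s) \<omega>) r \<omega>' \<partial>M)"
        using s ub gy by (auto simp: f_def indicator_def ennreal_mult[symmetric] mult_ac)
      finally show "ennreal (exp (- p * s) * exp (- p * (s + r)) * (?a \<omega> * u ?y)) \<le> f \<omega> s * (\<integral>\<^sup>+\<omega>'. g (X (max 0 s) \<omega>) r \<omega>' \<partial>M)" .
    qed
    finally show ?thesis .
  qed
  have "(\<integral>\<^sup>+\<omega>. occupation p d I \<omega> * occupation p d I \<omega> \<partial>M) = (\<integral>\<^sup>+\<omega>. 2 * (\<integral>\<^sup>+s. \<integral>\<^sup>+r. f \<omega> s * (f \<omega> (s + r) * indicator {0<..} r) \<partial>lborel \<partial>lborel) \<partial>M)"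
    unfolding occ by (intro nn_integral_cong nn_integral_square_ordered) measurable
  also have "\<dots> = 2 * (\<integral>\<^sup>+\<omega>. \<integral>\<^sup>+s. \<integral>\<^sup>+r. f \<omega> s * (f \<omega> (s + r) * indicator {0<..} r) \<partial>lborel \<partial>lborel \<partial>M)"
    by (rule nn_integral_cmult) measurable
  also have "(\<integral>\<^sup>+\<omega>. \<integral>\<^sup>+s. \<integral>\<^sup>+r. f \<omega> s * (f \<omega> (s + r) * indicator {0<..} r) \<partial>lborel \<partial>lborel \<partial>M) =
    (\<integral>\<^sup>+s. \<integral>\<^sup>+\<omega>. \<integral>\<^sup>+r. f \<omega> s * (f \<omega> (s + r) * indicator {0<..} r) \<partial>lborel \<partial>M \<partial>lborel)"
    by (rule P.Fubini') (unfold case_prod_beta', measurable)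
  also have "\<dots> = (\<integral>\<^sup>+s. \<integral>\<^sup>+r. \<integral>\<^sup>+\<omega>. f \<omega> s * (f \<omega> (s + r) * indicator {0<..} r) \<partial>M \<partial>lborel \<partial>lborel)"
    by (intro nn_integral_cong, rule P.Fubini') (unfold case_prod_beta', measurable)
  also have "\<dots> \<le> (\<integral>\<^sup>+s. \<integral>\<^sup>+r. \<integral>\<^sup>+\<omega>. f \<omega> s * (\<integral>\<^sup>+\<omega>'. g (X (max 0 s) \<omega>) r \<omega>' \<partial>M) \<partial>M \<partial>lborel \<partial>lborel)"
    by (intro nn_integral_mono inner)
  also have "\<dots> = (\<integral>\<^sup>+s. \<integral>\<^sup>+\<omega>. \<integral>\<^sup>+r. f \<omega> s * (\<integral>\<^sup>+\<omega>'. g (X (max 0 s) \<omega>) r \<omega>' \<partial>M) \<partial>lborel \<partial>M \<partial>lborel)"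
  proof (intro nn_integral_cong, rule P.Fubini'[symmetric])
    fix s :: real
    have [measurable]: "X (max 0 s) \<in> borel_measurable M" by simp
    show "(\<lambda>(r, \<omega>). f \<omega> s * (\<integral>\<^sup>+\<omega>'. g (X (max 0 s) \<omega>) r \<omega>' \<partial>M)) \<in> borel_measurable (lborel \<Otimes>\<^sub>M M)"
      unfolding case_prod_beta' by measurable
  qed
  also have "\<dots> \<le> (\<integral>\<^sup>+s. \<integral>\<^sup>+\<omega>. f \<omega> s * B \<partial>M \<partial>lborel)"
  proof (intro nn_integral_mono)
    fix s :: real and \<omega> assume \<omega>: "\<omega> \<in> space M"
    have "(\<integral>\<^sup>+r. f \<omega> s * (\<integral>\<^sup>+\<omega>'. g (X (max 0 s) \<omega>) r \<omega>' \<partial>M) \<partial>lborel) = f \<omega> s * (\<integral>\<^sup>+r. \<integral>\<^sup>+\<omega>'. g (X (max 0 s) \<omega>) r \<omega>' \<partial>M \<partial>lborel)"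
      by (rule nn_integral_cmult) measurable
    also have "\<dots> \<le> f \<omega> s * B"
      by (cases "X (max 0 s) \<omega> \<in> I") (auto intro!: mult_left_mono gB simp: f_def)
    finally show "(\<integral>\<^sup>+r. f \<omega> s * (\<integral>\<^sup>+\<omega>'. g (X (max 0 s) \<omega>) r \<omega>' \<partial>M) \<partial>lborel) \<le> f \<omega> s * B" .
  qed
  also have "\<dots> = (\<integral>\<^sup>+\<omega>. \<integral>\<^sup>+s. f \<omega> s * B \<partial>lborel \<partial>M)"
    by (rule P.Fubini'[symmetric]) (unfold case_prod_beta', measurable)
  also have "\<dots> = (\<integral>\<^sup>+\<omega>. (\<integral>\<^sup>+s. f \<omega> s \<partial>lborel) * B \<partial>M)"
    by (intro nn_integral_cong nn_integral_multc) measurable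
  also have "\<dots> = B * (\<integral>\<^sup>+\<omega>. occupation p d I \<omega> \<partial>M)"
    unfolding occ[symmetric] nn_integral_multc[OF occupation_measurable[OF I]] by (rule mult.commute)
  finally show ?thesis by (simp add: mult_left_mono)
qed

text \<open>Let \<open>a\<close> be the mean occupation and \<open>P\<close> the probability that it
  is positive. Its second moment is at most \<open>2 * b * a\<close>, so the weight
  \<open>1 / (4 * b)\<close> in \<open>ennreal_am_gm\<close> yields
  \<open>a <= a / 2 + b * P\<close>; finiteness of \<open>a\<close> allows the subtraction.\<close>

lemma potential_le_hitting:
  assumes I [measurable]: "I \<in> sets borel" and b: "0 < b"
    and B: "\<And>y. y \<in> I \<Longrightarrow> emeasure (potential p (d - y)) {x. y + x \<in> I} \<le> ennreal b" and p: "0 \<le> p"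
    and fin: "emeasure (potential p d) I < \<infinity>"
  shows "measure (potential p d) I \<le> 2 * b * (LINT \<omega>|M. of_bool (0 < occupation p d I \<omega>))"
proof -
  define a where "a = measure (potential p d) I"
  define P where "P = (LINT \<omega>|M. of_bool (0 < occupation p d I \<omega>) :: real)"
  have ea: "(\<integral>\<^sup>+\<omega>. occupation p d I \<omega> \<partial>M) = ennreal a"
    unfolding nn_integral_occupation[OF I] a_def using fin by (simp add: emeasure_eq_ennreal_measure less_top)
  have a0: "0 \<le> a" "0 \<le> P" by (auto simp: a_def P_def intro!: integral_nonneg_AE)
  have eP: "(\<integral>\<^sup>+\<omega>. indicator {0<..} (occupation p d I \<omega>) \<partial>M) = ennreal P"
  proof -
    have "(\<integral>\<^sup>+\<omega>. indicator {0<..} (occupation p d I \<omega>) \<partial>M) = (\<integral>\<^sup>+\<omega>. ennreal (of_bool (0 < occupation p d I \<omega>)) \<partial>M)"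
      by (intro nn_integral_cong) (auto simp: indicator_def)
    also have "\<dots> = ennreal P" unfolding P_def by (intro nn_integral_eq_integral integrable_const_bound[of _ 1]) auto
    finally show ?thesis .
  qed
  have "ennreal a \<le> (\<integral>\<^sup>+\<omega>. ennreal (1 / (4 * b)) * (occupation p d I \<omega> * occupation p d I \<omega>) + ennreal b * indicator {0<..} (occupation p d I \<omega>) \<partial>M)"
    unfolding ea[symmetric] by (intro nn_integral_mono ennreal_am_gm b)
  also have "\<dots> = ennreal (1 / (4 * b)) * (\<integral>\<^sup>+\<omega>. occupation p d I \<omega> * occupation p d I \<omega> \<partial>M) + ennreal b * ennreal P"
    by (simp add: nn_integral_add nn_integral_cmult eP)
  also have "\<dots> \<le> ennreal (1 / (4 * b)) * (2 * (ennreal b * ennreal a)) + ennreal b * ennreal P"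
    using occupation_second_moment[OF I B p] unfolding ea by (intro add_right_mono mult_left_mono) auto
  also have "\<dots> = ennreal (a / 2 + b * P)"
  proof -
    have "(2::ennreal) = ennreal 2" by simp
    then have "ennreal (1 / (4 * b)) * (2 * (ennreal b * ennreal a)) = ennreal (1 / (4 * b) * (2 * (b * a)))"
      using a0 b by (simp only: ennreal_mult mult_nonneg_nonneg less_imp_le zero_le_numeral zero_le_divide_1_iff)
    also have "1 / (4 * b) * (2 * (b * a)) = a / 2" using b by simp
    finally show ?thesis using a0 b by (simp add: ennreal_mult[symmetric])
  qed
  finally have "a \<le> a / 2 + b * P" using a0 b by (subst (asm) ennreal_le_iff) auto
  then show ?thesis unfolding a_def P_def by simp
qed


lemma potential_mono:
  assumes "c \<le> c'" and [measurable]: "A \<in> sets borel"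
  shows "emeasure (potential p c) A \<le> emeasure (potential p c') A"
  using nn_integral_excess[of "indicator A" "c' - c" p c] assms by simp

text \<open>The tilted mass near 0 is at most an increment of \<open>pot_mass\<close> over a step
  \<open>2 * d\<close>, hence linear in \<open>d\<close>. Within distance 1 of the origin, removing
  the tilt costs a factor of at most \<open>exp (\<Phi> p)\<close>.\<close>

lemma potential_interval_bound:
  assumes p: "0 \<le> p" and C: "0 \<le> C" and d: "0 < d" "d \<le> 1"
  shows "emeasure (potential p C) {-d<..<d} \<le> ennreal (exp (\<Phi> p) * (2 * d * tilted_scale p (C + 1)))"
proof -
  have Ph: "0 \<le> \<Phi> p" by (rule right_inverse_root(1)[OF p])
  have "emeasure (potential p C) {-d<..<d} \<le> (\<integral>\<^sup>+y. ennreal (exp (\<Phi> p)) * (ennreal (exp (\<Phi> p * y)) * indicator {-d<..<d} y) \<partial>potential p C)"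
  proof -
    have "indicator {-d<..<d} y \<le> ennreal (exp (\<Phi> p)) * (ennreal (exp (\<Phi> p * y)) * indicator {-d<..<d} y)" for y
    proof (cases "y \<in> {-d<..<d}")
      case True
      then have "\<Phi> p * (- 1) \<le> \<Phi> p * y" using Ph d by (intro mult_left_mono) auto
      then have "1 \<le> exp (\<Phi> p) * exp (\<Phi> p * y)" unfolding exp_add[symmetric] by simp
      then have "ennreal 1 \<le> ennreal (exp (\<Phi> p) * exp (\<Phi> p * y))" by (rule ennreal_leI)
      then show ?thesis using True by (simp add: ennreal_mult)
    qed simp
    then have "(\<integral>\<^sup>+y. indicator {-d<..<d} y \<partial>potential p C) \<le> (\<integral>\<^sup>+y. ennreal (exp (\<Phi> p)) * (ennreal (exp (\<Phi> p * y)) * indicator {-d<..<d} y) \<partial>potential p C)"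
      by (intro nn_integral_mono)
    then show ?thesis by simp
  qed
  also have "\<dots> = ennreal (exp (\<Phi> p)) * (\<integral>\<^sup>+y. ennreal (exp (\<Phi> p * y)) * indicator {-d<..<d} y \<partial>potential p C)"
    by (rule nn_integral_cmult) measurable
  also have "(\<integral>\<^sup>+y. ennreal (exp (\<Phi> p * y)) * indicator {-d<..<d} y \<partial>potential p C) \<le> ennreal (2 * d * tilted_scale p (C + 1))"
  proof -
    have dec: "ennreal (pot_tail p C (-d)) \<ge> (\<integral>\<^sup>+y. ennreal (exp (\<Phi> p * y)) * indicator {-d<..<d} y \<partial>potential p C) + ennreal (pot_tail p C d)"
      unfolding pot_tail_ennreal[OF p C]
      by (subst nn_integral_add[symmetric]) (use d in \<open>auto intro!: nn_integral_mono simp: indicator_def\<close>)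
    have fin: "ennreal (pot_tail p C d) \<noteq> \<top>" by simp
    have "pot_tail p C (-d) - pot_tail p C d \<le> 2 * d * tilted_scale p (C + 1)"
    proof -
      have "pot_tail p C (-d) - pot_tail p C d = (pot_mass p (C + d) - pot_mass p (C - d)) - pot_mass p d"
        using d by (simp add: pot_tail_eq[OF p C] pot_mass_def)
      also have "\<dots> \<le> pot_mass p ((C - d) + 2 * d) - pot_mass p (C - d)"
        using pot_mass_mono[OF p, of 0 d] d pot_mass_eq[of 0 p] pot_tail_above[of 0 0 p] by (simp add: add.commute)
      also have "\<dots> \<le> 2 * d * tilted_scale p ((C - d) + 2 * d)" by (rule pot_mass_bounds(2)[OF p]) (use d in simp)
      also have "\<dots> \<le> 2 * d * tilted_scale p (C + 1)" using d by (intro mult_left_mono tilted_scale_mono[OF p]) auto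
      finally show ?thesis .
    qed
    then have "ennreal (pot_tail p C (-d)) \<le> ennreal (2 * d * tilted_scale p (C + 1) + pot_tail p C d)" by (intro ennreal_leI) simp
    also have "\<dots> = ennreal (2 * d * tilted_scale p (C + 1)) + ennreal (pot_tail p C d)"
      using d slope_tendsto(3)[OF p] by (intro ennreal_plus) auto
    finally have "(\<integral>\<^sup>+y. ennreal (exp (\<Phi> p * y)) * indicator {-d<..<d} y \<partial>potential p C) + ennreal (pot_tail p C d) \<le> ennreal (2 * d * tilted_scale p (C + 1)) + ennreal (pot_tail p C d)"
      using dec by (rule order_trans[rotated])
    then show ?thesis using fin by (simp add: add.commute[of _ "ennreal (pot_tail p C d)"] ennreal_add_left_cancel_le)
  qed
  finally show ?thesis
    using d slope_tendsto(3)[OF p, of "C + 1"] by (simp add: ennreal_mult[symmetric] mult_left_mono)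
qed

text \<open>Fix a path. By right continuity it stays above \<open>- c / 2\<close> for a while, and
  by regularity it takes some positive value within that time. Once the level
  \<open>1 / (n + 1)\<close> is below this value, the path is killed before it can come near
  \<open>- c\<close>.\<close>

lemma occupation_away_vanishes:
  assumes c: "0 < c"
  shows "(\<lambda>n. LINT \<omega>|M. of_bool (0 < occupation p (1 / real (Suc n)) {- c<..- c + 1 / real (Suc n)} \<omega>) :: real) \<longlonglongrightarrow> 0"
proof -
  define I where "I n = {- c<..- c + 1 / real (Suc n)}" for n
  define d where "d n = 1 / real (Suc n)" for n
  have "(\<lambda>n. LINT \<omega>|M. of_bool (0 < occupation p (d n) (I n) \<omega>) :: real) \<longlonglongrightarrow> (LINT \<omega>|M. 0)"
  proof (rule integral_dominated_convergence[where w = "\<lambda>_. 1"])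
    have [measurable]: "I n \<in> sets borel" for n by (simp add: I_def)
    show "(\<lambda>\<omega>. of_bool (0 < occupation p (d n) (I n) \<omega>) :: real) \<in> borel_measurable M" for n by measurable
    have "AE \<omega> in M. \<omega> \<in> space M" by simp
    with start_0 AE_regular show "AE \<omega> in M. (\<lambda>n. of_bool (0 < occupation p (d n) (I n) \<omega>) :: real) \<longlonglongrightarrow> 0"
    proof eventually_elim
      case (elim \<omega>)
      let ?w = "\<lambda>r. X r \<omega>"
      have "continuous (at_right 0) ?w" using right_cont_path[OF elim(3)] by (simp add: right_cont_def)
      then have "(?w \<longlongrightarrow> 0) (at_right 0)" using elim(1) by (simp add: continuous_within)
      then have "\<forall>\<^sub>F t in at_right 0. - (c / 2) < ?w t" using c by (intro order_tendstoD) auto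
      then obtain b where b: "0 < b" "\<And>t. 0 < t \<Longrightarrow> t < b \<Longrightarrow> - (c / 2) < ?w t"
        unfolding eventually_at_right_field by auto
      obtain t where t: "fpt 0 ?w \<le> t" "t < fpt 0 ?w + b" "0 < t" "0 < ?w t"
        using fpt_approx[of 0 ?w b] elim(2) b(1) by blast
      have tb: "t < b" using t(2) elim(2) by simp
      have "\<forall>\<^sub>F n in sequentially. d n < ?w t" "\<forall>\<^sub>F n in sequentially. d n < c / 2"
        unfolding d_def using order_tendstoD(2)[OF tendsto_one_over_Suc t(4)] order_tendstoD(2)[OF tendsto_one_over_Suc, of "c / 2"] c by (simp_all del: of_nat_Suc)
      then have "\<forall>\<^sub>F n in sequentially. occupation p (d n) (I n) \<omega> = 0"
      proof eventually_elim
        case (elim n)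
        have "ennreal (of_bool (0 < s \<and> alive (d n) s ?w) * exp (- p * s)) * indicator (I n) (X (max 0 s) \<omega>) = 0" for s
        proof (cases "0 < s \<and> alive (d n) s ?w")
          case True
          have "s < t"
          proof (rule ccontr)
            assume "\<not> s < t"
            then have "?w t \<le> d n" using True t(3) by (auto simp: alive_def)
            then show False using elim by simp
          qed
          then have "- (c / 2) < ?w s" using b(2)[of s] tb True by simp
          then have "X (max 0 s) \<omega> \<notin> I n" using True elim(2) by (auto simp: I_def d_def max_def)
          then show ?thesis by simp
        qed simp
        then show ?case unfolding occupation_def by (subst nn_integral_cong[where v = "\<lambda>_. 0"]) auto
      qed
      then show ?case by (intro tendsto_eventually) (auto elim: eventually_mono)
    qed
  qed auto
  then show ?thesis unfolding I_def d_def by simp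
qed

text \<open>
  A jump at \<open>c\<close> would give the interval \<open>{- c<..- c + d}\<close> a potential of order \<open>d\<close> for the process
  killed at height \<open>d\<close>. By the second moment bound this potential is at most of order \<open>d\<close> times the
  probability of visiting the interval before the passage of \<open>d\<close>, and that probability tends to \<open>0\<close>.
\<close>

lemma tilted_scale_left_limit:
  assumes p: "0 \<le> p" and c: "0 < c" and L: "\<And>y. 0 \<le> y \<Longrightarrow> y < c \<Longrightarrow> tilted_scale p y \<le> L"
  shows "tilted_scale p c \<le> L"
proof -
  define d where "d n = 1 / real (Suc n)" for n
  define P where "P n = (LINT \<omega>|M. of_bool (0 < occupation p (d n) {- c<..- c + d n} \<omega>) :: real)" for n
  \<comment> \<open>The constant of \<open>potential_interval_bound\<close> at level
    \<open>c + 1\<close>, raised by 1 to be strictly positive.\<close>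
  define B where "B = exp (\<Phi> p) * (2 * tilted_scale p (c + 1 + 1)) + 1"
  have d: "0 < d n" "d n \<le> 1" for n by (auto simp: d_def)
  have dl: "d \<longlonglongrightarrow> 0" unfolding d_def by (rule tendsto_one_over_Suc)
  have Pl: "P \<longlonglongrightarrow> 0" unfolding P_def d_def by (rule occupation_away_vanishes[OF c])
  have Ph: "0 \<le> \<Phi> p" by (rule right_inverse_root(1)[OF p])
  have B0: "0 < B" using slope_tendsto(3)[OF p, of "c + 1 + 1"] by (simp add: B_def add_nonneg_pos)
  have L0: "0 \<le> L" using L[of 0] c slope_tendsto(3)[OF p, of 0] by linarith
  have main: "tilted_scale p c \<le> L + 2 * B * P n" if dn: "d n < c" for n
  proof -
    let ?d = "d n" and ?I = "{- c<..- c + d n}"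
    \<comment> \<open>From a point \<open>y\<close> of the interval the remaining level
      \<open>?d - y\<close> is below \<open>c + 1\<close>, and the translated interval lies within
      distance \<open>?d\<close> of 0; so \<open>B\<close> serves all \<open>y\<close> and all
      \<open>n\<close>.\<close>
    have bnd: "emeasure (potential p (?d - y)) {x. y + x \<in> ?I} \<le> ennreal (B * ?d)" if y: "y \<in> ?I" for y
    proof -
      have s: "{x. y + x \<in> ?I} \<subseteq> {-?d<..<?d}" using y by auto
      have "emeasure (potential p (?d - y)) {x. y + x \<in> ?I} \<le> emeasure (potential p (?d - y)) {-?d<..<?d}"
        using s by (intro emeasure_mono) auto
      also have "\<dots> \<le> emeasure (potential p (c + 1)) {-?d<..<?d}" using y d[of n] by (intro potential_mono) auto
      also have "\<dots> \<le> ennreal (exp (\<Phi> p) * (2 * ?d * tilted_scale p (c + 1 + 1)))"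
        using c d by (intro potential_interval_bound p) auto
      also have "\<dots> \<le> ennreal (B * ?d)" using d[of n] by (intro ennreal_leI) (simp add: B_def algebra_simps)
      finally show ?thesis .
    qed
    have tails: "ennreal (pot_tail p ?d (- c)) = (\<integral>\<^sup>+y. ennreal (exp (\<Phi> p * y)) * indicator ?I y \<partial>potential p ?d) + ennreal (pot_tail p ?d (- c + ?d))"
      unfolding pot_tail_ennreal[OF p less_imp_le[OF d(1)]]
      by (subst nn_integral_add[symmetric]) (use d[of n] in \<open>auto intro!: nn_integral_cong simp: indicator_def\<close>)
    have fin: "emeasure (potential p ?d) ?I < \<infinity>"
    proof -
      have "emeasure (potential p ?d) ?I \<le> (\<integral>\<^sup>+y. ennreal (exp (\<Phi> p * c)) * (ennreal (exp (\<Phi> p * y)) * indicator ?I y) \<partial>potential p ?d)"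
      proof -
        have "indicator ?I y \<le> ennreal (exp (\<Phi> p * c)) * (ennreal (exp (\<Phi> p * y)) * indicator ?I y)" for y
        proof (cases "y \<in> ?I")
          case True
          then have "0 \<le> \<Phi> p * (c + y)" using Ph by (intro mult_nonneg_nonneg) auto
          then have "1 \<le> exp (\<Phi> p * c) * exp (\<Phi> p * y)" unfolding exp_add[symmetric] by (simp add: distrib_left)
          then have "ennreal 1 \<le> ennreal (exp (\<Phi> p * c) * exp (\<Phi> p * y))" by (rule ennreal_leI)
          then show ?thesis using True by (simp add: ennreal_mult)
        qed simp
        then have "(\<integral>\<^sup>+y. indicator ?I y \<partial>potential p ?d) \<le> (\<integral>\<^sup>+y. ennreal (exp (\<Phi> p * c)) * (ennreal (exp (\<Phi> p * y)) * indicator ?I y) \<partial>potential p ?d)"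
          by (intro nn_integral_mono)
        then show ?thesis by simp
      qed
      also have "\<dots> = ennreal (exp (\<Phi> p * c)) * (\<integral>\<^sup>+y. ennreal (exp (\<Phi> p * y)) * indicator ?I y \<partial>potential p ?d)"
        by (rule nn_integral_cmult) measurable
      also have "\<dots> \<le> ennreal (exp (\<Phi> p * c)) * ennreal (pot_tail p ?d (- c))"
        unfolding tails by (intro mult_left_mono) auto
      also have "\<dots> < \<infinity>" by (simp add: ennreal_mult_less_top)
      finally show ?thesis .
    qed
    have "(\<integral>\<^sup>+y. ennreal (exp (\<Phi> p * y)) * indicator ?I y \<partial>potential p ?d) \<le> (\<integral>\<^sup>+y. indicator ?I y \<partial>potential p ?d)"
    proof (intro nn_integral_mono)
      fix y
      have "\<Phi> p * y \<le> 0" if "y \<in> ?I" using that dn Ph by (intro mult_nonneg_nonpos) auto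
      then show "ennreal (exp (\<Phi> p * y)) * indicator ?I y \<le> indicator ?I y" by (auto simp: indicator_def)
    qed
    also have "\<dots> = ennreal (measure (potential p ?d) ?I)" using fin by (simp add: emeasure_eq_ennreal_measure less_top)
    finally have "ennreal (pot_tail p ?d (- c)) \<le> ennreal (measure (potential p ?d) ?I) + ennreal (pot_tail p ?d (- c + ?d))"
      unfolding tails by (rule add_right_mono)
    also have "\<dots> = ennreal (measure (potential p ?d) ?I + pot_tail p ?d (- c + ?d))" by (rule ennreal_plus[symmetric]) auto
    finally have "pot_tail p ?d (- c) \<le> measure (potential p ?d) ?I + pot_tail p ?d (- c + ?d)" by (subst (asm) ennreal_le_iff) auto
    \<comment> \<open>The tilted mass of the interval is a second difference of
      \<open>pot_mass\<close> at \<open>c\<close>; a jump of the slope would contribute a term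
      proportional to \<open>?d\<close>.\<close>
    then have "(pot_mass p (c + ?d) - pot_mass p c) - (pot_mass p c - pot_mass p (c - ?d)) \<le> measure (potential p ?d) ?I"
      using d[of n] by (simp add: pot_tail_eq[OF p] add.commute)
    also have "\<dots> \<le> 2 * (B * ?d) * P n"
      unfolding P_def using B0 d bnd p fin by (intro potential_le_hitting) auto
    finally have 1: "(pot_mass p (c + ?d) - pot_mass p c) \<le> (pot_mass p c - pot_mass p (c - ?d)) + 2 * (B * ?d) * P n" by simp
    \<comment> \<open>The bound \<open>L\<close> is available only strictly to the left of
      \<open>c\<close>, so the increment up to \<open>c\<close> is reached from the left by
      continuity of \<open>pot_mass\<close>.\<close>
    have "(\<lambda>m. pot_mass p (c - 1 / real (Suc m) * ?d)) \<longlonglongrightarrow> pot_mass p (c - 0 * ?d)"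
    proof (rule continuous_on_tendsto_compose[OF pot_mass_continuous[OF p]])
      show "(\<lambda>m. c - 1 / real (Suc m) * ?d) \<longlonglongrightarrow> c - 0 * ?d" by (intro tendsto_intros tendsto_one_over_Suc)
    qed auto
    then have kl: "(\<lambda>m. pot_mass p (c - 1 / real (Suc m) * ?d) - pot_mass p (c - ?d)) \<longlonglongrightarrow> pot_mass p c - pot_mass p (c - ?d)"
      by (intro tendsto_diff tendsto_const) simp
    have "pot_mass p (c - 1 / real (Suc m) * ?d) - pot_mass p (c - ?d) \<le> ?d * L" for m
    proof -
      let ?e = "1 / real (Suc m) * ?d"
      have e: "0 < ?e" "?e \<le> ?d" using d[of n] by (auto simp: field_simps)
      have "pot_mass p ((c - ?d) + (?d - ?e)) - pot_mass p (c - ?d) \<le> (?d - ?e) * tilted_scale p ((c - ?d) + (?d - ?e))"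
        by (rule pot_mass_bounds(2)[OF p]) (use e in simp)
      also have "\<dots> \<le> (?d - ?e) * L" using e dn by (intro mult_left_mono L) auto
      also have "\<dots> \<le> ?d * L" using e L0 by (intro mult_right_mono) auto
      finally show ?thesis by simp
    qed
    then have 2: "pot_mass p c - pot_mass p (c - ?d) \<le> ?d * L" using kl by (intro LIMSEQ_le_const2) auto
    have "?d * tilted_scale p c \<le> ?d * (L + 2 * B * P n)"
      using pot_mass_bounds(1)[OF p, of ?d c] d[of n] 1 2 by (simp add: algebra_simps)
    then show ?thesis using d[of n] by simp
  qed
  have "(\<lambda>n. L + 2 * B * P n) \<longlonglongrightarrow> L + 2 * B * 0" by (intro tendsto_intros Pl)
  moreover have "\<forall>\<^sub>F n in sequentially. tilted_scale p c \<le> L + 2 * B * P n"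
    using order_tendstoD(2)[OF dl c] by eventually_elim (rule main)
  ultimately have "tilted_scale p c \<le> L + 2 * B * 0"
    by (intro tendsto_lowerbound[where F = sequentially]) auto
  then show ?thesis by simp
qed

text \<open>From the right: a decreasing limit of the continuous functions \<open>slope p n\<close>
  cannot jump up, and monotonicity prevents a jump down. From the left: if all earlier values stayed
  \<open>e\<close> below the value at \<open>x\<close>, this would contradict
  \<open>tilted_scale_left_limit\<close>. At 0 only the right side matters, and there a jump from
  the value 0 at negative points is allowed.\<close>

lemma tilted_scale_continuous:
  assumes p: "0 \<le> p"
  shows "continuous_on {0..} (tilted_scale p)"
  unfolding continuous_on_iff
proof (intro ballI allI impI)
  fix x e :: real assume x: "x \<in> {0..}" and e: "0 < e"
  have "\<exists>d>0. \<forall>y. x \<le> y \<longrightarrow> y < x + d \<longrightarrow> tilted_scale p y < tilted_scale p x + e"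
  proof -
    obtain n where n: "slope p n x < tilted_scale p x + e"
      using order_tendstoD(2)[OF slope_tendsto(1)[OF p, of x], of "tilted_scale p x + e"] e by (auto simp: eventually_sequentially)
    have kc: "isCont (pot_mass p) z" for z using pot_mass_continuous[OF p] by (simp add: continuous_on_eq_continuous_at)
    have "isCont (\<lambda>x. pot_mass p (x + 1 / 2 ^ n)) x"
      by (rule isCont_o2[of x "\<lambda>x. x + 1 / 2 ^ n", OF _ kc]) (intro continuous_intros)
    then have "isCont (\<lambda>x. 2 ^ n * (pot_mass p (x + 1 / 2 ^ n) - pot_mass p x)) x" by (intro continuous_intros kc)
    then have "isCont (slope p n) x" by (simp add: slope_def[abs_def])
    then have "\<forall>\<^sub>F y in at x. slope p n y < tilted_scale p x + e" using n unfolding isCont_def by (rule order_tendstoD(2))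
    then obtain d where d: "0 < d" "\<And>y. y \<noteq> x \<Longrightarrow> dist y x < d \<Longrightarrow> slope p n y < tilted_scale p x + e"
      unfolding eventually_at by auto
    show ?thesis
    proof (intro exI[of _ d] conjI allI impI d(1))
      fix y assume y: "x \<le> y" "y < x + d"
      have "slope p n y < tilted_scale p x + e"
        using d(2)[of y] n y by (cases "y = x") (auto simp: dist_real_def)
      then show "tilted_scale p y < tilted_scale p x + e" using slope_tendsto(2)[OF p, of y n] by simp
    qed
  qed
  then obtain d1 where d1: "0 < d1" "\<And>y. x \<le> y \<Longrightarrow> y < x + d1 \<Longrightarrow> tilted_scale p y < tilted_scale p x + e" by blast
  have "\<exists>d>0. \<forall>y. 0 \<le> y \<longrightarrow> x - d < y \<longrightarrow> y \<le> x \<longrightarrow> tilted_scale p x - e < tilted_scale p y"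
  proof (cases "x = 0")
    case True
    then show ?thesis using e by (intro exI[of _ 1]) auto
  next
    case False
    have "\<exists>z. 0 \<le> z \<and> z < x \<and> tilted_scale p x - e < tilted_scale p z"
    proof (rule ccontr)
      assume n: "\<not> ?thesis"
      have "tilted_scale p x \<le> tilted_scale p x - e"
      proof (rule tilted_scale_left_limit[OF p])
        show "0 < x" using x False by simp
        show "tilted_scale p y \<le> tilted_scale p x - e" if "0 \<le> y" "y < x" for y
          using n that by (meson not_le)
      qed
      then show False using e by simp
    qed
    then obtain z where z: "0 \<le> z" "z < x" "tilted_scale p x - e < tilted_scale p z" by blast
    show ?thesis
    proof (intro exI[of _ "x - z"] conjI allI impI)
      fix y assume "0 \<le> y" "x - (x - z) < y" "y \<le> x"
      then have "tilted_scale p z \<le> tilted_scale p y" by (intro tilted_scale_mono[OF p]) simp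
      then show "tilted_scale p x - e < tilted_scale p y" using z by simp
    qed (use z in simp)
  qed
  then obtain d2 where d2: "0 < d2" "\<And>y. 0 \<le> y \<Longrightarrow> x - d2 < y \<Longrightarrow> y \<le> x \<Longrightarrow> tilted_scale p x - e < tilted_scale p y" by blast
  show "\<exists>d>0. \<forall>y\<in>{0..}. dist y x < d \<longrightarrow> dist (tilted_scale p y) (tilted_scale p x) < e"
  proof (intro exI[of _ "min d1 d2"] conjI ballI impI)
    fix y assume y: "y \<in> {0..}" "dist y x < min d1 d2"
    show "dist (tilted_scale p y) (tilted_scale p x) < e"
    proof (cases "x \<le> y")
      case True
      then show ?thesis using d1(2)[of y] y tilted_scale_mono[OF p True] by (auto simp: dist_real_def)
    next
      case False
      then show ?thesis using d2(2)[of y] y tilted_scale_mono[OF p, of y x] by (auto simp: dist_real_def)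
    qed
  qed (use d1 d2 in simp)
qed

end

section \<open>Potential density and existence of the scale function\<close>

context spectrally_negative_levy_process
begin

lemma tilted_scale_measurable [measurable]:
  assumes p: "0 \<le> p" shows "tilted_scale p \<in> borel_measurable borel"
  by (rule borel_measurable_mono) (auto intro: monoI tilted_scale_mono[OF p])

text \<open>The difference quotient is squeezed between the values of \<open>tilted_scale p\<close>
  at the two ends, and these merge by continuity.\<close>

lemma pot_mass_deriv:
  assumes p: "0 \<le> p" and x: "0 < x"
  shows "(pot_mass p has_real_derivative tilted_scale p x) (at x)"
proof -
  have "isCont (tilted_scale p) x"
    using tilted_scale_continuous[OF p] x by (intro continuous_on_interior[of "{0..}"]) (auto simp: interior_real_atLeast)
  then have c: "(tilted_scale p \<longlongrightarrow> tilted_scale p x) (at x)" by (simp add: isCont_def)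
  have b: "\<bar>(pot_mass p y - pot_mass p x) / (y - x) - tilted_scale p x\<bar> \<le> \<bar>tilted_scale p y - tilted_scale p x\<bar>" if "y \<noteq> x" for y
  proof (cases "x < y")
    case True
    have "tilted_scale p x \<le> (pot_mass p y - pot_mass p x) / (y - x)" "(pot_mass p y - pot_mass p x) / (y - x) \<le> tilted_scale p y"
      using pot_mass_bounds[OF p, of "y - x" x] True by (auto simp: pos_le_divide_eq pos_divide_le_eq mult.commute)
    then show ?thesis by simp
  next
    case False
    then have yx: "y < x" using that by simp
    have e: "(pot_mass p y - pot_mass p x) / (y - x) = (pot_mass p x - pot_mass p y) / (x - y)"
      by (metis minus_diff_eq minus_divide_divide)
    have "tilted_scale p y \<le> (pot_mass p x - pot_mass p y) / (x - y)" "(pot_mass p x - pot_mass p y) / (x - y) \<le> tilted_scale p x"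
      using pot_mass_bounds[OF p, of "x - y" y] yx by (auto simp: pos_le_divide_eq pos_divide_le_eq mult.commute)
    then show ?thesis unfolding e by simp
  qed
  have z: "((\<lambda>y. \<bar>tilted_scale p y - tilted_scale p x\<bar>) \<longlongrightarrow> 0) (at x)"
    using tendsto_rabs_zero[OF LIM_zero[OF c]] .
  have "((\<lambda>y. (pot_mass p y - pot_mass p x) / (y - x) - tilted_scale p x) \<longlongrightarrow> 0) (at x)"
    by (rule Lim_null_comparison[OF _ z]) (auto simp: eventually_at_filter b)
  then show ?thesis by (simp add: has_field_derivative_iff LIM_zero_iff)
qed

lemma pot_mass_integral:
  assumes p: "0 \<le> p"
  shows "(\<integral>\<^sup>+u. indicator {..<x} u * ennreal (tilted_scale p u) \<partial>lborel) = ennreal (pot_mass p x)"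
proof (cases "0 < x")
  case True
  have "(tilted_scale p has_integral pot_mass p x - pot_mass p 0) {0..x}"
    by (rule fundamental_theorem_of_calculus_interior)
      (use True pot_mass_continuous[OF p] pot_mass_deriv[OF p] in
        \<open>auto simp: has_real_derivative_iff_has_vector_derivative intro: continuous_on_subset\<close>)
  then have hi: "(tilted_scale p has_integral pot_mass p x) {0..x}" by (simp add: pot_mass_def)
  have "(\<integral>\<^sup>+u. indicator {..<x} u * ennreal (tilted_scale p u) \<partial>lborel) = (\<integral>\<^sup>+u. ennreal (indicator {0..x} u * tilted_scale p u) \<partial>lborel)"
  proof (rule nn_integral_cong_AE)
    show "AE u in lborel. indicator {..<x} u * ennreal (tilted_scale p u) = ennreal (indicator {0..x} u * tilted_scale p u)"
      using AE_lborel_singleton[of x]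
    proof eventually_elim
      case (elim u)
      then show ?case by (cases "u < 0") (auto simp: indicator_def tilted_scale_neg)
    qed
  qed
  also have "\<dots> = ennreal (pot_mass p x)"
  proof (rule nn_integral_has_integral_lborel)
    have "((\<lambda>u. if u \<in> {0..x} then tilted_scale p u else 0) has_integral pot_mass p x) UNIV"
      using hi by (simp only: has_integral_restrict_UNIV)
    moreover have "(\<lambda>u. if u \<in> {0..x} then tilted_scale p u else 0) = (\<lambda>u. indicator {0..x} u * tilted_scale p u)" by (auto simp: indicator_def)
    ultimately show "((\<lambda>u. indicator {0..x} u * tilted_scale p u) has_integral pot_mass p x) UNIV" by simp
  qed (use p slope_tendsto(3)[OF p] in auto)
  finally show ?thesis .
next
  case False
  then have "(\<integral>\<^sup>+u. indicator {..<x} u * ennreal (tilted_scale p u) \<partial>lborel) = (\<integral>\<^sup>+u. 0 \<partial>(lborel :: real measure))"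
    by (intro nn_integral_cong) (auto simp: indicator_def tilted_scale_neg)
  then show ?thesis using False by (simp add: pot_mass_def)
qed

lemma tilted_scale_reflect_integral:
  assumes p: "0 \<le> p" and [measurable]: "f \<in> borel_measurable borel"
  shows "(\<integral>\<^sup>+y. f y * ennreal (tilted_scale p (c - y)) \<partial>lborel) = (\<integral>\<^sup>+u. f (c - u) * ennreal (tilted_scale p u) \<partial>lborel)"
proof -
  note [measurable] = tilted_scale_measurable[OF p]
  show ?thesis
    by (subst nn_integral_real_affine[where c = "-1" and t = c]) (auto simp: field_simps)
qed

text \<open>Both tilted measures give every half-line above \<open>z\<close> the same finite mass, a
  difference of two values of \<open>pot_mass\<close>, and such half-lines determine a
  measure.\<close>

lemma potential_density:
  assumes p: "0 \<le> p" and c: "0 \<le> c" and f [measurable]: "f \<in> borel_measurable borel"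
  shows "(\<integral>\<^sup>+y. ennreal (exp (\<Phi> p * y)) * f y \<partial>potential p c) = (\<integral>\<^sup>+y. f y * ennreal (tilted_scale p (c - y) - tilted_scale p (- y)) \<partial>lborel)"
proof -
  note [measurable] = tilted_scale_measurable[OF p]
  let ?d = "\<lambda>y. ennreal (tilted_scale p (c - y) - tilted_scale p (- y))"
  have split: "ennreal (tilted_scale p (c - y)) = ?d y + ennreal (tilted_scale p (- y))" for y
    using tilted_scale_mono[OF p, of "- y" "c - y"] c slope_tendsto(3)[OF p, of "- y"] by (simp add: ennreal_plus[symmetric] del: ennreal_plus)
  define N1 where "N1 = density (potential p c) (\<lambda>y. ennreal (exp (\<Phi> p * y)))"
  define N2 where "N2 = density lborel ?d"
  have e1: "emeasure N1 {z<..} = ennreal (pot_tail p c z)" for z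
    unfolding N1_def pot_tail_ennreal[OF p c] by (subst emeasure_density) auto
  have e2: "emeasure N2 {z<..} = ennreal (pot_tail p c z)" for z
  proof -
    have i: "(\<integral>\<^sup>+y. indicator {z<..} y * ennreal (tilted_scale p (b - y)) \<partial>lborel) = ennreal (pot_mass p (b - z))" for b
    proof -
      have "(\<integral>\<^sup>+y. indicator {z<..} y * ennreal (tilted_scale p (b - y)) \<partial>lborel) = (\<integral>\<^sup>+u. indicator {z<..} (b - u) * ennreal (tilted_scale p u) \<partial>lborel)"
        by (rule tilted_scale_reflect_integral[OF p]) simp
      also have "\<dots> = (\<integral>\<^sup>+u. indicator {..<b - z} u * ennreal (tilted_scale p u) \<partial>lborel)"
        by (intro nn_integral_cong) (auto simp: indicator_def)
      finally show ?thesis by (simp add: pot_mass_integral[OF p])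
    qed
    have "ennreal (pot_mass p (c - z)) = (\<integral>\<^sup>+y. indicator {z<..} y * ?d y + indicator {z<..} y * ennreal (tilted_scale p (0 - y)) \<partial>lborel)"
      unfolding i[symmetric] split by (simp add: distrib_left)
    also have "\<dots> = (\<integral>\<^sup>+y. indicator {z<..} y * ?d y \<partial>lborel) + ennreal (pot_mass p (0 - z))"
      by (subst nn_integral_add) (auto simp: i[of 0, simplified])
    also have "(\<integral>\<^sup>+y. indicator {z<..} y * ?d y \<partial>lborel) = emeasure N2 {z<..}"
      unfolding N2_def by (subst emeasure_density) (auto simp: mult.commute)
    finally have a: "emeasure N2 {z<..} + ennreal (pot_mass p (- z)) = ennreal (pot_mass p (c - z))" by simp
    have kn: "0 \<le> pot_mass p x" for x using pot_mass_mono[OF p, of "min x 0" x] by (simp add: pot_mass_def)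
    have "pot_mass p (c - z) = pot_tail p c z + pot_mass p (- z)" using pot_tail_eq[OF p c, of z] by simp
    then have "ennreal (pot_mass p (c - z)) = ennreal (pot_tail p c z) + ennreal (pot_mass p (- z))"
      by (simp only: ennreal_plus[OF pot_tail_nonneg kn])
    then have "ennreal (pot_mass p (- z)) + emeasure N2 {z<..} = ennreal (pot_mass p (- z)) + ennreal (pot_tail p c z)"
      using a by (simp only: add.commute)
    then show ?thesis by (simp add: ennreal_add_left_cancel)
  qed
  have "N1 = N2"
    by (rule measure_eqI_lessThan) (auto simp: e1 e2, auto simp: N1_def N2_def)
  then have "(\<integral>\<^sup>+y. f y \<partial>N1) = (\<integral>\<^sup>+y. f y \<partial>N2)" by simp
  then show ?thesis unfolding N1_def N2_def by (simp add: nn_integral_density mult.commute)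
qed

text \<open>Let \<open>T\<close> be the transform. Integrating the density at level \<open>c\<close>
  against \<open>exp (l * y)\<close> gives \<open>(exp (l * c) - 1) * T\<close> on one side and the
  potential's transform on the other. Cancellation is legitimate only after \<open>T\<close> is
  known to be finite.\<close>

lemma tilted_scale_laplace:
  assumes p: "0 \<le> p" and l: "0 < l"
  shows "(\<integral>\<^sup>+u. ennreal (exp (- l * u)) * ennreal (tilted_scale p u) \<partial>lborel) = ennreal (1 / (\<psi> (l + \<Phi> p) - p))"
proof -
  note [measurable] = tilted_scale_measurable[OF p]
  let ?x = "\<psi> (l + \<Phi> p) - p"
  have x: "0 < ?x" using right_inverse_root(3)[OF p, of "l + \<Phi> p"] l by simp
  define T where "T = (\<integral>\<^sup>+u. ennreal (exp (- l * u)) * ennreal (tilted_scale p u) \<partial>lborel)"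
  have tilt: "(\<integral>\<^sup>+y. ennreal (exp (\<Phi> p * y)) * ennreal (exp (l * y)) \<partial>potential p c) = ennreal ((exp (l * c) - 1) / ?x)" if "0 \<le> c" for c
  proof -
    have "(\<integral>\<^sup>+y. ennreal (exp (\<Phi> p * y)) * ennreal (exp (l * y)) \<partial>potential p c) = (\<integral>\<^sup>+y. ennreal (exp ((l + \<Phi> p) * y)) \<partial>potential p c)"
      by (intro nn_integral_cong) (simp add: ennreal_mult[symmetric] exp_add[symmetric] distrib_right add.commute)
    then show ?thesis using potential_laplace[OF p that, of "l + \<Phi> p"] l by simp
  qed
  have refl: "(\<integral>\<^sup>+y. ennreal (exp (l * y)) * ennreal (tilted_scale p (c - y)) \<partial>lborel) = ennreal (exp (l * c)) * T" for c
  proof -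
    have "(\<integral>\<^sup>+y. ennreal (exp (l * y)) * ennreal (tilted_scale p (c - y)) \<partial>lborel) = (\<integral>\<^sup>+u. ennreal (exp (l * (c - u))) * ennreal (tilted_scale p u) \<partial>lborel)"
      by (rule tilted_scale_reflect_integral[OF p]) measurable
    also have "\<dots> = (\<integral>\<^sup>+u. ennreal (exp (l * c)) * (ennreal (exp (- l * u)) * ennreal (tilted_scale p u)) \<partial>lborel)"
    proof (intro nn_integral_cong)
      fix u
      have "exp (l * (c - u)) = exp (l * c) * exp (- l * u)" unfolding exp_add[symmetric] by (simp add: algebra_simps)
      then show "ennreal (exp (l * (c - u))) * ennreal (tilted_scale p u) = ennreal (exp (l * c)) * (ennreal (exp (- l * u)) * ennreal (tilted_scale p u))"
        by (simp add: ennreal_mult mult.assoc)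
    qed
    also have "\<dots> = ennreal (exp (l * c)) * T" unfolding T_def by (rule nn_integral_cmult) measurable
    finally show ?thesis .
  qed
  \<comment> \<open>Restricting to \<open>u < n\<close> means \<open>y = n - u > 0\<close> after
    reflection, where the subtracted term \<open>tilted_scale p (- y)\<close> is 0; no difference of
    possibly infinite integrals arises.\<close>
  have part: "(\<integral>\<^sup>+u. indicator {..<real n} u * (ennreal (exp (- l * u)) * ennreal (tilted_scale p u)) \<partial>lborel) \<le> ennreal (1 / ?x)" for n :: nat
  proof -
    let ?J = "\<integral>\<^sup>+u. indicator {..<real n} u * (ennreal (exp (- l * u)) * ennreal (tilted_scale p u)) \<partial>lborel"
    have "ennreal (exp (l * real n)) * ?J = (\<integral>\<^sup>+u. ennreal (exp (l * real n)) * (indicator {..<real n} u * (ennreal (exp (- l * u)) * ennreal (tilted_scale p u))) \<partial>lborel)"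
      by (rule nn_integral_cmult[symmetric]) measurable
    also have "\<dots> = (\<integral>\<^sup>+u. (indicator {0<..} (real n - u) * ennreal (exp (l * (real n - u)))) * ennreal (tilted_scale p u) \<partial>lborel)"
    proof (intro nn_integral_cong)
      fix u
      have "exp (l * (real n - u)) = exp (l * real n) * exp (- l * u)" unfolding exp_add[symmetric] by (simp add: algebra_simps)
      then show "ennreal (exp (l * real n)) * (indicator {..<real n} u * (ennreal (exp (- l * u)) * ennreal (tilted_scale p u))) =
        (indicator {0<..} (real n - u) * ennreal (exp (l * (real n - u)))) * ennreal (tilted_scale p u)"
        by (auto simp: ennreal_mult mult.assoc indicator_def)
    qed
    also have "\<dots> = (\<integral>\<^sup>+y. (indicator {0<..} y * ennreal (exp (l * y))) * ennreal (tilted_scale p (real n - y)) \<partial>lborel)"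
      by (rule tilted_scale_reflect_integral[OF p, symmetric]) measurable
    also have "\<dots> \<le> (\<integral>\<^sup>+y. ennreal (exp (l * y)) * ennreal (tilted_scale p (real n - y) - tilted_scale p (- y)) \<partial>lborel)"
      by (intro nn_integral_mono) (auto simp: indicator_def tilted_scale_neg)
    also have "\<dots> = ennreal ((exp (l * real n) - 1) / ?x)"
      using potential_density[OF p, of "real n" "\<lambda>y. ennreal (exp (l * y))"] tilt[of "real n"] by simp
    also have "\<dots> \<le> ennreal (exp (l * real n) * (1 / ?x))" using x by (intro ennreal_leI) (simp add: divide_right_mono)
    also have "\<dots> = ennreal (exp (l * real n)) * ennreal (1 / ?x)" using x by (intro ennreal_mult) auto
    finally show ?thesis by (subst (asm) ennreal_mult_le_mult_iff) auto
  qed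
  have "T \<le> ennreal (1 / ?x)"
  proof -
    have "T = (\<integral>\<^sup>+u. (SUP n. indicator {..<real n} u * (ennreal (exp (- l * u)) * ennreal (tilted_scale p u))) \<partial>lborel)"
      unfolding T_def
    proof (intro nn_integral_cong)
      fix u :: real
      let ?a = "ennreal (exp (- l * u)) * ennreal (tilted_scale p u)"
      show "?a = (SUP n. indicator {..<real n} u * ?a)"
      proof (rule antisym)
        obtain n where "u < real n" using reals_Archimedean2 by blast
        then show "?a \<le> (SUP n. indicator {..<real n} u * ?a)" by (intro SUP_upper2[of n]) auto
        show "(SUP n. indicator {..<real n} u * ?a) \<le> ?a" by (intro SUP_least) (auto simp: indicator_def)
      qed
    qed
    also have "\<dots> = (SUP n. \<integral>\<^sup>+u. indicator {..<real n} u * (ennreal (exp (- l * u)) * ennreal (tilted_scale p u)) \<partial>lborel)"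
      by (rule nn_integral_monotone_convergence_SUP) (auto simp: incseq_def le_fun_def indicator_def intro!: mult_right_mono)
    also have "\<dots> \<le> ennreal (1 / ?x)" by (intro SUP_least part)
    finally show ?thesis .
  qed
  then obtain r where r: "T = ennreal r" "0 \<le> r" by (cases T) (auto simp: top_unique)
  \<comment> \<open>With \<open>T\<close> finite, the identity at level 1 is a linear equation that
    determines it.\<close>
  have "ennreal (exp (l * 1)) * T = (\<integral>\<^sup>+y. ennreal (exp (l * y)) * ennreal (tilted_scale p (1 - y)) \<partial>lborel)" by (rule refl[symmetric])
  also have "\<dots> = (\<integral>\<^sup>+y. ennreal (exp (l * y)) * ennreal (tilted_scale p (1 - y) - tilted_scale p (- y)) + ennreal (exp (l * y)) * ennreal (tilted_scale p (0 - y)) \<partial>lborel)"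
  proof (intro nn_integral_cong)
    fix y
    have "ennreal (tilted_scale p (1 - y)) = ennreal (tilted_scale p (1 - y) - tilted_scale p (- y)) + ennreal (tilted_scale p (0 - y))"
      using tilted_scale_mono[OF p, of "- y" "1 - y"] slope_tendsto(3)[OF p, of "- y"] by (simp add: ennreal_plus[symmetric] del: ennreal_plus)
    then show "ennreal (exp (l * y)) * ennreal (tilted_scale p (1 - y)) = ennreal (exp (l * y)) * ennreal (tilted_scale p (1 - y) - tilted_scale p (- y)) + ennreal (exp (l * y)) * ennreal (tilted_scale p (0 - y))"
      by (simp only: distrib_left)
  qed
  also have "\<dots> = (\<integral>\<^sup>+y. ennreal (exp (l * y)) * ennreal (tilted_scale p (1 - y) - tilted_scale p (- y)) \<partial>lborel) + ennreal (exp (l * 0)) * T"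
    unfolding refl[symmetric] by (rule nn_integral_add) measurable
  also have "(\<integral>\<^sup>+y. ennreal (exp (l * y)) * ennreal (tilted_scale p (1 - y) - tilted_scale p (- y)) \<partial>lborel) = ennreal ((exp (l * 1) - 1) / ?x)"
    using potential_density[OF p, of 1 "\<lambda>y. ennreal (exp (l * y))"] tilt[of 1] by simp
  finally have "ennreal (exp l * r) = ennreal ((exp l - 1) / ?x + r)"
    using r x l by (simp add: ennreal_mult ennreal_plus)
  then have "exp l * r = (exp l - 1) / ?x + r" using r x l by (subst (asm) ennreal_inj) auto
  then have "(exp l - 1) * r = (exp l - 1) * (1 / ?x)" by (simp add: algebra_simps)
  then have "r = 1 / ?x" using l by (subst (asm) mult_cancel_left) auto
  then show ?thesis using r by (simp add: T_def)
qed

definition scale :: "real \<Rightarrow> real \<Rightarrow> real" where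
  "scale p x = exp (\<Phi> p * x) * tilted_scale p x"

lemma scale_neg: "x < 0 \<Longrightarrow> scale p x = 0" by (simp add: scale_def tilted_scale_neg)

lemma scale_nonneg: "0 \<le> p \<Longrightarrow> 0 \<le> scale p x" using slope_tendsto(3) by (simp add: scale_def)

lemma scale_measurable [measurable]: "0 \<le> p \<Longrightarrow> scale p \<in> borel_measurable borel"
  unfolding scale_def[abs_def] using tilted_scale_measurable[of p] by measurable

lemma scale_continuous: "0 \<le> p \<Longrightarrow> continuous_on {0..} (scale p)"
  unfolding scale_def[abs_def] by (intro continuous_intros tilted_scale_continuous)

lemma scale_laplace:
  assumes p: "0 \<le> p" and l: "\<Phi> p < l"
  shows "has_bochner_integral lborel (\<lambda>y. exp (- l * y) * scale p y) (1 / (\<psi> l - p))"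
proof (rule has_bochner_integral_nn_integral)
  note [measurable] = scale_measurable[OF p]
  show "(\<lambda>y. exp (- l * y) * scale p y) \<in> borel_measurable lborel" by measurable
  show "AE y in lborel. 0 \<le> exp (- l * y) * scale p y" using scale_nonneg[OF p] by auto
  show "0 \<le> 1 / (\<psi> l - p)" using right_inverse_root(3)[OF p l] by simp
  have "(\<integral>\<^sup>+y. ennreal (exp (- l * y) * scale p y) \<partial>lborel) = (\<integral>\<^sup>+u. ennreal (exp (- (l - \<Phi> p) * u)) * ennreal (tilted_scale p u) \<partial>lborel)"
  proof (intro nn_integral_cong)
    fix u
    have "exp (- l * u) * scale p u = exp (- (l - \<Phi> p) * u) * tilted_scale p u"
      unfolding scale_def mult.assoc[symmetric] exp_add[symmetric] by (simp add: algebra_simps)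
    then show "ennreal (exp (- l * u) * scale p u) = ennreal (exp (- (l - \<Phi> p) * u)) * ennreal (tilted_scale p u)"
      using slope_tendsto(3)[OF p, of u] by (simp only: ennreal_mult[OF exp_ge_zero])
  qed
  then show "(\<integral>\<^sup>+y. ennreal (exp (- l * y) * scale p y) \<partial>lborel) = ennreal (1 / (\<psi> l - p))"
    using tilted_scale_laplace[OF p, of "l - \<Phi> p"] l by simp
qed

lemma scale_laplace_half_line:
  assumes p: "0 \<le> p" and l: "\<Phi> p < l"
  shows "set_integrable lborel {0..} (\<lambda>y. exp (- l * y) * scale p y)"
    and "(LBINT y:{0..}. exp (- l * y) * scale p y) = 1 / (\<psi> l - p)"
proof -
  have e: "indicator {0..} y *\<^sub>R (exp (- l * y) * scale p y) = exp (- l * y) * scale p y" for y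
    by (cases "y < 0") (auto simp: scale_neg)
  show "set_integrable lborel {0..} (\<lambda>y. exp (- l * y) * scale p y)"
    "(LBINT y:{0..}. exp (- l * y) * scale p y) = 1 / (\<psi> l - p)"
    unfolding set_integrable_def set_lebesgue_integral_def e using scale_laplace[OF p l] by (auto simp: has_bochner_integral_iff)
qed

text \<open>The construction supplies existence, uniqueness of Laplace transforms among continuous
  functions supplies the rest, and so the description in \<open>scale_function\<close> denotes
  \<open>scale p\<close>.\<close>

theorem scale_function_eq:
  assumes p: "0 \<le> p"
  shows "scale_function M X p = scale p"
  unfolding scale_function_def
proof (rule the_equality)
  show s: "is_scale_function M X p (scale p)"
    unfolding is_scale_function_def
    using scale_neg scale_continuous[OF p] scale_laplace_half_line[OF p] by auto
  fix W assume W: "is_scale_function M X p W"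
  show "W = scale p"
  proof
    fix x
    show "W x = scale p x"
    proof (cases "0 \<le> x")
      case True
      show ?thesis
        by (rule laplace_function_unique[where ?l0.0 = "\<Phi> p", OF _ _ _ _ _ True])
          (use W s in \<open>auto simp: is_scale_function_def\<close>)
    next
      case False
      then show ?thesis using W scale_neg[of x p] by (simp add: is_scale_function_def)
    qed
  qed
qed

lemma potential_density_scale:
  assumes p: "0 \<le> p" and c: "0 \<le> c" and f [measurable]: "f \<in> borel_measurable borel"
  shows "(\<integral>\<^sup>+y. f y \<partial>potential p c) = (\<integral>\<^sup>+y. f y * ennreal (exp (- (\<Phi> p * c)) * scale p (c - y) - scale p (- y)) \<partial>lborel)"
proof -
  note [measurable] = tilted_scale_measurable[OF p]
  have ee: "ennreal (exp (\<Phi> p * y)) * (ennreal (exp (- (\<Phi> p * y))) * a) = a" for y a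
    unfolding mult.assoc[symmetric] by (simp add: ennreal_mult[symmetric] exp_add[symmetric] flip: exp_add)
  have "(\<integral>\<^sup>+y. f y \<partial>potential p c) = (\<integral>\<^sup>+y. ennreal (exp (\<Phi> p * y)) * (ennreal (exp (- (\<Phi> p * y))) * f y) \<partial>potential p c)"
    by (simp only: ee)
  also have "\<dots> = (\<integral>\<^sup>+y. (ennreal (exp (- (\<Phi> p * y))) * f y) * ennreal (tilted_scale p (c - y) - tilted_scale p (- y)) \<partial>lborel)"
    by (rule potential_density[OF p c]) measurable
  also have "\<dots> = (\<integral>\<^sup>+y. f y * ennreal (exp (- (\<Phi> p * c)) * scale p (c - y) - scale p (- y)) \<partial>lborel)"
  proof (intro nn_integral_cong)
    fix y
    have a: "exp (- (\<Phi> p * c)) * exp (\<Phi> p * (c - y)) = exp (- (\<Phi> p * y))" unfolding exp_add[symmetric] by (simp add: algebra_simps)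
    have "exp (- (\<Phi> p * c)) * scale p (c - y) - scale p (- y) = exp (- (\<Phi> p * y)) * (tilted_scale p (c - y) - tilted_scale p (- y))"
      unfolding scale_def mult.assoc[symmetric] a by (simp add: right_diff_distrib)
    moreover have "0 \<le> tilted_scale p (c - y) - tilted_scale p (- y)" using tilted_scale_mono[OF p, of "- y" "c - y"] c by simp
    ultimately show "(ennreal (exp (- (\<Phi> p * y))) * f y) * ennreal (tilted_scale p (c - y) - tilted_scale p (- y)) =
      f y * ennreal (exp (- (\<Phi> p * c)) * scale p (c - y) - scale p (- y))"
      by (simp add: ennreal_mult mult_ac)
  qed
  finally show ?thesis .
qed

end

section \<open>The Feynman--Kac formula\<close>

lemma fpt_shift:
  assumes s: "0 \<le> s" and a: "alive c s w"
  shows "passes c (\<lambda>r. w (s + r)) \<longleftrightarrow> passes c w" "passes c w \<Longrightarrow> fpt c (\<lambda>r. w (s + r)) = fpt c w - s"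
proof -
  have later: "s < t" if "0 < t" "c < w t" for t
  proof (rule ccontr)
    assume "\<not> s < t"
    then have "w t \<le> c" using a that by (simp add: alive_def)
    then show False using that by simp
  qed
  show iff: "passes c (\<lambda>r. w (s + r)) \<longleftrightarrow> passes c w"
  proof
    assume "passes c (\<lambda>r. w (s + r))"
    then obtain r where "0 < r" "c < w (s + r)" by (auto simp: passes_def)
    then show "passes c w" unfolding passes_def using s by (intro exI[of _ "s + r"]) auto
  next
    assume "passes c w"
    then obtain t where t: "0 < t" "c < w t" by (auto simp: passes_def)
    then show "passes c (\<lambda>r. w (s + r))" unfolding passes_def using later[OF t] by (intro exI[of _ "t - s"]) auto
  qed
  assume p: "passes c w"
  show "fpt c (\<lambda>r. w (s + r)) = fpt c w - s"
  proof (rule antisym)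
    show "fpt c w - s \<le> fpt c (\<lambda>r. w (s + r))"
      unfolding fpt_def[of c "\<lambda>r. w (s + r)"]
    proof (rule cInf_greatest)
      show "{r. 0 < r \<and> c < w (s + r)} \<noteq> {}" using p iff by (auto simp: passes_def)
      fix r assume "r \<in> {r. 0 < r \<and> c < w (s + r)}"
      then show "fpt c w - s \<le> r" using fpt_le[of "s + r" c w] s by auto
    qed
    have "fpt c (\<lambda>r. w (s + r)) + s \<le> fpt c w"
      unfolding fpt_def[of c w]
    proof (rule cInf_greatest)
      show "{t. 0 < t \<and> c < w t} \<noteq> {}" using p by (auto simp: passes_def)
      fix t assume t: "t \<in> {t. 0 < t \<and> c < w t}"
      then have "s < t" using later by auto
      then show "fpt c (\<lambda>r. w (s + r)) + s \<le> t" using fpt_le[of "t - s" c "\<lambda>r. w (s + r)"] t by auto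
    qed
    then show "fpt c (\<lambda>r. w (s + r)) \<le> fpt c w - s" by simp
  qed
qed

lemma set_integral_Icc_Ioc:
  fixes f :: "real \<Rightarrow> real"
  shows "(LBINT s:{a..b}. f s) = (LBINT s:{a<..b}. f s)"
proof (cases "a \<le> b")
  case True
  then show ?thesis using interval_integral_Icc[OF True, of f] interval_integral_Ioc[OF True, of f] by simp
qed (simp add: set_lebesgue_integral_def)

text \<open>For a single path this is the fundamental theorem of calculus for the exponential of the
  running integral \<open>G\<close> of \<open>\<kappa>\<close>, multiplied by the total discount
  \<open>exp (- (P * \<tau> + G \<tau>))\<close>, where \<open>\<tau>\<close> is the passage time. A
  path that never passes has discount 0 throughout.\<close>

lemma path_feynman_kac:
  fixes P c :: real
  assumes w: "right_cont w" and [measurable]: "\<kappa> \<in> borel_measurable borel" and B: "\<And>y. \<bar>\<kappa> y\<bar> \<le> B"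
  defines "g \<equiv> \<lambda>y. P + \<kappa> y"
  shows "has_bochner_integral lborel
    (\<lambda>s. of_bool (0 < s \<and> alive c s w) * exp (- P * s) * \<kappa> (w (max 0 s)) * path_discount g c (\<lambda>r. w (max 0 s + r)))
    (path_discount (\<lambda>_. P) c w - path_discount g c w)"
proof (cases "passes c w")
  case False
  have e: "of_bool (0 < s \<and> alive c s w) * exp (- P * s) * \<kappa> (w (max 0 s)) * path_discount g c (\<lambda>r. w (max 0 s + r)) = 0" for s
    using False fpt_shift(1)[of s c w] by (auto simp: path_discount_def max_def)
  show ?thesis unfolding e using False by (simp add: path_discount_def has_bochner_integral_zero)
next
  case True
  note wm [measurable] = right_cont_measurable[OF w]
  let ?\<tau> = "fpt c w"
  have \<tau>: "0 \<le> ?\<tau>" by (rule fpt_nonneg[OF True])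
  define f where "f s = \<kappa> (w (max 0 s))" for s
  have [measurable]: "f \<in> borel_measurable borel" unfolding f_def by measurable
  have fB: "\<bar>f s\<bar> \<le> B" for s using B by (simp add: f_def)
  define G where "G s = (LBINT r:{0<..s}. f r)" for s
  have fi: "set_integrable lborel {x<..y} f" for x y
    by (rule integrable_bounded_interval[of _ _ x y B]) (use fB in auto)
  have Gd: "(LBINT r:{x<..y}. f r) = G y - G x" if "0 \<le> x" "x \<le> y" for x y
  proof -
    have "{0<..y} = {0<..x} \<union> {x<..y}" using that by auto
    then show ?thesis unfolding G_def using fi by (simp add: set_integral_Un)
  qed
  have g_int: "(LBINT r:{0..t - s}. g (w (s + r))) = P * (t - s) + (G t - G s)" if "0 \<le> s" "s \<le> t" for s t
  proof -
    have ind: "indicator {0<..t - s} r = (indicator {s<..t} (s + r) :: real)" for r by (auto simp: indicator_def)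
    have "(LBINT r:{0..t - s}. g (w (s + r))) = (LBINT r:{0<..t - s}. g (w (s + r)))" by (rule set_integral_Icc_Ioc)
    also have "\<dots> = (LINT r|lborel. indicator {s<..t} (s + 1 * r) *\<^sub>R (P + f (s + 1 * r)))"
      unfolding set_lebesgue_integral_def using that by (intro Bochner_Integration.integral_cong) (auto simp: ind g_def f_def indicator_def)
    also have "\<dots> = (LBINT r:{s<..t}. P + f r)"
      unfolding set_lebesgue_integral_def
      using lborel_integral_real_affine[of 1 "\<lambda>r. indicator {s<..t} r *\<^sub>R (P + f r)" s] by simp
    also have "\<dots> = (LBINT r:{s<..t}. P) + (LBINT r:{s<..t}. f r)"
      by (rule set_integral_add) (use fi in \<open>auto simp: set_integrable_def\<close>)
    also have "\<dots> = P * (t - s) + (G t - G s)"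
      using that Gd[OF that] by (simp add: set_lebesgue_integral_def)
    finally show ?thesis .
  qed
  have R: "path_discount g c (\<lambda>r. w (s + r)) = exp (- (P * (?\<tau> - s) + (G ?\<tau> - G s)))" if "0 \<le> s" "s \<le> ?\<tau>" "alive c s w" for s
    using fpt_shift[OF that(1,3)] True g_int[OF that(1,2)] by (simp add: path_discount_def)
  have G0: "G 0 = 0" by (simp add: G_def set_lebesgue_integral_def)
  have R0: "path_discount g c w = exp (- (P * ?\<tau> + G ?\<tau>))"
    using g_int[of 0 ?\<tau>] \<tau> True G0 by (simp add: path_discount_def)
  have "has_bochner_integral lborel (\<lambda>s. indicator {0<..?\<tau>} s *\<^sub>R (f s * exp (G s))) (exp (G ?\<tau>) - 1)"
    unfolding has_bochner_integral_iff
    using exp_integral_identity[of f B ?\<tau>] fB \<tau> by (simp add: set_integrable_def set_lebesgue_integral_def G_def)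
  then have "has_bochner_integral lborel (\<lambda>s. (indicator {0<..?\<tau>} s *\<^sub>R (f s * exp (G s))) * exp (- (P * ?\<tau> + G ?\<tau>))) ((exp (G ?\<tau>) - 1) * exp (- (P * ?\<tau> + G ?\<tau>)))"
    by (rule has_bochner_integral_mult_left[rotated])
  moreover have "(exp (G ?\<tau>) - 1) * exp (- (P * ?\<tau> + G ?\<tau>)) = path_discount (\<lambda>_. P) c w - path_discount g c w"
    unfolding R0 path_discount_const using True by (simp add: left_diff_distrib exp_add[symmetric] flip: exp_add)
  ultimately have v: "has_bochner_integral lborel (\<lambda>s. (indicator {0<..?\<tau>} s *\<^sub>R (f s * exp (G s))) * exp (- (P * ?\<tau> + G ?\<tau>))) (path_discount (\<lambda>_. P) c w - path_discount g c w)"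
    by (simp only:)
  let ?h = "\<lambda>s. of_bool (0 < s \<and> alive c s w) * exp (- P * s) * \<kappa> (w (max 0 s)) * path_discount g c (\<lambda>r. w (max 0 s + r))"
  let ?k = "\<lambda>s. (indicator {0<..?\<tau>} s *\<^sub>R (f s * exp (G s))) * exp (- (P * ?\<tau> + G ?\<tau>))"
  have km [measurable]: "?k \<in> borel_measurable lborel"
    using v by (auto simp: has_bochner_integral_iff dest: borel_measurable_integrable)
  have heq: "?h s = ?k s" if "s \<noteq> ?\<tau>" for s
  proof (cases "0 < s \<and> s < ?\<tau>")
    case True
    then have al: "alive c s w" by (intro alive_before_fpt) auto
    \<comment> \<open>The product of \<open>exp (G s)\<close> and the total discount splits at
      \<open>s\<close>: rate \<open>P\<close> alone before \<open>s\<close>, the full rate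
      afterwards.\<close>
    have e: "exp (- P * s) * exp (- (P * (?\<tau> - s) + (G ?\<tau> - G s))) = exp (G s) * exp (- (P * ?\<tau> + G ?\<tau>))"
      unfolding exp_add[symmetric] by (simp add: algebra_simps)
    have "?h s = f s * (exp (- P * s) * exp (- (P * (?\<tau> - s) + (G ?\<tau> - G s))))"
      using True al R[of s] by (simp add: f_def max_def)
    then show ?thesis unfolding e using True by (simp add: indicator_def)
  next
    case False
    then have "\<not> (0 < s \<and> alive c s w)"
      using that alive_imp_le_fpt[OF \<open>passes c w\<close>, of s] by auto
    then show ?thesis using False that by (auto simp: indicator_def)
  qed
  have "?h = (\<lambda>s. if s = ?\<tau> then ?h ?\<tau> else ?k s)" by (rule ext) (use heq in simp)
  moreover have "(\<lambda>s. if s = ?\<tau> then ?h ?\<tau> else ?k s) \<in> borel_measurable lborel" by measurable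
  ultimately have hm: "?h \<in> borel_measurable lborel" by (simp only:)
  have "AE s in lborel. ?k s = ?h s"
    using AE_lborel_singleton[of ?\<tau>] by eventually_elim (rule heq[symmetric])
  then show ?thesis using has_bochner_integral_cong_AE[OF km hm] v by simp
qed

context spectrally_negative_levy_process
begin

lemma alive_translate: "alive d t (\<lambda>r. a + w r) = alive (d - a) t w"
  by (auto simp: alive_def algebra_simps)

lemma passes_translate: "passes d (\<lambda>r. a + w r) = passes (d - a) w"
  by (auto simp: passes_def algebra_simps)

lemma fpt_translate: "fpt d (\<lambda>r. a + w r) = fpt (d - a) w"
  by (simp add: fpt_def algebra_simps)

text \<open>After taking expectations in the pathwise identity, the Markov property at
  \<open>s\<close> turns the discount accumulated after \<open>s\<close> into
  \<open>u (X s)\<close>. The integral over \<open>s\<close> is then an integral against the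
  \<open>P\<close>-potential, for which the density is available.\<close>

lemma feynman_kac:
  assumes P: "0 \<le> P" and PQ: "0 \<le> P + Q" and B [measurable]: "B \<in> sets borel" and Ba: "B \<subseteq> {a..}"
    and F: "path_functional (path_discount (\<lambda>y. P + Q * indicator B y) c)" and x: "x \<le> c"
  defines "u \<equiv> \<lambda>y. LINT \<omega>|M. path_discount (\<lambda>y. P + Q * indicator B y) c (\<lambda>r. y + X r \<omega>)"
  shows "integrable lborel (\<lambda>y. indicator B y * u y * (exp (- (\<Phi> P * (c - x))) * scale P (c - y) - scale P (x - y)))"
    and "u x = exp (- (\<Phi> P * (c - x))) - Q * (LINT y|lborel. indicator B y * u y * (exp (- (\<Phi> P * (c - x))) * scale P (c - y) - scale P (x - y)))"
proof -
  interpret PS: pair_sigma_finite lborel M ..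
  define g where "g = (\<lambda>y. P + Q * indicator B y :: real)"
  define Fg where "Fg = path_discount g c"
  have FF: "path_functional Fg" using F by (simp add: Fg_def g_def)
  have u: "u = (\<lambda>y. LINT \<omega>|M. Fg (\<lambda>r. y + X r \<omega>))" by (simp add: u_def Fg_def g_def)
  have g0: "0 \<le> g y" for y using P PQ by (auto simp: g_def indicator_def)
  have Fb: "0 \<le> Fg w" "Fg w \<le> 1" for w unfolding Fg_def by (rule path_discount_bounds[OF g0])+
  have Fi: "integrable M (\<lambda>\<omega>. Fg (\<lambda>r. y + X r \<omega>))" for y by (rule path_functional_integrable[OF FF])
  have ub: "0 \<le> u y" "u y \<le> 1" for y
    unfolding u using Fi Fb by (auto intro!: integral_nonneg_AE integral_le_const)
  have [measurable]: "u \<in> borel_measurable borel" unfolding u by (rule expectation_functional_measurable[OF FF])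
  note [measurable] = scale_measurable[OF P]
  let ?c = "c - x"
  have c0: "0 \<le> ?c" using x by simp
  define f where "f y = ennreal (indicator B (x + y) * u (x + y))" for y
  have [measurable]: "f \<in> borel_measurable borel" unfolding f_def by measurable
  define k where "k y = exp (- (\<Phi> P * ?c)) * scale P (c - y) - scale P (x - y)" for y
  have [measurable]: "k \<in> borel_measurable borel" unfolding k_def by measurable
  have kpos: "0 \<le> k y" for y
  proof -
    have "k y = exp (- (\<Phi> P * (y - x))) * (tilted_scale P (c - y) - tilted_scale P (x - y))"
    proof -
      have "exp (- (\<Phi> P * ?c)) * exp (\<Phi> P * (c - y)) = exp (- (\<Phi> P * (y - x)))" unfolding exp_add[symmetric] by (simp add: algebra_simps)
      moreover have "exp (\<Phi> P * (x - y)) = exp (- (\<Phi> P * (y - x)))" by (simp add: algebra_simps)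
      ultimately show ?thesis unfolding k_def scale_def mult.assoc[symmetric] by (simp add: right_diff_distrib)
    qed
    then show ?thesis using tilted_scale_mono[OF P, of "x - y" "c - y"] x by simp
  qed
  have dens: "(\<integral>\<^sup>+y. f y \<partial>potential P ?c) = (\<integral>\<^sup>+y. ennreal (indicator B y * u y * k y) \<partial>lborel)"
  proof -
    have "(\<integral>\<^sup>+y. f y \<partial>potential P ?c) = (\<integral>\<^sup>+y. f y * ennreal (exp (- (\<Phi> P * ?c)) * scale P (?c - y) - scale P (- y)) \<partial>lborel)"
      by (rule potential_density_scale[OF P c0]) measurable
    also have "\<dots> = (\<integral>\<^sup>+y. ennreal (indicator B (x + 1 * y) * u (x + 1 * y) * k (x + 1 * y)) \<partial>lborel)"
    proof (intro nn_integral_cong)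
      fix y
      have "exp (- (\<Phi> P * ?c)) * scale P (?c - y) - scale P (- y) = k (x + y)" by (simp add: k_def diff_diff_eq)
      then show "f y * ennreal (exp (- (\<Phi> P * ?c)) * scale P (?c - y) - scale P (- y)) = ennreal (indicator B (x + 1 * y) * u (x + 1 * y) * k (x + 1 * y))"
        using ub kpos by (simp add: f_def ennreal_mult)
    qed
    also have "\<dots> = (\<integral>\<^sup>+y. ennreal (indicator B y * u y * k y) \<partial>lborel)"
      using nn_integral_real_affine[of "\<lambda>y. ennreal (indicator B y * u y * k y)" 1 x] by simp
    finally show ?thesis .
  qed
  have fin: "(\<integral>\<^sup>+y. f y \<partial>potential P ?c) < \<infinity>"
  proof -
    have Ph: "0 \<le> \<Phi> P" by (rule right_inverse_root(1)[OF P])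
    \<comment> \<open>Every point of \<open>B - x\<close> is at least \<open>a - x\<close>; the
      extra 1 puts it strictly above \<open>?z\<close>, where the tilted potential has finite
      mass.\<close>
    let ?z = "a - x - 1"
    have "(\<integral>\<^sup>+y. f y \<partial>potential P ?c) \<le> (\<integral>\<^sup>+y. ennreal (exp (- (\<Phi> P * ?z))) * (ennreal (exp (\<Phi> P * y)) * indicator {?z<..} y) \<partial>potential P ?c)"
    proof (intro nn_integral_mono)
      fix y
      show "f y \<le> ennreal (exp (- (\<Phi> P * ?z))) * (ennreal (exp (\<Phi> P * y)) * indicator {?z<..} y)"
      proof (cases "x + y \<in> B")
        case True
        then have y: "?z < y" using Ba by auto
        then have "0 \<le> \<Phi> P * (y - ?z)" using Ph by simp
        then have "1 \<le> exp (- (\<Phi> P * ?z)) * exp (\<Phi> P * y)" unfolding exp_add[symmetric] by (simp add: algebra_simps)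
        then have "u (x + y) \<le> exp (- (\<Phi> P * ?z)) * exp (\<Phi> P * y)" using ub[of "x + y"] by linarith
        then have "ennreal (u (x + y)) \<le> ennreal (exp (- (\<Phi> P * ?z)) * exp (\<Phi> P * y))" by (rule ennreal_leI)
        then show ?thesis using True y by (simp add: f_def ennreal_mult)
      qed (simp add: f_def)
    qed
    also have "\<dots> = ennreal (exp (- (\<Phi> P * ?z))) * (\<integral>\<^sup>+y. ennreal (exp (\<Phi> P * y)) * indicator {?z<..} y \<partial>potential P ?c)"
      by (rule nn_integral_cmult) measurable
    also have "\<dots> < \<infinity>" using pot_tail_finite[OF P c0, of ?z] by (simp add: ennreal_mult_less_top)
    finally show ?thesis .
  qed
  have ki: "integrable lborel (\<lambda>y. indicator B y * u y * k y)"
  proof (rule integrableI_nonneg)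
    show "(\<integral>\<^sup>+y. ennreal (indicator B y * u y * k y) \<partial>lborel) < \<infinity>" using fin unfolding dens .
  qed (use kpos ub in \<open>auto intro!: AE_I2 mult_nonneg_nonneg\<close>)
  then show "integrable lborel (\<lambda>y. indicator B y * u y * (exp (- (\<Phi> P * (c - x))) * scale P (c - y) - scale P (x - y)))"
    by (simp add: k_def)
  have dens_real: "(\<integral>\<^sup>+y. f y \<partial>potential P ?c) = ennreal (LINT y|lborel. indicator B y * u y * k y)"
    unfolding dens by (rule nn_integral_eq_integral[OF ki]) (use kpos ub in \<open>auto intro!: AE_I2 mult_nonneg_nonneg\<close>)
  define D where "D \<omega> = path_discount (\<lambda>_. P) c (\<lambda>r. x + X r \<omega>)" for \<omega>
  have Deq: "D = passage_discount P ?c"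
    by (simp add: fun_eq_iff D_def passage_discount_eq path_discount_const passes_translate fpt_translate)
  have Di: "integrable M D" unfolding Deq by (rule passage_discount_integrable[OF P])
  have ED: "(LINT \<omega>|M. D \<omega>) = exp (- (\<Phi> P * ?c))" unfolding Deq by (rule passage_laplace[OF P c0])
  have "Q * (LINT y|lborel. indicator B y * u y * k y) = (LINT \<omega>|M. D \<omega> - Fg (\<lambda>r. x + X r \<omega>))"
  proof (cases "Q = 0")
    case True
    then have "D \<omega> - Fg (\<lambda>r. x + X r \<omega>) = 0" for \<omega> by (simp add: D_def Fg_def g_def)
    then show ?thesis using True by simp
  next
    case False
    \<comment> \<open>The pathwise integrand divided by \<open>Q\<close> is nonnegative whatever the
      sign of \<open>Q\<close>, so Tonelli's theorem applies in both parts of the result.\<close>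
    define h where "h \<omega> s = of_bool (0 < s \<and> alive c s (\<lambda>r. x + X r \<omega>)) * exp (- P * s) * indicator B (x + X (max 0 s) \<omega>) * Fg (\<lambda>r. x + X (max 0 s + r) \<omega>)" for \<omega> s
    have path: "has_bochner_integral lborel (h \<omega>) ((D \<omega> - Fg (\<lambda>r. x + X r \<omega>)) / Q)" if "\<omega> \<in> space M" for \<omega>
    proof -
      have "has_bochner_integral lborel
        (\<lambda>s. of_bool (0 < s \<and> alive c s (\<lambda>r. x + X r \<omega>)) * exp (- P * s) * (Q * indicator B (x + X (max 0 s) \<omega>)) * Fg (\<lambda>r. x + X (max 0 s + r) \<omega>))
        (D \<omega> - Fg (\<lambda>r. x + X r \<omega>))"
        unfolding D_def Fg_def g_def
        by (rule path_feynman_kac[OF right_cont_path_start[OF that], where B = "\<bar>Q\<bar>"]) (auto simp: indicator_def)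
      then have "has_bochner_integral lborel
        (\<lambda>s. (of_bool (0 < s \<and> alive c s (\<lambda>r. x + X r \<omega>)) * exp (- P * s) * (Q * indicator B (x + X (max 0 s) \<omega>)) * Fg (\<lambda>r. x + X (max 0 s + r) \<omega>)) / Q)
        ((D \<omega> - Fg (\<lambda>r. x + X r \<omega>)) / Q)"
        by (rule has_bochner_integral_divide_zero)
      moreover have "(of_bool (0 < s \<and> alive c s (\<lambda>r. x + X r \<omega>)) * exp (- P * s) * (Q * indicator B (x + X (max 0 s) \<omega>)) * Fg (\<lambda>r. x + X (max 0 s + r) \<omega>)) / Q = h \<omega> s" for s
        using False by (simp add: h_def)
      ultimately show ?thesis by simp
    qed
    have h0: "0 \<le> h \<omega> s" for \<omega> s unfolding h_def using Fb by (intro mult_nonneg_nonneg) auto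
    have hn: "(\<integral>\<^sup>+s. ennreal (h \<omega> s) \<partial>lborel) = ennreal ((D \<omega> - Fg (\<lambda>r. x + X r \<omega>)) / Q)" "0 \<le> (D \<omega> - Fg (\<lambda>r. x + X r \<omega>)) / Q" if "\<omega> \<in> space M" for \<omega>
    proof -
      have i: "integrable lborel (h \<omega>)" "integral\<^sup>L lborel (h \<omega>) = (D \<omega> - Fg (\<lambda>r. x + X r \<omega>)) / Q"
        using path[OF that] by (auto simp: has_bochner_integral_iff)
      show "(\<integral>\<^sup>+s. ennreal (h \<omega> s) \<partial>lborel) = ennreal ((D \<omega> - Fg (\<lambda>r. x + X r \<omega>)) / Q)"
        using nn_integral_eq_integral[OF i(1)] h0 i(2) by simp
      show "0 \<le> (D \<omega> - Fg (\<lambda>r. x + X r \<omega>)) / Q"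
        unfolding i(2)[symmetric] using h0 by (intro integral_nonneg_AE) auto
    qed
    have hm: "(\<lambda>z. ennreal (h (snd z) (fst z))) \<in> borel_measurable (lborel \<Otimes>\<^sub>M M)"
    proof -
      have [measurable]: "(\<lambda>z. Fg (\<lambda>r. x + X (max 0 (fst z) + r) (snd z))) \<in> borel_measurable (lborel \<Otimes>\<^sub>M M)"
        by (rule path_functional_measurable[OF FF]) measurable
      have "(\<lambda>z. ennreal (of_bool (0 < fst z) * of_bool (alive c (fst z) (\<lambda>r. x + X r (snd z))) * exp (- P * fst z) * indicator B (x + X (max 0 (fst z)) (snd z)) * Fg (\<lambda>r. x + X (max 0 (fst z) + r) (snd z)))) \<in> borel_measurable (lborel \<Otimes>\<^sub>M M)"
        by measurable
      then show ?thesis by (simp add: h_def of_bool_conj)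
    qed
    have inner: "(\<integral>\<^sup>+\<omega>. ennreal (h \<omega> s) \<partial>M) = (\<integral>\<^sup>+\<omega>. ennreal (of_bool (0 < s \<and> alive ?c s (\<lambda>r. X r \<omega>)) * exp (- P * s)) * f (X (max 0 s) \<omega>) \<partial>M)" for s
    proof (cases "0 < s")
      case True
      have [measurable]: "X s \<in> borel_measurable M" using True by simp
      let ?a = "\<lambda>\<omega>. of_bool (alive c s (\<lambda>r. x + X r \<omega>)) * indicator B (x + X s \<omega>) :: real"
      have mk: "(LINT \<omega>|M. ?a \<omega> * Fg (\<lambda>r. x + X (s + r) \<omega>)) = (LINT \<omega>|M. ?a \<omega> * u (x + X s \<omega>))"
        unfolding u by (rule markov_property[OF FF True]) (auto simp: indicator_def)
      have [measurable]: "(\<lambda>\<omega>. Fg (\<lambda>r. x + X (s + r) \<omega>)) \<in> borel_measurable M"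
        using path_functional_measurable[OF FF, of "\<lambda>_. s" M "\<lambda>\<omega>. \<omega>" "\<lambda>_. x"] True by simp
      have i1: "integrable M (\<lambda>\<omega>. ?a \<omega> * Fg (\<lambda>r. x + X (s + r) \<omega>))" and i2: "integrable M (\<lambda>\<omega>. ?a \<omega> * u (x + X s \<omega>))"
        by (rule integrable_const_bound[of _ 1]; use Fb ub in \<open>auto simp: indicator_def abs_of_nonneg\<close>)+
      have "(\<integral>\<^sup>+\<omega>. ennreal (h \<omega> s) \<partial>M) = (\<integral>\<^sup>+\<omega>. ennreal (exp (- P * s) * (?a \<omega> * Fg (\<lambda>r. x + X (s + r) \<omega>))) \<partial>M)"
        using True by (intro nn_integral_cong) (simp add: h_def mult_ac)
      also have "\<dots> = ennreal (LINT \<omega>|M. exp (- P * s) * (?a \<omega> * Fg (\<lambda>r. x + X (s + r) \<omega>)))"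
        by (rule nn_integral_eq_integral) (use i1 Fb in \<open>auto intro!: integrable_mult_right mult_nonneg_nonneg\<close>)
      also have "(LINT \<omega>|M. exp (- P * s) * (?a \<omega> * Fg (\<lambda>r. x + X (s + r) \<omega>))) = (LINT \<omega>|M. exp (- P * s) * (?a \<omega> * u (x + X s \<omega>)))"
        unfolding integral_mult_right_zero mk ..
      also have "ennreal \<dots> = (\<integral>\<^sup>+\<omega>. ennreal (exp (- P * s) * (?a \<omega> * u (x + X s \<omega>))) \<partial>M)"
        by (rule nn_integral_eq_integral[symmetric]) (use i2 ub in \<open>auto intro!: integrable_mult_right mult_nonneg_nonneg\<close>)
      also have "\<dots> = (\<integral>\<^sup>+\<omega>. ennreal (of_bool (0 < s \<and> alive ?c s (\<lambda>r. X r \<omega>)) * exp (- P * s)) * f (X (max 0 s) \<omega>) \<partial>M)"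
        using True ub by (intro nn_integral_cong) (simp add: f_def alive_translate ennreal_mult[symmetric] mult_ac)
      finally show ?thesis .
    qed (simp add: h_def)
    have "ennreal (LINT y|lborel. indicator B y * u y * k y) = (\<integral>\<^sup>+s. \<integral>\<^sup>+\<omega>. ennreal (h \<omega> s) \<partial>M \<partial>lborel)"
      unfolding dens_real[symmetric] inner by (rule nn_integral_potential(1)) measurable
    also have "\<dots> = (\<integral>\<^sup>+\<omega>. \<integral>\<^sup>+s. ennreal (h \<omega> s) \<partial>lborel \<partial>M)"
      by (rule PS.Fubini'[symmetric]) (use hm in \<open>simp add: case_prod_beta'\<close>)
    also have "\<dots> = (\<integral>\<^sup>+\<omega>. ennreal ((D \<omega> - Fg (\<lambda>r. x + X r \<omega>)) / Q) \<partial>M)" by (intro nn_integral_cong hn(1))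
    also have "\<dots> = ennreal (LINT \<omega>|M. (D \<omega> - Fg (\<lambda>r. x + X r \<omega>)) / Q)"
      by (rule nn_integral_eq_integral) (use Di Fi hn(2) in auto)
    finally have e: "ennreal (LINT y|lborel. indicator B y * u y * k y) = ennreal (LINT \<omega>|M. (D \<omega> - Fg (\<lambda>r. x + X r \<omega>)) / Q)" .
    have l0: "0 \<le> (LINT y|lborel. indicator B y * u y * k y)"
      using kpos ub by (intro integral_nonneg_AE AE_I2 mult_nonneg_nonneg) auto
    have r0: "0 \<le> (LINT \<omega>|M. (D \<omega> - Fg (\<lambda>r. x + X r \<omega>)) / Q)"
      by (rule integral_nonneg_AE, rule AE_I2, rule hn(2))
    have "(LINT y|lborel. indicator B y * u y * k y) = (LINT \<omega>|M. (D \<omega> - Fg (\<lambda>r. x + X r \<omega>)) / Q)"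
      using e ennreal_inj[OF l0 r0] by blast
    then show ?thesis using False by simp
  qed
  also have "\<dots> = exp (- (\<Phi> P * ?c)) - u x" using Di Fi ED by (simp add: u)
  finally show "u x = exp (- (\<Phi> P * (c - x))) - Q * (LINT y|lborel. indicator B y * u y * (exp (- (\<Phi> P * (c - x))) * scale P (c - y) - scale P (x - y)))"
    by (simp add: k_def)
qed

end

section \<open>Renewal equations for the function H\<close>

text \<open>Taken over the whole line; for functions that vanish on the negative half-line only
  \<open>y\<close> between 0 and \<open>x\<close> contributes.\<close>

definition conv :: "(real \<Rightarrow> real) \<Rightarrow> (real \<Rightarrow> real) \<Rightarrow> real \<Rightarrow> real" where
  "conv f g x = (LINT y|lborel. f (x - y) * g y)"

lemma integral_translate:
  fixes F :: "real \<Rightarrow> real"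
  shows "integrable lborel F \<Longrightarrow> integrable lborel (\<lambda>x. F (x - y))" "(LINT x|lborel. F (x - y)) = (LINT x|lborel. F x)"
  using lborel_integrable_real_affine[of F 1 "- y"] lborel_integral_real_affine[of 1 F "- y"] by auto

lemma integral_convolution:
  fixes F G :: "real \<Rightarrow> real"
  assumes F: "integrable lborel F" and G: "integrable lborel G"
  shows "has_bochner_integral lborel (\<lambda>x. LINT y|lborel. F (x - y) * G y) ((LINT x|lborel. F x) * (LINT y|lborel. G y))"
proof -
  have [measurable]: "F \<in> borel_measurable borel" "G \<in> borel_measurable borel" using F G by auto
  let ?h = "\<lambda>y x. F (x - y) * G y"
  have "integrable (lborel \<Otimes>\<^sub>M lborel) (case_prod ?h)"
  proof (rule lborel_pair.Fubini_integrable)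
    show "case_prod ?h \<in> borel_measurable (lborel \<Otimes>\<^sub>M lborel)" by measurable
    have "(LINT x|lborel. norm (case_prod ?h (y, x))) = (LINT x|lborel. \<bar>F x\<bar>) * \<bar>G y\<bar>" for y
      using integral_translate(2)[of "\<lambda>x. \<bar>F x\<bar>" y] by (simp add: abs_mult)
    then show "integrable lborel (\<lambda>y. LINT x|lborel. norm (case_prod ?h (y, x)))" using G by simp
    show "AE y in lborel. integrable lborel (\<lambda>x. case_prod ?h (y, x))" using integral_translate(1)[OF F] by simp
  qed
  note i = this
  show ?thesis
    unfolding has_bochner_integral_iff
  proof
    show "integrable lborel (\<lambda>x. LINT y|lborel. F (x - y) * G y)"
      using lborel_pair.integrable_snd[OF i] by simp
    have "(LINT x|lborel. LINT y|lborel. F (x - y) * G y) = (LINT y|lborel. LINT x|lborel. F (x - y) * G y)"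
      using lborel_pair.Fubini_integral[OF i] by simp
    also have "\<dots> = (LINT y|lborel. (LINT x|lborel. F x) * G y)"
      by (simp add: integral_translate(2))
    finally show "(LINT x|lborel. LINT y|lborel. F (x - y) * G y) = (LINT x|lborel. F x) * (LINT y|lborel. G y)" by simp
  qed
qed

lemma laplace_conv:
  assumes f: "has_bochner_integral lborel (\<lambda>y. exp (- l * y) * f y) A"
    and g: "has_bochner_integral lborel (\<lambda>y. exp (- l * y) * g y) B"
  shows "has_bochner_integral lborel (\<lambda>y. exp (- l * y) * conv f g y) (A * B)"
proof -
  have "(LINT y|lborel. (exp (- l * (x - y)) * f (x - y)) * (exp (- l * y) * g y)) = exp (- l * x) * conv f g x" for x
  proof -
    have "(exp (- l * (x - y)) * f (x - y)) * (exp (- l * y) * g y) = exp (- l * x) * (f (x - y) * g y)" for y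
    proof -
      have "exp (- l * (x - y)) * exp (- l * y) = exp (- l * x)" unfolding exp_add[symmetric] by (simp add: algebra_simps)
      then show ?thesis by (metis mult.assoc mult.left_commute)
    qed
    then show ?thesis unfolding conv_def by (simp only: integral_mult_right_zero)
  qed
  then show ?thesis
    using integral_convolution[of "\<lambda>y. exp (- l * y) * f y" "\<lambda>y. exp (- l * y) * g y"] f g
    by (simp add: has_bochner_integral_iff)
qed

lemma half_line_bounded:
  fixes f :: "real \<Rightarrow> real"
  assumes "continuous_on {0..} f" "\<And>x. x < 0 \<Longrightarrow> f x = 0"
  obtains C where "0 \<le> C" "\<And>x. x \<le> K \<Longrightarrow> \<bar>f x\<bar> \<le> C"
proof -
  have "compact (f ` {0..K})" using assms(1) by (intro compact_continuous_image continuous_on_subset[OF assms(1)]) auto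
  then obtain C where C: "\<And>x. x \<in> {0..K} \<Longrightarrow> \<bar>f x\<bar> \<le> C" using compact_imp_bounded by (fastforce simp: bounded_iff)
  show ?thesis
  proof (rule that[of "max 0 C"])
    fix x assume "x \<le> K"
    then show "\<bar>f x\<bar> \<le> max 0 C" using C[of x] assms(2)[of x] by (cases "x < 0") auto
  qed simp
qed

lemma half_line_measurable:
  fixes f :: "real \<Rightarrow> real"
  assumes c: "continuous_on {0..} f" and n: "\<And>x. x < 0 \<Longrightarrow> f x = 0"
  shows "f \<in> borel_measurable borel"
proof -
  have "(\<lambda>y. if y \<in> {0..} then f y else 0) \<in> borel_measurable borel"
    by (rule borel_measurable_continuous_on_if) (use c in auto)
  moreover have "(\<lambda>y. if y \<in> {0..} then f y else 0) = f" using n by (auto simp: fun_eq_iff)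
  ultimately show ?thesis by simp
qed

lemma conv_neg:
  assumes "\<And>x. x < 0 \<Longrightarrow> f x = 0" "\<And>x. x < 0 \<Longrightarrow> g x = 0" "x < 0"
  shows "conv f g x = 0"
proof -
  have "f (x - y) * g y = 0" for y using assms(1)[of "x - y"] assms(2)[of y] assms(3) by (cases "y < 0") auto
  then show ?thesis unfolding conv_def by (simp only: Bochner_Integration.integral_zero)
qed

text \<open>Both functions may jump at 0, as the scale function can. The jump of \<open>f\<close>
  affects the integrand only at the single point \<open>y = x\<close>, a null set; elsewhere
  dominated convergence applies.\<close>

lemma conv_continuous:
  fixes f g :: "real \<Rightarrow> real"
  assumes f: "continuous_on {0..} f" "\<And>x. x < 0 \<Longrightarrow> f x = 0" and g: "continuous_on {0..} g" "\<And>x. x < 0 \<Longrightarrow> g x = 0"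
  shows "continuous_on {0..} (conv f g)"
  unfolding continuous_on_sequentially o_def
proof (intro allI ballI impI; elim conjE)
  fix s :: "nat \<Rightarrow> real" and x assume x: "x \<in> {0..}" and s: "\<forall>n. s n \<in> {0..}" "s \<longlonglongrightarrow> x"
  note [measurable] = half_line_measurable[OF f] half_line_measurable[OF g]
  obtain K where K: "\<And>n. s n \<le> K" using convergent_imp_Bseq[of s] s(2) unfolding convergent_def Bseq_def
    by (metis abs_le_D1 real_norm_def)
  obtain C1 where C1: "0 \<le> C1" "\<And>x. x \<le> K \<Longrightarrow> \<bar>f x\<bar> \<le> C1" using half_line_bounded[OF f, of K] by metis
  obtain C2 where C2: "0 \<le> C2" "\<And>x. x \<le> K \<Longrightarrow> \<bar>g x\<bar> \<le> C2" using half_line_bounded[OF g, of K] by metis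
  show "(\<lambda>n. conv f g (s n)) \<longlonglongrightarrow> conv f g x"
    unfolding conv_def
  proof (rule integral_dominated_convergence[where w = "\<lambda>y. indicator {0..K} y *\<^sub>R (C1 * C2)"])
    show "integrable lborel (\<lambda>y. indicator {0..K} y *\<^sub>R (C1 * C2))" by simp
    show "AE y in lborel. norm (f (s n - y) * g y) \<le> indicator {0..K} y *\<^sub>R (C1 * C2)" for n
    proof (rule AE_I2)
      fix y
      show "norm (f (s n - y) * g y) \<le> indicator {0..K} y *\<^sub>R (C1 * C2)"
      proof (cases "y \<in> {0..K}")
        case True
        then have "\<bar>f (s n - y)\<bar> * \<bar>g y\<bar> \<le> C1 * C2" using C1 C2 K[of n] by (intro mult_mono) auto
        then show ?thesis using True by (simp add: abs_mult)
      next
        case False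
        then have "f (s n - y) * g y = 0" using f(2)[of "s n - y"] g(2)[of y] K[of n] by (cases "y < 0") auto
        then show ?thesis using False by (simp only:) simp
      qed
    qed
    show "AE y in lborel. (\<lambda>n. f (s n - y) * g y) \<longlonglongrightarrow> f (x - y) * g y"
      using AE_lborel_singleton[of x]
    proof eventually_elim
      case (elim y)
      have l: "(\<lambda>n. s n - y) \<longlonglongrightarrow> x - y" by (intro tendsto_intros s)
      have "(\<lambda>n. f (s n - y)) \<longlonglongrightarrow> f (x - y)"
      proof (cases "y < x")
        case True
        have "\<forall>\<^sub>F n in sequentially. s n - y \<in> {0..}"
          using order_tendstoD(1)[OF l, of 0] True by (auto elim!: eventually_mono)
        then show ?thesis using True by (intro continuous_on_tendsto_compose[OF f(1) l]) auto
      next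
        case False
        then have "x - y < 0" using elim by simp
        then have "\<forall>\<^sub>F n in sequentially. s n - y < 0" by (rule order_tendstoD(2)[OF l])
        then have "\<forall>\<^sub>F n in sequentially. f (s n - y) = f (x - y)"
          by eventually_elim (use f(2) \<open>x - y < 0\<close> in simp)
        then show ?thesis by (rule tendsto_eventually)
      qed
      then show ?case by (intro tendsto_mult tendsto_const)
    qed
  qed measurable
qed

lemma laplace_exp_half_line:
  fixes a l :: real
  assumes "a < l"
  shows "has_bochner_integral lborel (\<lambda>y. exp (- l * y) * (indicator {0..} y * exp (a * y))) (1 / (l - a))"
proof -
  define d where "d = l - a"
  have d: "0 < d" using assms by (simp add: d_def)
  have "(\<integral>\<^sup>+y. ennreal (exp (- d * y)) * indicator {0..} y \<partial>lborel) = ennreal (0 - (- exp (- d * 0) / d))"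
  proof (rule nn_integral_FTC_atLeast[where F = "\<lambda>y. - exp (- d * y) / d"])
    show "((\<lambda>y. - exp (- d * y) / d) has_real_derivative exp (- d * x)) (at x)" for x
      using d by (auto intro!: derivative_eq_intros)
    have "filterlim (\<lambda>y. d * y) at_top at_top" using d by (intro filterlim_tendsto_pos_mult_at_top[OF tendsto_const]) (auto intro: filterlim_ident)
    then have "filterlim (\<lambda>y. - d * y) at_bot at_top" by (simp add: filterlim_uminus_at_top)
    then have "((\<lambda>y. exp (- d * y)) \<longlongrightarrow> 0) at_top" by (rule filterlim_compose[OF exp_at_bot])
    then have "((\<lambda>y. - exp (- d * y) / d) \<longlongrightarrow> - 0 / d) at_top" by (intro tendsto_intros) (use d in auto)
    then show "((\<lambda>y. - exp (- d * y) / d) \<longlongrightarrow> 0) at_top" by simp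
  qed auto
  moreover have "(\<integral>\<^sup>+y. ennreal (exp (- l * y) * (indicator {0..} y * exp (a * y))) \<partial>lborel) = (\<integral>\<^sup>+y. ennreal (exp (- d * y)) * indicator {0..} y \<partial>lborel)"
  proof (intro nn_integral_cong)
    fix y
    have "exp (- l * y) * exp (a * y) = exp (- d * y)" unfolding exp_add[symmetric] by (simp add: d_def algebra_simps)
    then show "ennreal (exp (- l * y) * (indicator {0..} y * exp (a * y))) = ennreal (exp (- d * y)) * indicator {0..} y"
      by (auto simp: indicator_def)
  qed
  ultimately have "(\<integral>\<^sup>+y. ennreal (exp (- l * y) * (indicator {0..} y * exp (a * y))) \<partial>lborel) = ennreal (1 / (l - a))" by (simp add: d_def)
  then show ?thesis using assms by (intro has_bochner_integral_nn_integral) auto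
qed

context spectrally_negative_levy_process
begin

text \<open>Pulling the prefactor into the integral produces
  \<open>exp (\<Phi> p * (x - y))\<close>. For negative \<open>x\<close> both the oriented integral
  and the convolution are 0, because the scale function vanishes there.\<close>

lemma scale_H_eq:
  assumes p: "0 \<le> p" and pq: "0 \<le> p + q"
  shows "scale_H M X p q x = exp (\<Phi> p * x) + q * conv (\<lambda>y. indicator {0..} y * exp (\<Phi> p * y)) (scale (p + q)) x"
proof -
  let ?f = "\<lambda>y. exp (- \<Phi> p * y) * scale (p + q) y"
  have i: "(LBINT y=ereal 0..ereal x. ?f y) = (LINT y|lborel. indicator {..x} y * ?f y)"
  proof (cases "0 \<le> x")
    case True
    have "(LBINT y=ereal 0..ereal x. ?f y) = (LBINT y:{0..x}. ?f y)" using True by (rule interval_integral_Icc)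
    also have "\<dots> = (LINT y|lborel. indicator {..x} y * ?f y)"
      unfolding set_lebesgue_integral_def
      by (intro Bochner_Integration.integral_cong refl) (auto simp: indicator_def scale_neg)
    finally show ?thesis .
  next
    case False
    have "(LBINT y=ereal 0..ereal x. ?f y) = - (LBINT y=ereal x..ereal 0. ?f y)" by (rule interval_integral_endpoints_reverse)
    also have "(LBINT y=ereal x..ereal 0. ?f y) = (LBINT y:{x<..<0}. ?f y)" using False by (simp add: interval_integral_Ioo)
    also have "\<dots> = (LINT y|(lborel :: real measure). 0)"
      unfolding set_lebesgue_integral_def by (intro Bochner_Integration.integral_cong refl) (auto simp: indicator_def scale_neg)
    finally have "(LBINT y=ereal 0..ereal x. ?f y) = 0" by simp
    moreover have "(LINT y|lborel. indicator {..x} y * ?f y) = (LINT y|(lborel :: real measure). 0)"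
      using False by (intro Bochner_Integration.integral_cong refl) (auto simp: indicator_def scale_neg)
    ultimately show ?thesis by simp
  qed
  have "exp (\<Phi> p * x) * (LINT y|lborel. indicator {..x} y * ?f y) = (LINT y|lborel. exp (\<Phi> p * x) * (indicator {..x} y * ?f y))" by simp
  also have "\<dots> = conv (\<lambda>y. indicator {0..} y * exp (\<Phi> p * y)) (scale (p + q)) x"
    unfolding conv_def
  proof (intro Bochner_Integration.integral_cong refl)
    fix y
    have "exp (\<Phi> p * x) * exp (- \<Phi> p * y) = exp (\<Phi> p * (x - y))" unfolding exp_add[symmetric] by (simp add: algebra_simps)
    then show "exp (\<Phi> p * x) * (indicator {..x} y * ?f y) = indicator {0..} (x - y) * exp (\<Phi> p * (x - y)) * scale (p + q) y"
      by (auto simp: indicator_def mult.assoc[symmetric])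
  qed
  finally show ?thesis unfolding scale_H_def scale_function_eq[OF pq] i by (simp add: distrib_left mult.left_commute)
qed

text \<open>The cut at 0 turns integrals from 0 to \<open>x\<close> into convolutions, to which the
  transform on the half-line applies.\<close>

definition half_H :: "real \<Rightarrow> real \<Rightarrow> real \<Rightarrow> real" where
  "half_H p q x = indicator {0..} x * scale_H M X p q x"

lemma scale_H_neg:
  assumes "0 \<le> p" "0 \<le> p + q" "x \<le> 0"
  shows "scale_H M X p q x = exp (\<Phi> p * x)"
proof -
  have "(LINT y|lborel. indicator {0..} (x - y) * exp (\<Phi> p * (x - y)) * scale (p + q) y) = (LINT y|(lborel :: real measure). 0)"
  proof (rule integral_cong_AE)
    note [measurable] = scale_measurable[OF assms(2)]
    show "(\<lambda>y. indicator {0..} (x - y) * exp (\<Phi> p * (x - y)) * scale (p + q) y) \<in> borel_measurable lborel" by measurable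
    show "AE y in lborel. indicator {0..} (x - y) * exp (\<Phi> p * (x - y)) * scale (p + q) y = 0"
      using AE_lborel_singleton[of 0] by eventually_elim (use assms in \<open>auto simp: indicator_def scale_neg\<close>)
  qed simp
  then show ?thesis unfolding scale_H_eq[OF assms(1,2)] conv_def by simp
qed

lemma exp_half_continuous: "continuous_on {0..} (\<lambda>y. indicator {0..} y * exp (a * y) :: real)"
  by (rule continuous_on_eq[of _ "\<lambda>y. exp (a * y)"]) (auto intro!: continuous_intros)

lemma half_H_continuous:
  assumes p: "0 \<le> p" and pq: "0 \<le> p + q"
  shows "continuous_on {0..} (half_H p q)"
proof -
  have "continuous_on {0..} (\<lambda>x. exp (\<Phi> p * x) + q * conv (\<lambda>y. indicator {0..} y * exp (\<Phi> p * y)) (scale (p + q)) x)"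
    by (intro continuous_intros conv_continuous exp_half_continuous scale_continuous pq) (auto simp: scale_neg)
  then show ?thesis by (rule continuous_on_eq) (simp add: half_H_def scale_H_eq[OF p pq])
qed

lemma half_H_laplace:
  assumes p: "0 \<le> p" and pq: "0 \<le> p + q" and l: "\<Phi> p < l" "\<Phi> (p + q) < l"
  shows "has_bochner_integral lborel (\<lambda>y. exp (- l * y) * half_H p q y) (1 / (l - \<Phi> p) + q * (1 / (l - \<Phi> p) * (1 / (\<psi> l - (p + q)))))"
proof -
  let ?E = "\<lambda>y. indicator {0..} y * exp (\<Phi> p * y) :: real"
  have E: "has_bochner_integral lborel (\<lambda>y. exp (- l * y) * ?E y) (1 / (l - \<Phi> p))" by (rule laplace_exp_half_line[OF l(1)])
  have "has_bochner_integral lborel (\<lambda>y. exp (- l * y) * ?E y + q * (exp (- l * y) * conv ?E (scale (p + q)) y))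
      (1 / (l - \<Phi> p) + q * (1 / (l - \<Phi> p) * (1 / (\<psi> l - (p + q)))))"
    by (intro has_bochner_integral_add has_bochner_integral_mult_right E laplace_conv scale_laplace pq l)
  moreover have "exp (- l * y) * ?E y + q * (exp (- l * y) * conv ?E (scale (p + q)) y) = exp (- l * y) * half_H p q y" for y
    using conv_neg[of ?E "scale (p + q)" y] by (cases "0 \<le> y") (auto simp: half_H_def scale_H_eq[OF p pq] scale_neg algebra_simps)
  ultimately show ?thesis by simp
qed

text \<open>Put \<open>A = \<psi> l - p\<close> and \<open>B = \<psi> l - (p + q)\<close>, so that
  \<open>A = B + q\<close>. The transforms of the two sides are \<open>1 / (l - \<Phi> p)\<close>
  times \<open>1 + q / B\<close> and \<open>1 + q / A * (1 + q / B)\<close>, and these agree because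
  \<open>1 / A * (1 + q / B) = 1 / B\<close>. Continuity of both sides lifts this to equality
  everywhere.\<close>

theorem half_H_volterra:
  assumes p: "0 \<le> p" and pq: "0 \<le> p + q" and x: "0 \<le> x"
  shows "half_H p q x = exp (\<Phi> p * x) + q * conv (scale p) (half_H p q) x"
proof -
  let ?E = "\<lambda>y. indicator {0..} y * exp (\<Phi> p * y) :: real"
  let ?R = "\<lambda>y. ?E y + q * conv (scale p) (half_H p q) y"
  have R: "has_bochner_integral lborel (\<lambda>y. exp (- l * y) * ?R y) (1 / (l - \<Phi> p) + q * (1 / (l - \<Phi> p) * (1 / (\<psi> l - (p + q)))))"
    if l: "max (\<Phi> p) (\<Phi> (p + q)) < l" for l
  proof -
    let ?h = "1 / (l - \<Phi> p) + q * (1 / (l - \<Phi> p) * (1 / (\<psi> l - (p + q))))"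
    have "has_bochner_integral lborel (\<lambda>y. exp (- l * y) * ?E y + q * (exp (- l * y) * conv (scale p) (half_H p q) y))
      (1 / (l - \<Phi> p) + q * (1 / (\<psi> l - p) * ?h))"
      using l by (intro has_bochner_integral_add has_bochner_integral_mult_right laplace_exp_half_line laplace_conv scale_laplace half_H_laplace p pq) auto
    moreover have "1 / (l - \<Phi> p) + q * (1 / (\<psi> l - p) * ?h) = ?h"
    proof -
      define A where "A = \<psi> l - p"
      define B where "B = \<psi> l - (p + q)"
      have AB: "0 < A" "0 < B" "A = B + q" using right_inverse_root(3)[OF p, of l] right_inverse_root(3)[OF pq, of l] l by (auto simp: A_def B_def)
      have "1 / B = 1 / A * (1 + q / B)" using AB(1,2) by (simp add: field_simps AB(3))
      have h: "?h = 1 / (l - \<Phi> p) * (1 + q / B)" unfolding B_def[symmetric] by (simp add: distrib_left)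
      have "1 / (l - \<Phi> p) + q * (1 / A * (1 / (l - \<Phi> p) * (1 + q / B))) = 1 / (l - \<Phi> p) * (1 + q * (1 / A * (1 + q / B)))"
        by (simp add: distrib_left mult.left_commute)
      also have "\<dots> = 1 / (l - \<Phi> p) * (1 + q / B)" unfolding \<open>1 / B = _\<close>[symmetric] by simp
      finally show ?thesis unfolding h A_def[symmetric] .
    qed
    moreover have "exp (- l * y) * ?E y + q * (exp (- l * y) * conv (scale p) (half_H p q) y) = exp (- l * y) * ?R y" for y
      by (simp add: algebra_simps)
    ultimately show ?thesis by simp
  qed
  have hn: "half_H p q y = 0" if "y < 0" for y using that by (simp add: half_H_def)
  have half: "set_integrable lborel {0..} F \<and> (LBINT y:{0..}. F y) = A"
    if "has_bochner_integral lborel F A" "\<And>y. y < 0 \<Longrightarrow> F y = 0" for F :: "real \<Rightarrow> real" and A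
  proof -
    have "(\<lambda>y. indicator {0..} y *\<^sub>R F y) = F" using that(2) by (auto simp: fun_eq_iff indicator_def)
    then show ?thesis unfolding set_integrable_def set_lebesgue_integral_def using that(1) by (simp add: has_bochner_integral_iff)
  qed
  have Rn: "?R y = 0" if "y < 0" for y using conv_neg[of "scale p" "half_H p q" y] that hn scale_neg by simp
  have "half_H p q x = ?R x"
  proof (rule laplace_function_unique[where f = "half_H p q" and g = ?R and x = x, of "max (\<Phi> p) (\<Phi> (p + q))"])
    show "continuous_on {0..} (half_H p q)" by (rule half_H_continuous[OF p pq])
    show "continuous_on {0..} ?R"
      by (intro continuous_intros conv_continuous exp_half_continuous scale_continuous half_H_continuous p pq) (auto simp: scale_neg hn)
    fix l assume l: "max (\<Phi> p) (\<Phi> (p + q)) < l"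
    have H: "has_bochner_integral lborel (\<lambda>y. exp (- l * y) * half_H p q y) (1 / (l - \<Phi> p) + q * (1 / (l - \<Phi> p) * (1 / (\<psi> l - (p + q)))))"
      using l by (intro half_H_laplace[OF p pq]) auto
    show "set_integrable lborel {0..} (\<lambda>y. exp (- l * y) * half_H p q y)" using half[OF H] hn by simp
    show "set_integrable lborel {0..} (\<lambda>y. exp (- l * y) * ?R y)" using half[OF R[OF l]] Rn by simp
    show "(LBINT y:{0..}. exp (- l * y) * half_H p q y) = (LBINT y:{0..}. exp (- l * y) * ?R y)"
      using half[OF H] half[OF R[OF l]] hn Rn by simp
  qed (rule x)
  then show ?thesis using x by simp
qed

end

section \<open>Identification of the passage functionals\<close>

lemma conv_integrable:
  fixes f g :: "real \<Rightarrow> real"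
  assumes f: "continuous_on {0..} f" "\<And>x. x < 0 \<Longrightarrow> f x = 0" and g: "continuous_on {0..} g" "\<And>x. x < 0 \<Longrightarrow> g x = 0"
  shows "integrable lborel (\<lambda>y. f (x - y) * g y)"
proof -
  note [measurable] = half_line_measurable[OF f] half_line_measurable[OF g]
  obtain C1 where C1: "0 \<le> C1" "\<And>y. y \<le> x \<Longrightarrow> \<bar>f y\<bar> \<le> C1" using half_line_bounded[OF f, of x] by metis
  obtain C2 where C2: "0 \<le> C2" "\<And>y. y \<le> x \<Longrightarrow> \<bar>g y\<bar> \<le> C2" using half_line_bounded[OF g, of x] by metis
  have "set_integrable lborel {0..x} (\<lambda>y. f (x - y) * g y)"
  proof (rule integrable_bounded_interval[of _ _ 0 x "C1 * C2"])
    fix y assume "y \<in> {0..x}"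
    then show "\<bar>f (x - y) * g y\<bar> \<le> C1 * C2" unfolding abs_mult using C1 C2 by (intro mult_mono) auto
  qed auto
  moreover have "(\<lambda>y. indicator {0..x} y *\<^sub>R (f (x - y) * g y)) = (\<lambda>y. f (x - y) * g y)"
  proof
    fix y
    show "indicator {0..x} y *\<^sub>R (f (x - y) * g y) = f (x - y) * g y"
      using f(2)[of "x - y"] g(2)[of y] by (cases "y < 0"; cases "x < y") auto
  qed
  ultimately show ?thesis unfolding set_integrable_def by (simp only:)
qed

text \<open>The indicator of an open set of the form \<open>0 < m x\<close> is the increasing limit
  of the continuous functions \<open>min 1 (n * max 0 (m x))\<close>. Both occupation sets of the
  theorem are open, so each has such an \<open>m\<close>.\<close>

lemma path_functional_discount_positive:
  fixes m :: "real \<Rightarrow> real"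
  assumes m: "continuous_on UNIV m" and p: "0 \<le> p" and q: "0 \<le> q"
  shows "path_functional (path_discount (\<lambda>x. p + q * of_bool (0 < m x)) c)"
proof (rule path_functional_discount[where g = "\<lambda>n x. p + q * min 1 (real n * max 0 (m x))" and B = "p + q"])
  fix n :: nat and x
  show "continuous_on UNIV (\<lambda>x. p + q * min 1 (real n * max 0 (m x)))" by (intro continuous_intros m)
  show "0 \<le> p + q * min 1 (real n * max 0 (m x))" using p q by simp
  show "p + q * min 1 (real n * max 0 (m x)) \<le> p + q" using mult_left_mono[OF _ q, of "min 1 (real n * max 0 (m x))" 1] by simp
  have "(\<lambda>n. min 1 (real n * max 0 (m x))) \<longlonglongrightarrow> of_bool (0 < m x)"
  proof (cases "0 < m x")
    case True
    obtain N where N: "1 < real N * m x" using reals_Archimedean3[OF True] by blast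
    have "\<forall>\<^sub>F n in sequentially. min 1 (real n * max 0 (m x)) = of_bool (0 < m x)"
      using eventually_ge_at_top[of N]
    proof eventually_elim
      case (elim n)
      have "real N * m x \<le> real n * m x" using elim True by (intro mult_right_mono) auto
      then have "1 \<le> real n * m x" using N by linarith
      then show ?case using True by simp
    qed
    then show ?thesis by (rule tendsto_eventually)
  qed simp
  then show "(\<lambda>n. p + q * min 1 (real n * max 0 (m x))) \<longlonglongrightarrow> p + q * of_bool (0 < m x)"
    by (intro tendsto_intros)
qed

lemma discounted_passage_eq:
  assumes w: "right_cont w" and [measurable]: "A \<in> sets borel"
  shows "discounted_passage p q A c w = path_discount (\<lambda>y. p + q * indicator A y) c w"
proof (cases "passes c w")
  case True
  note [measurable] = right_cont_measurable[OF w]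
  let ?\<tau> = "fpt c w"
  let ?f = "\<lambda>s. indicator A (w (max 0 s)) :: real"
  have f: "set_integrable lborel {0..?\<tau>} ?f" by (rule integrable_bounded_interval[of _ _ 0 ?\<tau> 1]) (auto simp: indicator_def)
  have "(LBINT s:{0..?\<tau>}. p + q * indicator A (w s)) = (LBINT s:{0..?\<tau>}. p + q * ?f s)"
    by (rule set_lebesgue_integral_cong) auto
  also have "\<dots> = (LBINT s:{0..?\<tau>}. p) + (LBINT s:{0..?\<tau>}. q * ?f s)"
    by (intro set_integral_add set_integrable_mult_right f) (simp add: set_integrable_def)
  also have "(LBINT s:{0..?\<tau>}. p) = p * ?\<tau>" using fpt_nonneg[OF True] by (simp add: set_lebesgue_integral_def)
  also have "(LBINT s:{0..?\<tau>}. q * ?f s) = q * (LBINT s:{0..?\<tau>}. ?f s)" by (rule set_integral_mult_right)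
  also have "(LBINT s:{0..?\<tau>}. ?f s) = occupation_time A ?\<tau> w"
    unfolding occupation_time_def by (rule set_lebesgue_integral_cong) auto
  finally show ?thesis using True first_passage_fpt[of c w]
    by (simp add: discounted_passage_def path_discount_def)
next
  case False
  then show ?thesis using first_passage_fpt(1)[of c w] by (simp add: discounted_passage_def path_discount_def)
qed

context spectrally_negative_levy_process
begin

lemma expectation_discounted_passage:
  assumes "A \<in> sets borel"
  shows "expectation_from M X x (discounted_passage p q A c) = (LINT \<omega>|M. path_discount (\<lambda>y. p + q * indicator A y) c (\<lambda>r. x + X r \<omega>))"
  unfolding expectation_from_def
  by (intro Bochner_Integration.integral_cong refl discounted_passage_eq right_cont_path_start assms)

text \<open>Started at \<open>c\<close>, the process exceeds \<open>c\<close> immediately by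
  \<open>AE_regular\<close>, so no discount accumulates.\<close>

lemma passage_at_level:
  assumes F: "path_functional (path_discount g c)"
  shows "(LINT \<omega>|M. path_discount g c (\<lambda>r. c + X r \<omega>)) = 1"
proof -
  have "AE \<omega> in M. path_discount g c (\<lambda>r. c + X r \<omega>) = 1"
    using AE_regular
  proof eventually_elim
    case (elim \<omega>)
    then show ?case
      unfolding path_discount_def passes_translate fpt_translate set_integral_Icc_Ioc by (simp add: set_lebesgue_integral_def)
  qed
  then have "(LINT \<omega>|M. path_discount g c (\<lambda>r. c + X r \<omega>)) = (LINT \<omega>|M. 1)"
    using path_functional_integrable[OF F, of c] by (intro integral_cong_AE) auto
  then show ?thesis by (simp add: prob_space)
qed

text \<open>
  Inserting the potential density into the Feynman--Kac formula shows that the passage functional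
  and \<open>N\<close> solve the same Volterra equation up to the factor \<open>exp (\<Phi> P * (x - a))\<close>, hence are
  proportional; the constant follows from the value \<open>1\<close> at \<open>c\<close>.
\<close>

theorem passage_ratio:
  assumes P: "0 \<le> P" and PQ: "0 \<le> P + Q" and B [measurable]: "B \<in> sets borel" and Ba: "B \<subseteq> {a..}"
    and F: "path_functional (path_discount (\<lambda>y. P + Q * indicator B y) c)"
    and N [measurable]: "N \<in> borel_measurable borel" and Nb: "\<And>x. x \<le> c \<Longrightarrow> \<bar>N x\<bar> \<le> C"
    and Neq: "\<And>x. x \<le> c \<Longrightarrow> N x = exp (\<Phi> P * (x - a)) + Q * (LINT y|lborel. indicator B y * N y * scale P (x - y))"
    and x: "x \<le> c"
  shows "(LINT \<omega>|M. path_discount (\<lambda>y. P + Q * indicator B y) c (\<lambda>r. x + X r \<omega>)) = N x / N c"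
proof -
  define u where "u y = (LINT \<omega>|M. path_discount (\<lambda>y. P + Q * indicator B y) c (\<lambda>r. y + X r \<omega>))" for y
  define J where "J f x = (LINT y|lborel. indicator B y * f y * scale P (x - y))" for f x
  note [measurable] = scale_measurable[OF P]
  have um [measurable]: "u \<in> borel_measurable borel" unfolding u_def by (rule expectation_functional_measurable[OF F])
  have g0: "0 \<le> P + Q * indicator B y" for y using P PQ by (auto simp: indicator_def)
  have ub: "\<bar>u y\<bar> \<le> 1" for y
  proof -
    have "0 \<le> u y" unfolding u_def by (intro integral_nonneg_AE AE_I2 path_discount_bounds(1)[OF g0])
    moreover have "u y \<le> 1" unfolding u_def
      by (intro integral_le_const AE_I2 path_discount_bounds(2)[OF g0] path_functional_integrable[OF F])
    ultimately show ?thesis by simp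
  qed
  obtain S where S: "0 \<le> S" "\<And>y. y \<le> c - a \<Longrightarrow> \<bar>scale P y\<bar> \<le> S"
    using half_line_bounded[OF scale_continuous[OF P] scale_neg, of "c - a"] by metis
  have supp: "indicator B y * f y * scale P (x - y) = indicator {a..x} y *\<^sub>R (indicator B y * f y * scale P (x - y))" for f x y
    using Ba by (cases "x < y") (auto simp: indicator_def scale_neg)
  have Ji: "integrable lborel (\<lambda>y. indicator B y * f y * scale P (x - y))"
    if [measurable]: "f \<in> borel_measurable borel" and f: "\<And>y. y \<le> c \<Longrightarrow> \<bar>f y\<bar> \<le> C'" and x: "x \<le> c" for f C' x
  proof -
    have "set_integrable lborel {a..x} (\<lambda>y. indicator B y * f y * scale P (x - y))"
    proof (rule integrable_bounded_interval[of _ _ a x "C' * S"])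
      fix y assume y: "y \<in> {a..x}"
      have "\<bar>f y\<bar> * \<bar>scale P (x - y)\<bar> \<le> C' * S" using y x f[of y] S by (intro mult_mono) auto
      then show "\<bar>indicator B y * f y * scale P (x - y)\<bar> \<le> C' * S"
        using y x f[of y] S(1) by (auto simp: abs_mult indicator_def)
    qed auto
    then show ?thesis unfolding set_integrable_def supp[symmetric] .
  qed
  \<comment> \<open>The inhomogeneous term of the equation for \<open>u\<close> is
    \<open>exp (- (\<Phi> P * (c - x))) * (1 - Q * J u c)\<close>; written relative to
    \<open>a\<close> it is \<open>K * exp (\<Phi> P * (x - a))\<close>.\<close>
  define K where "K = exp (- (\<Phi> P * (c - a))) * (1 - Q * J u c)"
  have ueq: "u x = K * exp (\<Phi> P * (x - a)) + Q * J u x" if x: "x \<le> c" for x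
  proof -
    let ?e = "exp (- (\<Phi> P * (c - x)))"
    have "(LINT y|lborel. indicator B y * u y * (?e * scale P (c - y) - scale P (x - y))) =
      (LINT y|lborel. ?e * (indicator B y * u y * scale P (c - y)) - indicator B y * u y * scale P (x - y))"
      by (intro Bochner_Integration.integral_cong refl) (simp add: algebra_simps)
    also have "\<dots> = ?e * J u c - J u x"
      unfolding J_def using Ji[OF um, of 1] ub x
      by (subst Bochner_Integration.integral_diff) (auto intro!: integrable_mult_right)
    finally have "u x = ?e - Q * (?e * J u c - J u x)"
      using feynman_kac(2)[OF P PQ B Ba F x] unfolding u_def[symmetric] by simp
    moreover have "?e = exp (- (\<Phi> P * (c - a))) * exp (\<Phi> P * (x - a))" unfolding exp_add[symmetric] by (simp add: algebra_simps)
    ultimately show ?thesis by (simp add: K_def algebra_simps)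
  qed
  \<comment> \<open>The exponential terms cancel in \<open>u - K * N\<close>, which leaves the
    homogeneous Volterra equation.\<close>
  define D where "D x = u x - K * N x" for x
  have [measurable]: "D \<in> borel_measurable borel" unfolding D_def by measurable
  have Db: "\<bar>D x\<bar> \<le> 1 + \<bar>K\<bar> * C" if "x \<le> c" for x
  proof -
    have "\<bar>K * N x\<bar> \<le> \<bar>K\<bar> * C" unfolding abs_mult using Nb[OF that] by (intro mult_left_mono) auto
    then show ?thesis using ub[of x] unfolding D_def by linarith
  qed
  have Deq: "D x = Q * J D x" if x: "x \<le> c" for x
  proof -
    have "J D x = (LINT y|lborel. indicator B y * u y * scale P (x - y) - K * (indicator B y * N y * scale P (x - y)))"
      unfolding J_def by (intro Bochner_Integration.integral_cong refl) (simp add: D_def algebra_simps)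
    also have "\<dots> = J u x - K * J N x"
      unfolding J_def using Ji[OF um, of 1] Ji[OF N Nb] ub x
      by (subst Bochner_Integration.integral_diff) (auto intro!: integrable_mult_right)
    finally have "J D x = J u x - K * J N x" .
    moreover have "N x = exp (\<Phi> P * (x - a)) + Q * J N x" unfolding J_def by (rule Neq[OF x])
    ultimately have "Q * J D x = Q * (J u x - K * J N x)" "D x = (K * exp (\<Phi> P * (x - a)) + Q * J u x) - K * (exp (\<Phi> P * (x - a)) + Q * J N x)"
      using D_def[of x] ueq[OF x] by simp_all
    then show ?thesis by (simp add: algebra_simps)
  qed
  \<comment> \<open>Below \<open>a\<close> the integral is empty, since \<open>B\<close> lies above
    \<open>a\<close> and the kernel vanishes at negative arguments.\<close>
  have D0: "D x = 0" if x: "x \<le> c" for x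
  proof (cases "a \<le> x")
    case False
    have "indicator B y * D y * scale P (x - y) = 0" for y using False supp[of y D x] by simp
    then have "J D x = (LINT y|(lborel :: real measure). 0)" unfolding J_def by (simp only:)
    then show ?thesis using Deq[OF x] by simp
  next
    case True
    show ?thesis
    proof (rule volterra_zero[where D = D and x = x and C = "\<bar>Q\<bar> * S + 1" and a = a and c = c and M = "1 + \<bar>K\<bar> * C"])
      show "0 < \<bar>Q\<bar> * S + 1" using S(1) by (simp add: add_nonneg_pos)
      show "set_integrable lborel {a..c} D"
        by (rule integrable_bounded_interval[of _ _ a c "1 + \<bar>K\<bar> * C"]) (use Db in auto)
      show "\<bar>D x\<bar> \<le> 1 + \<bar>K\<bar> * C" if "x \<le> c" for x by (rule Db[OF that])
      fix x assume x: "a \<le> x" "x \<le> c"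
      have ai: "set_integrable lborel {a..x} (\<lambda>y. \<bar>D y\<bar>)"
        by (rule integrable_bounded_interval[of _ _ a x "1 + \<bar>K\<bar> * C"]) (use Db x in auto)
      then have si: "integrable lborel (\<lambda>y. S * (indicator {a..x} y *\<^sub>R \<bar>D y\<bar>))" unfolding set_integrable_def by (rule integrable_mult_right)
      have "\<bar>J D x\<bar> \<le> (LINT y|lborel. \<bar>indicator B y * D y * scale P (x - y)\<bar>)"
        unfolding J_def by (rule integral_abs_bound)
      also have "\<dots> \<le> (LINT y|lborel. S * (indicator {a..x} y *\<^sub>R \<bar>D y\<bar>))"
      proof (rule integral_mono[OF _ si])
        show "integrable lborel (\<lambda>y. \<bar>indicator B y * D y * scale P (x - y)\<bar>)"
          by (rule integrable_abs, rule Ji[OF _ Db x(2)]) measurable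
        fix y
        show "\<bar>indicator B y * D y * scale P (x - y)\<bar> \<le> S * (indicator {a..x} y *\<^sub>R \<bar>D y\<bar>)"
        proof (cases "y \<in> {a..x}")
          case True
          have "\<bar>scale P (x - y)\<bar> * \<bar>D y\<bar> \<le> S * \<bar>D y\<bar>" using True x S(2)[of "x - y"] by (intro mult_right_mono) auto
          then show ?thesis using True S(1) by (auto simp: abs_mult indicator_def mult.commute)
        next
          case False
          then show ?thesis using supp[of y D x] by simp
        qed
      qed
      also have "\<dots> = S * (LBINT y:{a..x}. \<bar>D y\<bar>)" unfolding set_lebesgue_integral_def by simp
      finally have J: "\<bar>J D x\<bar> \<le> S * (LBINT y:{a..x}. \<bar>D y\<bar>)" .
      have l0: "0 \<le> (LBINT y:{a..x}. \<bar>D y\<bar>)"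
        unfolding set_lebesgue_integral_def by (intro integral_nonneg_AE AE_I2) auto
      have "\<bar>D x\<bar> = \<bar>Q\<bar> * \<bar>J D x\<bar>" using Deq[OF x(2)] by (simp add: abs_mult)
      also have "\<dots> \<le> \<bar>Q\<bar> * (S * (LBINT y:{a..x}. \<bar>D y\<bar>))" using J by (intro mult_left_mono) auto
      also have "\<dots> \<le> (\<bar>Q\<bar> * S + 1) * (LBINT y:{a..x}. \<bar>D y\<bar>)" using l0 by (simp add: algebra_simps)
      finally show "\<bar>D x\<bar> \<le> (\<bar>Q\<bar> * S + 1) * (LBINT y:{a..x}. \<bar>D y\<bar>)" .
    qed (use True x in auto)
  qed
  \<comment> \<open>Gives both the value of \<open>K\<close> and the fact that \<open>N c\<close> is
    nonzero.\<close>
  have "u c = 1" unfolding u_def by (rule passage_at_level[OF F])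
  then have "1 = K * N c" using D0[of c] by (simp add: D_def)
  moreover from this have "N c \<noteq> 0" by auto
  ultimately have "K = 1 / N c" by (simp add: nonzero_eq_divide_eq)
  then show ?thesis using D0[OF x] by (simp add: D_def u_def)
qed

section \<open>The two passage formulas\<close>

lemma scale_H_volterra:
  assumes p: "0 \<le> p" and pq: "0 \<le> p + q"
  shows "scale_H M X p q (x - a) = exp (\<Phi> p * (x - a)) + q * conv (scale p) (half_H p q) (x - a)"
proof (cases "a \<le> x")
  case True
  then show ?thesis using half_H_volterra[OF p pq, of "x - a"] by (simp add: half_H_def)
next
  case False
  then show ?thesis using scale_H_neg[OF p pq, of "x - a"] conv_neg[of "scale p" "half_H p q" "x - a"]
    by (simp add: half_H_def scale_neg)
qed

lemma half_H_conv_translate: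
  "conv (scale p) (half_H p q) (x - a) = (LINT y|lborel. scale p (x - y) * half_H p q (y - a))"
  unfolding conv_def using integral_translate(2)[of "\<lambda>y. scale p (x - a - y) * half_H p q y" a] by simp

lemma scale_conv_regular:
  assumes "0 \<le> p" "continuous_on {0..} g" "\<And>x. x < 0 \<Longrightarrow> g x = 0"
  shows "conv (scale p) g \<in> borel_measurable borel" "\<exists>C. \<forall>x\<le>K. \<bar>conv (scale p) g x\<bar> \<le> C"
proof -
  have c: "continuous_on {0..} (conv (scale p) g)" by (rule conv_continuous) (use assms scale_continuous scale_neg in auto)
  have n: "conv (scale p) g x = 0" if "x < 0" for x by (rule conv_neg) (use assms that scale_neg in auto)
  show "conv (scale p) g \<in> borel_measurable borel" by (rule half_line_measurable[OF c n])
  show "\<exists>C. \<forall>x\<le>K. \<bar>conv (scale p) g x\<bar> \<le> C" using half_line_bounded[OF c n, of K] by metis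
qed

lemma exp_bound:
  assumes "0 \<le> p" "x \<le> c"
  shows "\<bar>exp (\<Phi> p * (x - a))\<bar> \<le> exp (\<Phi> p * (c - a))"
  using right_inverse_root(1)[OF assms(1)] assms(2) by (simp add: mult_left_mono)

text \<open>The rate is read as \<open>p + q\<close>, lowered by \<open>q\<close> on
  \<open>{b..}\<close>, a set bounded below. The Volterra equation for \<open>H\<close> with
  parameters \<open>p + q\<close> and \<open>- q\<close>, translated by \<open>b\<close>, is exactly
  the equation that \<open>passage_ratio\<close> asks for.\<close>

lemma passage_below:
  assumes bc: "b \<le> c" and p: "0 \<le> p" and q: "0 \<le> q" and x: "x \<le> c"
  shows "expectation_from M X x (discounted_passage p q {..<b} c) = scale_H M X (p + q) (- q) (x - b) / scale_H M X (p + q) (- q) (c - b)"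
proof -
  let ?P = "p + q"
  have P: "0 \<le> ?P" and PQ: "0 \<le> ?P + - q" using p q by auto
  have g: "p + q * indicator {..<b} y = ?P + - q * indicator {b..} y" for y by (auto simp: indicator_def)
  have m: "p + q * of_bool (0 < b - y) = ?P + - q * indicator {b..} y" for y by (auto simp: indicator_def)
  have F: "path_functional (path_discount (\<lambda>y. ?P + - q * indicator {b..} y) c)"
    using path_functional_discount_positive[of "\<lambda>y. b - y" p q c] p q unfolding m by (simp add: continuous_on_diff)
  have hn: "half_H ?P (- q) y = 0" if "y < 0" for y using that by (simp add: half_H_def)
  note hc = half_H_continuous[OF P PQ]
  let ?N = "\<lambda>x. scale_H M X ?P (- q) (x - b)"
  note Neq = scale_H_volterra[OF P PQ, where a = b]
  note [measurable] = scale_conv_regular(1)[OF P hc hn]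
  obtain C where C: "\<And>y. y \<le> c - b \<Longrightarrow> \<bar>conv (scale ?P) (half_H ?P (- q)) y\<bar> \<le> C"
    using scale_conv_regular(2)[OF P hc hn, of "c - b"] by blast
  have "(LINT \<omega>|M. path_discount (\<lambda>y. ?P + - q * indicator {b..} y) c (\<lambda>r. x + X r \<omega>)) = ?N x / ?N c"
  proof (rule passage_ratio[where a = b and C = "exp (\<Phi> ?P * (c - b)) + q * C"])
    show "?N \<in> borel_measurable borel" unfolding Neq by measurable
    show "\<bar>?N x\<bar> \<le> exp (\<Phi> ?P * (c - b)) + q * C" if "x \<le> c" for x
    proof -
      have "\<bar>- q * conv (scale ?P) (half_H ?P (- q)) (x - b)\<bar> \<le> q * C"
        unfolding abs_mult using q that C[of "x - b"] by (simp add: mult_left_mono)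
      then show ?thesis unfolding Neq using exp_bound[OF P that, of b] by linarith
    qed
    show "?N x = exp (\<Phi> ?P * (x - b)) + - q * (LINT y|lborel. indicator {b..} y * ?N y * scale ?P (x - y))" for x
    proof -
      have "(LINT y|lborel. indicator {b..} y * ?N y * scale ?P (x - y)) = (LINT y|lborel. scale ?P (x - y) * half_H ?P (- q) (y - b))"
        by (intro Bochner_Integration.integral_cong refl) (auto simp: half_H_def indicator_def)
      then show ?thesis unfolding half_H_conv_translate[symmetric] using Neq[of x] by simp
    qed
  qed (use P PQ bc F x in auto)
  then show ?thesis unfolding expectation_discounted_passage[OF borel_open[OF open_lessThan]] g .
qed

lemma upper_integral:
  fixes f :: "real \<Rightarrow> real"
  assumes f: "\<And>y. x < y \<Longrightarrow> f y = 0"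
  shows "(LBINT y=ereal b..ereal x. f y) = (LINT y|lborel. indicator {b..} y * f y)"
proof (cases "b \<le> x")
  case True
  have "(LBINT y=ereal b..ereal x. f y) = (LBINT y:{b..x}. f y)" using True by (rule interval_integral_Icc)
  also have "\<dots> = (LINT y|lborel. indicator {b..} y * f y)"
    unfolding set_lebesgue_integral_def
    by (intro Bochner_Integration.integral_cong refl) (auto simp: indicator_def f)
  finally show ?thesis .
next
  case False
  have "(LBINT y=ereal b..ereal x. f y) = - (LBINT y=ereal x..ereal b. f y)" by (rule interval_integral_endpoints_reverse)
  also have "(LBINT y=ereal x..ereal b. f y) = (LBINT y:{x<..<b}. f y)" using False by (simp add: interval_integral_Ioo)
  also have "\<dots> = (LINT y|(lborel :: real measure). 0)"
    unfolding set_lebesgue_integral_def by (intro Bochner_Integration.integral_cong refl) (auto simp: indicator_def f)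
  finally have "(LBINT y=ereal b..ereal x. f y) = 0" by simp
  moreover have "(LINT y|lborel. indicator {b..} y * f y) = (LINT y|(lborel :: real measure). 0)"
    using False by (intro Bochner_Integration.integral_cong refl) (auto simp: indicator_def f)
  ultimately show ?thesis by simp
qed

text \<open>\<open>H\<close> solves the equation in which the extra rate \<open>q\<close> acts
  everywhere above \<open>a\<close>. Subtracting the integral over the part above \<open>b\<close>
  leaves \<open>q\<close> acting on \<open>{a<..<b}\<close> only, and there \<open>N\<close> and
  \<open>H\<close> coincide, so \<open>N\<close> solves the equation with the right set.\<close>

lemma passage_between:
  assumes ab: "a \<le> b" and bc: "b \<le> c" and p: "0 \<le> p" and q: "0 \<le> q" and x: "x \<le> c"
  defines "N \<equiv> \<lambda>x. scale_H M X p q (x - a) - q * (LBINT y=ereal b..ereal x. scale_function M X p (x - y) * scale_H M X p q (y - a))"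
  shows "expectation_from M X x (discounted_passage p q {a<..<b} c) = N x / N c"
proof -
  have pq: "0 \<le> p + q" using p q by auto
  have m: "p + q * of_bool (0 < min (y - a) (b - y)) = p + q * indicator {a<..<b} y" for y by (auto simp: indicator_def)
  have F: "path_functional (path_discount (\<lambda>y. p + q * indicator {a<..<b} y) c)"
    using path_functional_discount_positive[of "\<lambda>y. min (y - a) (b - y)" p q c] p q unfolding m by (simp add: continuous_intros)
  let ?h = "half_H p q"
  \<comment> \<open>The subtracted integral becomes a convolution in \<open>x - b\<close> with this
    translate of \<open>H\<close>, so that measurability and boundedness of \<open>N\<close> come
    from the general facts on convolutions.\<close>
  define k where "k y = indicator {0..} y * ?h (y + (b - a))" for y
  have hn: "?h y = 0" if "y < 0" for y using that by (simp add: half_H_def)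
  have kn: "k y = 0" if "y < 0" for y using that by (simp add: k_def)
  note hc = half_H_continuous[OF p pq]
  have kc: "continuous_on {0..} k"
  proof (rule continuous_on_eq)
    show "continuous_on {0..} (\<lambda>y. ?h (y + (b - a)))"
      by (rule continuous_on_compose2[OF hc]) (use ab in \<open>auto intro!: continuous_intros\<close>)
  qed (simp add: k_def)
  have rest: "(LBINT y=ereal b..ereal x. scale_function M X p (x - y) * scale_H M X p q (y - a)) =
      (LINT y|lborel. indicator {b..} y * (scale p (x - y) * ?h (y - a)))" for x
  proof -
    have "(LBINT y=ereal b..ereal x. scale_function M X p (x - y) * scale_H M X p q (y - a)) =
        (LINT y|lborel. indicator {b..} y * (scale p (x - y) * scale_H M X p q (y - a)))"
      unfolding scale_function_eq[OF p] by (rule upper_integral) (simp add: scale_neg)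
    also have "\<dots> = (LINT y|lborel. indicator {b..} y * (scale p (x - y) * ?h (y - a)))"
      using ab by (intro Bochner_Integration.integral_cong refl) (auto simp: half_H_def indicator_def)
    finally show ?thesis .
  qed
  have restk: "(LINT y|lborel. indicator {b..} y * (scale p (x - y) * ?h (y - a))) = conv (scale p) k (x - b)" for x
  proof -
    have "conv (scale p) k (x - b) = (LINT y|lborel. scale p (x - b - (y - b)) * k (y - b))"
      unfolding conv_def using integral_translate(2)[of "\<lambda>y. scale p (x - b - y) * k y" b] by simp
    also have "\<dots> = (LINT y|lborel. indicator {b..} y * (scale p (x - y) * ?h (y - a)))"
      by (intro Bochner_Integration.integral_cong refl) (auto simp: k_def indicator_def)
    finally show ?thesis by simp
  qed
  note Neq = scale_H_volterra[OF p pq, where a = a]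
  have Nk: "N x = exp (\<Phi> p * (x - a)) + q * (conv (scale p) ?h (x - a) - conv (scale p) k (x - b))" for x
    unfolding N_def rest restk by (simp add: Neq[of x] algebra_simps)
  note [measurable] = scale_conv_regular(1)[OF p hc hn] scale_conv_regular(1)[OF p kc kn]
  obtain C where C: "\<And>y. y \<le> c - a \<Longrightarrow> \<bar>conv (scale p) ?h y\<bar> \<le> C"
    using scale_conv_regular(2)[OF p hc hn, of "c - a"] by blast
  obtain C' where C': "\<And>y. y \<le> c - b \<Longrightarrow> \<bar>conv (scale p) k y\<bar> \<le> C'"
    using scale_conv_regular(2)[OF p kc kn, of "c - b"] by blast
  \<comment> \<open>For \<open>y\<close> up to \<open>b\<close> the correction term integrates over
    a null set.\<close>
  have low: "N y = scale_H M X p q (y - a)" if "y \<le> b" for y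
  proof -
    have "(LINT z|lborel. indicator {b..} z * (scale p (y - z) * ?h (z - a))) = (LINT z|(lborel :: real measure). 0)"
    proof (rule integral_cong_AE)
      note [measurable] = scale_measurable[OF p] half_line_measurable[OF hc hn]
      show "(\<lambda>z. indicator {b..} z * (scale p (y - z) * ?h (z - a))) \<in> borel_measurable lborel" by measurable
      show "AE z in lborel. indicator {b..} z * (scale p (y - z) * ?h (z - a)) = 0"
        using AE_lborel_singleton[of b] by eventually_elim (use that in \<open>auto simp: indicator_def scale_neg\<close>)
    qed simp
    then show ?thesis unfolding N_def rest by simp
  qed
  have "(LINT \<omega>|M. path_discount (\<lambda>y. p + q * indicator {a<..<b} y) c (\<lambda>r. x + X r \<omega>)) = N x / N c"
  proof (rule passage_ratio[where a = a and C = "exp (\<Phi> p * (c - a)) + q * (C + C')"])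
    show "N \<in> borel_measurable borel" unfolding Nk by measurable
    show "\<bar>N x\<bar> \<le> exp (\<Phi> p * (c - a)) + q * (C + C')" if "x \<le> c" for x
    proof -
      have "\<bar>conv (scale p) ?h (x - a) - conv (scale p) k (x - b)\<bar> \<le> C + C'"
        using C[of "x - a"] C'[of "x - b"] that by linarith
      then have "\<bar>q * (conv (scale p) ?h (x - a) - conv (scale p) k (x - b))\<bar> \<le> q * (C + C')"
        unfolding abs_mult using q by (simp add: mult_left_mono)
      then show ?thesis unfolding Nk using exp_bound[OF p that, of a] by linarith
    qed
    show "N x = exp (\<Phi> p * (x - a)) + q * (LINT y|lborel. indicator {a<..<b} y * N y * scale p (x - y))" for x
    proof -
      let ?g = "\<lambda>y. scale p (x - y) * ?h (y - a)"
      have gi: "integrable lborel ?g"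
        using integral_translate(1)[OF conv_integrable[OF scale_continuous[OF p] scale_neg hc hn, of "x - a"], of a] by simp
      \<comment> \<open>The integral over everything above \<open>a\<close> minus the one above
        \<open>b\<close>; what is left is the interval between them, up to the single point
        \<open>a\<close>.\<close>
      have "(LINT y|lborel. ?g y) - (LINT y|lborel. indicator {b..} y * ?g y) = (LINT y|lborel. ?g y - indicator {b..} y * ?g y)"
        using gi integrable_mult_indicator[OF _ gi, of "{b..}"] by (subst Bochner_Integration.integral_diff) auto
      also have "\<dots> = (LINT y|lborel. indicator {a<..<b} y * N y * scale p (x - y))"
      proof (rule integral_cong_AE)
        note [measurable] = scale_measurable[OF p] half_line_measurable[OF hc hn] \<open>N \<in> _\<close>
        show "(\<lambda>y. ?g y - indicator {b..} y * ?g y) \<in> borel_measurable lborel" by measurable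
        show "(\<lambda>y. indicator {a<..<b} y * N y * scale p (x - y)) \<in> borel_measurable lborel" by measurable
        show "AE y in lborel. ?g y - indicator {b..} y * ?g y = indicator {a<..<b} y * N y * scale p (x - y)"
          using AE_lborel_singleton[of a]
        proof eventually_elim
          case (elim y)
          then show ?case using low[of y] hn[of "y - a"] by (auto simp: indicator_def half_H_def)
        qed
      qed
      finally show ?thesis unfolding Nk half_H_conv_translate restk[symmetric] by simp
    qed
  qed (use p pq ab bc F x in auto)
  then show ?thesis unfolding expectation_discounted_passage[OF borel_open[OF open_greaterThanLessThan]] .
qed

end

theorem corollary2:
  fixes M :: "'a measure" and X :: "real \<Rightarrow> 'a \<Rightarrow> real"
  assumes "spectrally_negative_levy_process M X"
  shows
    "(\<forall>a b c p q x :: real. a \<le> b \<and> b \<le> c \<and> 0 \<le> p \<and> 0 \<le> q \<and> x \<le> c \<longrightarrow>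
        expectation_from M X x (discounted_passage p q {a<..<b} c) =
          (scale_H M X p q (x - a)
            - q * (LBINT y=ereal b..ereal x. scale_function M X p (x - y) * scale_H M X p q (y - a)))
          / (scale_H M X p q (c - a)
            - q * (LBINT y=ereal b..ereal c. scale_function M X p (c - y) * scale_H M X p q (y - a)))) \<and>
     (\<forall>b c p q x :: real. b \<le> c \<and> 0 \<le> p \<and> 0 \<le> q \<and> x \<le> c \<longrightarrow>
        expectation_from M X x (discounted_passage p q {..<b} c) =
          scale_H M X (p + q) (- q) (x - b) / scale_H M X (p + q) (- q) (c - b))"
proof -
  interpret spectrally_negative_levy_process M X by fact
  show ?thesis by (intro conjI allI impI; elim conjE) (rule passage_between passage_below; assumption)+
qed

end
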